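(* Let $f:\mathbb{R}\to\mathbb{R}$ be continuous and bounded from above, and suppose there exist $\beta,\gamma\ge 0$ such that $|f(x)+\beta x^2|\le\gamma(1+|x|)$ for all $x\in\mathbb{R}$. Let $w(x,y):=\sup_{\alpha\in\mathcal{A}}\mathbb{E}^x[f(W(\tau^\alpha))]$ for $(x,y)\in\mathbb{R}\times[0,\infty)$. Then for each $x\in\mathbb{R}$, the map $y\mapsto w(x,y)$ is concave on $[0,\infty)$.
   Context: $W$ is a standard one-dimensional Brownian motion on a probability space $(\Omega,\mathcal{F},\mathbb{P})$, and $\mathbb{F}=\{\mathcal{F}_t\}_{t\ge 0}$ is its augmented canonical filtration. $\mathbb{P}^x$ (expectation $\mathbb{E}^x$) denotes the measure under which $W$ starts at $x\in\mathbb{R}$. $\mathcal{A}$ is the collection of all real-valued, progressively measurable processes $\alpha$ that are square-integrable, i.e. $\mathbb{E}^x\left[\int_0^\infty\alpha(s)^2\,ds\right]<\infty$. For $\alpha\in\mathcal{A}$ and $y\ge 0$, $\tau^\alpha:=\inf\{t\ge 0 : y-t+\int_0^t\alpha(s)\,dW(s)=0\}$. *)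

theory Defs
  imports "HOL-Probability.Probability"
begin

text \<open>
  Time is modelled by the type \<^typ>\<open>real\<close>; the values of processes at negative times play no role.
  Augmenting a filtration adds null sets that need not belong to the underlying sigma-algebra,
  so integrals over the sample space are taken with respect to the completed measure.
\<close>

section \<open>Brownian motion and its augmented filtration\<close>

definition natural_filtration :: "'a measure \<Rightarrow> (real \<Rightarrow> 'a \<Rightarrow> real) \<Rightarrow> real \<Rightarrow> 'a measure" where
  "natural_filtration M W t =
     sigma (space M) (\<Union>s\<in>{0..t}. {W s -` B \<inter> space M | B. B \<in> sets borel})"

definition augmented_filtration :: "'a measure \<Rightarrow> (real \<Rightarrow> 'a \<Rightarrow> real) \<Rightarrow> real \<Rightarrow> 'a measure" where
  "augmented_filtration M W t =
     sigma (space M) (sets (natural_filtration M W t) \<union> null_sets (completion M))"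

lemma filtration_augmented_filtration: "filtration (space M) (augmented_filtration M W)"
proof
  have nat: "sets (natural_filtration M W t) \<subseteq> Pow (space M)" for t
    using sets.space_closed[of "natural_filtration M W t"]
    by (simp add: natural_filtration_def space_measure_of_conv)
  have nul: "null_sets (completion M) \<subseteq> Pow (space M)"
    using null_setsD2[THEN sets.sets_into_space, of _ "completion M"] by auto
  show "space (augmented_filtration M W t) = space M" for t
    by (simp add: augmented_filtration_def space_measure_of_conv)
  fix s t :: real assume "s \<le> t"
  then have "sets (natural_filtration M W s) \<subseteq> sets (natural_filtration M W t)"
    unfolding natural_filtration_def
    by (subst (1 2) sets_measure_of) (force intro!: sigma_sets_mono')+
  then show "sets (augmented_filtration M W s) \<subseteq> sets (augmented_filtration M W t)"
    unfolding augmented_filtration_def using nat nul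
    by (subst (1 2) sets_measure_of) (auto intro!: sigma_sets_mono')
qed

definition brownian_motion :: "'a measure \<Rightarrow> (real \<Rightarrow> 'a \<Rightarrow> real) \<Rightarrow> real \<Rightarrow> bool" where
  "brownian_motion M W x \<longleftrightarrow>
     prob_space M \<and>
     (\<forall>t\<ge>0. W t \<in> borel_measurable M) \<and>
     (\<forall>\<omega>\<in>space M. continuous_on {0..} (\<lambda>t. W t \<omega>)) \<and>
     (AE \<omega> in M. W 0 \<omega> = x) \<and>
     (\<forall>s t. 0 \<le> s \<and> s < t \<longrightarrow>
        distributed M lborel (\<lambda>\<omega>. W t \<omega> - W s \<omega>)
          (\<lambda>z. ennreal (normal_density 0 (sqrt (t - s)) z)) \<and>
        prob_space.indep_set M
          (sets (natural_filtration M W s))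
          {(\<lambda>\<omega>. W t \<omega> - W s \<omega>) -` B \<inter> space M | B. B \<in> sets borel})"

section \<open>Controls\<close>

definition progressively_measurable :: "(real \<Rightarrow> 'a measure) \<Rightarrow> (real \<Rightarrow> 'a \<Rightarrow> real) \<Rightarrow> bool" where
  "progressively_measurable F \<alpha> \<longleftrightarrow>
     (\<forall>t\<ge>0. (\<lambda>(s, \<omega>). \<alpha> s \<omega>) \<in> borel_measurable (restrict_space borel {0..t} \<Otimes>\<^sub>M F t))"

definition sq_norm_process :: "'a measure \<Rightarrow> (real \<Rightarrow> 'a \<Rightarrow> real) \<Rightarrow> ennreal" where
  "sq_norm_process M \<alpha> =
     (\<integral>\<^sup>+\<omega>. (\<integral>\<^sup>+s\<in>{0..}. ennreal ((\<alpha> s \<omega>)\<^sup>2) \<partial>lborel) \<partial>completion M)"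

definition controls :: "'a measure \<Rightarrow> (real \<Rightarrow> 'a \<Rightarrow> real) \<Rightarrow> (real \<Rightarrow> 'a \<Rightarrow> real) set" where
  "controls M W =
     {\<alpha>. progressively_measurable (augmented_filtration M W) \<alpha> \<and> sq_norm_process M \<alpha> < \<infinity>}"

section \<open>The Ito integral\<close>

text \<open>
  Simple processes are encoded by a number of intervals, a partition
  \<open>0 \<le> ts 0 \<le> \<dots> \<le> ts n\<close>, and bounded weights \<open>\<xi> i\<close> known at time \<open>ts i\<close>.
\<close>

definition simple_data ::
  "'a measure \<Rightarrow> (real \<Rightarrow> 'a \<Rightarrow> real) \<Rightarrow> nat \<Rightarrow> (nat \<Rightarrow> real) \<Rightarrow> (nat \<Rightarrow> 'a \<Rightarrow> real) \<Rightarrow> bool" where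
  "simple_data M W n ts \<xi> \<longleftrightarrow>
     0 \<le> ts 0 \<and>
     (\<forall>i<n. ts i \<le> ts (Suc i) \<and>
            \<xi> i \<in> borel_measurable (augmented_filtration M W (ts i)) \<and>
            (\<exists>C. \<forall>\<omega>\<in>space M. \<bar>\<xi> i \<omega>\<bar> \<le> C))"

definition simple_process ::
  "nat \<Rightarrow> (nat \<Rightarrow> real) \<Rightarrow> (nat \<Rightarrow> 'a \<Rightarrow> real) \<Rightarrow> real \<Rightarrow> 'a \<Rightarrow> real" where
  "simple_process n ts \<xi> t \<omega> = (\<Sum>i<n. \<xi> i \<omega> * indicator {ts i<..ts (Suc i)} t)"

definition simple_integral ::
  "(real \<Rightarrow> 'a \<Rightarrow> real) \<Rightarrow> nat \<Rightarrow> (nat \<Rightarrow> real) \<Rightarrow> (nat \<Rightarrow> 'a \<Rightarrow> real) \<Rightarrow> real \<Rightarrow> 'a \<Rightarrow> real" where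
  "simple_integral W n ts \<xi> t \<omega> =
     (\<Sum>i<n. \<xi> i \<omega> * (W (min (ts (Suc i)) t) \<omega> - W (min (ts i) t) \<omega>))"

text \<open>
  A version of the Ito integral of a square-integrable process is a continuous adapted process
  that at each time is the \<open>L\<^sup>2\<close> limit of integrals of simple processes approximating the
  integrand. By the Ito isometry the limit does not depend on the approximating sequence, so two
  versions of the integral are indistinguishable.
\<close>

definition is_ito_integral ::
  "'a measure \<Rightarrow> (real \<Rightarrow> 'a \<Rightarrow> real) \<Rightarrow> (real \<Rightarrow> 'a \<Rightarrow> real) \<Rightarrow> (real \<Rightarrow> 'a \<Rightarrow> real) \<Rightarrow> bool" where
  "is_ito_integral M W \<alpha> I \<longleftrightarrow>
     (\<forall>t\<ge>0. I t \<in> borel_measurable (augmented_filtration M W t)) \<and>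
     (\<forall>\<omega>\<in>space M. continuous_on {0..} (\<lambda>t. I t \<omega>)) \<and>
     (\<exists>n ts \<xi>.
        (\<forall>k. simple_data M W (n k) (ts k) (\<xi> k)) \<and>
        (\<lambda>k. sq_norm_process M (\<lambda>s \<omega>. simple_process (n k) (ts k) (\<xi> k) s \<omega> - \<alpha> s \<omega>))
          \<longlonglongrightarrow> 0 \<and>
        (\<forall>t\<ge>0. (\<lambda>k. \<integral>\<^sup>+\<omega>. ennreal ((simple_integral W (n k) (ts k) (\<xi> k) t \<omega> - I t \<omega>)\<^sup>2)
                    \<partial>completion M) \<longlonglongrightarrow> 0))"

definition ito_integral ::
  "'a measure \<Rightarrow> (real \<Rightarrow> 'a \<Rightarrow> real) \<Rightarrow> (real \<Rightarrow> 'a \<Rightarrow> real) \<Rightarrow> real \<Rightarrow> 'a \<Rightarrow> real" where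
  "ito_integral M W \<alpha> = (SOME I. is_ito_integral M W \<alpha> I)"

section \<open>The value function\<close>

text \<open>
  For a Brownian motion and a control, the hitting time is almost surely finite: the stochastic
  integral is an \<open>L\<^sup>2\<close>-bounded martingale, hence converges, while \<open>y - t\<close> tends to minus infinity.
  The value of \<^term>\<open>Inf {} :: real\<close> is therefore irrelevant.
\<close>

definition hitting_time ::
  "'a measure \<Rightarrow> (real \<Rightarrow> 'a \<Rightarrow> real) \<Rightarrow> (real \<Rightarrow> 'a \<Rightarrow> real) \<Rightarrow> real \<Rightarrow> 'a \<Rightarrow> real" where
  "hitting_time M W \<alpha> y \<omega> = Inf {t. 0 \<le> t \<and> y - t + ito_integral M W \<alpha> t \<omega> = 0}"

text \<open>
  \<open>P x\<close> is the measure under which \<open>W\<close> starts at \<open>x\<close>. For \<open>y \<ge> 0\<close> the hitting time has mean at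
  most \<open>y\<close>, so \<open>W\<close> evaluated there is square-integrable; if \<open>f\<close> has at most quadratic growth, the
  expectations exist, and if \<open>f\<close> is bounded above, so is the set of expectations.
\<close>

definition value_function ::
  "(real \<Rightarrow> 'a measure) \<Rightarrow> (real \<Rightarrow> 'a \<Rightarrow> real) \<Rightarrow> (real \<Rightarrow> real) \<Rightarrow> real \<Rightarrow> real \<Rightarrow> real" where
  "value_function P W f x y =
     (SUP \<alpha>\<in>controls (P x) W.
        \<integral>\<omega>. f (W (hitting_time (P x) W \<alpha> y \<omega>) \<omega>) \<partial>completion (P x))"

end

theory Submission
  imports Defs
begin

text \<open>
  Given controls \<open>\<alpha>\<^sub>1\<close>, \<open>\<alpha>\<^sub>2\<close> for initial values \<open>y\<^sub>1 > y\<^sub>2\<close>, start from \<open>y = l y\<^sub>1 + (1 - l) y\<^sub>2\<close> with the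
  steep martingale \<open>y + c (W - W 0)\<close>. By optional stopping it leaves \<open>(y\<^sub>2 + h, y\<^sub>1 + h)\<close> at the two ends
  with probabilities close to \<open>l\<close> and \<open>1 - l\<close>, and for large \<open>c\<close> it does so before the short time \<open>h\<close>
  with probability close to one. Wait until time \<open>h\<close>, by when the drift has used up the extra \<open>h\<close>, and
  then apply \<open>\<alpha>\<^sub>1\<close> or \<open>\<alpha>\<^sub>2\<close> to the Brownian motion restarted at \<open>h\<close>. By the Markov property this yields
  nearly the corresponding convex combination of the payoffs.

  Shifting a control in time requires it to be a functional of the path, so \<open>\<alpha>\<^sub>1\<close> and \<open>\<alpha>\<^sub>2\<close> are first
  replaced by simple processes. The payoff is stable under this approximation because all the hitting
  times \<open>\<tau>\<close> have the same mean \<open>y\<close>. Bounded uniformly continuous payoffs suffice: by Wald's identity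
  \<open>W \<tau> - W 0\<close> has second moment \<open>y\<close>, so the quadratic part of \<open>f\<close> contributes an affine function of \<open>y\<close>, and
  truncating the part of linear growth at level \<open>R\<close> costs at most a multiple of \<open>y / R\<close>.
\<close>

section \<open>Square-integrable functions\<close>

text \<open>The constants of the mixing step are fixed in a definite order. Waiting until
  \<open>h\<close> moves the terminal value by \<open>W h - W 0\<close>, so uniform continuity of
  the payoff fixes a tolerance \<open>\<delta>\<close> and this in turn limits \<open>h\<close>.
  Optional stopping gives the upper end the probability \<open>l - h / L\<close>, where
  \<open>L = y1 - y2\<close>, up to the probability of not leaving the strip; this limits
  \<open>h\<close> a second time. Only then is the slope \<open>c\<close> chosen, from the bounded
  density of \<open>W h - W 0\<close>.

  The equal means of the hitting times are not automatic: stopping at a finite horizon yields a mean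
  of at most \<open>y\<close>. The integrals are bounded in \<open>L2\<close>, so the paths that
  have not yet hit carry a vanishing share of the stopped process, and in the limit the inequality
  becomes an equality.

  The Ito integral of a control is a chosen version. Every estimate for the new control is therefore
  proved for all versions of its integral, which uniqueness identifies with an explicit
  process.\<close>

definition sq_integrable :: "'a measure \<Rightarrow> ('a \<Rightarrow> real) \<Rightarrow> bool" where
  "sq_integrable M X \<longleftrightarrow> X \<in> borel_measurable M \<and> integrable M (\<lambda>\<omega>. (X \<omega>)\<^sup>2)"

lemma sq_integrableD:
  assumes "sq_integrable M X"
  shows "X \<in> borel_measurable M" "integrable M (\<lambda>\<omega>. (X \<omega>)\<^sup>2)"
  using assms by (auto simp: sq_integrable_def)

lemma sq_integrable_mult:
  assumes X: "sq_integrable M X" and Y: "sq_integrable M Y"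
  shows "integrable M (\<lambda>\<omega>. X \<omega> * Y \<omega>)"
proof (rule Bochner_Integration.integrable_bound)
  show "integrable M (\<lambda>\<omega>. (X \<omega>)\<^sup>2 + (Y \<omega>)\<^sup>2)" using X Y by (simp add: sq_integrable_def)
  show "(\<lambda>\<omega>. X \<omega> * Y \<omega>) \<in> borel_measurable M"
    using X Y by (auto simp: sq_integrable_def intro!: borel_measurable_times)
  have "\<bar>a * b\<bar> \<le> a\<^sup>2 + b\<^sup>2" for a b :: real
  proof -
    have "2 * (\<bar>a\<bar> * \<bar>b\<bar>) \<le> \<bar>a\<bar>\<^sup>2 + \<bar>b\<bar>\<^sup>2" using sum_squares_bound[of "\<bar>a\<bar>" "\<bar>b\<bar>"] by simp
    moreover have "0 \<le> \<bar>a\<bar> * \<bar>b\<bar>" by simp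
    ultimately show ?thesis unfolding abs_mult by (simp only: power2_abs)
  qed
  then show "AE \<omega> in M. norm (X \<omega> * Y \<omega>) \<le> norm ((X \<omega>)\<^sup>2 + (Y \<omega>)\<^sup>2)" by simp
qed

lemma sq_integrable_add [intro]:
  assumes X: "sq_integrable M X" and Y: "sq_integrable M Y"
  shows "sq_integrable M (\<lambda>\<omega>. X \<omega> + Y \<omega>)"
  using sq_integrable_mult[OF X Y] X Y unfolding sq_integrable_def power2_sum
  by (auto simp: mult.assoc)

lemma sq_integrable_cmult [intro]:
  "sq_integrable M X \<Longrightarrow> sq_integrable M (\<lambda>\<omega>. c * X \<omega>)"
  by (auto simp: sq_integrable_def power_mult_distrib)

lemma sq_integrable_diff [intro]:
  assumes X: "sq_integrable M X" and Y: "sq_integrable M Y"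
  shows "sq_integrable M (\<lambda>\<omega>. X \<omega> - Y \<omega>)"
  using sq_integrable_add[OF X sq_integrable_cmult[OF Y, of "-1"]] by simp

lemma sq_integrable_zero [intro, simp]: "sq_integrable M (\<lambda>_. 0)"
  by (simp add: sq_integrable_def)

lemma sq_integrable_sum [intro]:
  "(\<And>i. i \<in> P \<Longrightarrow> sq_integrable M (X i)) \<Longrightarrow> sq_integrable M (\<lambda>\<omega>. \<Sum>i\<in>P. X i \<omega>)"
  by (induction P rule: infinite_finite_induct) (auto intro: sq_integrable_add)

lemma sq_integrable_dominated:
  assumes Y: "sq_integrable M Y" and X: "X \<in> borel_measurable M"
    and le: "AE \<omega> in M. \<bar>X \<omega>\<bar> \<le> c * \<bar>Y \<omega>\<bar>"
  shows "sq_integrable M X"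
  unfolding sq_integrable_def
proof
  show "integrable M (\<lambda>\<omega>. (X \<omega>)\<^sup>2)"
  proof (rule Bochner_Integration.integrable_bound)
    show "integrable M (\<lambda>\<omega>. c\<^sup>2 * (Y \<omega>)\<^sup>2)" using Y by (simp add: sq_integrable_def)
    show "(\<lambda>\<omega>. (X \<omega>)\<^sup>2) \<in> borel_measurable M" using X by simp
    show "AE \<omega> in M. norm ((X \<omega>)\<^sup>2) \<le> norm (c\<^sup>2 * (Y \<omega>)\<^sup>2)"
      using le
    proof eventually_elim
      case (elim \<omega>)
      then have "\<bar>X \<omega>\<bar>\<^sup>2 \<le> (c * \<bar>Y \<omega>\<bar>)\<^sup>2" by (intro power_mono) auto
      then show ?case by (simp add: power_mult_distrib)
    qed
  qed
qed fact

lemma sq_integrable_bounded_mult: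
  assumes Y: "sq_integrable M Y" and X: "X \<in> borel_measurable M"
    and le: "\<And>\<omega>. \<omega> \<in> space M \<Longrightarrow> \<bar>X \<omega>\<bar> \<le> c"
  shows "sq_integrable M (\<lambda>\<omega>. X \<omega> * Y \<omega>)"
proof (rule sq_integrable_dominated[OF Y, where c = c])
  show "AE \<omega> in M. \<bar>X \<omega> * Y \<omega>\<bar> \<le> c * \<bar>Y \<omega>\<bar>"
    using le by (intro AE_I2) (simp add: abs_mult mult_right_mono)
qed (use X Y in \<open>auto simp: sq_integrable_def intro!: borel_measurable_times\<close>)

lemma sq_integrable_if [intro]:
  assumes "sq_integrable M X" "A \<in> sets M"
  shows "sq_integrable M (\<lambda>\<omega>. indicator A \<omega> * X \<omega>)"
  using assms by (intro sq_integrable_bounded_mult[where c = 1]) (auto simp: indicator_def)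

lemma (in finite_measure) sq_integrable_bounded:
  assumes "X \<in> borel_measurable M" "\<And>\<omega>. \<omega> \<in> space M \<Longrightarrow> \<bar>X \<omega>\<bar> \<le> c"
  shows "sq_integrable M X"
proof -
  have "sq_integrable M (\<lambda>_. 1)" by (simp add: sq_integrable_def)
  from sq_integrable_bounded_mult[OF this assms] show ?thesis by simp
qed

lemma (in finite_measure) sq_integrable_integrable [intro]:
  assumes "sq_integrable M X" shows "integrable M X"
proof -
  have "sq_integrable M (\<lambda>_. 1)" by (simp add: sq_integrable_def)
  from sq_integrable_mult[OF assms this] show ?thesis by simp
qed

lemma sq_integrable_iff_nn:
  "sq_integrable M X \<longleftrightarrow> X \<in> borel_measurable M \<and> (\<integral>\<^sup>+\<omega>. ennreal ((X \<omega>)\<^sup>2) \<partial>M) < \<infinity>"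
  unfolding sq_integrable_def integrable_iff_bounded by auto

lemma sq_integrable_nn_eq:
  "sq_integrable M X \<Longrightarrow> (\<integral>\<^sup>+\<omega>. ennreal ((X \<omega>)\<^sup>2) \<partial>M) = ennreal (\<integral>\<omega>. (X \<omega>)\<^sup>2 \<partial>M)"
  by (intro nn_integral_eq_integral) (auto simp: sq_integrable_def)

text \<open>The integral of \<open>(X - c * Y)^2\<close> is a nonnegative quadratic in
  \<open>c\<close>, and its value at the minimiser yields the bound. If \<open>Y\<close> vanishes
  almost everywhere, both sides are zero and this case is treated apart.\<close>

lemma Cauchy_Schwarz_integral:
  assumes X: "sq_integrable M X" and Y: "sq_integrable M Y"
  shows "\<bar>\<integral>\<omega>. X \<omega> * Y \<omega> \<partial>M\<bar> \<le> sqrt (\<integral>\<omega>. (X \<omega>)\<^sup>2 \<partial>M) * sqrt (\<integral>\<omega>. (Y \<omega>)\<^sup>2 \<partial>M)"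
proof -
  note [simp] = sq_integrable_mult[OF X Y] sq_integrableD(2)[OF X] sq_integrableD(2)[OF Y]
  define a b p where "a = (\<integral>\<omega>. (X \<omega>)\<^sup>2 \<partial>M)" and "b = (\<integral>\<omega>. (Y \<omega>)\<^sup>2 \<partial>M)" and "p = (\<integral>\<omega>. X \<omega> * Y \<omega> \<partial>M)"
  have *: "0 \<le> a - 2 * c * p + c\<^sup>2 * b" for c
  proof -
    have "0 \<le> (\<integral>\<omega>. (X \<omega> - c * Y \<omega>)\<^sup>2 \<partial>M)" by simp
    also have "\<dots> = (\<integral>\<omega>. (X \<omega>)\<^sup>2 - 2 * c * (X \<omega> * Y \<omega>) + c\<^sup>2 * (Y \<omega>)\<^sup>2 \<partial>M)"
      by (intro Bochner_Integration.integral_cong) (auto simp: power2_eq_square algebra_simps)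
    finally show ?thesis by (simp add: a_def b_def p_def)
  qed
  have b0: "0 \<le> b" by (simp add: b_def)
  have "p\<^sup>2 \<le> a * b"
  proof (cases "b = 0")
    case True
    then have "AE \<omega> in M. (Y \<omega>)\<^sup>2 = 0"
      unfolding b_def by (subst (asm) integral_nonneg_eq_0_iff_AE) auto
    then have "AE \<omega> in M. X \<omega> * Y \<omega> = 0" by eventually_elim simp
    then have "p = 0" unfolding p_def by (rule integral_eq_zero_AE)
    then show ?thesis using True by simp
  next
    case False
    with b0 have "b > 0" by simp
    with *[of "p / b"] show ?thesis
      by (simp add: power2_eq_square divide_simps)
  qed
  then have "sqrt (p\<^sup>2) \<le> sqrt (a * b)" by (rule real_sqrt_le_mono)
  then show ?thesis by (simp add: real_sqrt_mult a_def b_def p_def)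
qed

text \<open>Cauchy-Schwarz turns mean-square convergence into convergence against a fixed
  \<open>Z\<close>. The martingale property is phrased through such test functions, so this is what
  carries it from simple integrals to Ito integrals.\<close>

lemma L2_tendsto_mult:
  assumes X: "\<And>k. sq_integrable M (X k)" "sq_integrable M Y" and Z: "sq_integrable M Z"
    and lim: "(\<lambda>k. \<integral>\<omega>. (X k \<omega> - Y \<omega>)\<^sup>2 \<partial>M) \<longlonglongrightarrow> 0"
  shows "(\<lambda>k. \<integral>\<omega>. X k \<omega> * Z \<omega> \<partial>M) \<longlonglongrightarrow> (\<integral>\<omega>. Y \<omega> * Z \<omega> \<partial>M)"
proof -
  have "(\<lambda>k. (\<integral>\<omega>. X k \<omega> * Z \<omega> \<partial>M) - (\<integral>\<omega>. Y \<omega> * Z \<omega> \<partial>M)) \<longlonglongrightarrow> 0"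
  proof (rule Lim_null_comparison)
    show "(\<lambda>k. sqrt (\<integral>\<omega>. (X k \<omega> - Y \<omega>)\<^sup>2 \<partial>M) * sqrt (\<integral>\<omega>. (Z \<omega>)\<^sup>2 \<partial>M)) \<longlonglongrightarrow> 0"
      using tendsto_mult_right[OF tendsto_real_sqrt[OF lim]] by (simp add: tendsto_mult_left_zero)
    have "(\<integral>\<omega>. X k \<omega> * Z \<omega> \<partial>M) - (\<integral>\<omega>. Y \<omega> * Z \<omega> \<partial>M) = (\<integral>\<omega>. (X k \<omega> - Y \<omega>) * Z \<omega> \<partial>M)" for k
      unfolding left_diff_distrib using X Z by (simp add: sq_integrable_mult)
    with Cauchy_Schwarz_integral[OF sq_integrable_diff[OF X] Z]
    show "\<forall>\<^sub>F k in sequentially. norm ((\<integral>\<omega>. X k \<omega> * Z \<omega> \<partial>M) - (\<integral>\<omega>. Y \<omega> * Z \<omega> \<partial>M))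
        \<le> sqrt (\<integral>\<omega>. (X k \<omega> - Y \<omega>)\<^sup>2 \<partial>M) * sqrt (\<integral>\<omega>. (Z \<omega>)\<^sup>2 \<partial>M)"
      by simp
  qed
  then show ?thesis by (simp add: LIM_zero_iff)
qed

text \<open>Polarisation: the squared norm of \<open>X k\<close> is that of \<open>X k - Y\<close>,
  plus twice the inner product with \<open>Y\<close>, minus the squared norm of \<open>Y\<close>,
  and each piece converges.\<close>

lemma L2_tendsto_sq:
  assumes X: "\<And>k. sq_integrable M (X k)" and Y: "sq_integrable M Y"
    and lim: "(\<lambda>k. \<integral>\<omega>. (X k \<omega> - Y \<omega>)\<^sup>2 \<partial>M) \<longlonglongrightarrow> 0"
  shows "(\<lambda>k. \<integral>\<omega>. (X k \<omega>)\<^sup>2 \<partial>M) \<longlonglongrightarrow> (\<integral>\<omega>. (Y \<omega>)\<^sup>2 \<partial>M)"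
proof -
  have eq: "(\<integral>\<omega>. (X k \<omega>)\<^sup>2 \<partial>M) = (\<integral>\<omega>. (X k \<omega> - Y \<omega>)\<^sup>2 \<partial>M) + 2 * (\<integral>\<omega>. X k \<omega> * Y \<omega> \<partial>M) - (\<integral>\<omega>. (Y \<omega>)\<^sup>2 \<partial>M)" for k
  proof -
    have "(\<integral>\<omega>. (X k \<omega>)\<^sup>2 \<partial>M) = (\<integral>\<omega>. (X k \<omega> - Y \<omega>)\<^sup>2 + 2 * (X k \<omega> * Y \<omega>) - (Y \<omega>)\<^sup>2 \<partial>M)"
      by (intro Bochner_Integration.integral_cong) (auto simp: power2_eq_square algebra_simps)
    also have "\<dots> = (\<integral>\<omega>. (X k \<omega> - Y \<omega>)\<^sup>2 \<partial>M) + 2 * (\<integral>\<omega>. X k \<omega> * Y \<omega> \<partial>M) - (\<integral>\<omega>. (Y \<omega>)\<^sup>2 \<partial>M)"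
      using sq_integrable_mult[OF X Y, of k] sq_integrableD(2)[OF sq_integrable_diff[OF X Y], of k] sq_integrableD(2)[OF Y]
      by simp
    finally show ?thesis .
  qed
  have "(\<lambda>k. (\<integral>\<omega>. (X k \<omega> - Y \<omega>)\<^sup>2 \<partial>M) + 2 * (\<integral>\<omega>. X k \<omega> * Y \<omega> \<partial>M) - (\<integral>\<omega>. (Y \<omega>)\<^sup>2 \<partial>M))
      \<longlonglongrightarrow> 0 + 2 * (\<integral>\<omega>. Y \<omega> * Y \<omega> \<partial>M) - (\<integral>\<omega>. (Y \<omega>)\<^sup>2 \<partial>M)"
    by (intro tendsto_intros lim L2_tendsto_mult X Y)
  then show ?thesis by (subst eq) (simp add: power2_eq_square)
qed

text \<open>Boundedness in \<open>L\<^sup>2\<close> gives uniform integrability.\<close>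

lemma (in prob_space) L2_bounded_tendsto_L1:
  assumes X: "\<And>k. sq_integrable M (X k)" and Y [measurable]: "Y \<in> borel_measurable M"
    and bd: "\<And>k. (\<integral>\<omega>. (X k \<omega>)\<^sup>2 \<partial>M) \<le> C"
    and lim: "AE \<omega> in M. (\<lambda>k. X k \<omega>) \<longlonglongrightarrow> Y \<omega>"
  shows "sq_integrable M Y" "(\<integral>\<omega>. (Y \<omega>)\<^sup>2 \<partial>M) \<le> C" "(\<lambda>k. \<integral>\<omega>. \<bar>X k \<omega> - Y \<omega>\<bar> \<partial>M) \<longlonglongrightarrow> 0"
proof -
  have [measurable]: "X k \<in> borel_measurable M" for k by (rule sq_integrableD(1)[OF X])
  have C: "0 \<le> C" by (rule order_trans[OF _ bd[of 0]]) simp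
  have "(\<integral>\<^sup>+\<omega>. ennreal ((Y \<omega>)\<^sup>2) \<partial>M) = (\<integral>\<^sup>+\<omega>. liminf (\<lambda>k. ennreal ((X k \<omega>)\<^sup>2)) \<partial>M)"
  proof (rule nn_integral_cong_AE, use lim in eventually_elim)
    case (elim \<omega>)
    have "(\<lambda>k. ennreal ((X k \<omega>)\<^sup>2)) \<longlonglongrightarrow> ennreal ((Y \<omega>)\<^sup>2)"
      by (intro tendsto_ennrealI tendsto_power elim)
    then show ?case by (rule lim_imp_Liminf[OF trivial_limit_sequentially, symmetric])
  qed
  also have "\<dots> \<le> liminf (\<lambda>k. \<integral>\<^sup>+\<omega>. ennreal ((X k \<omega>)\<^sup>2) \<partial>M)"
    by (rule nn_integral_liminf) simp
  also have "\<dots> \<le> liminf (\<lambda>k. ennreal C)"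
    by (intro Liminf_mono always_eventually allI) (simp add: sq_integrable_nn_eq[OF X] bd C ennreal_le_iff)
  finally have Yle: "(\<integral>\<^sup>+\<omega>. ennreal ((Y \<omega>)\<^sup>2) \<partial>M) \<le> ennreal C"
    by (simp add: Liminf_const)
  then show Ysq: "sq_integrable M Y"
    unfolding sq_integrable_iff_nn by (auto intro: le_less_trans)
  with Yle show YC: "(\<integral>\<omega>. (Y \<omega>)\<^sup>2 \<partial>M) \<le> C" by (simp add: sq_integrable_nn_eq C)
  have dbd: "(\<integral>\<omega>. (X k \<omega> - Y \<omega>)\<^sup>2 \<partial>M) \<le> 4 * C" for k
  proof -
    have "(\<integral>\<omega>. (X k \<omega> - Y \<omega>)\<^sup>2 \<partial>M) \<le> (\<integral>\<omega>. 2 * (X k \<omega>)\<^sup>2 + 2 * (Y \<omega>)\<^sup>2 \<partial>M)"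
    proof (rule integral_mono)
      show "integrable M (\<lambda>\<omega>. (X k \<omega> - Y \<omega>)\<^sup>2)"
        by (rule sq_integrableD(2)[OF sq_integrable_diff[OF X Ysq]])
      show "integrable M (\<lambda>\<omega>. 2 * (X k \<omega>)\<^sup>2 + 2 * (Y \<omega>)\<^sup>2)"
        using sq_integrableD(2)[OF X] sq_integrableD(2)[OF Ysq] by simp
      have "(a - b)\<^sup>2 \<le> 2 * a\<^sup>2 + 2 * b\<^sup>2" for a b :: real
        using zero_le_power2[of "a + b"] by (simp add: power2_eq_square algebra_simps)
      then show "(X k \<omega> - Y \<omega>)\<^sup>2 \<le> 2 * (X k \<omega>)\<^sup>2 + 2 * (Y \<omega>)\<^sup>2" for \<omega> .
    qed
    also have "\<dots> = 2 * (\<integral>\<omega>. (X k \<omega>)\<^sup>2 \<partial>M) + 2 * (\<integral>\<omega>. (Y \<omega>)\<^sup>2 \<partial>M)" 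
      using sq_integrableD(2)[OF X] sq_integrableD(2)[OF Ysq] by simp
    also have "\<dots> \<le> 4 * C" using bd[of k] YC by simp
    finally show ?thesis .
  qed
  show "(\<lambda>k. \<integral>\<omega>. \<bar>X k \<omega> - Y \<omega>\<bar> \<partial>M) \<longlonglongrightarrow> 0"
  proof (rule LIMSEQ_I)
    fix r :: real assume r: "0 < r"
    \<comment> \<open>Above the level \<open>R\<close> the difference is at most its square divided
      by \<open>R\<close>, so the tail contributes at most \<open>4 * C / R\<close>. This
      \<open>R\<close> makes that at most \<open>r / 2\<close>; the added 1 keeps it positive when
      \<open>C = 0\<close>.\<close>
    define R where "R = 8 * (C + 1) / r"
    have R: "R > 0" using r C by (simp add: R_def)
    have "(\<lambda>k. \<integral>\<omega>. min \<bar>X k \<omega> - Y \<omega>\<bar> R \<partial>M) \<longlonglongrightarrow> (\<integral>\<omega>. 0 \<partial>M)"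
    proof (rule integral_dominated_convergence[where w = "\<lambda>_. R"])
      show "AE \<omega> in M. (\<lambda>k. min \<bar>X k \<omega> - Y \<omega>\<bar> R) \<longlonglongrightarrow> 0"
        using lim
      proof eventually_elim
        case (elim \<omega>)
        have "(\<lambda>k. min \<bar>X k \<omega> - Y \<omega>\<bar> R) \<longlonglongrightarrow> min \<bar>Y \<omega> - Y \<omega>\<bar> R"
          by (intro tendsto_intros elim)
        then show ?case using R by simp
      qed
    qed (use R in auto)
    then have "\<forall>\<^sub>F k in sequentially. (\<integral>\<omega>. min \<bar>X k \<omega> - Y \<omega>\<bar> R \<partial>M) < r / 2"
      using r by (intro order_tendstoD(2)) auto
    then obtain k0 where k0: "\<And>k. k \<ge> k0 \<Longrightarrow> (\<integral>\<omega>. min \<bar>X k \<omega> - Y \<omega>\<bar> R \<partial>M) < r / 2"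
      by (auto simp: eventually_sequentially)
    have "(\<integral>\<omega>. \<bar>X k \<omega> - Y \<omega>\<bar> \<partial>M) < r" if "k \<ge> k0" for k
    proof -
      have sq: "sq_integrable M (\<lambda>\<omega>. X k \<omega> - Y \<omega>)" by (rule sq_integrable_diff[OF X Ysq])
      have int: "integrable M (\<lambda>\<omega>. \<bar>X k \<omega> - Y \<omega>\<bar>)" using sq_integrable_integrable[OF sq] by simp
      have imin: "integrable M (\<lambda>\<omega>. min \<bar>X k \<omega> - Y \<omega>\<bar> R)"
        by (rule integrable_const_bound[where B = R]) (use R in auto)
      have "(\<integral>\<omega>. \<bar>X k \<omega> - Y \<omega>\<bar> \<partial>M) \<le> (\<integral>\<omega>. min \<bar>X k \<omega> - Y \<omega>\<bar> R + (X k \<omega> - Y \<omega>)\<^sup>2 / R \<partial>M)"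
      proof (rule integral_mono[OF int])
        show "integrable M (\<lambda>\<omega>. min \<bar>X k \<omega> - Y \<omega>\<bar> R + (X k \<omega> - Y \<omega>)\<^sup>2 / R)" using imin sq_integrableD(2)[OF sq] by simp
        show "\<bar>X k \<omega> - Y \<omega>\<bar> \<le> min \<bar>X k \<omega> - Y \<omega>\<bar> R + (X k \<omega> - Y \<omega>)\<^sup>2 / R" for \<omega>
        proof (cases "\<bar>X k \<omega> - Y \<omega>\<bar> \<le> R")
          case False
          then have "\<bar>X k \<omega> - Y \<omega>\<bar> * R \<le> \<bar>X k \<omega> - Y \<omega>\<bar> * \<bar>X k \<omega> - Y \<omega>\<bar>" by (intro mult_left_mono) auto
          then have "\<bar>X k \<omega> - Y \<omega>\<bar> \<le> (X k \<omega> - Y \<omega>)\<^sup>2 / R"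
            using R by (simp add: pos_le_divide_eq power2_eq_square)
          then show ?thesis using R by simp
        qed (use R in auto)
      qed
      also have "\<dots> = (\<integral>\<omega>. min \<bar>X k \<omega> - Y \<omega>\<bar> R \<partial>M) + (\<integral>\<omega>. (X k \<omega> - Y \<omega>)\<^sup>2 \<partial>M) / R"
        using imin sq_integrableD(2)[OF sq] by simp
      also have "(\<integral>\<omega>. (X k \<omega> - Y \<omega>)\<^sup>2 \<partial>M) / R \<le> 4 * C / R" using dbd[of k] R by (simp add: divide_right_mono)
      also have "4 * C / R \<le> r / 2" using r C by (simp add: R_def field_simps)
      finally show ?thesis using k0[OF that] by simp
    qed
    then show "\<exists>no. \<forall>n\<ge>no. norm ((\<integral>\<omega>. \<bar>X n \<omega> - Y \<omega>\<bar> \<partial>M) - 0) < r" by auto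
  qed
qed

lemma (in prob_space) L2_bounded_tendsto_expectation:
  assumes X: "\<And>k. sq_integrable M (X k)" and Y: "Y \<in> borel_measurable M"
    and bd: "\<And>k. (\<integral>\<omega>. (X k \<omega>)\<^sup>2 \<partial>M) \<le> C"
    and lim: "AE \<omega> in M. (\<lambda>k. X k \<omega>) \<longlonglongrightarrow> Y \<omega>"
  shows "(\<lambda>k. \<integral>\<omega>. X k \<omega> \<partial>M) \<longlonglongrightarrow> (\<integral>\<omega>. Y \<omega> \<partial>M)"
proof -
  note * = L2_bounded_tendsto_L1[OF assms]
  have "(\<lambda>k. (\<integral>\<omega>. X k \<omega> \<partial>M) - (\<integral>\<omega>. Y \<omega> \<partial>M)) \<longlonglongrightarrow> 0"
  proof (rule Lim_null_comparison[OF _ *(3)])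
    have "norm ((\<integral>\<omega>. X k \<omega> \<partial>M) - (\<integral>\<omega>. Y \<omega> \<partial>M)) \<le> (\<integral>\<omega>. \<bar>X k \<omega> - Y \<omega>\<bar> \<partial>M)" for k
    proof -
      have i: "integrable M (X k)" "integrable M Y" by (rule sq_integrable_integrable, rule X *(1))+
      then have "(\<integral>\<omega>. X k \<omega> \<partial>M) - (\<integral>\<omega>. Y \<omega> \<partial>M) = (\<integral>\<omega>. X k \<omega> - Y \<omega> \<partial>M)" by simp
      then show ?thesis using integral_norm_bound[of M "\<lambda>\<omega>. X k \<omega> - Y \<omega>"] by simp
    qed
    then show "\<forall>\<^sub>F k in sequentially. norm ((\<integral>\<omega>. X k \<omega> \<partial>M) - (\<integral>\<omega>. Y \<omega> \<partial>M)) \<le> (\<integral>\<omega>. \<bar>X k \<omega> - Y \<omega>\<bar> \<partial>M)" by simp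
  qed
  then show ?thesis by (simp add: LIM_zero_iff)
qed

section \<open>Elementary stochastic integrals\<close>

lemma lborel_integral_Ioc: "(\<integral>s. indicator {l<..u} s \<partial>lborel) = max 0 (u - l :: real)"
  by (cases "l \<le> u") auto

text \<open>Here \<open>N\<close> stands for the completed space: almost sure limits stay
  measurable, and null sets lie in every \<open>F t\<close>. \<open>F_generated\<close> describes
  events through the increments from \<open>W 0\<close> rather than through \<open>W\<close>, so
  that the same set of paths can be tested on the motion restarted at a later time.\<close>

locale filtered_bm = prob_space N + complete_measure N for N :: "'a measure" +
  fixes F :: "real \<Rightarrow> 'a measure" and W :: "real \<Rightarrow> 'a \<Rightarrow> real" and x :: real
  assumes space_F: "space (F t) = space N"
    and sets_F: "sets (F t) \<subseteq> sets N"
    and F_mono: "s \<le> t \<Longrightarrow> sets (F s) \<subseteq> sets (F t)"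
    and F_null: "null_sets N \<subseteq> sets (F t)"
    and W_adapted: "0 \<le> t \<Longrightarrow> W t \<in> borel_measurable (F t)"
    and W_continuous: "\<omega> \<in> space N \<Longrightarrow> continuous_on {0..} (\<lambda>t. W t \<omega>)"
    and W_start: "AE \<omega> in N. W 0 \<omega> = x"
    and W_increment: "0 \<le> s \<Longrightarrow> s < t \<Longrightarrow>
      distributed N lborel (\<lambda>\<omega>. W t \<omega> - W s \<omega>) (\<lambda>z. ennreal (normal_density 0 (sqrt (t - s)) z))"
    and W_indep: "0 \<le> s \<Longrightarrow> s < t \<Longrightarrow>
      indep_set (sets (F s)) {(\<lambda>\<omega>. W t \<omega> - W s \<omega>) -` B \<inter> space N | B. B \<in> sets borel}"
    and F_generated: "0 \<le> t \<Longrightarrow> A \<in> sets (F t) \<Longrightarrow>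
      \<exists>C\<in>sets (PiM {0..t} (\<lambda>_. borel)). AE \<omega> in N. \<omega> \<in> A \<longleftrightarrow> (\<lambda>s\<in>{0..t}. W s \<omega> - W 0 \<omega>) \<in> C"
begin

lemma F_measurable_mono: "s \<le> t \<Longrightarrow> f \<in> measurable (F s) S \<Longrightarrow> f \<in> measurable (F t) S"
  using F_mono[of s t] by (auto simp: measurable_def space_F)

lemma F_measurable_N: "f \<in> measurable (F s) S \<Longrightarrow> f \<in> measurable N S"
  using sets_F[of s] by (auto simp: measurable_def space_F)

lemma W_F: "0 \<le> s \<Longrightarrow> s \<le> t \<Longrightarrow> W s \<in> borel_measurable (F t)"
  by (rule F_measurable_mono[OF _ W_adapted])

lemma W_measurable: "0 \<le> s \<Longrightarrow> W s \<in> borel_measurable N"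
  by (rule F_measurable_N[OF W_adapted])

text \<open>The preimages under the increment already form a sigma-algebra, so the sigma-algebras
  generated by \<open>Z\<close> and by the increment contain nothing that \<open>W_indep\<close>
  does not cover. The map \<open>u\<close> allows for the square of the increment, and for pairing
  it with a dummy value, because the two variables of \<open>indep_var\<close> share one value
  type.\<close>

lemma indep_var_increment:
  assumes st: "0 \<le> s" "s < t" and Z: "Z \<in> measurable (F s) S"
    and u: "u \<in> measurable borel S'"
  shows "indep_var S Z S' (\<lambda>\<omega>. u (W t \<omega> - W s \<omega>))"
  unfolding indep_var_eq
proof (intro conjI)
  have [measurable]: "W t \<in> borel_measurable N" "W s \<in> borel_measurable N"
    using W_measurable st by auto
  note [measurable] = u
  show "random_variable S Z" using F_measurable_N[OF Z] .
  show "random_variable S' (\<lambda>\<omega>. u (W t \<omega> - W s \<omega>))" by measurable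
  let ?D = "{(\<lambda>\<omega>. W t \<omega> - W s \<omega>) -` B \<inter> space N | B. B \<in> sets borel}"
  have D: "sigma_sets (space N) {(\<lambda>\<omega>. u (W t \<omega> - W s \<omega>)) -` A \<inter> space N | A. A \<in> sets S'} \<subseteq> sets (vimage_algebra (space N) (\<lambda>\<omega>. W t \<omega> - W s \<omega>) (borel :: real measure))"
  proof (intro sets.sigma_sets_subset[of _ "vimage_algebra (space N) (\<lambda>\<omega>. W t \<omega> - W s \<omega>) borel", simplified] subsetI)
    fix E assume "E \<in> {(\<lambda>\<omega>. u (W t \<omega> - W s \<omega>)) -` A \<inter> space N | A. A \<in> sets S'}"
    then obtain A where A: "A \<in> sets S'" "E = (\<lambda>\<omega>. u (W t \<omega> - W s \<omega>)) -` A \<inter> space N" by auto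
    have "u -` A \<in> sets borel" using measurable_sets[OF u A(1)] by simp
    then show "E \<in> sets (vimage_algebra (space N) (\<lambda>\<omega>. W t \<omega> - W s \<omega>) borel)"
      unfolding A by (subst sets_vimage_algebra2) (auto intro!: exI[of _ "u -` A"])
  qed
  have Dv: "sets (vimage_algebra (space N) (\<lambda>\<omega>. W t \<omega> - W s \<omega>) (borel :: real measure)) = ?D"
    by (subst sets_vimage_algebra2) auto
  have Z': "sigma_sets (space N) {Z -` A \<inter> space N |A. A \<in> sets S} \<subseteq> sets (F s)"
    using measurable_sets[OF Z] by (intro sets.sigma_sets_subset[of _ "F s", unfolded space_F]) (auto simp: space_F)
  show "indep_set (sigma_sets (space N) {Z -` A \<inter> space N |A. A \<in> sets S})
     (sigma_sets (space N) {(\<lambda>\<omega>. u (W t \<omega> - W s \<omega>)) -` A \<inter> space N |A. A \<in> sets S'})"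
    using W_indep[OF st, folded Dv] unfolding indep_sets2_eq
    by (auto simp: subset_iff dest!: subsetD[OF Z'] subsetD[OF D])
qed

section \<open>Moments of increments weighted by the past\<close>

lemma increment_sq_integrable:
  assumes "0 \<le> s" "0 \<le> t"
  shows "sq_integrable N (\<lambda>\<omega>. W t \<omega> - W s \<omega>)"
proof -
  have *: "sq_integrable N (\<lambda>\<omega>. W t \<omega> - W s \<omega>)" if "0 \<le> s" "s < t" for s t
  proof -
    have "integrable N (\<lambda>\<omega>. (W t \<omega> - W s \<omega>)\<^sup>2)"
      using integrable_normal_moment[where \<mu> = 0 and \<sigma> = "sqrt (t - s)" and k = 2] that
      by (subst distributed_integrable[OF W_increment[OF that], symmetric]) auto
    then show ?thesis using W_measurable that by (auto simp: sq_integrable_def)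
  qed
  consider "s < t" | "t < s" | "s = t" by linarith
  then show ?thesis
  proof cases
    case 2
    then show ?thesis using sq_integrable_cmult[OF *[of t s], of "-1"] assms by simp
  qed (use * assms in auto)
qed

lemma increment_mean:
  assumes st: "0 \<le> s" "s \<le> t" and Z: "Z \<in> borel_measurable (F s)" "integrable N Z"
  shows "integrable N (\<lambda>\<omega>. Z \<omega> * (W t \<omega> - W s \<omega>))" "(\<integral>\<omega>. Z \<omega> * (W t \<omega> - W s \<omega>) \<partial>N) = 0"
proof -
  have "integrable N (\<lambda>\<omega>. Z \<omega> * (W t \<omega> - W s \<omega>)) \<and> (\<integral>\<omega>. Z \<omega> * (W t \<omega> - W s \<omega>) \<partial>N) = 0"
  proof (cases "s = t")
    case False
    with st have lt: "s < t" by simp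
    note iv = indep_var_increment[OF st(1) lt Z(1), of "\<lambda>z. z" borel, simplified]
    have i: "integrable N (\<lambda>\<omega>. W t \<omega> - W s \<omega>)"
      using increment_sq_integrable[of s t] st by (intro sq_integrable_integrable) auto
    have "(\<integral>\<omega>. W t \<omega> - W s \<omega> \<partial>N) = 0"
      using lt by (intro normal_distributed_expectation[OF _ W_increment[OF st(1) lt]]) auto
    then show ?thesis
      using indep_var_lebesgue_integral[OF iv Z(2) i] indep_var_integrable[OF iv Z(2) i] by simp
  qed simp
  then show "integrable N (\<lambda>\<omega>. Z \<omega> * (W t \<omega> - W s \<omega>))" "(\<integral>\<omega>. Z \<omega> * (W t \<omega> - W s \<omega>) \<partial>N) = 0" by auto
qed

lemma increment_variance:
  assumes st: "0 \<le> s" "s \<le> t" and Z: "Z \<in> borel_measurable (F s)" "integrable N Z"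
  shows "integrable N (\<lambda>\<omega>. Z \<omega> * (W t \<omega> - W s \<omega>)\<^sup>2)"
    "(\<integral>\<omega>. Z \<omega> * (W t \<omega> - W s \<omega>)\<^sup>2 \<partial>N) = (\<integral>\<omega>. Z \<omega> \<partial>N) * (t - s)"
proof -
  have "integrable N (\<lambda>\<omega>. Z \<omega> * (W t \<omega> - W s \<omega>)\<^sup>2) \<and>
    (\<integral>\<omega>. Z \<omega> * (W t \<omega> - W s \<omega>)\<^sup>2 \<partial>N) = (\<integral>\<omega>. Z \<omega> \<partial>N) * (t - s)"
  proof (cases "s = t")
    case False
    with st have lt: "s < t" by simp
    have iv: "indep_var borel Z borel (\<lambda>\<omega>. (W t \<omega> - W s \<omega>)\<^sup>2)"
      by (rule indep_var_increment[OF st(1) lt Z(1), of "\<lambda>z. z\<^sup>2"]) simp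
    have i: "integrable N (\<lambda>\<omega>. (W t \<omega> - W s \<omega>)\<^sup>2)"
      using increment_sq_integrable[of s t] st by (intro sq_integrableD) auto
    have "(\<integral>\<omega>. W t \<omega> - W s \<omega> \<partial>N) = 0"
      using lt by (intro normal_distributed_expectation[OF _ W_increment[OF st(1) lt]]) auto
    then have "(\<integral>\<omega>. (W t \<omega> - W s \<omega>)\<^sup>2 \<partial>N) = t - s"
      using normal_distributed_variance[OF _ W_increment[OF st(1) lt]] lt by simp
    then show ?thesis
      using indep_var_lebesgue_integral[OF iv Z(2) i] indep_var_integrable[OF iv Z(2) i] by simp
  qed simp
  then show "integrable N (\<lambda>\<omega>. Z \<omega> * (W t \<omega> - W s \<omega>)\<^sup>2)"
    "(\<integral>\<omega>. Z \<omega> * (W t \<omega> - W s \<omega>)\<^sup>2 \<partial>N) = (\<integral>\<omega>. Z \<omega> \<partial>N) * (t - s)" by auto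
qed

section \<open>Bounded weights and products of weighted increments\<close>

definition weight :: "real \<Rightarrow> ('a \<Rightarrow> real) \<Rightarrow> bool" where
  "weight a \<xi> \<longleftrightarrow> \<xi> \<in> borel_measurable (F a) \<and> (\<exists>C. \<forall>\<omega>\<in>space N. \<bar>\<xi> \<omega>\<bar> \<le> C)"

lemma weight_mono: "weight a \<xi> \<Longrightarrow> a \<le> b \<Longrightarrow> weight b \<xi>"
  unfolding weight_def by (blast intro: F_measurable_mono)

lemma weight_mult:
  assumes "weight a \<xi>" "weight a \<eta>" shows "weight a (\<lambda>\<omega>. \<xi> \<omega> * \<eta> \<omega>)"
proof -
  from assms obtain C D where C: "\<And>\<omega>. \<omega> \<in> space N \<Longrightarrow> \<bar>\<xi> \<omega>\<bar> \<le> C" "\<And>\<omega>. \<omega> \<in> space N \<Longrightarrow> \<bar>\<eta> \<omega>\<bar> \<le> D"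
    by (auto simp: weight_def)
  have "\<bar>\<xi> \<omega> * \<eta> \<omega>\<bar> \<le> C * D" if "\<omega> \<in> space N" for \<omega>
    unfolding abs_mult using C[OF that] by (intro mult_mono) auto
  then show ?thesis using assms by (auto simp: weight_def)
qed

lemma weight_sq_integrable:
  assumes "weight a \<xi>" shows "sq_integrable N \<xi>"
proof -
  from assms obtain C where "\<xi> \<in> borel_measurable (F a)" "\<And>\<omega>. \<omega> \<in> space N \<Longrightarrow> \<bar>\<xi> \<omega>\<bar> \<le> C"
    by (auto simp: weight_def)
  then show ?thesis by (intro sq_integrable_bounded F_measurable_N)
qed

lemma weight_mult_sq_integrable:
  assumes "weight a \<xi>" "sq_integrable N Z" shows "sq_integrable N (\<lambda>\<omega>. \<xi> \<omega> * Z \<omega>)"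
proof -
  from assms obtain C where "\<xi> \<in> borel_measurable (F a)" "\<And>\<omega>. \<omega> \<in> space N \<Longrightarrow> \<bar>\<xi> \<omega>\<bar> \<le> C"
    by (auto simp: weight_def)
  then show ?thesis by (intro sq_integrable_bounded_mult[OF assms(2)] F_measurable_N)
qed

lemma weight_indicator: "A \<in> sets (F a) \<Longrightarrow> weight a (indicator A)"
  by (auto simp: weight_def indicator_def intro!: exI[of _ 1])

lemma weight_increment_orthogonal:
  assumes "0 \<le> a" "a \<le> b" "weight a \<xi>" "Z \<in> borel_measurable (F a)" "sq_integrable N Z"
  shows "(\<integral>\<omega>. \<xi> \<omega> * (W b \<omega> - W a \<omega>) * Z \<omega> \<partial>N) = 0"
proof -
  have "(\<integral>\<omega>. (\<xi> \<omega> * Z \<omega>) * (W b \<omega> - W a \<omega>) \<partial>N) = 0"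
    using assms weight_mult_sq_integrable[OF assms(3,5)]
    by (intro increment_mean) (auto simp: weight_def)
  then show ?thesis by (simp add: mult_ac)
qed

text \<open>The longer increment is the shorter one followed by a later increment, which is
  orthogonal to everything known before; only the square of the shorter one survives.\<close>

lemma increment_product:
  assumes ab: "0 \<le> a" "a \<le> b" "a \<le> b'" and \<eta>: "weight a \<eta>"
  shows "(\<integral>\<omega>. \<eta> \<omega> * ((W b \<omega> - W a \<omega>) * (W b' \<omega> - W a \<omega>)) \<partial>N) = (\<integral>\<omega>. \<eta> \<omega> \<partial>N) * (min b b' - a)"
proof -
  have *: "(\<integral>\<omega>. \<eta> \<omega> * ((W b \<omega> - W a \<omega>) * (W b' \<omega> - W a \<omega>)) \<partial>N) = (\<integral>\<omega>. \<eta> \<omega> \<partial>N) * (b - a)"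
    if b: "a \<le> b" "b \<le> b'" for b b'
  proof -
    have b0: "0 \<le> b" "0 \<le> b'" using ab b by auto
    have int\<eta>: "integrable N \<eta>" by (intro sq_integrable_integrable weight_sq_integrable[OF \<eta>])
    have m: "W b \<in> borel_measurable (F b)" "W a \<in> borel_measurable (F b)" "\<eta> \<in> borel_measurable (F b)"
      using W_F ab b \<eta> F_measurable_mono by (auto simp: weight_def)
    have sq: "sq_integrable N (\<lambda>\<omega>. \<eta> \<omega> * (W b \<omega> - W a \<omega>))"
      by (rule weight_mult_sq_integrable[OF \<eta> increment_sq_integrable]) (use ab b in auto)
    then have Z: "integrable N (\<lambda>\<omega>. \<eta> \<omega> * (W b \<omega> - W a \<omega>))" by (rule sq_integrable_integrable)
    note v = increment_variance[OF ab(1) b(1) _ int\<eta>]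
    note z = increment_mean[OF b0(1) b(2) _ Z]
    have "(\<integral>\<omega>. \<eta> \<omega> * ((W b \<omega> - W a \<omega>) * (W b' \<omega> - W a \<omega>)) \<partial>N)
       = (\<integral>\<omega>. \<eta> \<omega> * (W b \<omega> - W a \<omega>)\<^sup>2 + \<eta> \<omega> * (W b \<omega> - W a \<omega>) * (W b' \<omega> - W b \<omega>) \<partial>N)"
      by (intro Bochner_Integration.integral_cong) (auto simp: power2_eq_square algebra_simps)
    also have "\<dots> = (\<integral>\<omega>. \<eta> \<omega> \<partial>N) * (b - a)"
      using v z m \<eta> by (subst Bochner_Integration.integral_add) (auto simp: weight_def)
    finally show ?thesis .
  qed
  show ?thesis
  proof (cases "b \<le> b'")
    case False
    then have "(\<integral>\<omega>. \<eta> \<omega> * ((W b' \<omega> - W a \<omega>) * (W b \<omega> - W a \<omega>)) \<partial>N) = (\<integral>\<omega>. \<eta> \<omega> \<partial>N) * (b' - a)"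
      using ab by (intro *) auto
    then show ?thesis using False by (simp add: mult.commute[of "W b' _ - _"])
  qed (use * ab in auto)
qed

text \<open>Polarised isometry for two single intervals. The portion of the earlier interval that
  precedes the start of the later one is known at that start, hence orthogonal to the later
  increment; what remains starts at a common point. The outer \<open>max 0\<close> accounts for
  disjoint intervals.\<close>

lemma weighted_increments_product:
  assumes a: "0 \<le> a" "a \<le> b" "0 \<le> a'" "a' \<le> b'" and \<xi>: "weight a \<xi>" "weight a' \<xi>'"
  shows "(\<integral>\<omega>. (\<xi> \<omega> * (W b \<omega> - W a \<omega>)) * (\<xi>' \<omega> * (W b' \<omega> - W a' \<omega>)) \<partial>N)
     = (\<integral>\<omega>. \<xi> \<omega> * \<xi>' \<omega> \<partial>N) * max 0 (min b b' - max a a')"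
proof -
  have *: "(\<integral>\<omega>. (\<xi> \<omega> * (W b \<omega> - W a \<omega>)) * (\<xi>' \<omega> * (W b' \<omega> - W a' \<omega>)) \<partial>N)
     = (\<integral>\<omega>. \<xi> \<omega> * \<xi>' \<omega> \<partial>N) * max 0 (min b b' - a')"
    if le: "0 \<le> a" "a \<le> b" "a \<le> a'" "a' \<le> b'" and w: "weight a \<xi>" "weight a' \<xi>'"
    for a b a' b' \<xi> \<xi>'
  proof -
    have w': "weight a' \<xi>" by (rule weight_mono[OF w(1) le(3)])
    have m: "\<xi> \<in> borel_measurable (F a')" "\<xi>' \<in> borel_measurable (F a')" using w w' by (auto simp: weight_def)
    have orth: "(\<integral>\<omega>. (\<xi> \<omega> * (W c \<omega> - W a \<omega>)) * (\<xi>' \<omega> * (W b' \<omega> - W a' \<omega>)) \<partial>N) = 0" if "a \<le> c" "c \<le> a'" for c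
    proof -
      have "(\<integral>\<omega>. \<xi>' \<omega> * (W b' \<omega> - W a' \<omega>) * (\<xi> \<omega> * (W c \<omega> - W a \<omega>)) \<partial>N) = 0"
      proof (rule weight_increment_orthogonal)
        show "(\<lambda>\<omega>. \<xi> \<omega> * (W c \<omega> - W a \<omega>)) \<in> borel_measurable (F a')"
          using W_F[of c a'] W_F[of a a'] m le that by auto
        show "sq_integrable N (\<lambda>\<omega>. \<xi> \<omega> * (W c \<omega> - W a \<omega>))"
          by (rule weight_mult_sq_integrable[OF w(1) increment_sq_integrable]) (use le that in auto)
      qed (use le w in auto)
      then show ?thesis by (simp add: mult.commute)
    qed
    show ?thesis
    proof (cases "b \<le> a'")
      case True
      then show ?thesis using orth[of b] le by (simp add: max_def)
    next
      case False
      have sq: "sq_integrable N (\<lambda>\<omega>. \<xi> \<omega> * (W c \<omega> - W d \<omega>))" "sq_integrable N (\<lambda>\<omega>. \<xi>' \<omega> * (W c \<omega> - W d \<omega>))"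
        if "0 \<le> c" "0 \<le> d" for c d
        using weight_mult_sq_integrable[OF w(1) increment_sq_integrable] weight_mult_sq_integrable[OF w(2) increment_sq_integrable] that by auto
      have i: "integrable N (\<lambda>\<omega>. (\<xi> \<omega> * (W c \<omega> - W d \<omega>)) * (\<xi>' \<omega> * (W b' \<omega> - W a' \<omega>)))"
        if "0 \<le> c" "0 \<le> d" for c d
        using sq that le by (intro sq_integrable_mult) auto
      have "(\<integral>\<omega>. (\<xi> \<omega> * (W b \<omega> - W a \<omega>)) * (\<xi>' \<omega> * (W b' \<omega> - W a' \<omega>)) \<partial>N)
        = (\<integral>\<omega>. (\<xi> \<omega> * (W a' \<omega> - W a \<omega>)) * (\<xi>' \<omega> * (W b' \<omega> - W a' \<omega>)) + (\<xi> \<omega> * (W b \<omega> - W a' \<omega>)) * (\<xi>' \<omega> * (W b' \<omega> - W a' \<omega>)) \<partial>N)"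
        by (intro Bochner_Integration.integral_cong) (auto simp: algebra_simps)
      also have "\<dots> = (\<integral>\<omega>. (\<xi> \<omega> * (W b \<omega> - W a' \<omega>)) * (\<xi>' \<omega> * (W b' \<omega> - W a' \<omega>)) \<partial>N)"
        using i[of a' a] i[of b a'] le False orth[of a'] by (subst Bochner_Integration.integral_add) auto
      also have "\<dots> = (\<integral>\<omega>. (\<xi> \<omega> * \<xi>' \<omega>) * ((W b \<omega> - W a' \<omega>) * (W b' \<omega> - W a' \<omega>)) \<partial>N)"
        by (intro Bochner_Integration.integral_cong) (auto simp: mult_ac)
      also have "\<dots> = (\<integral>\<omega>. \<xi> \<omega> * \<xi>' \<omega> \<partial>N) * (min b b' - a')"
        by (rule increment_product) (use le False weight_mult[OF w' w(2)] in auto)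
      finally show ?thesis using False le by (simp add: max_def min_def)
    qed
  qed
  show ?thesis
  proof (cases "a \<le> a'")
    case True
    then show ?thesis using *[OF a(1,2) _ a(4) \<xi>] by simp
  next
    case False
    then show ?thesis using *[OF a(3,4) _ a(2) \<xi>(2,1)] by (simp add: mult.commute min.commute)
  qed
qed

text \<open>
  Elementary processes are indexed by an arbitrary finite set rather than by the cells of a
  partition, so that sums and differences need no common refinement.
\<close>

definition elem_data :: "'i set \<Rightarrow> ('i \<Rightarrow> real) \<Rightarrow> ('i \<Rightarrow> real) \<Rightarrow> ('i \<Rightarrow> 'a \<Rightarrow> real) \<Rightarrow> bool" where
  "elem_data P a b \<xi> \<longleftrightarrow> finite P \<and> (\<forall>p\<in>P. 0 \<le> a p \<and> a p \<le> b p \<and> weight (a p) (\<xi> p))"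

definition elem_process :: "'i set \<Rightarrow> ('i \<Rightarrow> real) \<Rightarrow> ('i \<Rightarrow> real) \<Rightarrow> ('i \<Rightarrow> 'a \<Rightarrow> real) \<Rightarrow> real \<Rightarrow> 'a \<Rightarrow> real" where
  "elem_process P a b \<xi> t \<omega> = (\<Sum>p\<in>P. \<xi> p \<omega> * indicator {a p<..b p} t)"

definition elem_integral :: "'i set \<Rightarrow> ('i \<Rightarrow> real) \<Rightarrow> ('i \<Rightarrow> real) \<Rightarrow> ('i \<Rightarrow> 'a \<Rightarrow> real) \<Rightarrow> real \<Rightarrow> 'a \<Rightarrow> real" where
  "elem_integral P a b \<xi> t \<omega> = (\<Sum>p\<in>P. \<xi> p \<omega> * (W (min (b p) t) \<omega> - W (min (a p) t) \<omega>))"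

text \<open>Writing the length of the overlap as an integral of indicators puts the cross terms into
  the form that appears when the square of the integrand is expanded.\<close>

lemma stopped_increments_product:
  assumes a: "0 \<le> a" "a \<le> b" "0 \<le> a'" "a' \<le> b'" and t: "0 \<le> t" and \<xi>: "weight a \<xi>" "weight a' \<xi>'"
  shows "(\<integral>\<omega>. (\<xi> \<omega> * (W (min b t) \<omega> - W (min a t) \<omega>)) * (\<xi>' \<omega> * (W (min b' t) \<omega> - W (min a' t) \<omega>)) \<partial>N)
     = (\<integral>\<omega>. \<xi> \<omega> * \<xi>' \<omega> \<partial>N) * (\<integral>s. indicator {0..t} s * (indicator {a<..b} s * indicator {a'<..b'} s) \<partial>lborel)"
proof -
  have "indicator {0..t} s * (indicator {a<..b} s * indicator {a'<..b'} s) = (indicator {max a a'<..min (min b b') t} s :: real)" for s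
    using a by (auto simp: indicator_def)
  then have I: "(\<integral>s. indicator {0..t} s * (indicator {a<..b} s * indicator {a'<..b'} s) \<partial>lborel) = max 0 (min (min b b') t - max a a')"
    using lborel_integral_Ioc by (simp only:)
  show ?thesis
  proof (cases "a \<le> t \<and> a' \<le> t")
    case True
    have "(\<integral>\<omega>. (\<xi> \<omega> * (W (min b t) \<omega> - W a \<omega>)) * (\<xi>' \<omega> * (W (min b' t) \<omega> - W a' \<omega>)) \<partial>N)
       = (\<integral>\<omega>. \<xi> \<omega> * \<xi>' \<omega> \<partial>N) * max 0 (min (min b t) (min b' t) - max a a')"
      by (rule weighted_increments_product) (use a t \<xi> True in auto)
    moreover have "min (min b t) (min b' t) = min (min b b') t" by (simp add: min_def)
    ultimately show ?thesis using True unfolding I by simp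
  next
    case False
    then show ?thesis unfolding I using a by (auto simp: max_def min_def)
  qed
qed

lemma elem_integral_sq_integrable:
  assumes "elem_data P a b \<xi>" "0 \<le> t"
  shows "sq_integrable N (elem_integral P a b \<xi> t)"
  unfolding elem_integral_def using assms
  by (intro sq_integrable_sum weight_mult_sq_integrable increment_sq_integrable) (auto simp: elem_data_def)

text \<open>Intervals may overlap, so the cross terms do not vanish; both sides are expanded into
  the same double sum and compared term by term. On the right the time integral is evaluated for
  each path before the expectation is taken.\<close>

theorem elem_isometry:
  assumes d: "elem_data P a b \<xi>" and t: "0 \<le> t"
  shows "(\<integral>\<^sup>+\<omega>. ennreal ((elem_integral P a b \<xi> t \<omega>)\<^sup>2) \<partial>N)
    = (\<integral>\<^sup>+\<omega>. (\<integral>\<^sup>+s\<in>{0..t}. ennreal ((elem_process P a b \<xi> s \<omega>)\<^sup>2) \<partial>lborel) \<partial>N)"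
proof -
  have fin: "finite P" and ab: "\<And>p. p \<in> P \<Longrightarrow> 0 \<le> a p \<and> a p \<le> b p \<and> weight (a p) (\<xi> p)"
    using d by (auto simp: elem_data_def)
  define I :: "_ \<Rightarrow> _ \<Rightarrow> real" where "I p q = (\<integral>s. indicator {0..t} s * (indicator {a p<..b p} s * indicator {a q<..b q} s) \<partial>lborel)" for p q
  define D where "D p \<omega> = \<xi> p \<omega> * (W (min (b p) t) \<omega> - W (min (a p) t) \<omega>)" for p \<omega>
  have Dsq: "sq_integrable N (D p)" if "p \<in> P" for p
    unfolding D_def using ab[OF that] t by (intro weight_mult_sq_integrable increment_sq_integrable) auto
  have D1: "integrable N (\<lambda>\<omega>. D p \<omega> * D q \<omega>)" if "p \<in> P" "q \<in> P" for p q
    using Dsq that by (intro sq_integrable_mult) auto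
  have D2: "(\<integral>\<omega>. D p \<omega> * D q \<omega> \<partial>N) = (\<integral>\<omega>. \<xi> p \<omega> * \<xi> q \<omega> \<partial>N) * I p q" if "p \<in> P" "q \<in> P" for p q
    unfolding D_def I_def using ab that t by (intro stopped_increments_product) auto
  have x1: "integrable N (\<lambda>\<omega>. \<xi> p \<omega> * \<xi> q \<omega>)" if "p \<in> P" "q \<in> P" for p q
    using ab[OF that(1)] ab[OF that(2)] by (intro sq_integrable_mult weight_sq_integrable[of "a p"] weight_sq_integrable[of "a q"]) auto
  have path: "ennreal (\<Sum>p\<in>P. \<Sum>q\<in>P. \<xi> p \<omega> * \<xi> q \<omega> * I p q)
      = (\<integral>\<^sup>+s\<in>{0..t}. ennreal ((elem_process P a b \<xi> s \<omega>)\<^sup>2) \<partial>lborel)"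
    and nonneg: "0 \<le> (\<Sum>p\<in>P. \<Sum>q\<in>P. \<xi> p \<omega> * \<xi> q \<omega> * I p q)" for \<omega>
  proof -
    let ?f = "\<lambda>s. (\<Sum>p\<in>P. \<Sum>q\<in>P. (\<xi> p \<omega> * \<xi> q \<omega>) * (indicator {0..t} s * (indicator {a p<..b p} s * indicator {a q<..b q} s)))"
    have f: "?f s = indicator {0..t} s * (elem_process P a b \<xi> s \<omega>)\<^sup>2" for s
    proof -
      have "?f s = (\<Sum>p\<in>P. \<Sum>q\<in>P. indicator {0..t} s * ((\<xi> p \<omega> * indicator {a p<..b p} s) * (\<xi> q \<omega> * indicator {a q<..b q} s)))"
        by (intro sum.cong refl) (simp add: mult_ac)
      also have "\<dots> = indicator {0..t} s * (elem_process P a b \<xi> s \<omega>)\<^sup>2"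
        unfolding elem_process_def power2_eq_square sum_product by (simp only: sum_distrib_left)
      finally show ?thesis .
    qed
    have i: "integrable lborel (\<lambda>s. indicator {0..t} s * (indicator {a p<..b p} s * indicator {a q<..b q} s) :: real)" for p q
    proof -
      have "indicator {0..t} s * (indicator {a p<..b p} s * indicator {a q<..b q} s) = (indicator ({0..t} \<inter> {a p<..b p} \<inter> {a q<..b q}) s :: real)" for s
        by (auto simp: indicator_def)
      moreover have "emeasure lborel ({0..t} \<inter> {a p<..b p} \<inter> {a q<..b q}) < \<infinity>"
        by (rule le_less_trans[OF emeasure_mono[of _ "{0..t}"]]) (use t in auto)
      ultimately show ?thesis by simp
    qed
    have eq: "(\<Sum>p\<in>P. \<Sum>q\<in>P. \<xi> p \<omega> * \<xi> q \<omega> * I p q) = (\<integral>s. ?f s \<partial>lborel)"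
      using i by (simp add: I_def Bochner_Integration.integral_sum Bochner_Integration.integrable_sum)
    then have "ennreal (\<Sum>p\<in>P. \<Sum>q\<in>P. \<xi> p \<omega> * \<xi> q \<omega> * I p q) = ennreal (\<integral>s. ?f s \<partial>lborel)" by simp
    also have "\<dots> = (\<integral>\<^sup>+s. ennreal (?f s) \<partial>lborel)"
      using i f by (intro nn_integral_eq_integral[symmetric] Bochner_Integration.integrable_sum) auto
    also have "\<dots> = (\<integral>\<^sup>+s\<in>{0..t}. ennreal ((elem_process P a b \<xi> s \<omega>)\<^sup>2) \<partial>lborel)"
      unfolding f by (intro nn_integral_cong) (auto simp: indicator_def)
    finally show "ennreal (\<Sum>p\<in>P. \<Sum>q\<in>P. \<xi> p \<omega> * \<xi> q \<omega> * I p q)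
      = (\<integral>\<^sup>+s\<in>{0..t}. ennreal ((elem_process P a b \<xi> s \<omega>)\<^sup>2) \<partial>lborel)" .
    show "0 \<le> (\<Sum>p\<in>P. \<Sum>q\<in>P. \<xi> p \<omega> * \<xi> q \<omega> * I p q)"
      unfolding eq f by simp
  qed
  have "(\<integral>\<^sup>+\<omega>. ennreal ((elem_integral P a b \<xi> t \<omega>)\<^sup>2) \<partial>N) = ennreal (\<integral>\<omega>. (elem_integral P a b \<xi> t \<omega>)\<^sup>2 \<partial>N)"
    by (rule sq_integrable_nn_eq[OF elem_integral_sq_integrable[OF d t]])
  also have "(\<integral>\<omega>. (elem_integral P a b \<xi> t \<omega>)\<^sup>2 \<partial>N) = (\<integral>\<omega>. (\<Sum>p\<in>P. \<Sum>q\<in>P. D p \<omega> * D q \<omega>) \<partial>N)"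
    by (simp add: elem_integral_def D_def power2_eq_square sum_product)
  also have "\<dots> = (\<Sum>p\<in>P. \<Sum>q\<in>P. (\<integral>\<omega>. \<xi> p \<omega> * \<xi> q \<omega> \<partial>N) * I p q)"
    using D1 D2 by (simp add: Bochner_Integration.integral_sum Bochner_Integration.integrable_sum)
  also have "\<dots> = (\<integral>\<omega>. (\<Sum>p\<in>P. \<Sum>q\<in>P. (\<xi> p \<omega> * \<xi> q \<omega>) * I p q) \<partial>N)"
    using x1 by (simp add: Bochner_Integration.integral_sum Bochner_Integration.integrable_sum)
  also have "ennreal \<dots> = (\<integral>\<^sup>+\<omega>. ennreal (\<Sum>p\<in>P. \<Sum>q\<in>P. (\<xi> p \<omega> * \<xi> q \<omega>) * I p q) \<partial>N)"
  proof (rule nn_integral_eq_integral[symmetric])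
    show "integrable N (\<lambda>\<omega>. \<Sum>p\<in>P. \<Sum>q\<in>P. \<xi> p \<omega> * \<xi> q \<omega> * I p q)"
      using x1 by (intro Bochner_Integration.integrable_sum) auto
    show "AE \<omega> in N. 0 \<le> (\<Sum>p\<in>P. \<Sum>q\<in>P. \<xi> p \<omega> * \<xi> q \<omega> * I p q)" by (simp add: nonneg)
  qed
  also have "\<dots> = (\<integral>\<^sup>+\<omega>. (\<integral>\<^sup>+s\<in>{0..t}. ennreal ((elem_process P a b \<xi> s \<omega>)\<^sup>2) \<partial>lborel) \<partial>N)"
    by (rule nn_integral_cong) (rule path)
  finally show ?thesis .
qed

lemma elem_integral_adapted:
  assumes d: "elem_data P a b \<xi>" and t: "0 \<le> t"
  shows "elem_integral P a b \<xi> t \<in> borel_measurable (F t)"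
  unfolding elem_integral_def
proof (rule borel_measurable_sum)
  fix p assume "p \<in> P"
  then have p: "0 \<le> a p" "a p \<le> b p" "weight (a p) (\<xi> p)" using d by (auto simp: elem_data_def)
  show "(\<lambda>\<omega>. \<xi> p \<omega> * (W (min (b p) t) \<omega> - W (min (a p) t) \<omega>)) \<in> borel_measurable (F t)"
  proof (cases "a p \<le> t")
    case True
    then have "\<xi> p \<in> borel_measurable (F t)" using p F_measurable_mono by (auto simp: weight_def)
    then show ?thesis using W_F[of "min (b p) t" t] W_F[of "min (a p) t" t] p t by auto
  next
    \<comment> \<open>The interval has not begun at time \<open>t\<close>: its weight need not be
      known yet, but the factor of the weight is zero.\<close>
    case False
    then have "min (b p) t = t" "min (a p) t = t" using p by auto
    then show ?thesis by simp
  qed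
qed

lemma elem_integral_continuous:
  assumes d: "elem_data P a b \<xi>" and \<omega>: "\<omega> \<in> space N"
  shows "continuous_on {0..} (\<lambda>t. elem_integral P a b \<xi> t \<omega>)"
proof -
  have "continuous_on {0..} (\<lambda>t. W (min c t) \<omega>)" if "0 \<le> c" for c
    using that by (intro continuous_on_compose2[OF W_continuous[OF \<omega>]] continuous_intros) auto
  then show ?thesis unfolding elem_integral_def using d
    by (intro continuous_intros) (force simp: elem_data_def)+
qed

text \<open>Between \<open>s\<close> and \<open>t\<close> only the part of each interval from
  \<open>max (a p) s\<close> to \<open>min (b p) t\<close> adds anything, and its increment is
  orthogonal to all that is known at its start, in particular to \<open>Z\<close> times the
  weight.\<close>

lemma elem_integral_martingale:
  assumes d: "elem_data P a b \<xi>" and st: "0 \<le> s" "s \<le> t"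
    and Z: "Z \<in> borel_measurable (F s)" "sq_integrable N Z"
  shows "(\<integral>\<omega>. elem_integral P a b \<xi> t \<omega> * Z \<omega> \<partial>N) = (\<integral>\<omega>. elem_integral P a b \<xi> s \<omega> * Z \<omega> \<partial>N)"
proof -
  have *: "(\<integral>\<omega>. \<xi> p \<omega> * (W (min (b p) t) \<omega> - W (min (a p) t) \<omega>) * Z \<omega> \<partial>N)
     = (\<integral>\<omega>. \<xi> p \<omega> * (W (min (b p) s) \<omega> - W (min (a p) s) \<omega>) * Z \<omega> \<partial>N)" if "p \<in> P" for p
  proof -
    have p: "0 \<le> a p" "a p \<le> b p" "weight (a p) (\<xi> p)" using d that by (auto simp: elem_data_def)
    consider "t \<le> a p" | "b p \<le> s" | "a p < t" "s < b p" by linarith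
    then show ?thesis
    proof cases
      case 3
      define c where "c = max (a p) s"
      define e where "e = min (b p) t"
      have c: "0 \<le> c" "c \<le> e" "a p \<le> c" "s \<le> c" using p st 3 by (auto simp: c_def e_def)
      have "(\<integral>\<omega>. \<xi> p \<omega> * (W e \<omega> - W c \<omega>) * Z \<omega> \<partial>N) = 0"
        using c weight_mono[OF p(3)] F_measurable_mono[OF _ Z(1)] Z(2)
        by (intro weight_increment_orthogonal) auto
      moreover have "\<xi> p \<omega> * (W (min (b p) t) \<omega> - W (min (a p) t) \<omega>) * Z \<omega>
         = \<xi> p \<omega> * (W e \<omega> - W c \<omega>) * Z \<omega> + \<xi> p \<omega> * (W (min (b p) s) \<omega> - W (min (a p) s) \<omega>) * Z \<omega>" for \<omega>
      proof (cases "s \<le> a p")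
        case True
        then have "min (a p) s = s" "min (b p) s = s" "min (a p) t = a p" "c = a p"
          using p 3 by (auto simp: c_def)
        then show ?thesis by (simp add: e_def)
      next
        case False
        then have "min (a p) s = a p" "min (b p) s = s" "min (a p) t = a p" "c = s"
          using p 3 by (auto simp: c_def)
        then show ?thesis by (simp add: e_def algebra_simps)
      qed
      moreover have "integrable N (\<lambda>\<omega>. \<xi> p \<omega> * (W u \<omega> - W v \<omega>) * Z \<omega>)" if "0 \<le> u" "0 \<le> v" for u v
        using that by (intro sq_integrable_mult weight_mult_sq_integrable[OF p(3)] increment_sq_integrable Z)
      ultimately show ?thesis using c p st by simp
    next
      case 1
      then have "min (a p) t = t" "min (b p) t = t" "min (a p) s = s" "min (b p) s = s" using p st by auto
      then show ?thesis by simp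
    next
      case 2
      then have "min (a p) t = a p" "min (b p) t = b p" "min (a p) s = a p" "min (b p) s = b p" using p st by auto
      then show ?thesis by simp
    qed
  qed
  have i: "integrable N (\<lambda>\<omega>. \<xi> p \<omega> * (W (min (b p) t) \<omega> - W (min (a p) t) \<omega>) * Z \<omega>)" if "p \<in> P" "0 \<le> t" for p t
    using that d by (intro sq_integrable_mult weight_mult_sq_integrable[of "a p"] increment_sq_integrable Z) (auto simp: elem_data_def)
  show ?thesis
    unfolding elem_integral_def sum_distrib_right using i st * by (simp add: Bochner_Integration.integral_sum)
qed

lemma elem_diff:
  assumes "elem_data P a b \<xi>" "elem_data Q a' b' \<xi>'"
  shows "elem_data (P <+> Q) (case_sum a a') (case_sum b b') (case_sum \<xi> (\<lambda>q \<omega>. - \<xi>' q \<omega>))"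
    "elem_process (P <+> Q) (case_sum a a') (case_sum b b') (case_sum \<xi> (\<lambda>q \<omega>. - \<xi>' q \<omega>)) t \<omega>
       = elem_process P a b \<xi> t \<omega> - elem_process Q a' b' \<xi>' t \<omega>"
    "elem_integral (P <+> Q) (case_sum a a') (case_sum b b') (case_sum \<xi> (\<lambda>q \<omega>. - \<xi>' q \<omega>)) t \<omega>
       = elem_integral P a b \<xi> t \<omega> - elem_integral Q a' b' \<xi>' t \<omega>"
proof -
  have fin: "finite P" "finite Q" using assms by (auto simp: elem_data_def)
  show "elem_data (P <+> Q) (case_sum a a') (case_sum b b') (case_sum \<xi> (\<lambda>q \<omega>. - \<xi>' q \<omega>))"
    using assms unfolding elem_data_def weight_def by auto
  show "elem_process (P <+> Q) (case_sum a a') (case_sum b b') (case_sum \<xi> (\<lambda>q \<omega>. - \<xi>' q \<omega>)) t \<omega>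
       = elem_process P a b \<xi> t \<omega> - elem_process Q a' b' \<xi>' t \<omega>"
    unfolding elem_process_def sum.Plus[OF fin] o_def by (simp only: sum.case mult_minus_left sum_negf)
  show "elem_integral (P <+> Q) (case_sum a a') (case_sum b b') (case_sum \<xi> (\<lambda>q \<omega>. - \<xi>' q \<omega>)) t \<omega>
       = elem_integral P a b \<xi> t \<omega> - elem_integral Q a' b' \<xi>' t \<omega>"
    unfolding elem_integral_def sum.Plus[OF fin] o_def by (simp only: sum.case mult_minus_left sum_negf)
qed

end

section \<open>Exit times of continuous paths\<close>

definition grid_index :: "real \<Rightarrow> nat \<Rightarrow> real \<Rightarrow> nat" where
  "grid_index T n r = nat \<lceil>r * real n / T\<rceil>"

definition grid_up :: "real \<Rightarrow> nat \<Rightarrow> real \<Rightarrow> real" where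
  "grid_up T n r = real (grid_index T n r) * T / real n"

text \<open>Rounding up means that a cell counts as soon as \<open>r\<close> lies beyond its left
  end. For a stopping time \<open>r\<close> this is an event of that left end, so its indicator is
  an admissible weight there.\<close>

lemma grid_index_less:
  assumes "0 < T" "0 < n"
  shows "i < grid_index T n r \<longleftrightarrow> real i * T / real n < r"
proof -
  have "i < grid_index T n r \<longleftrightarrow> real i < r * real n / T"
    unfolding grid_index_def zless_nat_eq_int_zless by (simp add: less_ceiling_iff)
  also have "\<dots> \<longleftrightarrow> real i * T / real n < r" using assms by (simp add: field_simps)
  finally show ?thesis .
qed

lemma grid_up_bounds:
  assumes T: "0 < T" "0 < n" and r: "0 \<le> r" "r \<le> T"
  shows "grid_index T n r \<le> n" "r \<le> grid_up T n r" "grid_up T n r \<le> r + T / real n"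
    "0 \<le> grid_up T n r" "grid_up T n r \<le> T"
proof -
  have "\<not> n < grid_index T n r" using grid_index_less[OF T, of n r] T r by simp
  then show i: "grid_index T n r \<le> n" by simp
  have "\<not> grid_index T n r < grid_index T n r" by simp
  then show "r \<le> grid_up T n r" unfolding grid_index_less[OF T] grid_up_def by simp
  show "grid_up T n r \<le> r + T / real n"
  proof (cases "grid_index T n r")
    case (Suc i)
    then have "real i * T / real n < r" using grid_index_less[OF T, of i r] by simp
    moreover have "real (Suc i) * T / real n = real i * T / real n + T / real n"
      by (simp add: algebra_simps add_divide_distrib)
    ultimately show ?thesis using Suc by (simp add: grid_up_def)
  qed (use r T in \<open>simp add: grid_up_def\<close>)
  show "0 \<le> grid_up T n r" using T by (simp add: grid_up_def)
  show "grid_up T n r \<le> T" using T i by (simp add: grid_up_def field_simps)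
qed

lemma grid_up_tendsto:
  assumes T: "0 < T" and r: "0 \<le> r" "r \<le> T"
  shows "(\<lambda>n. grid_up T (Suc n) r) \<longlonglongrightarrow> r"
proof (rule tendsto_sandwich)
  show "\<forall>\<^sub>F n in sequentially. r \<le> grid_up T (Suc n) r"
    using grid_up_bounds[OF T _ r] by simp
  show "\<forall>\<^sub>F n in sequentially. grid_up T (Suc n) r \<le> r + T * inverse (real (Suc n))"
    using grid_up_bounds(3)[OF T _ r] by (simp add: divide_inverse del: of_nat_Suc)
  have "(\<lambda>n. r + T * inverse (real (Suc n))) \<longlonglongrightarrow> r + T * 0"
    by (intro tendsto_intros LIMSEQ_inverse_real_of_nat)
  then show "(\<lambda>n. r + T * inverse (real (Suc n))) \<longlonglongrightarrow> r" by simp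
qed simp

lemma grid_up_path_tendsto:
  fixes v :: "real \<Rightarrow> real"
  assumes T: "0 < T" and r: "0 \<le> r" "r \<le> T" and v: "continuous_on {0..} v"
  shows "(\<lambda>n. v (grid_up T (Suc n) r)) \<longlonglongrightarrow> v r"
  by (rule continuous_on_tendsto_compose[OF v grid_up_tendsto[OF T r]])
     (use r grid_up_bounds[OF T _ r] in auto)

text \<open>A path stopped at the rounded time is a sum of cell increments with weights decided at
  the left ends, which is the shape of an elementary integral.\<close>

lemma grid_up_telescope:
  fixes v :: "real \<Rightarrow> real"
  assumes T: "0 < T" "0 < n" and r: "0 \<le> r" "r \<le> T" and t: "0 \<le> t"
  shows "(\<Sum>i<n. (if real i * T / real n < r then 1 else 0) * (v (min (real (Suc i) * T / real n) t) - v (min (real i * T / real n) t)))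
    = v (min (grid_up T n r) t) - v 0"
proof -
  let ?g = "\<lambda>i. v (min (real i * T / real n) t)"
  have "(\<Sum>i<n. (if real i * T / real n < r then 1 else 0) * (?g (Suc i) - ?g i))
     = (\<Sum>i\<in>{..<n} \<inter> {i. i < grid_index T n r}. ?g (Suc i) - ?g i)"
    by (subst sum.inter_restrict) (auto simp: grid_index_less[OF T] intro!: sum.cong)
  also have "{..<n} \<inter> {i. i < grid_index T n r} = {..<grid_index T n r}"
    using grid_up_bounds(1)[OF T r] by auto
  also have "(\<Sum>i<grid_index T n r. ?g (Suc i) - ?g i) = ?g (grid_index T n r) - ?g 0"
    by (rule sum_lessThan_telescope)
  finally show ?thesis using t by (simp add: grid_up_def)
qed

text \<open>A continuous path that is positive on a compact interval is bounded away from zero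
  there. The bound has to be uniform over all grids, since positivity at every grid point alone
  would still admit a zero in between. The right side involves countably many times only, whence
  measurability.\<close>

lemma positive_path_iff:
  fixes v :: "real \<Rightarrow> real"
  assumes T: "0 < T" and v: "continuous_on {0..} v"
  shows "(\<forall>s\<in>{0..T}. 0 < v s) \<longleftrightarrow>
    (\<exists>m. \<forall>n i. i \<le> Suc n \<longrightarrow> inverse (real (Suc m)) \<le> v (real i * T / real (Suc n)))"
proof
  assume pos: "\<forall>s\<in>{0..T}. 0 < v s"
  have "continuous_on {0..T} v" using v by (rule continuous_on_subset) auto
  then obtain s where s: "s \<in> {0..T}" "\<And>r. r \<in> {0..T} \<Longrightarrow> v s \<le> v r"
    using continuous_attains_inf[of "{0..T}" v] T by auto
  obtain m where m: "inverse (real (Suc m)) < v s"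
    using reals_Archimedean[of "v s"] pos s by auto
  have "inverse (real (Suc m)) \<le> v (real i * T / real (Suc n))" if "i \<le> Suc n" for n i
  proof -
    have "real i * T \<le> T * real (Suc n)" using that T by (subst mult.commute) (intro mult_left_mono, auto)
    then have "real i * T / real (Suc n) \<in> {0..T}" using T by (simp add: pos_divide_le_eq)
    then show ?thesis using s(2) m by fastforce
  qed
  then show "\<exists>m. \<forall>n i. i \<le> Suc n \<longrightarrow> inverse (real (Suc m)) \<le> v (real i * T / real (Suc n))" by blast
next
  assume "\<exists>m. \<forall>n i. i \<le> Suc n \<longrightarrow> inverse (real (Suc m)) \<le> v (real i * T / real (Suc n))"
  then obtain m where m: "\<And>n i. i \<le> Suc n \<Longrightarrow> inverse (real (Suc m)) \<le> v (real i * T / real (Suc n))" by blast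
  show "\<forall>s\<in>{0..T}. 0 < v s"
  proof
    fix s assume s: "s \<in> {0..T}"
    have "inverse (real (Suc m)) \<le> v (grid_up T (Suc n) s)" for n
      using grid_up_bounds(1)[OF T, of "Suc n" s] s unfolding grid_up_def by (intro m) auto
    then have "inverse (real (Suc m)) \<le> v s"
      using s by (intro LIMSEQ_le_const[OF grid_up_path_tendsto[OF T _ _ v, of s]]) auto
    moreover have "0 < inverse (real (Suc m))" by simp
    ultimately show "0 < v s" by linarith
  qed
qed

lemma positive_path_measurable:
  fixes V :: "real \<Rightarrow> 'b \<Rightarrow> real"
  assumes V: "\<And>s. 0 \<le> s \<Longrightarrow> s \<le> t \<Longrightarrow> V s \<in> borel_measurable M"
    and cont: "\<And>\<omega>. \<omega> \<in> space M \<Longrightarrow> continuous_on {0..} (\<lambda>s. V s \<omega>)" and t: "0 \<le> t"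
  shows "{\<omega> \<in> space M. \<forall>s\<in>{0..t}. 0 < V s \<omega>} \<in> sets M"
\<comment> \<open>At \<open>t = 0\<close> the grid degenerates to a single point.\<close>
proof (cases "t = 0")
  case True
  then show ?thesis using V[of 0] by simp
next
  case False
  with t have t: "0 < t" by simp
  have V': "V (real i * t / real (Suc n)) \<in> borel_measurable M" if "i \<le> Suc n" for i n
  proof (rule V)
    have "real i * t \<le> t * real (Suc n)" using that t by (subst mult.commute) (intro mult_left_mono, auto)
    then show "real i * t / real (Suc n) \<le> t" by (simp add: pos_divide_le_eq)
  qed (use t in auto)
  have "{\<omega> \<in> space M. \<forall>s\<in>{0..t}. 0 < V s \<omega>} = {\<omega> \<in> space M. \<exists>m. \<forall>n. \<forall>i\<in>{..Suc n}. inverse (real (Suc m)) \<le> V (real i * t / real (Suc n)) \<omega>}"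
    by (intro Collect_cong conj_cong refl) (simp only: positive_path_iff[OF t cont], simp only: Ball_def atMost_iff)
  also have "\<dots> = (\<Union>m. \<Inter>n. \<Inter>i\<in>{..Suc n}. {\<omega> \<in> space M. inverse (real (Suc m)) \<le> V (real i * t / real (Suc n)) \<omega>})"
    by auto
  also have "\<dots> \<in> sets M"
    using borel_measurable_le[OF borel_measurable_const V']
    by (intro sets.countable_UN sets.countable_INT image_subsetI sets.finite_INT) auto
  finally show ?thesis .
qed

text \<open>The cap makes the exit time finite and bounded on every path, even on one that stays
  positive for ever, and it ensures that the infimum is taken over a nonempty set.\<close>

definition exit_time :: "(real \<Rightarrow> real) \<Rightarrow> real \<Rightarrow> real" where
  "exit_time v T = (if \<forall>s\<in>{0..T}. 0 < v s then T else Inf {s\<in>{0..T}. v s \<le> 0})"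

lemma exit_time_bounds:
  assumes "0 \<le> T" shows "0 \<le> exit_time v T" "exit_time v T \<le> T"
proof -
  have "0 \<le> exit_time v T \<and> exit_time v T \<le> T"
  proof (cases "\<forall>s\<in>{0..T}. 0 < v s")
    case False
    then obtain s where s: "s \<in> {0..T}" "v s \<le> 0" by (auto simp: not_less)
    have "Inf {s\<in>{0..T}. v s \<le> 0} \<le> s" using s by (intro cInf_lower bdd_belowI[of _ 0]) auto
    moreover have "0 \<le> Inf {s\<in>{0..T}. v s \<le> 0}" using s by (intro cInf_greatest) auto
    ultimately show ?thesis using False s by (auto simp: exit_time_def)
  qed (use assms in \<open>auto simp: exit_time_def\<close>)
  then show "0 \<le> exit_time v T" "exit_time v T \<le> T" by auto
qed

lemma exit_time_le: "0 \<le> s \<Longrightarrow> s \<le> T \<Longrightarrow> v s \<le> 0 \<Longrightarrow> exit_time v T \<le> s"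
  unfolding exit_time_def by (auto simp: not_less intro!: cInf_lower bdd_belowI[of _ 0] dest!: bspec[of _ _ s])

lemma exit_time_positive:
  assumes "0 \<le> s" "s < exit_time v T" "0 \<le> T" shows "0 < v s"
  using exit_time_le[of s T v] exit_time_bounds[of T v] assms by force

lemma exit_time_nonpos:
  assumes v: "continuous_on {0..} v" and s: "s \<in> {0..T}" "v s \<le> 0"
  shows "v (exit_time v T) \<le> 0"
proof -
  let ?S = "{s\<in>{0..T}. v s \<le> 0}"
  have "closed {s\<in>{0..T}. v s \<le> 0}"
    using continuous_closed_preimage[OF continuous_on_subset[OF v, of "{0..T}"], of "{..0}"]
    by (simp add: vimage_def Int_def)
  then have "Inf ?S \<in> ?S" using s by (intro closed_contains_Inf bdd_belowI[of _ 0]) auto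
  then show ?thesis using s by (force simp: exit_time_def)
qed

text \<open>Closedness of the exit set excludes a positive value; a negative one would, by the
  intermediate value theorem, be preceded by a zero and hence by an earlier exit.\<close>

lemma exit_time_zero:
  assumes v: "continuous_on {0..} v" and s: "s \<in> {0..T}" "v s \<le> 0" and v0: "0 \<le> v 0"
  shows "v (exit_time v T) = 0"
proof -
  let ?e = "exit_time v T"
  have T: "0 \<le> T" using s by auto
  have "0 \<le> v ?e"
  proof (rule ccontr)
    assume neg: "\<not> 0 \<le> v ?e"
    have "continuous_on {0..?e} v" using v by (rule continuous_on_subset) auto
    then obtain r where r: "0 \<le> r" "r \<le> ?e" "v r = 0"
      using IVT2'[of v ?e 0 0] neg v0 exit_time_bounds[OF T, of v] by auto
    then have "r \<noteq> ?e" using neg by auto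
    then show False using exit_time_positive[of r v T] r T by auto
  qed
  with exit_time_nonpos[OF v s] show ?thesis by simp
qed

text \<open>Whether the exit has occurred is read off the path up to \<open>t\<close>, which makes
  exit times stopping times. The statement stays strictly below the cap, because at the cap the left
  side holds for every path.\<close>

lemma exit_time_le_iff:
  assumes v: "continuous_on {0..} v" and t: "0 \<le> t" "t < T"
  shows "exit_time v T \<le> t \<longleftrightarrow> \<not> (\<forall>s\<in>{0..t}. 0 < v s)"
proof
  assume le: "exit_time v T \<le> t"
  show "\<not> (\<forall>s\<in>{0..t}. 0 < v s)"
  proof
    assume pos: "\<forall>s\<in>{0..t}. 0 < v s"
    have "\<not> (\<forall>s\<in>{0..T}. 0 < v s)" using le t unfolding exit_time_def by (intro notI) simp
    then obtain s where "s \<in> {0..T}" "v s \<le> 0" by (auto simp: not_less)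
    from exit_time_nonpos[OF v this] pos le exit_time_bounds[of T v] t show False by force
  qed
next
  assume "\<not> (\<forall>s\<in>{0..t}. 0 < v s)"
  then obtain s where "s \<in> {0..t}" "v s \<le> 0" by (auto simp: not_less)
  then show "exit_time v T \<le> t" using exit_time_le[of s T v] t by auto
qed

text \<open>Hitting times are defined through zeros, while measurability is available for the first
  time at or below zero; for a continuous path that starts nonnegative the two agree.\<close>

lemma Inf_zeros_eq_exit_time:
  assumes v: "continuous_on {0..} v" and s: "s \<in> {0..T}" "v s \<le> 0" and v0: "0 \<le> v 0"
  shows "Inf {t. 0 \<le> t \<and> v t = 0} = exit_time v T"
proof (rule cInf_eq_minimum)
  have T: "0 \<le> T" using s by auto
  show "exit_time v T \<in> {t. 0 \<le> t \<and> v t = 0}"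
    using exit_time_zero[OF v s v0] exit_time_bounds[OF T, of v] by auto
  show "exit_time v T \<le> t" if "t \<in> {t. 0 \<le> t \<and> v t = 0}" for t
    using exit_time_positive[of t v T] T that by (force simp: not_less[symmetric])
qed

lemma exit_time_measurable:
  fixes V :: "real \<Rightarrow> 'b \<Rightarrow> real"
  assumes V: "\<And>s. 0 \<le> s \<Longrightarrow> V s \<in> borel_measurable M"
    and cont: "\<And>\<omega>. \<omega> \<in> space M \<Longrightarrow> continuous_on {0..} (\<lambda>s. V s \<omega>)" and T: "0 \<le> T"
  shows "(\<lambda>\<omega>. exit_time (\<lambda>s. V s \<omega>) T) \<in> borel_measurable M"
proof (rule borel_measurableI_le)
  fix t
  consider "t < 0" | "0 \<le> t" "t < T" | "T \<le> t" by linarith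
  then show "{\<omega> \<in> space M. exit_time (\<lambda>s. V s \<omega>) T \<le> t} \<in> sets M"
  proof cases
    case 1
    then have "\<not> exit_time (\<lambda>s. V s \<omega>) T \<le> t" for \<omega>
      using exit_time_bounds(1)[OF T, of "\<lambda>s. V s \<omega>"] by linarith
    then show ?thesis by simp
  next
    case 2
    then have "{\<omega> \<in> space M. exit_time (\<lambda>s. V s \<omega>) T \<le> t} = space M - {\<omega> \<in> space M. \<forall>s\<in>{0..t}. 0 < V s \<omega>}"
      using exit_time_le_iff[OF cont] by auto
    then show ?thesis using positive_path_measurable[of t V M] V cont 2 by simp
  next
    case 3
    then have "exit_time (\<lambda>s. V s \<omega>) T \<le> t" for \<omega>
      using exit_time_bounds(2)[OF T, of "\<lambda>s. V s \<omega>"] by linarith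
    then show ?thesis by simp
  qed
qed

lemma grid_sample_eq:
  assumes T: "0 < T" "0 < n" and r: "0 \<le> r" "r \<le> T"
  shows "v (grid_up T n r) = (\<Sum>i\<le>n. (if grid_index T n r = i then 1 else 0) * (v (real i * T / real n) :: real))"
  using grid_up_bounds(1)[OF T r] by (simp add: grid_up_def if_distrib[of "\<lambda>c. c * _"] cong: if_cong)

text \<open>At a time rounded to a grid, the sample is a finite sum of values at fixed times
  weighted by measurable indicators; continuity of the paths then lets the mesh tend to
  zero.\<close>

lemma sample_measurable:
  fixes X :: "real \<Rightarrow> 'b \<Rightarrow> real"
  assumes X: "\<And>s. 0 \<le> s \<Longrightarrow> X s \<in> borel_measurable M"
    and cont: "\<And>\<omega>. \<omega> \<in> space M \<Longrightarrow> continuous_on {0..} (\<lambda>s. X s \<omega>)" and T: "0 < T"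
    and \<rho>: "\<rho> \<in> borel_measurable M" "\<And>\<omega>. \<omega> \<in> space M \<Longrightarrow> 0 \<le> \<rho> \<omega> \<and> \<rho> \<omega> \<le> T"
  shows "(\<lambda>\<omega>. X (\<rho> \<omega>) \<omega>) \<in> borel_measurable M"
proof (rule borel_measurable_LIMSEQ_real)
  show "(\<lambda>n. X (grid_up T (Suc n) (\<rho> \<omega>)) \<omega>) \<longlonglongrightarrow> X (\<rho> \<omega>) \<omega>" if "\<omega> \<in> space M" for \<omega>
    using grid_up_path_tendsto[OF T _ _ cont[OF that], of "\<rho> \<omega>"] \<rho>(2)[OF that] by auto
  fix n
  note [measurable] = \<rho>(1)
  have [measurable]: "(\<lambda>\<omega>. X (real i * T / real (Suc n)) \<omega>) \<in> borel_measurable M" for i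
    using T by (intro X) auto
  have "(\<lambda>\<omega>. \<Sum>i\<le>Suc n. (if grid_index T (Suc n) (\<rho> \<omega>) = i then 1 else 0) * (X (real i * T / real (Suc n)) \<omega>)) \<in> borel_measurable M"
    unfolding grid_index_def by measurable
  then show "(\<lambda>\<omega>. X (grid_up T (Suc n) (\<rho> \<omega>)) \<omega>) \<in> borel_measurable M"
    by (rule measurable_cong[THEN iffD1, rotated]) (rule grid_sample_eq[symmetric], use \<rho>(2) T in auto)
qed

section \<open>Square-integrable martingales and stopping\<close>

context filtered_bm begin

text \<open>Conditional Jensen inequality without conditional expectations: the nonnegative integral
  of \<open>(Y - X)^2\<close> over \<open>A\<close> is expanded, and the martingale identity is
  tested with \<open>X\<close> cut off outside \<open>A\<close>.\<close>

lemma martingale_sq_mono: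
  assumes sq: "sq_integrable N X" "sq_integrable N Y" and X: "X \<in> borel_measurable (F s)"
    and mart: "\<And>Z. Z \<in> borel_measurable (F s) \<Longrightarrow> sq_integrable N Z \<Longrightarrow> (\<integral>\<omega>. Y \<omega> * Z \<omega> \<partial>N) = (\<integral>\<omega>. X \<omega> * Z \<omega> \<partial>N)"
    and A: "A \<in> sets (F s)"
  shows "(\<integral>\<omega>. indicator A \<omega> * (X \<omega>)\<^sup>2 \<partial>N) \<le> (\<integral>\<omega>. indicator A \<omega> * (Y \<omega>)\<^sup>2 \<partial>N)"
proof -
  have A': "A \<in> sets N" using A sets_F by auto
  have ZF: "(\<lambda>\<omega>. indicator A \<omega> * X \<omega>) \<in> borel_measurable (F s)" using A X by simp
  note Z = sq_integrable_if[OF sq(1) A'] and ZY = sq_integrable_if[OF sq(2) A']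
  have i: "integrable N (\<lambda>\<omega>. indicator A \<omega> * (X \<omega>)\<^sup>2)" "integrable N (\<lambda>\<omega>. indicator A \<omega> * (Y \<omega>)\<^sup>2)"
    "integrable N (\<lambda>\<omega>. Y \<omega> * (indicator A \<omega> * X \<omega>))"
    using sq_integrable_mult[OF Z sq(1)] sq_integrable_mult[OF ZY sq(2)] sq_integrable_mult[OF sq(2) Z]
    by (simp_all add: power2_eq_square mult.assoc)
  have "0 \<le> (\<integral>\<omega>. indicator A \<omega> * (Y \<omega> - X \<omega>)\<^sup>2 \<partial>N)" by (rule Bochner_Integration.integral_nonneg) simp
  also have "\<dots> = (\<integral>\<omega>. indicator A \<omega> * (Y \<omega>)\<^sup>2 - 2 * (Y \<omega> * (indicator A \<omega> * X \<omega>)) + indicator A \<omega> * (X \<omega>)\<^sup>2 \<partial>N)"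
    by (intro Bochner_Integration.integral_cong) (auto simp: power2_eq_square algebra_simps)
  also have "\<dots> = (\<integral>\<omega>. indicator A \<omega> * (Y \<omega>)\<^sup>2 \<partial>N) - 2 * (\<integral>\<omega>. Y \<omega> * (indicator A \<omega> * X \<omega>) \<partial>N) + (\<integral>\<omega>. indicator A \<omega> * (X \<omega>)\<^sup>2 \<partial>N)"
    using i by simp
  also have "(\<integral>\<omega>. Y \<omega> * (indicator A \<omega> * X \<omega>) \<partial>N) = (\<integral>\<omega>. indicator A \<omega> * (X \<omega>)\<^sup>2 \<partial>N)"
    unfolding mart[OF ZF Z] by (simp add: power2_eq_square mult_ac)
  finally show ?thesis by simp
qed

text \<open>The martingale property is tested against square-integrable variables of the past,
  because this form passes directly to \<open>L2\<close> limits. The constant \<open>C\<close>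
  bounds the second moments uniformly in time, which the mean of the hitting time requires at
  infinity.\<close>

definition l2_martingale :: "(real \<Rightarrow> 'a \<Rightarrow> real) \<Rightarrow> real \<Rightarrow> bool" where
  "l2_martingale I C \<longleftrightarrow>
     (\<forall>t\<ge>0. I t \<in> borel_measurable (F t)) \<and>
     (\<forall>\<omega>\<in>space N. continuous_on {0..} (\<lambda>t. I t \<omega>)) \<and>
     (\<forall>t\<ge>0. sq_integrable N (I t) \<and> (\<integral>\<omega>. (I t \<omega>)\<^sup>2 \<partial>N) \<le> C) \<and>
     (\<forall>s t Z. 0 \<le> s \<longrightarrow> s \<le> t \<longrightarrow> Z \<in> borel_measurable (F s) \<longrightarrow> sq_integrable N Z \<longrightarrow>
        (\<integral>\<omega>. I t \<omega> * Z \<omega> \<partial>N) = (\<integral>\<omega>. I s \<omega> * Z \<omega> \<partial>N))"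

lemma l2_martingaleD:
  assumes "l2_martingale I C"
  shows "0 \<le> t \<Longrightarrow> I t \<in> borel_measurable (F t)"
    and "\<omega> \<in> space N \<Longrightarrow> continuous_on {0..} (\<lambda>t. I t \<omega>)"
    and "0 \<le> t \<Longrightarrow> sq_integrable N (I t)"
    and "0 \<le> t \<Longrightarrow> (\<integral>\<omega>. (I t \<omega>)\<^sup>2 \<partial>N) \<le> C"
    and "0 \<le> s \<Longrightarrow> s \<le> t \<Longrightarrow> Z \<in> borel_measurable (F s) \<Longrightarrow> sq_integrable N Z \<Longrightarrow>
        (\<integral>\<omega>. I t \<omega> * Z \<omega> \<partial>N) = (\<integral>\<omega>. I s \<omega> * Z \<omega> \<partial>N)"
  using assms unfolding l2_martingale_def by blast+

lemma l2_martingale_sq_mono: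
  assumes I: "l2_martingale I C" and st: "0 \<le> s" "s \<le> t" and A: "A \<in> sets (F s)"
  shows "(\<integral>\<omega>. indicator A \<omega> * (I s \<omega>)\<^sup>2 \<partial>N) \<le> (\<integral>\<omega>. indicator A \<omega> * (I t \<omega>)\<^sup>2 \<partial>N)"
  using st by (intro martingale_sq_mono[where s = s] l2_martingaleD[OF I] A) auto

lemma l2_martingale_diff:
  assumes I: "l2_martingale I C" and J: "l2_martingale J D"
  shows "l2_martingale (\<lambda>t \<omega>. I t \<omega> - J t \<omega>) (2 * C + 2 * D)"
  unfolding l2_martingale_def
proof (intro conjI allI ballI impI)
  note i = l2_martingaleD[OF I] and j = l2_martingaleD[OF J]
  show "(\<lambda>\<omega>. I t \<omega> - J t \<omega>) \<in> borel_measurable (F t)" if "0 \<le> t" for t using i(1)[OF that] j(1)[OF that] by simp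
  show "continuous_on {0..} (\<lambda>t. I t \<omega> - J t \<omega>)" if "\<omega> \<in> space N" for \<omega>
    by (intro continuous_intros i(2) j(2) that)
  show "sq_integrable N (\<lambda>\<omega>. I t \<omega> - J t \<omega>)" if "0 \<le> t" for t using i(3)[OF that] j(3)[OF that] by (rule sq_integrable_diff)
  show "(\<integral>\<omega>. (I t \<omega> - J t \<omega>)\<^sup>2 \<partial>N) \<le> 2 * C + 2 * D" if t: "0 \<le> t" for t
  proof -
    note [simp] = sq_integrableD(2)[OF i(3)[OF t]] sq_integrableD(2)[OF j(3)[OF t]]
      sq_integrableD(2)[OF sq_integrable_diff[OF i(3)[OF t] j(3)[OF t]]]
    have "(a - b)\<^sup>2 \<le> 2 * a\<^sup>2 + 2 * b\<^sup>2" for a b :: real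
      using zero_le_power2[of "a + b"] by (simp add: power2_eq_square algebra_simps)
    then have "(\<integral>\<omega>. (I t \<omega> - J t \<omega>)\<^sup>2 \<partial>N) \<le> (\<integral>\<omega>. 2 * (I t \<omega>)\<^sup>2 + 2 * (J t \<omega>)\<^sup>2 \<partial>N)"
      by (intro integral_mono) auto
    also have "\<dots> \<le> 2 * C + 2 * D" using i(4)[OF t] j(4)[OF t] by simp
    finally show ?thesis .
  qed
  show "(\<integral>\<omega>. (I t \<omega> - J t \<omega>) * Z \<omega> \<partial>N) = (\<integral>\<omega>. (I s \<omega> - J s \<omega>) * Z \<omega> \<partial>N)"
    if st: "0 \<le> s" "s \<le> t" and Z: "Z \<in> borel_measurable (F s)" "sq_integrable N Z" for s t Z
  proof -
    have [simp]: "integrable N (\<lambda>\<omega>. I u \<omega> * Z \<omega>)" "integrable N (\<lambda>\<omega>. J u \<omega> * Z \<omega>)" if "0 \<le> u" for u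
      by (intro sq_integrable_mult i(3) j(3) Z that)+
    show ?thesis using i(5)[OF st Z] j(5)[OF st Z] st by (simp add: left_diff_distrib)
  qed
qed

lemma elem_l2_martingale:
  assumes d: "elem_data P a b \<xi>"
  shows "\<exists>C. l2_martingale (elem_integral P a b \<xi>) C"
proof -
  \<comment> \<open>The sum of the right ends bounds each of them, also when \<open>P\<close> is
    empty; after this time the integral is constant.\<close>
  define T where "T = (\<Sum>p\<in>P. b p)"
  have fin: "finite P" and ab: "\<And>p. p \<in> P \<Longrightarrow> 0 \<le> a p \<and> a p \<le> b p" using d by (auto simp: elem_data_def)
  have bT: "b p \<le> T" if "p \<in> P" for p
    unfolding T_def using ab fin that by (intro member_le_sum) force+
  have T: "0 \<le> T" unfolding T_def using ab by (intro sum_nonneg) force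
  note sq = elem_integral_sq_integrable[OF d]
  have le: "(\<integral>\<omega>. (elem_integral P a b \<xi> t \<omega>)\<^sup>2 \<partial>N) \<le> (\<integral>\<omega>. (elem_integral P a b \<xi> T \<omega>)\<^sup>2 \<partial>N)" if t: "0 \<le> t" for t
  proof (cases "t \<le> T")
    case True
    have "(\<integral>\<omega>. indicator (space N) \<omega> * (elem_integral P a b \<xi> t \<omega>)\<^sup>2 \<partial>N) \<le> (\<integral>\<omega>. indicator (space N) \<omega> * (elem_integral P a b \<xi> T \<omega>)\<^sup>2 \<partial>N)"
      using elem_integral_martingale[OF d t True] sets.top[of "F t"]
      by (intro martingale_sq_mono[where s = t] sq t T elem_integral_adapted[OF d t]) (auto simp: space_F)
    then show ?thesis by (simp cong: Bochner_Integration.integral_cong)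
  next
    case False
    then have "min (b p) t = b p" "min (b p) T = b p" "min (a p) t = a p" "min (a p) T = a p" if "p \<in> P" for p
      using bT[OF that] ab[OF that] by auto
    then have "elem_integral P a b \<xi> t = elem_integral P a b \<xi> T"
      unfolding elem_integral_def by (intro ext sum.cong) auto
    then show ?thesis by simp
  qed
  then show ?thesis unfolding l2_martingale_def
    by (intro exI[of _ "\<integral>\<omega>. (elem_integral P a b \<xi> T \<omega>)\<^sup>2 \<partial>N"] conjI allI ballI impI elem_integral_adapted[OF d]
        elem_integral_continuous[OF d] sq elem_integral_martingale[OF d] le)
qed

text \<open>Doob's inequality in its weak \<open>L2\<close> form. On a finite grid the event is
  split according to the first grid point of exceedance; each piece is known at that time, and the
  second moment over it only grows up to \<open>T\<close>. Refining the grid reaches all times,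
  because paths are continuous and the inequality \<open>e < \<bar>I t \<omega>\<bar>\<close> is
  strict.\<close>

lemma maximal_inequality:
  assumes I: "l2_martingale I C" and T: "0 < T" and e: "0 < e"
  shows "{\<omega> \<in> space N. \<exists>t\<in>{0..T}. e < \<bar>I t \<omega>\<bar>} \<in> sets N"
    "prob {\<omega> \<in> space N. \<exists>t\<in>{0..T}. e < \<bar>I t \<omega>\<bar>} \<le> (\<integral>\<omega>. (I T \<omega>)\<^sup>2 \<partial>N) / e\<^sup>2"
proof -
  note i = l2_martingaleD[OF I]
  define g where "g n j = real j * T / real (2 ^ n)" for n j
  define B where "B n j = {\<omega> \<in> space N. e < \<bar>I (g n j) \<omega>\<bar>}" for n j
  define E where "E n = (\<Union>j\<in>{0..<Suc (2 ^ n)}. B n j)" for n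
  have g: "0 \<le> g n j" "j \<le> 2 ^ n \<Longrightarrow> g n j \<le> T" "k \<le> j \<Longrightarrow> g n k \<le> g n j" for n j k
  proof -
    show "j \<le> 2 ^ n \<Longrightarrow> g n j \<le> T" 
    proof -
      assume "j \<le> 2 ^ n"
      then have "real j \<le> real (2 ^ n)" by (rule of_nat_mono)
      then have "real j * T \<le> real (2 ^ n) * T" using T by (intro mult_right_mono) auto
      then show "g n j \<le> T" unfolding g_def by (simp add: pos_divide_le_eq mult.commute)
    qed
  qed (use T in \<open>auto simp: g_def divide_right_mono\<close>)
  have BF: "B n k \<in> sets (F (g n j))" if "k \<le> j" for n j k
  proof -
    have [measurable]: "I (g n k) \<in> borel_measurable (F (g n j))"
      by (rule F_measurable_mono[OF g(3)[OF that] i(1)[OF g(1)]])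
    have "{\<omega> \<in> space (F (g n j)). e < \<bar>I (g n k) \<omega>\<bar>} \<in> sets (F (g n j))" by measurable
    then show ?thesis by (simp add: B_def space_F)
  qed
  have EN: "E n \<in> sets N" for n unfolding E_def using BF sets_F by blast
  have Ele: "prob (E n) \<le> (\<integral>\<omega>. (I T \<omega>)\<^sup>2 \<partial>N) / e\<^sup>2" for n
  proof -
    \<comment> \<open>\<open>disjointed\<close> isolates the first grid point at which the level is
      exceeded.\<close>
    let ?A = "disjointed (B n)"
    have AF: "?A j \<in> sets (F (g n j))" for j
      unfolding disjointed_def using BF by (intro sets.Diff sets.finite_UN) auto
    then have AN: "?A j \<in> sets N" for j using sets_F by blast
    have IT: "integrable N (\<lambda>\<omega>. indicator A \<omega> * (I T \<omega>)\<^sup>2)" if "A \<in> sets N" for A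
      using sq_integrable_mult[OF sq_integrable_if[OF i(3) that] i(3)] T by (simp add: power2_eq_square mult.assoc)
    have le: "e\<^sup>2 * prob (?A j) \<le> (\<integral>\<omega>. indicator (?A j) \<omega> * (I T \<omega>)\<^sup>2 \<partial>N)" if "j \<le> 2 ^ n" for j
    proof -
      have "e\<^sup>2 * prob (?A j) = (\<integral>\<omega>. indicator (?A j) \<omega> * e\<^sup>2 \<partial>N)" using AN[of j] by (simp add: mult.commute Int_absorb2 sets.sets_into_space)
      also have "\<dots> \<le> (\<integral>\<omega>. indicator (?A j) \<omega> * (I (g n j) \<omega>)\<^sup>2 \<partial>N)"
      proof (rule integral_mono)
        show "integrable N (\<lambda>\<omega>. indicator (?A j) \<omega> * e\<^sup>2)" using AN[of j] by (simp add: emeasure_eq_measure)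
        show "integrable N (\<lambda>\<omega>. indicator (?A j) \<omega> * (I (g n j) \<omega>)\<^sup>2)"
          using sq_integrable_mult[OF sq_integrable_if[OF i(3) AN[of j]] i(3)] g(1) by (simp add: power2_eq_square mult.assoc)
        fix \<omega>
        show "indicator (?A j) \<omega> * e\<^sup>2 \<le> indicator (?A j) \<omega> * (I (g n j) \<omega>)\<^sup>2"
        proof (cases "\<omega> \<in> ?A j")
          case True
          then have "e \<le> \<bar>I (g n j) \<omega>\<bar>" using disjointed_subset[of "B n" j] by (auto simp: B_def)
          then have "e\<^sup>2 \<le> \<bar>I (g n j) \<omega>\<bar>\<^sup>2" using e by (intro power_mono) auto
          then show ?thesis using True by simp
        qed simp
      qed
      also have "\<dots> \<le> (\<integral>\<omega>. indicator (?A j) \<omega> * (I T \<omega>)\<^sup>2 \<partial>N)"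
        by (rule l2_martingale_sq_mono[OF I g(1) g(2)[OF that] AF])
      finally show ?thesis .
    qed
    have E_eq: "E n = (\<Union>j\<in>{0..<Suc (2 ^ n)}. ?A j)"
      by (simp only: E_def finite_UN_disjointed_eq)
    have "e\<^sup>2 * prob (E n) = e\<^sup>2 * (\<Sum>j\<in>{0..<Suc (2 ^ n)}. prob (?A j))"
      unfolding E_eq
      using AN disjoint_family_disjointed[of "B n"] by (subst finite_measure_finite_Union) (auto simp: disjoint_family_on_def)
    also have "\<dots> \<le> (\<Sum>j\<in>{0..<Suc (2 ^ n)}. (\<integral>\<omega>. indicator (?A j) \<omega> * (I T \<omega>)\<^sup>2 \<partial>N))"
      unfolding sum_distrib_left by (intro sum_mono le) auto
    also have "\<dots> = (\<integral>\<omega>. (\<Sum>j\<in>{0..<Suc (2 ^ n)}. indicator (?A j) \<omega> * (I T \<omega>)\<^sup>2) \<partial>N)"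
      using IT AN by (subst Bochner_Integration.integral_sum) auto
    also have "\<dots> = (\<integral>\<omega>. indicator (E n) \<omega> * (I T \<omega>)\<^sup>2 \<partial>N)"
      unfolding E_eq sum_distrib_right[symmetric]
      using disjoint_family_disjointed[of "B n"] by (subst indicator_UN_disjoint) (auto simp: disjoint_family_on_def)
    also have "\<dots> \<le> (\<integral>\<omega>. (I T \<omega>)\<^sup>2 \<partial>N)"
      using IT[OF EN] i(3)[of T] T by (intro integral_mono sq_integrableD) (auto simp: indicator_def)
    finally show ?thesis using e by (simp add: field_simps)
  qed
  \<comment> \<open>Dyadic grids are nested, so the exceedance events increase with
    \<open>n\<close>.\<close>
  have inc: "incseq E"
  proof (rule incseq_SucI)
    show "E n \<subseteq> E (Suc n)" for n
    proof
      fix \<omega> assume "\<omega> \<in> E n"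
      then obtain j where "j \<le> 2 ^ n" "\<omega> \<in> B n j" by (auto simp: E_def less_Suc_eq_le)
      moreover have "B n j = B (Suc n) (2 * j)" by (simp add: B_def g_def)
      ultimately show "\<omega> \<in> E (Suc n)" by (auto simp: E_def less_Suc_eq_le intro!: bexI[of _ "2 * j"])
    qed
  qed
  have E: "(\<Union>n. E n) = {\<omega> \<in> space N. \<exists>t\<in>{0..T}. e < \<bar>I t \<omega>\<bar>}"
  proof (intro equalityI subsetI)
    fix \<omega> assume "\<omega> \<in> (\<Union>n. E n)"
    then show "\<omega> \<in> {\<omega> \<in> space N. \<exists>t\<in>{0..T}. e < \<bar>I t \<omega>\<bar>}"
      using g by (fastforce simp: E_def B_def less_Suc_eq_le)
  next
    fix \<omega> assume "\<omega> \<in> {\<omega> \<in> space N. \<exists>t\<in>{0..T}. e < \<bar>I t \<omega>\<bar>}"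
    then obtain t where \<omega>: "\<omega> \<in> space N" and t: "0 \<le> t" "t \<le> T" and et: "e < \<bar>I t \<omega>\<bar>" by auto
    have "(\<lambda>n. \<bar>I (grid_up T (Suc n) t) \<omega>\<bar>) \<longlonglongrightarrow> \<bar>I t \<omega>\<bar>"
      by (intro tendsto_rabs grid_up_path_tendsto T t i(2) \<omega>)
    then have "\<forall>\<^sub>F n in sequentially. e < \<bar>I (grid_up T (Suc n) t) \<omega>\<bar>"
      using et by (rule order_tendstoD)
    then obtain m where m: "\<And>n. m \<le> n \<Longrightarrow> e < \<bar>I (grid_up T (Suc n) t) \<omega>\<bar>" by (auto simp: eventually_sequentially)
    \<comment> \<open>The convergent sequence runs over all mesh sizes; the mesh
      \<open>2 ^ m\<close> occurs in it with index \<open>2 ^ m - 1\<close>, which is at least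
      \<open>m\<close>.\<close>
    obtain n where n: "2 ^ m = Suc n" by (cases "(2::nat) ^ m") auto
    have "m < Suc n" unfolding n[symmetric] by (rule less_exp)
    with m[of n] have *: "e < \<bar>I (grid_up T (2 ^ m) t) \<omega>\<bar>" by (simp only: n less_Suc_eq_le)
    have "grid_index T (2 ^ m) t \<le> 2 ^ m" using grid_up_bounds(1)[OF T, of "2 ^ m"] t by simp
    then have "grid_index T (2 ^ m) t \<in> {0..<Suc (2 ^ m)}" "\<omega> \<in> B m (grid_index T (2 ^ m) t)"
      using * \<omega> by (auto simp: B_def g_def grid_up_def)
    then show "\<omega> \<in> (\<Union>n. E n)" unfolding E_def by blast
  qed
  show "{\<omega> \<in> space N. \<exists>t\<in>{0..T}. e < \<bar>I t \<omega>\<bar>} \<in> sets N" unfolding E[symmetric] using EN by blast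
  have "(\<lambda>n. prob (E n)) \<longlonglongrightarrow> prob (\<Union>n. E n)"
    using EN inc by (intro finite_Lim_measure_incseq) auto
  then show "prob {\<omega> \<in> space N. \<exists>t\<in>{0..T}. e < \<bar>I t \<omega>\<bar>} \<le> (\<integral>\<omega>. (I T \<omega>)\<^sup>2 \<partial>N) / e\<^sup>2"
    unfolding E[symmetric] using Ele by (intro LIMSEQ_le_const2) auto
qed

section \<open>Bounded stopping times and optional stopping\<close>

definition bounded_stopping :: "real \<Rightarrow> ('a \<Rightarrow> real) \<Rightarrow> bool" where
  "bounded_stopping T \<rho> \<longleftrightarrow> 0 < T \<and> stopping_time F \<rho> \<and> (\<forall>\<omega>\<in>space N. 0 \<le> \<rho> \<omega> \<and> \<rho> \<omega> \<le> T)"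

lemma bounded_stoppingD:
  assumes "bounded_stopping T \<rho>"
  shows "0 < T" "\<omega> \<in> space N \<Longrightarrow> 0 \<le> \<rho> \<omega>" "\<omega> \<in> space N \<Longrightarrow> \<rho> \<omega> \<le> T"
    "{\<omega> \<in> space N. \<rho> \<omega> \<le> t} \<in> sets (F t)" "{\<omega> \<in> space N. t < \<rho> \<omega>} \<in> sets (F t)"
    "\<rho> \<in> borel_measurable N"
proof -
  have s: "stopping_time F \<rho>" using assms by (simp add: bounded_stopping_def)
  show "{\<omega> \<in> space N. \<rho> \<omega> \<le> t} \<in> sets (F t)" "{\<omega> \<in> space N. t < \<rho> \<omega>} \<in> sets (F t)"
    using stopping_timeD[OF s, of t] stopping_timeD2[OF s, of t] by (auto simp: Measurable.pred_def space_F)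
  show "\<rho> \<in> borel_measurable N" using measurable_stopping_time[OF s] space_F sets_F by blast
qed (use assms in \<open>auto simp: bounded_stopping_def\<close>)

lemma exit_time_stopping:
  assumes V: "\<And>s. 0 \<le> s \<Longrightarrow> V s \<in> borel_measurable (F s)"
    and cont: "\<And>\<omega>. \<omega> \<in> space N \<Longrightarrow> continuous_on {0..} (\<lambda>s. V s \<omega>)" and T: "0 < T"
  shows "bounded_stopping T (\<lambda>\<omega>. exit_time (\<lambda>s. V s \<omega>) T)"
  unfolding bounded_stopping_def
proof (intro conjI ballI stopping_timeI)
  fix t
  have "{\<omega> \<in> space (F t). exit_time (\<lambda>s. V s \<omega>) T \<le> t} \<in> sets (F t)"
  proof -
    consider "t < 0" | "0 \<le> t" "t < T" | "T \<le> t" by linarith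
    then show ?thesis
    proof cases
      case 1
      then have "\<not> exit_time (\<lambda>s. V s \<omega>) T \<le> t" for \<omega>
        using exit_time_bounds(1)[of T "\<lambda>s. V s \<omega>"] T by linarith
      then show ?thesis by simp
    next
      case 2
      then have "{\<omega> \<in> space (F t). exit_time (\<lambda>s. V s \<omega>) T \<le> t} = space (F t) - {\<omega> \<in> space (F t). \<forall>s\<in>{0..t}. 0 < V s \<omega>}"
        using exit_time_le_iff[OF cont] by (auto simp: space_F)
      moreover have "{\<omega> \<in> space (F t). \<forall>s\<in>{0..t}. 0 < V s \<omega>} \<in> sets (F t)"
        using F_measurable_mono[OF _ V] cont 2 by (intro positive_path_measurable) (auto simp: space_F)
      ultimately show ?thesis by simp
    next
      case 3
      then have "exit_time (\<lambda>s. V s \<omega>) T \<le> t" for \<omega>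
        using exit_time_bounds(2)[of T "\<lambda>s. V s \<omega>"] T by linarith
      then show ?thesis by simp
    qed
  qed
  then show "Measurable.pred (F t) (\<lambda>\<omega>. exit_time (\<lambda>s. V s \<omega>) T \<le> t)" by (simp add: Measurable.pred_def)
qed (use T exit_time_bounds[of T] in auto)

lemma sample_measurable_N:
  fixes X :: "real \<Rightarrow> 'a \<Rightarrow> real"
  assumes X: "\<And>s. 0 \<le> s \<Longrightarrow> X s \<in> borel_measurable (F s)"
    and cont: "\<And>\<omega>. \<omega> \<in> space N \<Longrightarrow> continuous_on {0..} (\<lambda>s. X s \<omega>)"
    and \<rho>: "bounded_stopping T \<rho>"
  shows "(\<lambda>\<omega>. X (\<rho> \<omega>) \<omega>) \<in> borel_measurable N"
  by (rule sample_measurable[where T = T and X = X and \<rho> = \<rho>, OF F_measurable_N[OF X] cont])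
     (use bounded_stoppingD[OF \<rho>] in auto)

text \<open>For the time rounded up to a grid, the event of stopping at a grid point is known there,
  so under the expectation the value at that point may be replaced by the value at \<open>T\<close>.
  The second moments of the rounded samples stay below \<open>C\<close>, and this uniform bound lets
  the expectations follow the almost sure limit.\<close>

lemma optional_stopping:
  assumes I: "l2_martingale I C" and \<rho>: "bounded_stopping T \<rho>"
  shows "sq_integrable N (\<lambda>\<omega>. I (\<rho> \<omega>) \<omega>)" "(\<integral>\<omega>. I (\<rho> \<omega>) \<omega> \<partial>N) = (\<integral>\<omega>. I 0 \<omega> \<partial>N)"
proof -
  note i = l2_martingaleD[OF I] and r = bounded_stoppingD[OF \<rho>]
  have T: "0 < T" by (rule r)
  define R where "R n \<omega> = I (grid_up T (Suc n) (\<rho> \<omega>)) \<omega>" for n \<omega>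
  have step: "sq_integrable N (R n) \<and> (\<integral>\<omega>. (R n \<omega>)\<^sup>2 \<partial>N) \<le> C \<and> (\<integral>\<omega>. R n \<omega> \<partial>N) = (\<integral>\<omega>. I 0 \<omega> \<partial>N)" for n
  proof -
    define g where "g j = real j * T / real (Suc n)" for j
    define E where "E j = {\<omega> \<in> space N. grid_index T (Suc n) (\<rho> \<omega>) = j}" for j
    have g: "0 \<le> g j" "k \<le> j \<Longrightarrow> g k \<le> g j" "j \<le> Suc n \<Longrightarrow> g j \<le> T" for j k
    proof -
      show "j \<le> Suc n \<Longrightarrow> g j \<le> T"
      proof -
        assume "j \<le> Suc n"
        then have "real j * T \<le> real (Suc n) * T" using T by (intro mult_right_mono) auto
        then show "g j \<le> T" unfolding g_def by (simp add: pos_divide_le_eq mult.commute)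
      qed
      show "k \<le> j \<Longrightarrow> g k \<le> g j" unfolding g_def using T by (intro divide_right_mono mult_right_mono) auto
    qed (use T in \<open>auto simp: g_def\<close>)
    have idx: "k < grid_index T (Suc n) (\<rho> \<omega>) \<longleftrightarrow> g k < \<rho> \<omega>" for k \<omega>
      unfolding g_def by (rule grid_index_less[OF T]) simp
    have EF: "E j \<in> sets (F (g j))" for j
    proof -
      \<comment> \<open>Only comparisons with grid points up to \<open>g j\<close> occur, so the
        event is decided at time \<open>g j\<close>.\<close>
      have "(grid_index T (Suc n) (\<rho> \<omega>) = j) \<longleftrightarrow> \<rho> \<omega> \<le> g j \<and> (\<forall>k<j. g k < \<rho> \<omega>)" for \<omega>
        unfolding idx[symmetric] using idx[of j \<omega>] by (auto simp: not_less[symmetric] intro: linorder_neqE_nat)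
      then have "E j = {\<omega> \<in> space N. \<rho> \<omega> \<le> g j} - (\<Union>k\<in>{..<j}. {\<omega> \<in> space N. \<rho> \<omega> \<le> g k})"
        by (auto simp: E_def not_le)
      also have "\<dots> \<in> sets (F (g j))"
        using r(4) F_mono[OF g(2)] by (intro sets.Diff sets.finite_UN) (blast intro: less_imp_le | simp)+
      finally show ?thesis .
    qed
    then have EN: "E j \<in> sets N" for j using sets_F by blast
    have sample: "v (grid_up T (Suc n) (\<rho> \<omega>)) = (\<Sum>j\<le>Suc n. indicator (E j) \<omega> * v (g j))"
      if "\<omega> \<in> space N" for v :: "real \<Rightarrow> real" and \<omega>
      unfolding g_def grid_sample_eq[OF T zero_less_Suc r(2)[OF that] r(3)[OF that], of v n]
      by (intro sum.cong refl) (simp add: E_def that indicator_def)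
    have Rn: "R n \<omega> = (\<Sum>j\<le>Suc n. indicator (E j) \<omega> * I (g j) \<omega>)" if "\<omega> \<in> space N" for \<omega>
      unfolding R_def by (rule sample[OF that])
    have Rn2: "(R n \<omega>)\<^sup>2 = (\<Sum>j\<le>Suc n. indicator (E j) \<omega> * (I (g j) \<omega>)\<^sup>2)" if "\<omega> \<in> space N" for \<omega>
      unfolding R_def by (rule sample[OF that])
    have one: "(\<Sum>j\<le>Suc n. indicator (E j) \<omega>) = (1::real)" if "\<omega> \<in> space N" for \<omega>
      using sample[OF that, of "\<lambda>_. 1"] by simp
    have sqE: "sq_integrable N (\<lambda>\<omega>. indicator (E j) \<omega> * I s \<omega>)" if "0 \<le> s" for j s
      by (intro sq_integrable_if i(3) that EN)
    have sqR: "sq_integrable N (R n)"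
    proof -
      have "sq_integrable N (\<lambda>\<omega>. \<Sum>j\<le>Suc n. indicator (E j) \<omega> * I (g j) \<omega>)"
        by (intro sq_integrable_sum sqE g)
      then show ?thesis unfolding sq_integrable_def
        by (simp only: Rn cong: measurable_cong Bochner_Integration.integrable_cong)
    qed
    have iE: "integrable N (\<lambda>\<omega>. indicator (E j) \<omega> * (I s \<omega>)\<^sup>2)" if "0 \<le> s" for j s
      using sq_integrable_mult[OF sqE[OF that] i(3)[OF that]] by (simp add: power2_eq_square mult.assoc)
    have "(\<integral>\<omega>. (R n \<omega>)\<^sup>2 \<partial>N) = (\<Sum>j\<le>Suc n. \<integral>\<omega>. indicator (E j) \<omega> * (I (g j) \<omega>)\<^sup>2 \<partial>N)"
      by (subst Bochner_Integration.integral_cong[OF refl Rn2]) (assumption, rule Bochner_Integration.integral_sum, rule iE[OF g(1)])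
    also have "\<dots> \<le> (\<Sum>j\<le>Suc n. \<integral>\<omega>. indicator (E j) \<omega> * (I T \<omega>)\<^sup>2 \<partial>N)"
      by (intro sum_mono l2_martingale_sq_mono[OF I] EF g) auto
    also have "\<dots> = (\<integral>\<omega>. (\<Sum>j\<le>Suc n. indicator (E j) \<omega> * (I T \<omega>)\<^sup>2) \<partial>N)"
      using iE T by (intro Bochner_Integration.integral_sum[symmetric]) auto
    also have "\<dots> = (\<integral>\<omega>. (I T \<omega>)\<^sup>2 \<partial>N)"
      unfolding sum_distrib_right[symmetric] using one by (intro Bochner_Integration.integral_cong) auto
    finally have le: "(\<integral>\<omega>. (R n \<omega>)\<^sup>2 \<partial>N) \<le> C" using i(4)[of T] T by simp
    have iE1: "integrable N (\<lambda>\<omega>. indicator (E j) \<omega> * I s \<omega>)" if "0 \<le> s" for j s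
      by (rule sq_integrable_integrable[OF sqE[OF that]])
    have "(\<integral>\<omega>. R n \<omega> \<partial>N) = (\<Sum>j\<le>Suc n. \<integral>\<omega>. indicator (E j) \<omega> * I (g j) \<omega> \<partial>N)"
      by (subst Bochner_Integration.integral_cong[OF refl Rn]) (assumption, rule Bochner_Integration.integral_sum, rule iE1[OF g(1)])
    also have "\<dots> = (\<Sum>j\<le>Suc n. \<integral>\<omega>. indicator (E j) \<omega> * I T \<omega> \<partial>N)"
    proof (rule sum.cong)
      fix j assume "j \<in> {..Suc n}"
      then show "(\<integral>\<omega>. indicator (E j) \<omega> * I (g j) \<omega> \<partial>N) = (\<integral>\<omega>. indicator (E j) \<omega> * I T \<omega> \<partial>N)"
        using i(5)[OF g(1) g(3), of j "indicator (E j)"] EF[of j] weight_sq_integrable[OF weight_indicator[OF EF]]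
        by (simp add: mult.commute)
    qed simp
    also have "\<dots> = (\<integral>\<omega>. (\<Sum>j\<le>Suc n. indicator (E j) \<omega> * I T \<omega>) \<partial>N)"
      using iE1 T by (intro Bochner_Integration.integral_sum[symmetric]) auto
    also have "\<dots> = (\<integral>\<omega>. I T \<omega> * 1 \<partial>N)"
      unfolding sum_distrib_right[symmetric] using one by (intro Bochner_Integration.integral_cong) auto
    also have "\<dots> = (\<integral>\<omega>. I 0 \<omega> * 1 \<partial>N)"
      using T by (intro i(5)) (auto simp: sq_integrable_def)
    finally show ?thesis using sqR le by simp
  qed
  have meas: "(\<lambda>\<omega>. I (\<rho> \<omega>) \<omega>) \<in> borel_measurable N"
    by (rule sample_measurable_N[OF i(1,2) \<rho>])
  have lim: "AE \<omega> in N. (\<lambda>n. R n \<omega>) \<longlonglongrightarrow> I (\<rho> \<omega>) \<omega>"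
    unfolding R_def using r i(2) by (intro AE_I2 grid_up_path_tendsto) auto
  show "sq_integrable N (\<lambda>\<omega>. I (\<rho> \<omega>) \<omega>)"
    by (rule L2_bounded_tendsto_L1(1)[OF _ meas _ lim]) (use step in auto)
  have "(\<lambda>n. \<integral>\<omega>. R n \<omega> \<partial>N) \<longlonglongrightarrow> (\<integral>\<omega>. I (\<rho> \<omega>) \<omega> \<partial>N)"
    by (rule L2_bounded_tendsto_expectation[OF _ meas _ lim]) (use step in auto)
  then show "(\<integral>\<omega>. I (\<rho> \<omega>) \<omega> \<partial>N) = (\<integral>\<omega>. I 0 \<omega> \<partial>N)"
    using step by (simp add: LIMSEQ_const_iff)
qed

end

lemma exit_time_mono:
  assumes v: "continuous_on {0..} v" and T: "0 \<le> T" "T \<le> T'"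
  shows "exit_time v T \<le> exit_time v T'"
proof (cases "T \<le> exit_time v T'")
  case True
  then show ?thesis using exit_time_bounds(2)[OF T(1), of v] by linarith
next
  case False
  then have lt: "exit_time v T' < T'" using T by linarith
  then have "\<not> (\<forall>s\<in>{0..T'}. 0 < v s)" by (intro notI) (simp add: exit_time_def)
  then obtain s where "s \<in> {0..T'}" "v s \<le> 0" by (auto simp: not_less)
  from exit_time_nonpos[OF v this] show ?thesis
    using exit_time_bounds[of T' v] False T by (intro exit_time_le[of "exit_time v T'"]) auto
qed

text \<open>Completeness lets a function defined path by path, such as a hitting time, inherit
  measurability from a limit with which it agrees only almost surely.\<close>

lemma (in complete_measure) complete_AE_measurable:
  assumes f: "f \<in> measurable M S" and eq: "AE \<omega> in M. f \<omega> = g \<omega>"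
    and g: "\<And>\<omega>. \<omega> \<in> space M \<Longrightarrow> g \<omega> \<in> space S"
  shows "g \<in> measurable M S"
proof (rule measurableI)
  fix A assume A: "A \<in> sets S"
  have "AE \<omega> in M. \<omega> \<in> f -` A \<inter> space M \<longleftrightarrow> \<omega> \<in> g -` A \<inter> space M"
    using eq by eventually_elim auto
  then show "g -` A \<inter> space M \<in> sets M"
    by (rule in_sets_AE[OF _ measurable_sets[OF f A]]) auto
qed (rule g)

context filtered_bm begin

section \<open>Wald's identity for bounded stopping times\<close>

lemma bounded_stopping_mono: "bounded_stopping T \<rho> \<Longrightarrow> T \<le> T' \<Longrightarrow> bounded_stopping T' \<rho>"
  by (force simp: bounded_stopping_def)

lemma bounded_stopping_zero: "0 < T \<Longrightarrow> bounded_stopping T (\<lambda>_. 0)"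
  by (simp add: bounded_stopping_def stopping_time_const)

definition grid_point :: "real \<Rightarrow> nat \<Rightarrow> nat \<Rightarrow> real" where
  "grid_point T n i = real i * T / real n"

definition stop_weight :: "real \<Rightarrow> real \<Rightarrow> nat \<Rightarrow> ('a \<Rightarrow> real) \<Rightarrow> nat \<Rightarrow> 'a \<Rightarrow> real" where
  "stop_weight c T n \<rho> i \<omega> = c * indicator {\<omega> \<in> space N. grid_point T n i < \<rho> \<omega>} \<omega>"

text \<open>Brownian motion stopped at a rounded time is an elementary integral whose integrand is
  \<open>c\<close> up to that time: the weight of a cell asks whether \<open>\<rho>\<close> lies
  beyond its left end.\<close>

lemma stopped_elem:
  assumes \<rho>: "bounded_stopping T \<rho>" and n: "0 < n"
  shows "elem_data {..<n} (grid_point T n) (\<lambda>i. grid_point T n (Suc i)) (stop_weight c T n \<rho>)"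
    and "0 \<le> t \<Longrightarrow> \<omega> \<in> space N \<Longrightarrow>
      elem_integral {..<n} (grid_point T n) (\<lambda>i. grid_point T n (Suc i)) (stop_weight c T n \<rho>) t \<omega>
        = c * (W (min (grid_up T n (\<rho> \<omega>)) t) \<omega> - W 0 \<omega>)"
    and "\<omega> \<in> space N \<Longrightarrow>
      elem_process {..<n} (grid_point T n) (\<lambda>i. grid_point T n (Suc i)) (stop_weight c T n \<rho>) s \<omega>
        = c * indicator {0<..grid_up T n (\<rho> \<omega>)} s"
proof -
  note r = bounded_stoppingD[OF \<rho>]
  show "elem_data {..<n} (grid_point T n) (\<lambda>i. grid_point T n (Suc i)) (stop_weight c T n \<rho>)"
    unfolding elem_data_def
  proof (intro conjI ballI)
    fix i
    show "0 \<le> grid_point T n i" "grid_point T n i \<le> grid_point T n (Suc i)"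
      using r(1) n by (auto simp: grid_point_def divide_right_mono)
    have "weight (grid_point T n i) (\<lambda>\<omega>. c * indicator {\<omega> \<in> space N. grid_point T n i < \<rho> \<omega>} \<omega>)"
      by (intro weight_mult weight_indicator r) (auto simp: weight_def)
    then show "weight (grid_point T n i) (stop_weight c T n \<rho> i)" by (simp add: stop_weight_def[abs_def])
  qed simp
  show "elem_integral {..<n} (grid_point T n) (\<lambda>i. grid_point T n (Suc i)) (stop_weight c T n \<rho>) t \<omega>
        = c * (W (min (grid_up T n (\<rho> \<omega>)) t) \<omega> - W 0 \<omega>)" if t: "0 \<le> t" and \<omega>: "\<omega> \<in> space N"
    unfolding grid_up_telescope[OF r(1) n r(2)[OF \<omega>] r(3)[OF \<omega>] t, of "\<lambda>t. W t \<omega>", symmetric]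
      elem_integral_def sum_distrib_left
    by (intro sum.cong refl) (simp add: stop_weight_def grid_point_def \<omega> indicator_def)
  show "elem_process {..<n} (grid_point T n) (\<lambda>i. grid_point T n (Suc i)) (stop_weight c T n \<rho>) s \<omega>
        = c * indicator {0<..grid_up T n (\<rho> \<omega>)} s" if \<omega>: "\<omega> \<in> space N"
  proof -
    \<comment> \<open>The telescoping identity is used a second time, now for the function of
      \<open>u\<close> obtained by fixing \<open>s\<close>, in order to identify the
      integrand.\<close>
    let ?v = "\<lambda>u. indicator {0<..u} s :: real"
    have "c * (?v (min (grid_up T n (\<rho> \<omega>)) T) - ?v 0) = (\<Sum>i<n. c * ((if real i * T / real n < \<rho> \<omega> then 1 else 0) *
        (?v (min (real (Suc i) * T / real n) T) - ?v (min (real i * T / real n) T))))"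
      unfolding grid_up_telescope[OF r(1) n r(2)[OF \<omega>] r(3)[OF \<omega>] less_imp_le[OF r(1)], of ?v, symmetric] sum_distrib_left ..
    also have "\<dots> = elem_process {..<n} (grid_point T n) (\<lambda>i. grid_point T n (Suc i)) (stop_weight c T n \<rho>) s \<omega>"
      unfolding elem_process_def
    proof (intro sum.cong refl)
      fix i assume i: "i \<in> {..<n}"
      have *: "real j * T / real n \<le> T" if "j \<le> n" for j
        using mult_right_mono[of "real j" "real n" T] that n r(1) by (simp add: pos_divide_le_eq mult.commute)
      have "?v (min (real (Suc i) * T / real n) T) - ?v (min (real i * T / real n) T) = indicator {grid_point T n i<..grid_point T n (Suc i)} s"
      proof -
        have "0 \<le> grid_point T n i" "grid_point T n i \<le> grid_point T n (Suc i)"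
          using r(1) n by (auto simp: grid_point_def divide_right_mono)
        moreover have "min (real (Suc i) * T / real n) T = grid_point T n (Suc i)" "min (real i * T / real n) T = grid_point T n i"
          using *[of "Suc i"] *[of i] i by (auto simp: grid_point_def)
        ultimately show ?thesis by (simp only:) (auto simp: indicator_def)
      qed
      then show "c * ((if real i * T / real n < \<rho> \<omega> then 1 else 0) * (?v (min (real (Suc i) * T / real n) T) - ?v (min (real i * T / real n) T)))
        = stop_weight c T n \<rho> i \<omega> * indicator {grid_point T n i<..grid_point T n (Suc i)} s"
        by (simp only:) (simp add: stop_weight_def \<omega> grid_point_def)
    qed
    finally show ?thesis using grid_up_bounds(5)[OF r(1) n r(2)[OF \<omega>] r(3)[OF \<omega>]] by (simp add: min_absorb1)
  qed
qed

lemma grid_up_measurable: "bounded_stopping T \<rho> \<Longrightarrow> (\<lambda>\<omega>. grid_up T n (\<rho> \<omega>)) \<in> borel_measurable N"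
  unfolding grid_up_def grid_index_def using bounded_stoppingD(6)[of T \<rho>] by measurable

lemma wald_grid:
  assumes \<rho>: "bounded_stopping T \<rho>" "bounded_stopping T \<rho>'" and n: "0 < n" "0 < m"
  defines "D \<equiv> \<lambda>\<omega>. W (grid_up T n (\<rho> \<omega>)) \<omega> - W (grid_up T m (\<rho>' \<omega>)) \<omega>"
  shows "sq_integrable N D" "(\<integral>\<omega>. (D \<omega>)\<^sup>2 \<partial>N) = (\<integral>\<omega>. \<bar>grid_up T n (\<rho> \<omega>) - grid_up T m (\<rho>' \<omega>)\<bar> \<partial>N)"
proof -
  note r = bounded_stoppingD[OF \<rho>(1)] and r' = bounded_stoppingD[OF \<rho>(2)]
  have T: "0 < T" by (rule r)
  note e = stopped_elem[OF \<rho>(1) n(1), where c = 1] and e' = stopped_elem[OF \<rho>(2) n(2), where c = 1]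
  note b = grid_up_bounds[OF T n(1) r(2) r(3)] and b' = grid_up_bounds[OF T n(2) r'(2) r'(3)]
  note d = elem_diff[OF e(1) e'(1)]
  have int: "elem_integral ({..<n} <+> {..<m}) (case_sum (grid_point T n) (grid_point T m))
      (case_sum (\<lambda>i. grid_point T n (Suc i)) (\<lambda>i. grid_point T m (Suc i)))
      (case_sum (stop_weight 1 T n \<rho>) (\<lambda>q \<omega>. - stop_weight 1 T m \<rho>' q \<omega>)) T \<omega> = D \<omega>" if \<omega>: "\<omega> \<in> space N" for \<omega>
    unfolding d(3) e(2)[OF less_imp_le[OF T] \<omega>] e'(2)[OF less_imp_le[OF T] \<omega>] D_def
    using b(5)[OF \<omega> \<omega>] b'(5)[OF \<omega> \<omega>] by (simp add: min_absorb1)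
  have "sq_integrable N (elem_integral ({..<n} <+> {..<m}) (case_sum (grid_point T n) (grid_point T m))
      (case_sum (\<lambda>i. grid_point T n (Suc i)) (\<lambda>i. grid_point T m (Suc i)))
      (case_sum (stop_weight 1 T n \<rho>) (\<lambda>q \<omega>. - stop_weight 1 T m \<rho>' q \<omega>)) T)"
    using T by (intro elem_integral_sq_integrable[OF d(1)]) auto
  then show D: "sq_integrable N D"
    unfolding sq_integrable_def by (simp only: int cong: measurable_cong Bochner_Integration.integrable_cong)
  have inner: "(\<integral>\<^sup>+s\<in>{0..T}. ennreal ((1 * indicator {0<..u} s - 1 * indicator {0<..v} s)\<^sup>2) \<partial>lborel) = ennreal \<bar>u - v\<bar>"
    if "0 \<le> u" "u \<le> T" "0 \<le> v" "v \<le> T" for u v :: real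
  proof -
    have "(\<integral>\<^sup>+s\<in>{0..T}. ennreal ((1 * indicator {0<..u} s - 1 * indicator {0<..v} s)\<^sup>2) \<partial>lborel)
       = (\<integral>\<^sup>+s. indicator {min u v<..max u v} s \<partial>lborel)"
      using that by (intro nn_integral_cong) (auto simp: indicator_def)
    also have "\<dots> = ennreal \<bar>u - v\<bar>" by (simp add: max_def min_def)
    finally show ?thesis .
  qed
  have "ennreal (\<integral>\<omega>. (D \<omega>)\<^sup>2 \<partial>N) = (\<integral>\<^sup>+\<omega>. ennreal ((D \<omega>)\<^sup>2) \<partial>N)"
    by (rule sq_integrable_nn_eq[OF D, symmetric])
  also have "\<dots> = (\<integral>\<^sup>+\<omega>. ennreal ((elem_integral ({..<n} <+> {..<m}) (case_sum (grid_point T n) (grid_point T m))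
      (case_sum (\<lambda>i. grid_point T n (Suc i)) (\<lambda>i. grid_point T m (Suc i)))
      (case_sum (stop_weight 1 T n \<rho>) (\<lambda>q \<omega>. - stop_weight 1 T m \<rho>' q \<omega>)) T \<omega>)\<^sup>2) \<partial>N)"
    by (intro nn_integral_cong) (simp only: int)
  also have "\<dots> = (\<integral>\<^sup>+\<omega>. ennreal \<bar>grid_up T n (\<rho> \<omega>) - grid_up T m (\<rho>' \<omega>)\<bar> \<partial>N)"
    unfolding elem_isometry[OF d(1) less_imp_le[OF T]] d(2)
    using b b' by (intro nn_integral_cong) (simp only: e(3) e'(3) inner)
  also have "\<dots> = ennreal (\<integral>\<omega>. \<bar>grid_up T n (\<rho> \<omega>) - grid_up T m (\<rho>' \<omega>)\<bar> \<partial>N)"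
  proof (rule nn_integral_eq_integral)
    have "\<bar>grid_up T n (\<rho> \<omega>) - grid_up T m (\<rho>' \<omega>)\<bar> \<le> T" if \<omega>: "\<omega> \<in> space N" for \<omega>
      using b(4,5)[OF \<omega> \<omega>] b'(4,5)[OF \<omega> \<omega>] by linarith
    then show "integrable N (\<lambda>\<omega>. \<bar>grid_up T n (\<rho> \<omega>) - grid_up T m (\<rho>' \<omega>)\<bar>)"
      using grid_up_measurable[OF \<rho>(1), of n] grid_up_measurable[OF \<rho>(2), of m]
      by (intro integrable_const_bound[where B = T]) auto
  qed simp
  finally show "(\<integral>\<omega>. (D \<omega>)\<^sup>2 \<partial>N) = (\<integral>\<omega>. \<bar>grid_up T n (\<rho> \<omega>) - grid_up T m (\<rho>' \<omega>)\<bar> \<partial>N)"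
    by simp
qed

text \<open>The rounding is compared with ever finer ones: all of them lie within
  \<open>T / real (Suc n)\<close> above \<open>\<rho>\<close>, and a uniform second-moment bound
  survives the almost sure limit.\<close>

lemma wald_grid_approx:
  assumes \<rho>: "bounded_stopping T \<rho>"
  defines "D \<equiv> \<lambda>n \<omega>. W (grid_up T (Suc n) (\<rho> \<omega>)) \<omega> - W (\<rho> \<omega>) \<omega>"
  shows "sq_integrable N (D n)" "(\<integral>\<omega>. (D n \<omega>)\<^sup>2 \<partial>N) \<le> T * inverse (real (Suc n))"
proof -
  note r = bounded_stoppingD[OF \<rho>]
  define X where "X k \<omega> = W (grid_up T (Suc n) (\<rho> \<omega>)) \<omega> - W (grid_up T (Suc (k + n)) (\<rho> \<omega>)) \<omega>" for k \<omega>
  have Xsq: "sq_integrable N (X k)" for k unfolding X_def[abs_def] by (intro wald_grid \<rho>) auto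
  have bd: "(\<integral>\<omega>. (X k \<omega>)\<^sup>2 \<partial>N) \<le> T * inverse (real (Suc n))" for k
  proof -
    have "\<bar>grid_up T (Suc n) (\<rho> \<omega>) - grid_up T (Suc (k + n)) (\<rho> \<omega>)\<bar> \<le> T * inverse (real (Suc n))" if "\<omega> \<in> space N" for \<omega>
    proof -
      have "T / real (Suc (k + n)) \<le> T / real (Suc n)" using r(1) by (intro divide_left_mono) auto
      then show ?thesis
        using grid_up_bounds(2,3)[OF r(1) zero_less_Suc r(2)[OF that] r(3)[OF that], of n]
          grid_up_bounds(2,3)[OF r(1) zero_less_Suc r(2)[OF that] r(3)[OF that], of "k + n"]
        unfolding divide_inverse by linarith
    qed
    then have "(\<integral>\<omega>. \<bar>grid_up T (Suc n) (\<rho> \<omega>) - grid_up T (Suc (k + n)) (\<rho> \<omega>)\<bar> \<partial>N) \<le> (\<integral>\<omega>. T * inverse (real (Suc n)) \<partial>N)"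
      using grid_up_measurable[OF \<rho>, of "Suc n"] grid_up_measurable[OF \<rho>, of "Suc (k + n)"]
      by (intro integral_mono integrable_const_bound[where B = "T * inverse (real (Suc n))"]) (use r(1) in auto)
    then show ?thesis unfolding X_def using wald_grid(2)[OF \<rho> \<rho>, of "Suc n" "Suc (k + n)"] by (simp add: prob_space)
  qed
  have lim: "AE \<omega> in N. (\<lambda>k. X k \<omega>) \<longlonglongrightarrow> D n \<omega>"
  proof (rule AE_I2)
    fix \<omega> assume \<omega>: "\<omega> \<in> space N"
    have "(\<lambda>k. W (grid_up T (Suc k) (\<rho> \<omega>)) \<omega>) \<longlonglongrightarrow> W (\<rho> \<omega>) \<omega>"
      by (intro grid_up_path_tendsto r \<omega> W_continuous)
    from LIMSEQ_ignore_initial_segment[OF this, of n]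
    show "(\<lambda>k. X k \<omega>) \<longlonglongrightarrow> D n \<omega>" unfolding X_def D_def by (intro tendsto_intros) simp
  qed
  have meas: "D n \<in> borel_measurable N"
  proof -
    have "(\<lambda>\<omega>. W (\<rho> \<omega>) \<omega>) \<in> borel_measurable N"
      by (rule sample_measurable_N[OF W_adapted W_continuous \<rho>])
    moreover have "(\<lambda>\<omega>. W (grid_up T (Suc n) (\<rho> \<omega>)) \<omega>) \<in> borel_measurable N"
      by (intro sample_measurable[where X = W and T = T, OF W_measurable W_continuous r(1) grid_up_measurable[OF \<rho>]]
          conjI grid_up_bounds(4,5)[OF r(1) zero_less_Suc] r(2,3))
    ultimately show ?thesis unfolding D_def by simp
  qed
  show "sq_integrable N (D n)" "(\<integral>\<omega>. (D n \<omega>)\<^sup>2 \<partial>N) \<le> T * inverse (real (Suc n))"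
    by (rule L2_bounded_tendsto_L1[OF Xsq meas bd lim])+
qed

text \<open>The form with two times shows that the values of \<open>W\<close> along an increasing
  sequence of bounded stopping times are Cauchy in mean square as soon as the mean times converge.
  This is how unbounded hitting times are reached.\<close>

theorem wald:
  assumes \<rho>: "bounded_stopping T \<rho>" "bounded_stopping T \<rho>'"
  shows "sq_integrable N (\<lambda>\<omega>. W (\<rho> \<omega>) \<omega> - W (\<rho>' \<omega>) \<omega>)"
    "(\<integral>\<omega>. (W (\<rho> \<omega>) \<omega> - W (\<rho>' \<omega>) \<omega>)\<^sup>2 \<partial>N) = (\<integral>\<omega>. \<bar>\<rho> \<omega> - \<rho>' \<omega>\<bar> \<partial>N)"
proof -
  note r = bounded_stoppingD[OF \<rho>(1)] and r' = bounded_stoppingD[OF \<rho>(2)]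
  define A where "A n \<omega> = W (grid_up T (Suc n) (\<rho> \<omega>)) \<omega> - W (\<rho> \<omega>) \<omega>" for n \<omega>
  define B where "B n \<omega> = W (grid_up T (Suc n) (\<rho>' \<omega>)) \<omega> - W (\<rho>' \<omega>) \<omega>" for n \<omega>
  define X where "X n \<omega> = W (grid_up T (Suc n) (\<rho> \<omega>)) \<omega> - W (grid_up T (Suc n) (\<rho>' \<omega>)) \<omega>" for n \<omega>
  let ?D = "\<lambda>\<omega>. W (\<rho> \<omega>) \<omega> - W (\<rho>' \<omega>) \<omega>"
  have Xsq: "sq_integrable N (X n)" for n unfolding X_def[abs_def] by (intro wald_grid \<rho>) auto
  have A: "sq_integrable N (A n)" "(\<integral>\<omega>. (A n \<omega>)\<^sup>2 \<partial>N) \<le> T * inverse (real (Suc n))" for n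
    using wald_grid_approx[OF \<rho>(1), of n] by (simp_all add: A_def[abs_def])
  have B: "sq_integrable N (B n)" "(\<integral>\<omega>. (B n \<omega>)\<^sup>2 \<partial>N) \<le> T * inverse (real (Suc n))" for n
    using wald_grid_approx[OF \<rho>(2), of n] by (simp_all add: B_def[abs_def])
  have "?D = (\<lambda>\<omega>. X 0 \<omega> - (A 0 \<omega> - B 0 \<omega>))" by (auto simp: X_def A_def B_def)
  then show D: "sq_integrable N ?D" using sq_integrable_diff[OF Xsq[of 0] sq_integrable_diff[OF A(1)[of 0] B(1)[of 0]]] by simp
  have "(\<lambda>n. \<integral>\<omega>. (X n \<omega>)\<^sup>2 \<partial>N) \<longlonglongrightarrow> (\<integral>\<omega>. (?D \<omega>)\<^sup>2 \<partial>N)"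
  proof (rule L2_tendsto_sq[OF Xsq D], rule tendsto_sandwich)
    show "\<forall>\<^sub>F n in sequentially. 0 \<le> (\<integral>\<omega>. (X n \<omega> - ?D \<omega>)\<^sup>2 \<partial>N)" by simp
    show "\<forall>\<^sub>F n in sequentially. (\<integral>\<omega>. (X n \<omega> - ?D \<omega>)\<^sup>2 \<partial>N) \<le> 4 * T * inverse (real (Suc n))"
    proof (intro always_eventually allI)
      fix n
      note [simp] = sq_integrableD(2)[OF A(1)[of n]] sq_integrableD(2)[OF B(1)[of n]]
        sq_integrableD(2)[OF sq_integrable_diff[OF A(1)[of n] B(1)[of n]]]
      have "(a - b)\<^sup>2 \<le> 2 * a\<^sup>2 + 2 * b\<^sup>2" for a b :: real
        using zero_le_power2[of "a + b"] by (simp add: power2_eq_square algebra_simps)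
      then have "(\<integral>\<omega>. (A n \<omega> - B n \<omega>)\<^sup>2 \<partial>N) \<le> (\<integral>\<omega>. 2 * (A n \<omega>)\<^sup>2 + 2 * (B n \<omega>)\<^sup>2 \<partial>N)"
        by (intro integral_mono) auto
      also have "\<dots> = 2 * (\<integral>\<omega>. (A n \<omega>)\<^sup>2 \<partial>N) + 2 * (\<integral>\<omega>. (B n \<omega>)\<^sup>2 \<partial>N)" by simp
      also have "\<dots> \<le> 4 * T * inverse (real (Suc n))" using A(2)[of n] B(2)[of n] by linarith
      finally have "(\<integral>\<omega>. (A n \<omega> - B n \<omega>)\<^sup>2 \<partial>N) \<le> 4 * T * inverse (real (Suc n))" .
      moreover have "X n \<omega> - ?D \<omega> = A n \<omega> - B n \<omega>" for \<omega> by (simp add: X_def A_def B_def)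
      ultimately show "(\<integral>\<omega>. (X n \<omega> - ?D \<omega>)\<^sup>2 \<partial>N) \<le> 4 * T * inverse (real (Suc n))" by simp
    qed
    show "(\<lambda>n. 4 * T * inverse (real (Suc n))) \<longlonglongrightarrow> 0"
      using tendsto_mult[OF tendsto_const[of "4 * T"] LIMSEQ_inverse_real_of_nat] by simp
  qed simp
  moreover have "(\<lambda>n. \<integral>\<omega>. (X n \<omega>)\<^sup>2 \<partial>N) \<longlonglongrightarrow> (\<integral>\<omega>. \<bar>\<rho> \<omega> - \<rho>' \<omega>\<bar> \<partial>N)"
  proof -
    have "(\<lambda>n. \<integral>\<omega>. \<bar>grid_up T (Suc n) (\<rho> \<omega>) - grid_up T (Suc n) (\<rho>' \<omega>)\<bar> \<partial>N) \<longlonglongrightarrow> (\<integral>\<omega>. \<bar>\<rho> \<omega> - \<rho>' \<omega>\<bar> \<partial>N)"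
    proof (rule integral_dominated_convergence[where w = "\<lambda>_. T"])
      show "AE \<omega> in N. (\<lambda>n. \<bar>grid_up T (Suc n) (\<rho> \<omega>) - grid_up T (Suc n) (\<rho>' \<omega>)\<bar>) \<longlonglongrightarrow> \<bar>\<rho> \<omega> - \<rho>' \<omega>\<bar>"
        by (intro AE_I2 tendsto_intros grid_up_tendsto r r')
      show "AE \<omega> in N. norm \<bar>grid_up T (Suc n) (\<rho> \<omega>) - grid_up T (Suc n) (\<rho>' \<omega>)\<bar> \<le> T" for n
      proof (rule AE_I2)
        fix \<omega> assume \<omega>: "\<omega> \<in> space N"
        show "norm \<bar>grid_up T (Suc n) (\<rho> \<omega>) - grid_up T (Suc n) (\<rho>' \<omega>)\<bar> \<le> T"
          using grid_up_bounds(4,5)[OF r(1) zero_less_Suc r(2)[OF \<omega>] r(3)[OF \<omega>], of n]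
            grid_up_bounds(4,5)[OF r(1) zero_less_Suc r'(2)[OF \<omega>] r'(3)[OF \<omega>], of n]
          unfolding real_norm_def by linarith
      qed
      show "(\<lambda>\<omega>. \<bar>grid_up T (Suc n) (\<rho> \<omega>) - grid_up T (Suc n) (\<rho>' \<omega>)\<bar>) \<in> borel_measurable N" for n
        using grid_up_measurable[OF \<rho>(1), of "Suc n"] grid_up_measurable[OF \<rho>(2), of "Suc n"] by simp
    qed (use r(6) r'(6) in auto)
    then show ?thesis unfolding X_def using wald_grid(2)[OF \<rho>] by simp
  qed
  ultimately show "(\<integral>\<omega>. (?D \<omega>)\<^sup>2 \<partial>N) = (\<integral>\<omega>. \<bar>\<rho> \<omega> - \<rho>' \<omega>\<bar> \<partial>N)" by (rule LIMSEQ_unique)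
qed

end

section \<open>The hitting time of a control\<close>

text \<open>The driving path is an argument, so that one functional serves Ito integrals, simple
  integrals and integrals computed on path space.\<close>

definition hit :: "real \<Rightarrow> (real \<Rightarrow> real) \<Rightarrow> real" where
  "hit y v = Inf {t. 0 \<le> t \<and> y - t + v t = 0}"

lemma hit_eq_exit_time:
  assumes v: "continuous_on {0..} v" "v 0 = 0" "0 \<le> y" and s: "0 \<le> s" "s \<le> T" "y - s + v s \<le> 0"
  shows "hit y v = exit_time (\<lambda>t. y - t + v t) T"
  unfolding hit_def using v s
  by (intro Inf_zeros_eq_exit_time[of "\<lambda>t. y - t + v t" s T] continuous_intros) auto

context filtered_bm begin

context
  fixes I :: "real \<Rightarrow> 'a \<Rightarrow> real" and C y :: real
  assumes I: "l2_martingale I C" and I0: "AE \<omega> in N. I 0 \<omega> = 0" and y: "0 \<le> y"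
begin

section \<open>The hitting time as a limit of times capped at a finite horizon\<close>

definition capped :: "real \<Rightarrow> 'a \<Rightarrow> real" where
  "capped T \<omega> = exit_time (\<lambda>t. y - t + I t \<omega>) T"

lemma drift_continuous: "\<omega> \<in> space N \<Longrightarrow> continuous_on {0..} (\<lambda>t. y - t + I t \<omega>)"
  by (intro continuous_intros l2_martingaleD[OF I])

lemma capped_stopping: "0 < T \<Longrightarrow> bounded_stopping T (capped T)"
  unfolding capped_def[abs_def] using l2_martingaleD(1)[OF I] drift_continuous
  by (intro exit_time_stopping) auto

lemma capped_integrable: "0 < T \<Longrightarrow> integrable N (capped T)"
  using bounded_stoppingD[OF capped_stopping] by (intro integrable_const_bound[where B = T]) auto

lemma capped_mean:
  assumes T: "0 < T"
  shows "integrable N (\<lambda>\<omega>. y - capped T \<omega> + I (capped T \<omega>) \<omega>)"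
    "(\<integral>\<omega>. capped T \<omega> \<partial>N) = y - (\<integral>\<omega>. y - capped T \<omega> + I (capped T \<omega>) \<omega> \<partial>N)"
proof -
  note os = optional_stopping[OF I capped_stopping[OF T]]
  have i: "integrable N (\<lambda>\<omega>. I (capped T \<omega>) \<omega>)" by (rule sq_integrable_integrable[OF os(1)])
  have "(\<integral>\<omega>. I 0 \<omega> \<partial>N) = 0" by (rule integral_eq_zero_AE[OF I0])
  then show "integrable N (\<lambda>\<omega>. y - capped T \<omega> + I (capped T \<omega>) \<omega>)"
    "(\<integral>\<omega>. capped T \<omega> \<partial>N) = y - (\<integral>\<omega>. y - capped T \<omega> + I (capped T \<omega>) \<omega> \<partial>N)"
    using i os(2) capped_integrable[OF T] by (simp_all add: prob_space)
qed

definition unhit :: "real \<Rightarrow> 'a set" where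
  "unhit T = {\<omega> \<in> space N. \<forall>s\<in>{0..T}. 0 < y - s + I s \<omega>}"

lemma unhit_sets: "0 \<le> T \<Longrightarrow> unhit T \<in> sets N"
  unfolding unhit_def using F_measurable_N[OF l2_martingaleD(1)[OF I]] drift_continuous
  by (intro positive_path_measurable[where V = "\<lambda>s \<omega>. y - s + I s \<omega>"]) auto

text \<open>Either the drifted path has come down to zero by the horizon, and then the stopped value
  is zero, or it has not, and then the capped time is the horizon itself.\<close>

lemma stopped_drift:
  assumes T: "0 < T"
  shows "AE \<omega> in N. y - capped T \<omega> + I (capped T \<omega>) \<omega> = indicator (unhit T) \<omega> * (y - T + I T \<omega>)"
proof (rule AE_mp[OF I0], rule AE_I2, rule impI)
  fix \<omega> assume \<omega>: "\<omega> \<in> space N" and 0: "I 0 \<omega> = 0"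
  let ?v = "\<lambda>t. y - t + I t \<omega>"
  show "y - capped T \<omega> + I (capped T \<omega>) \<omega> = indicator (unhit T) \<omega> * (y - T + I T \<omega>)"
  proof (cases "\<omega> \<in> unhit T")
    case True
    then have "capped T \<omega> = T" by (simp add: capped_def exit_time_def unhit_def)
    then show ?thesis using True by simp
  next
    case False
    then obtain s where "s \<in> {0..T}" "?v s \<le> 0" using \<omega> by (auto simp: unhit_def not_less)
    then have "?v (exit_time ?v T) = 0" using y 0 by (intro exit_time_zero[OF drift_continuous[OF \<omega>]]) auto
    then show ?thesis using False by (simp add: capped_def)
  qed
qed

lemma stopped_drift_nonneg:
  assumes T: "0 < T"
  shows "AE \<omega> in N. 0 \<le> y - capped T \<omega> + I (capped T \<omega>) \<omega>"
  using stopped_drift[OF T]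
proof eventually_elim
  case (elim \<omega>)
  then show ?case using T by (auto simp: indicator_def unhit_def less_imp_le)
qed

lemma capped_mean_le:
  assumes T: "0 < T" shows "(\<integral>\<omega>. capped T \<omega> \<partial>N) \<le> y"
  using capped_mean(2)[OF T] integral_nonneg_AE[OF stopped_drift_nonneg[OF T]] by simp

text \<open>Markov's inequality: on this event the capped time equals \<open>T\<close>, while its
  mean is at most \<open>y\<close>.\<close>

lemma prob_unhit_le:
  assumes T: "0 < T" shows "prob (unhit T) \<le> y / T"
proof -
  have U: "unhit T \<in> sets N" using T by (intro unhit_sets) simp
  have "T * prob (unhit T) = (\<integral>\<omega>. indicator (unhit T) \<omega> * T \<partial>N)"
    using sets.sets_into_space[OF U] by (simp add: mult.commute Int_absorb2)
  also have "\<dots> \<le> (\<integral>\<omega>. capped T \<omega> \<partial>N)"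
  proof (rule integral_mono[OF _ capped_integrable[OF T]])
    show "integrable N (\<lambda>\<omega>. indicator (unhit T) \<omega> * T)" using U by (simp add: emeasure_eq_measure)
    show "indicator (unhit T) \<omega> * T \<le> capped T \<omega>" if "\<omega> \<in> space N" for \<omega>
    proof (cases "\<omega> \<in> unhit T")
      case True
      then show ?thesis by (simp add: capped_def unhit_def exit_time_def)
    next
      case False
      then show ?thesis using exit_time_bounds(1)[of T] T by (simp add: capped_def)
    qed
  qed
  also have "\<dots> \<le> y" by (rule capped_mean_le[OF T])
  finally show ?thesis using T by (simp add: field_simps)
qed

text \<open>The gap between \<open>y\<close> and the mean capped time is the mean stopped value,
  which lives on the event of not having hit. By Cauchy-Schwarz and the uniform bound
  \<open>C\<close> it is at most \<open>y * p n + sqrt (p n) * sqrt C\<close>, and the probability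
  \<open>p n\<close> of that event tends to zero. Boundedness in \<open>L2\<close> thus excludes a
  loss of mass at infinity.\<close>

lemma capped_mean_tendsto: "(\<lambda>n. \<integral>\<omega>. capped (real (Suc n)) \<omega> \<partial>N) \<longlonglongrightarrow> y"
proof -
  define p where "p n = prob (unhit (real (Suc n)))" for n
  have p: "p \<longlonglongrightarrow> 0"
  proof (rule tendsto_sandwich[of "\<lambda>_. 0"])
    show "\<forall>\<^sub>F n in sequentially. p n \<le> y * inverse (real (Suc n))"
      using prob_unhit_le by (simp add: p_def divide_inverse del: of_nat_Suc)
    show "(\<lambda>n. y * inverse (real (Suc n))) \<longlonglongrightarrow> 0"
      using tendsto_mult[OF tendsto_const[of y] LIMSEQ_inverse_real_of_nat] by simp
  qed (simp_all add: p_def)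
  have le: "y - (y * p n + sqrt (p n) * sqrt C) \<le> (\<integral>\<omega>. capped (real (Suc n)) \<omega> \<partial>N)" for n
  proof -
    define T where "T = real (Suc n)"
    have T: "0 < T" by (simp add: T_def)
    have U: "unhit T \<in> sets N" using T by (intro unhit_sets) simp
    note [simp] = emeasure_eq_measure
    have iU: "sq_integrable N (indicator (unhit T))" using U by (intro sq_integrable_bounded[where c = 1]) (auto simp: indicator_def)
    have sT: "sq_integrable N (I T)" using l2_martingaleD(3)[OF I] T by simp
    have iI: "integrable N (\<lambda>\<omega>. indicator (unhit T) \<omega> * I T \<omega>)" by (rule sq_integrable_mult[OF iU sT])
    have pU: "(\<integral>\<omega>. indicator (unhit T) \<omega> \<partial>N) = p n"
      using sets.sets_into_space[OF U] by (simp add: p_def T_def Int_absorb2 del: of_nat_Suc)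
    have "(\<integral>\<omega>. y - capped T \<omega> + I (capped T \<omega>) \<omega> \<partial>N) = (\<integral>\<omega>. indicator (unhit T) \<omega> * (y - T + I T \<omega>) \<partial>N)"
    proof (rule integral_cong_AE[OF _ _ stopped_drift[OF T]])
      show "(\<lambda>\<omega>. y - capped T \<omega> + I (capped T \<omega>) \<omega>) \<in> borel_measurable N" using capped_mean(1)[OF T] by simp
      show "(\<lambda>\<omega>. indicator (unhit T) \<omega> * (y - T + I T \<omega>)) \<in> borel_measurable N" using U sT[THEN sq_integrableD(1)] by simp
    qed
    also have "\<dots> \<le> (\<integral>\<omega>. y * indicator (unhit T) \<omega> + indicator (unhit T) \<omega> * I T \<omega> \<partial>N)"
    proof (rule integral_mono)
      have "(\<lambda>\<omega>. indicator (unhit T) \<omega> * (y - T + I T \<omega>)) = (\<lambda>\<omega>. (y - T) * indicator (unhit T) \<omega> + indicator (unhit T) \<omega> * I T \<omega>)"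
        by (auto simp: algebra_simps)
      then show "integrable N (\<lambda>\<omega>. indicator (unhit T) \<omega> * (y - T + I T \<omega>))" using iI U by simp
      show "integrable N (\<lambda>\<omega>. y * indicator (unhit T) \<omega> + indicator (unhit T) \<omega> * I T \<omega>)" using iI U by simp
    qed (use T in \<open>auto simp: indicator_def\<close>)
    also have "\<dots> = y * p n + (\<integral>\<omega>. indicator (unhit T) \<omega> * I T \<omega> \<partial>N)"
      unfolding pU[symmetric] using iI U by (subst Bochner_Integration.integral_add) auto
    also have "(\<integral>\<omega>. indicator (unhit T) \<omega> * I T \<omega> \<partial>N) \<le> sqrt (\<integral>\<omega>. (indicator (unhit T) \<omega>)\<^sup>2 \<partial>N) * sqrt (\<integral>\<omega>. (I T \<omega>)\<^sup>2 \<partial>N)"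
      using Cauchy_Schwarz_integral[OF iU sT] by linarith
    also have "(\<integral>\<omega>. (indicator (unhit T) \<omega>)\<^sup>2 \<partial>N) = p n"
      unfolding pU[symmetric] by (intro Bochner_Integration.integral_cong) (auto simp: indicator_def)
    also have "sqrt (p n) * sqrt (\<integral>\<omega>. (I T \<omega>)\<^sup>2 \<partial>N) \<le> sqrt (p n) * sqrt C"
      using l2_martingaleD(4)[OF I] T by (intro mult_left_mono real_sqrt_le_mono) (auto simp: p_def)
    finally show ?thesis using capped_mean(2)[OF T] by (simp add: T_def)
  qed
  show ?thesis
  proof (rule tendsto_sandwich)
    show "\<forall>\<^sub>F n in sequentially. y - (y * p n + sqrt (p n) * sqrt C) \<le> (\<integral>\<omega>. capped (real (Suc n)) \<omega> \<partial>N)"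
      using le by simp
    show "\<forall>\<^sub>F n in sequentially. (\<integral>\<omega>. capped (real (Suc n)) \<omega> \<partial>N) \<le> y"
      using capped_mean_le by simp
    have "(\<lambda>n. y - (y * p n + sqrt (p n) * sqrt C)) \<longlonglongrightarrow> y - (y * 0 + sqrt 0 * sqrt C)"
      by (intro tendsto_intros p)
    then show "(\<lambda>n. y - (y * p n + sqrt (p n) * sqrt C)) \<longlonglongrightarrow> y" by simp
  qed simp
qed

text \<open>The event of never hitting is contained in every \<open>unhit\<close>, and those have
  probability at most \<open>y\<close> divided by the horizon.\<close>

lemma hit_exists: "AE \<omega> in N. I 0 \<omega> = 0 \<and> (\<exists>s\<ge>0. y - s + I s \<omega> \<le> 0)"
proof -
  define U where "U = (\<Inter>n. unhit (real (Suc n)))"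
  have US: "U \<in> sets N" unfolding U_def using unhit_sets by (intro sets.countable_INT) auto
  have "prob U \<le> y * inverse (real (Suc n))" for n
  proof -
    have "prob U \<le> prob (unhit (real (Suc n)))"
      using unhit_sets by (intro finite_measure_mono) (auto simp: U_def)
    also have "\<dots> \<le> y / real (Suc n)" by (intro prob_unhit_le) simp
    finally show ?thesis by (simp add: divide_inverse)
  qed
  moreover have "(\<lambda>n. y * inverse (real (Suc n))) \<longlonglongrightarrow> 0"
    using tendsto_mult[OF tendsto_const[of y] LIMSEQ_inverse_real_of_nat] by simp
  ultimately have "prob U \<le> 0" by (intro LIMSEQ_le_const[of _ 0]) auto
  then have "prob U = 0" using measure_nonneg[of N U] by linarith
  then have "AE \<omega> in N. \<omega> \<notin> U" using US by (simp add: prob_eq_0)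
  with I0 show ?thesis using AE_space
  proof eventually_elim
    case (elim \<omega>)
    then obtain n where "\<omega> \<notin> unhit (real (Suc n))" by (auto simp: U_def)
    then show ?case using elim by (auto simp: unhit_def not_less)
  qed
qed

text \<open>For almost every path the capped times are eventually constant and not merely
  convergent, so the values of \<open>W\<close> at them become constant as well.\<close>

lemma capped_eventually_hit:
  "AE \<omega> in N. incseq (\<lambda>n. capped (real (Suc n)) \<omega>) \<and> (\<forall>\<^sub>F n in sequentially. capped (real (Suc n)) \<omega> = hit y (\<lambda>t. I t \<omega>))"
  using hit_exists AE_space
proof eventually_elim
  case (elim \<omega>)
  then obtain s where s: "0 \<le> s" "y - s + I s \<omega> \<le> 0" by auto
  obtain m :: nat where m: "s \<le> real m" using real_arch_simple by blast
  have "capped (real (Suc n)) \<omega> = hit y (\<lambda>t. I t \<omega>)" if "m \<le> n" for n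
    unfolding capped_def using elim m that y s
    by (intro hit_eq_exit_time[where s = s, symmetric] l2_martingaleD[OF I]) auto
  moreover have "incseq (\<lambda>n. capped (real (Suc n)) \<omega>)"
    unfolding capped_def by (intro incseq_SucI exit_time_mono drift_continuous elim) auto
  ultimately show ?case unfolding eventually_sequentially by blast
qed

lemma hit_tendsto: "AE \<omega> in N. (\<lambda>n. capped (real (Suc n)) \<omega>) \<longlonglongrightarrow> hit y (\<lambda>t. I t \<omega>)"
  using capped_eventually_hit by eventually_elim (auto intro: tendsto_eventually)

lemma hit_measurable: "(\<lambda>\<omega>. hit y (\<lambda>t. I t \<omega>)) \<in> borel_measurable N"
proof (rule complete_AE_measurable)
  have "(\<lambda>\<omega>. capped (real (Suc n)) \<omega>) \<in> borel_measurable N" for n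
    using capped_integrable[of "real (Suc n)"] by auto
  then show "(\<lambda>\<omega>. lim (\<lambda>n. capped (real (Suc n)) \<omega>)) \<in> borel_measurable N"
    by (rule borel_measurable_lim_metric)
  show "AE \<omega> in N. lim (\<lambda>n. capped (real (Suc n)) \<omega>) = hit y (\<lambda>t. I t \<omega>)"
    using hit_tendsto by eventually_elim (rule limI)
qed simp

text \<open>The capped times increase, so by monotone convergence the limit of their means is the
  mean of their limit.\<close>

theorem hit_mean: "integrable N (\<lambda>\<omega>. hit y (\<lambda>t. I t \<omega>))" "(\<integral>\<omega>. hit y (\<lambda>t. I t \<omega>) \<partial>N) = y"
proof -
  have i: "integrable N (\<lambda>\<omega>. capped (real (Suc n)) \<omega>)" for n
    by (rule capped_integrable) simp
  have m: "AE \<omega> in N. mono (\<lambda>n. capped (real (Suc n)) \<omega>)"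
    using capped_eventually_hit by eventually_elim simp
  note * = integral_monotone_convergence[OF i m hit_tendsto capped_mean_tendsto hit_measurable]
    integrable_monotone_convergence[OF i m hit_tendsto capped_mean_tendsto hit_measurable]
  show "integrable N (\<lambda>\<omega>. hit y (\<lambda>t. I t \<omega>))" "(\<integral>\<omega>. hit y (\<lambda>t. I t \<omega>) \<partial>N) = y"
    using * by auto
qed

lemma hit_path:
  "AE \<omega> in N. 0 \<le> hit y (\<lambda>t. I t \<omega>) \<and> y - hit y (\<lambda>t. I t \<omega>) + I (hit y (\<lambda>t. I t \<omega>)) \<omega> = 0
     \<and> (\<forall>s. 0 \<le> s \<longrightarrow> s < hit y (\<lambda>t. I t \<omega>) \<longrightarrow> 0 < y - s + I s \<omega>)"
  using hit_exists AE_space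
proof eventually_elim
  case (elim \<omega>)
  then obtain s where s: "0 \<le> s" "y - s + I s \<omega> \<le> 0" by auto
  have eq: "hit y (\<lambda>t. I t \<omega>) = exit_time (\<lambda>t. y - t + I t \<omega>) s"
    using elim y s by (intro hit_eq_exit_time[where s = s] l2_martingaleD[OF I]) auto
  show ?case
    unfolding eq using elim s y exit_time_zero[OF drift_continuous[of \<omega>], of s s] exit_time_bounds[OF s(1)]
      exit_time_positive[of _ "\<lambda>t. y - t + I t \<omega>" s] by auto
qed

text \<open>An equality is needed where Fatou's lemma alone would give an inequality. Wald's
  identity for two capped times bounds the second moment of the remaining displacement by what the
  mean of \<open>c n\<close> still lacks to \<open>y\<close>, and this tends to zero.\<close>

theorem wald_hit:
  shows "sq_integrable N (\<lambda>\<omega>. W (hit y (\<lambda>t. I t \<omega>)) \<omega> - W 0 \<omega>)"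
    "(\<integral>\<omega>. (W (hit y (\<lambda>t. I t \<omega>)) \<omega> - W 0 \<omega>)\<^sup>2 \<partial>N) = y"
proof -
  let ?h = "\<lambda>\<omega>. hit y (\<lambda>t. I t \<omega>)"
  define c where "c n = capped (real (Suc n))" for n
  define Wn where "Wn n \<omega> = W (c n \<omega>) \<omega> - W 0 \<omega>" for n \<omega>
  have st: "bounded_stopping (real (Suc m)) (c n)" if "n \<le> m" for n m
    unfolding c_def using that by (intro bounded_stopping_mono[OF capped_stopping]) auto
  have cn: "integrable N (c n)" for n unfolding c_def by (rule capped_integrable) simp
  have inc: "AE \<omega> in N. incseq (\<lambda>n. c n \<omega>)" using capped_eventually_hit unfolding c_def by eventually_elim simp
  have Wlim: "AE \<omega> in N. (\<lambda>n. W (c n \<omega>) \<omega>) \<longlonglongrightarrow> W (?h \<omega>) \<omega>"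
    using capped_eventually_hit unfolding c_def
  proof eventually_elim
    case (elim \<omega>)
    then have "\<forall>\<^sub>F n in sequentially. W (capped (real (Suc n)) \<omega>) \<omega> = W (?h \<omega>) \<omega>"
      by (auto elim: eventually_mono)
    then show ?case by (rule tendsto_eventually)
  qed
  have Wc: "(\<lambda>\<omega>. W (c n \<omega>) \<omega>) \<in> borel_measurable N" for n
    by (rule sample_measurable_N[OF W_adapted W_continuous st[OF order_refl]])
  have Wh: "(\<lambda>\<omega>. W (?h \<omega>) \<omega>) \<in> borel_measurable N"
  proof (rule complete_AE_measurable)
    show "(\<lambda>\<omega>. lim (\<lambda>n. W (c n \<omega>) \<omega>)) \<in> borel_measurable N"
      by (rule borel_measurable_lim_metric[OF Wc])
    show "AE \<omega> in N. lim (\<lambda>n. W (c n \<omega>) \<omega>) = W (?h \<omega>) \<omega>"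
      using Wlim by eventually_elim (rule limI)
  qed simp
  have W0: "(\<lambda>\<omega>. W 0 \<omega>) \<in> borel_measurable N" by (rule W_measurable) simp
  have step: "sq_integrable N (\<lambda>\<omega>. W (?h \<omega>) \<omega> - W (c n \<omega>) \<omega>) \<and>
      (\<integral>\<omega>. (W (?h \<omega>) \<omega> - W (c n \<omega>) \<omega>)\<^sup>2 \<partial>N) \<le> y - (\<integral>\<omega>. c n \<omega> \<partial>N)" for n
  proof -
    define X where "X k \<omega> = W (c (k + n) \<omega>) \<omega> - W (c n \<omega>) \<omega>" for k \<omega>
    note w = wald[OF st[OF order_refl] st[of n "_ + n"], simplified]
    have Xsq: "sq_integrable N (X k)" for k unfolding X_def[abs_def] by (rule w)
    have bd: "(\<integral>\<omega>. (X k \<omega>)\<^sup>2 \<partial>N) \<le> y - (\<integral>\<omega>. c n \<omega> \<partial>N)" for k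
    proof -
      have "(\<integral>\<omega>. (X k \<omega>)\<^sup>2 \<partial>N) = (\<integral>\<omega>. \<bar>c (k + n) \<omega> - c n \<omega>\<bar> \<partial>N)" unfolding X_def by (rule w)
      also have "\<dots> = (\<integral>\<omega>. c (k + n) \<omega> - c n \<omega> \<partial>N)"
      proof (rule integral_cong_AE)
        show "AE \<omega> in N. \<bar>c (k + n) \<omega> - c n \<omega>\<bar> = c (k + n) \<omega> - c n \<omega>"
          using inc by eventually_elim (auto dest: incseqD[of _ n "k + n"])
      qed (use cn[THEN borel_measurable_integrable] in auto)
      also have "\<dots> = (\<integral>\<omega>. c (k + n) \<omega> \<partial>N) - (\<integral>\<omega>. c n \<omega> \<partial>N)" using cn by simp
      also have "(\<integral>\<omega>. c (k + n) \<omega> \<partial>N) \<le> y" unfolding c_def by (rule capped_mean_le) simp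
      finally show ?thesis by simp
    qed
    have lim: "AE \<omega> in N. (\<lambda>k. X k \<omega>) \<longlonglongrightarrow> W (?h \<omega>) \<omega> - W (c n \<omega>) \<omega>"
      using Wlim
    proof eventually_elim
      case (elim \<omega>)
      from LIMSEQ_ignore_initial_segment[OF this, of n] show ?case
        unfolding X_def by (intro tendsto_intros) simp
    qed
    have "(\<lambda>\<omega>. W (?h \<omega>) \<omega> - W (c n \<omega>) \<omega>) \<in> borel_measurable N" using Wh Wc by simp
    from L2_bounded_tendsto_L1(1,2)[OF Xsq this bd lim] show ?thesis by simp
  qed
  have Wnsq: "sq_integrable N (Wn n)" and Wnint: "(\<integral>\<omega>. (Wn n \<omega>)\<^sup>2 \<partial>N) = (\<integral>\<omega>. c n \<omega> \<partial>N)" for n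
  proof -
    have T: "0 < real (Suc n)" by simp
    note w = wald[OF st[OF order_refl] bounded_stopping_zero[OF T]]
    show "sq_integrable N (Wn n)" unfolding Wn_def[abs_def] by (rule w)
    have "(\<integral>\<omega>. (Wn n \<omega>)\<^sup>2 \<partial>N) = (\<integral>\<omega>. \<bar>c n \<omega> - 0\<bar> \<partial>N)" unfolding Wn_def by (rule w)
    also have "\<dots> = (\<integral>\<omega>. c n \<omega> \<partial>N)"
      using bounded_stoppingD(2)[OF st[OF order_refl]] by (intro Bochner_Integration.integral_cong) auto
    finally show "(\<integral>\<omega>. (Wn n \<omega>)\<^sup>2 \<partial>N) = (\<integral>\<omega>. c n \<omega> \<partial>N)" .
  qed
  have "(\<lambda>\<omega>. W (?h \<omega>) \<omega> - W 0 \<omega>) = (\<lambda>\<omega>. (W (?h \<omega>) \<omega> - W (c 0 \<omega>) \<omega>) + Wn 0 \<omega>)"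
    by (simp add: Wn_def)
  then show sq: "sq_integrable N (\<lambda>\<omega>. W (?h \<omega>) \<omega> - W 0 \<omega>)"
    using sq_integrable_add[OF conjunct1[OF step[of 0]] Wnsq[of 0]] by simp
  have "(\<lambda>n. \<integral>\<omega>. (Wn n \<omega>)\<^sup>2 \<partial>N) \<longlonglongrightarrow> (\<integral>\<omega>. (W (?h \<omega>) \<omega> - W 0 \<omega>)\<^sup>2 \<partial>N)"
  proof (rule L2_tendsto_sq[OF Wnsq sq], rule tendsto_sandwich[of "\<lambda>_. 0"])
    have eq: "(\<integral>\<omega>. (Wn n \<omega> - (W (?h \<omega>) \<omega> - W 0 \<omega>))\<^sup>2 \<partial>N) = (\<integral>\<omega>. (W (?h \<omega>) \<omega> - W (c n \<omega>) \<omega>)\<^sup>2 \<partial>N)" for n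
      by (intro Bochner_Integration.integral_cong) (auto simp: Wn_def power2_commute)
    show "\<forall>\<^sub>F n in sequentially. (\<integral>\<omega>. (Wn n \<omega> - (W (?h \<omega>) \<omega> - W 0 \<omega>))\<^sup>2 \<partial>N) \<le> y - (\<integral>\<omega>. c n \<omega> \<partial>N)"
      unfolding eq using step by simp
    show "(\<lambda>n. y - (\<integral>\<omega>. c n \<omega> \<partial>N)) \<longlonglongrightarrow> 0"
      using tendsto_diff[OF tendsto_const[of y] capped_mean_tendsto] by (simp add: c_def)
  qed simp_all
  moreover have "(\<lambda>n. \<integral>\<omega>. (Wn n \<omega>)\<^sup>2 \<partial>N) \<longlonglongrightarrow> y"
    unfolding Wnint c_def by (rule capped_mean_tendsto)
  ultimately show "(\<integral>\<omega>. (W (?h \<omega>) \<omega> - W 0 \<omega>)\<^sup>2 \<partial>N) = y" by (rule LIMSEQ_unique)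
qed

end

lemma W_hit_measurable:
  assumes "l2_martingale I C" "AE \<omega> in N. I 0 \<omega> = 0" "0 \<le> y"
  shows "(\<lambda>\<omega>. W (hit y (\<lambda>t. I t \<omega>)) \<omega>) \<in> borel_measurable N"
proof -
  have "(\<lambda>\<omega>. (W (hit y (\<lambda>t. I t \<omega>)) \<omega> - W 0 \<omega>) + W 0 \<omega>) \<in> borel_measurable N"
    using wald_hit(1)[OF assms] W_measurable[of 0] by (intro borel_measurable_add) (auto simp: sq_integrable_def)
  then show ?thesis by simp
qed

text \<open>
  Uniform convergence only gives \<open>liminf \<tau>\<^sub>k \<ge> \<tau>\<close>, but since all hitting times have the same mean this
  already forces convergence in \<open>L\<^sup>1\<close>.
\<close>

theorem hit_stability:
  assumes I: "l2_martingale I C" "AE \<omega> in N. I 0 \<omega> = 0" and y: "0 \<le> y"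
    and J: "\<And>k. l2_martingale (J k) (D k)" "\<And>k. AE \<omega> in N. J k 0 \<omega> = 0"
    and lim: "\<And>t. 0 \<le> t \<Longrightarrow> (\<lambda>k. \<integral>\<omega>. (J k t \<omega> - I t \<omega>)\<^sup>2 \<partial>N) \<longlonglongrightarrow> 0"
  shows "\<exists>r :: nat \<Rightarrow> nat. (\<forall>j. j \<le> r j) \<and>
    (AE \<omega> in N. (\<lambda>j. W (hit y (\<lambda>t. J (r j) t \<omega>)) \<omega>) \<longlonglongrightarrow> W (hit y (\<lambda>t. I t \<omega>)) \<omega>)"
proof -
  let ?h = "\<lambda>\<omega>. hit y (\<lambda>t. I t \<omega>)"
  \<comment> \<open>The maximal inequality at level \<open>(1/2) ^ j\<close> divides by
    \<open>(1/4) ^ j\<close>, so the rate \<open>(1/8) ^ j\<close> leaves the summable bound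
    \<open>(1/2) ^ j\<close>. The horizon \<open>Suc j\<close> grows so that every time is
    eventually covered.\<close>
  have "\<exists>k\<ge>j. (\<integral>\<omega>. (J k (real (Suc j)) \<omega> - I (real (Suc j)) \<omega>)\<^sup>2 \<partial>N) < (1/8) ^ j" for j
  proof -
    have "\<forall>\<^sub>F k in sequentially. (\<integral>\<omega>. (J k (real (Suc j)) \<omega> - I (real (Suc j)) \<omega>)\<^sup>2 \<partial>N) < (1/8) ^ j"
      by (rule order_tendstoD(2)[OF lim]) auto
    then have "\<forall>\<^sub>F k in sequentially. j \<le> k \<and> (\<integral>\<omega>. (J k (real (Suc j)) \<omega> - I (real (Suc j)) \<omega>)\<^sup>2 \<partial>N) < (1/8) ^ j"
      by (intro eventually_conj eventually_ge_at_top)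
    then show ?thesis by (auto simp: eventually_sequentially)
  qed
  then obtain q where q: "\<And>j. j \<le> q j"
    "\<And>j. (\<integral>\<omega>. (J (q j) (real (Suc j)) \<omega> - I (real (Suc j)) \<omega>)\<^sup>2 \<partial>N) < (1/8) ^ j" by metis
  define B where "B j = {\<omega> \<in> space N. \<exists>t\<in>{0..real (Suc j)}. (1/2) ^ j < \<bar>J (q j) t \<omega> - I t \<omega>\<bar>}" for j
  have B: "B j \<in> sets N" "prob (B j) \<le> (1/2) ^ j" for j
  proof -
    note m = maximal_inequality[OF l2_martingale_diff[OF J(1)[of "q j"] I(1)], of "real (Suc j)" "(1/2) ^ j"]
    show "B j \<in> sets N" unfolding B_def by (rule m) auto
    have "prob (B j) \<le> (\<integral>\<omega>. (J (q j) (real (Suc j)) \<omega> - I (real (Suc j)) \<omega>)\<^sup>2 \<partial>N) / ((1/2) ^ j)\<^sup>2"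
      unfolding B_def by (rule m) auto
    also have "\<dots> \<le> (1/8) ^ j / ((1/2) ^ j)\<^sup>2" using q(2)[of j] by (intro divide_right_mono) auto
    also have "\<dots> = (1/2) ^ j"
    proof -
      have "(1/8 :: real) ^ j = (1/2) ^ j * ((1/2) ^ j)\<^sup>2"
        unfolding power2_eq_square power_mult_distrib[symmetric] by simp
      then show ?thesis by simp
    qed
    finally show "prob (B j) \<le> (1/2) ^ j" .
  qed
  have BC: "AE \<omega> in N. \<forall>\<^sub>F j in sequentially. \<omega> \<in> space N - B j"
  proof (rule borel_cantelli_AE1[OF B(1)])
    show "summable (\<lambda>j. measure N (B j))"
      by (rule summable_comparison_test[OF _ summable_geometric[of "1/2 :: real"]]) (use B(2) in auto)
  qed (simp add: emeasure_eq_measure)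
  define \<tau> where "\<tau> j \<omega> = hit y (\<lambda>t. J (q j) t \<omega>)" for j \<omega>
  have \<tau>: "integrable N (\<tau> j)" "(\<integral>\<omega>. \<tau> j \<omega> \<partial>N) = y" for j
    unfolding \<tau>_def[abs_def] using hit_mean[OF J(1)[of "q j"] J(2) y] by auto
  note h = hit_mean[OF I y]
  have \<tau>path: "AE \<omega> in N. \<forall>j. 0 \<le> \<tau> j \<omega> \<and> y - \<tau> j \<omega> + J (q j) (\<tau> j \<omega>) \<omega> = 0"
    unfolding AE_all_countable
  proof
    fix j show "AE \<omega> in N. 0 \<le> \<tau> j \<omega> \<and> y - \<tau> j \<omega> + J (q j) (\<tau> j \<omega>) \<omega> = 0"
      using hit_path[OF J(1)[of "q j"] J(2) y] unfolding \<tau>_def by eventually_elim simp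
  qed
  \<comment> \<open>Up to any time \<open>s\<close> before the limiting hitting time, the drifted
    limit path has a positive minimum; once the approximation error is below it, the approximating
    path has no zero up to \<open>s\<close>.\<close>
  have below: "AE \<omega> in N. (\<lambda>j. max 0 (?h \<omega> - \<tau> j \<omega>)) \<longlonglongrightarrow> 0"
    using BC \<tau>path hit_path[OF I y] AE_space
  proof eventually_elim
    case (elim \<omega>)
    show ?case
    proof (rule LIMSEQ_I)
      fix r :: real assume r: "0 < r"
      define s where "s = ?h \<omega> - r / 2"
      show "\<exists>n0. \<forall>n\<ge>n0. norm (max 0 (?h \<omega> - \<tau> n \<omega>) - 0) < r"
      proof (cases "0 \<le> s")
        case False
        have "norm (max 0 (?h \<omega> - \<tau> n \<omega>) - 0) < r" for n
        proof -
          have "0 \<le> \<tau> n \<omega>" using elim(2) by simp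
          then show ?thesis using False r by (simp add: s_def)
        qed
        then show ?thesis by blast
      next
        case True
        have "continuous_on {0..s} (\<lambda>t. y - t + I t \<omega>)"
          by (rule continuous_on_subset[OF drift_continuous[OF I y elim(4)]]) auto
        then obtain a where a: "a \<in> {0..s}" "\<And>t. t \<in> {0..s} \<Longrightarrow> y - a + I a \<omega> \<le> y - t + I t \<omega>"
          using continuous_attains_inf[of "{0..s}" "\<lambda>t. y - t + I t \<omega>"] True by auto
        have pos: "0 < y - a + I a \<omega>" using elim(3) a(1) r by (auto simp: s_def)
        have "(\<lambda>j. (1/2 :: real) ^ j) \<longlonglongrightarrow> 0" by (rule LIMSEQ_power_zero) simp
        then have "\<forall>\<^sub>F j in sequentially. (1/2 :: real) ^ j < y - a + I a \<omega>"
          by (rule order_tendstoD(2)[OF _ pos])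
        moreover have "\<forall>\<^sub>F j in sequentially. s \<le> real j"
          using filterlim_real_sequentially by (simp add: filterlim_at_top)
        ultimately have "\<forall>\<^sub>F j in sequentially. s < \<tau> j \<omega>"
          using elim(1)
        proof eventually_elim
          case (elim j)
          note e = this and p = \<open>\<forall>j. 0 \<le> \<tau> j \<omega> \<and> y - \<tau> j \<omega> + J (q j) (\<tau> j \<omega>) \<omega> = 0\<close>
          show ?case
          proof (rule ccontr)
            assume "\<not> s < \<tau> j \<omega>"
            then have t: "\<tau> j \<omega> \<in> {0..s}" using p by auto
            then have "\<bar>J (q j) (\<tau> j \<omega>) \<omega> - I (\<tau> j \<omega>) \<omega>\<bar> \<le> (1/2) ^ j"
              using e(2,3) unfolding B_def by (force simp: not_less)
            then show False using a(2)[OF t] e(1) p by (smt (verit))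
          qed
        qed
        then obtain n0 where "\<And>n. n \<ge> n0 \<Longrightarrow> s < \<tau> n \<omega>" by (auto simp: eventually_sequentially)
        then show ?thesis using r unfolding s_def by (intro exI[of _ n0]) (force simp: max_def)
      qed
    qed
  qed
  have "(\<lambda>j. \<integral>\<omega>. max 0 (?h \<omega> - \<tau> j \<omega>) \<partial>N) \<longlonglongrightarrow> (\<integral>\<omega>. 0 \<partial>N)"
  proof (rule integral_dominated_convergence[where w = "?h"])
    show "AE \<omega> in N. norm (max 0 (?h \<omega> - \<tau> j \<omega>)) \<le> ?h \<omega>" for j
      using \<tau>path hit_path[OF I y] by eventually_elim (auto simp: max_def)
  qed (use below \<tau>(1) h(1) in \<open>auto dest: borel_measurable_integrable\<close>)
  then have below1: "(\<lambda>j. \<integral>\<omega>. max 0 (?h \<omega> - \<tau> j \<omega>) \<partial>N) \<longlonglongrightarrow> 0" by simp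
  \<comment> \<open>The absolute difference is twice the positive part of
    \<open>?h \<omega> - \<tau> j \<omega>\<close> plus
    \<open>\<tau> j \<omega> - ?h \<omega>\<close>, and the last term has mean zero because both
    means are \<open>y\<close>.\<close>
  have "(\<integral>\<omega>. norm (\<tau> j \<omega> - ?h \<omega>) \<partial>N) = 2 * (\<integral>\<omega>. max 0 (?h \<omega> - \<tau> j \<omega>) \<partial>N)" for j
  proof -
    have "(\<integral>\<omega>. norm (\<tau> j \<omega> - ?h \<omega>) \<partial>N) = (\<integral>\<omega>. 2 * max 0 (?h \<omega> - \<tau> j \<omega>) + (\<tau> j \<omega> - ?h \<omega>) \<partial>N)"
      by (intro Bochner_Integration.integral_cong) (auto simp: max_def)
    also have "\<dots> = 2 * (\<integral>\<omega>. max 0 (?h \<omega> - \<tau> j \<omega>) \<partial>N)"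
      using \<tau>[of j] h by simp
    finally show ?thesis .
  qed
  then have "(\<lambda>j. \<integral>\<omega>. norm (\<tau> j \<omega> - ?h \<omega>) \<partial>N) \<longlonglongrightarrow> 0"
    using tendsto_mult[OF tendsto_const[of 2] below1] by simp
  \<comment> \<open>Convergence in mean gives almost sure convergence along a further subsequence,
    and continuity of \<open>W\<close> transfers it to the terminal values.\<close>
  from tendsto_L1_AE_subseq[OF _ this] \<tau>(1) h(1)
  obtain r :: "nat \<Rightarrow> nat" where r: "strict_mono r" "AE \<omega> in N. (\<lambda>n. \<tau> (r n) \<omega> - ?h \<omega>) \<longlonglongrightarrow> 0" by auto
  show ?thesis
  proof (intro exI[of _ "\<lambda>j. q (r j)"] conjI allI)
    show "j \<le> q (r j)" for j using q(1)[of "r j"] seq_suble[OF r(1), of j] by linarith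
    show "AE \<omega> in N. (\<lambda>j. W (hit y (\<lambda>t. J (q (r j)) t \<omega>)) \<omega>) \<longlonglongrightarrow> W (?h \<omega>) \<omega>"
      using r(2) \<tau>path hit_path[OF I y] AE_space
    proof eventually_elim
      case (elim \<omega>)
      have "(\<lambda>n. \<tau> (r n) \<omega>) \<longlonglongrightarrow> ?h \<omega>" using elim(1) by (simp add: LIM_zero_iff)
      then show ?case unfolding \<tau>_def[symmetric]
        by (rule continuous_on_tendsto_compose[OF W_continuous[OF elim(4)]]) (use elim in auto)
    qed
  qed
qed

end

section \<open>Averaging over the preceding grid cell\<close>

text \<open>
  Averaging over the preceding cell, rather than over the current one, keeps the approximation adapted.
\<close>

definition cell_kernel :: "nat \<Rightarrow> real \<Rightarrow> real \<Rightarrow> real" where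
  "cell_kernel n s u = (if \<lceil>real n * u\<rceil> + 1 = \<lceil>real n * s\<rceil> then real n else 0)"

lemma cell_kernel_measurable [measurable]:
  "case_prod (cell_kernel n) \<in> borel_measurable (borel \<Otimes>\<^sub>M borel)"
  unfolding cell_kernel_def by measurable

lemma cell_kernel_measurable1 [measurable]: "cell_kernel n s \<in> borel_measurable borel"
  unfolding cell_kernel_def[abs_def] by measurable

lemma cell_kernel_nonneg [simp]: "0 \<le> cell_kernel n s u"
  by (simp add: cell_kernel_def)

lemma cell_kernel_eq1:
  assumes "0 < n"
  shows "cell_kernel n s u = real n * indicator {(of_int \<lceil>real n * s\<rceil> - 2) / real n<..(of_int \<lceil>real n * s\<rceil> - 1) / real n} u"
proof -
  have "\<lceil>real n * u\<rceil> + 1 = \<lceil>real n * s\<rceil> \<longleftrightarrow> \<lceil>real n * u\<rceil> = \<lceil>real n * s\<rceil> - 1" by linarith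
  also have "\<dots> \<longleftrightarrow> u \<in> {(of_int \<lceil>real n * s\<rceil> - 2) / real n<..(of_int \<lceil>real n * s\<rceil> - 1) / real n}"
    unfolding ceiling_eq_iff using assms by (auto simp: field_simps)
  finally show ?thesis by (auto simp: cell_kernel_def indicator_def)
qed

lemma cell_kernel_eq2:
  assumes "0 < n"
  shows "cell_kernel n s u = real n * indicator {of_int \<lceil>real n * u\<rceil> / real n<..(of_int \<lceil>real n * u\<rceil> + 1) / real n} s"
proof -
  have "\<lceil>real n * u\<rceil> + 1 = \<lceil>real n * s\<rceil> \<longleftrightarrow> \<lceil>real n * s\<rceil> = \<lceil>real n * u\<rceil> + 1" by auto
  also have "\<dots> \<longleftrightarrow> s \<in> {of_int \<lceil>real n * u\<rceil> / real n<..(of_int \<lceil>real n * u\<rceil> + 1) / real n}"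
    unfolding ceiling_eq_iff using assms by (auto simp: field_simps)
  finally show ?thesis by (auto simp: cell_kernel_def indicator_def)
qed

lemma nn_integral_scaled_cell:
  assumes "0 < n" "b = a + 1 / real n"
  shows "(\<integral>\<^sup>+u. ennreal (real n * indicator {a<..b} u) \<partial>lborel) = 1"
proof -
  have "(\<integral>\<^sup>+u. ennreal (real n * indicator {a<..b} u) \<partial>lborel) = (\<integral>\<^sup>+u. ennreal (real n) * indicator {a<..b} u \<partial>lborel)"
    by (intro nn_integral_cong) (simp add: indicator_def)
  also have "\<dots> = ennreal (real n) * ennreal (1 / real n)"
    using assms by (subst nn_integral_cmult_indicator) auto
  also have "\<dots> = 1" using assms by (subst ennreal_mult[symmetric]) auto
  finally show ?thesis .
qed

text \<open>In \<open>u\<close> the total mass one makes the kernel an average; in \<open>s\<close>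
  it makes averaging a contraction in \<open>L1\<close>, which controls the approximation error
  after the integrals are exchanged.\<close>

lemma cell_kernel_integral:
  assumes n: "0 < n"
  shows "(\<integral>\<^sup>+u. ennreal (cell_kernel n s u) \<partial>lborel) = 1" "(\<integral>\<^sup>+s. ennreal (cell_kernel n s u) \<partial>lborel) = 1"
  unfolding cell_kernel_eq1[OF n, of s] cell_kernel_eq2[OF n, of _ u] using n
  by (auto intro!: nn_integral_scaled_cell simp: field_simps)

lemma cell_kernel_dist:
  assumes "0 < n" "cell_kernel n s u \<noteq> 0" shows "\<bar>u - s\<bar> \<le> 2 / real n"
proof -
  have eq: "\<lceil>real n * u\<rceil> + 1 = \<lceil>real n * s\<rceil>" using assms by (auto simp: cell_kernel_def split: if_splits)
  have "real n * \<bar>u - s\<bar> = \<bar>real n * u - real n * s\<bar>" using assms(1) by (simp add: abs_mult right_diff_distrib[symmetric])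
  also have "\<dots> \<le> 2" using eq by linarith
  finally show ?thesis using assms(1) by (simp add: field_simps)
qed

text \<open>\<open>measurable_on\<close> supplies continuous functions that converge almost
  everywhere. Clamping them to \<open>{-R..R}\<close> and multiplying by a cutoff provides an
  integrable bound without spoiling the limit.\<close>

lemma continuous_L1_approx:
  fixes f :: "real \<Rightarrow> real"
  assumes f: "f \<in> borel_measurable borel" and R: "0 < R" and bd: "\<And>u. \<bar>f u\<bar> \<le> R"
    and supp: "\<And>u. u \<notin> {0..R} \<Longrightarrow> f u = 0" and e: "0 < e"
  shows "\<exists>g. continuous_on UNIV g \<and> (\<forall>u. u \<notin> {-1..R+1} \<longrightarrow> g u = 0) \<and>
    (\<integral>\<^sup>+u. ennreal \<bar>f u - g u\<bar> \<partial>lborel) < ennreal e"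
proof -
  note [measurable] = f
  have "f measurable_on UNIV" using f by (intro lebesgue_measurable_imp_measurable_on) (auto simp: measurable_completion)
  then obtain K g where K: "negligible K" and g: "\<And>n. continuous_on UNIV (g n)"
    and lim: "\<And>u. u \<notin> K \<Longrightarrow> (\<lambda>n. g n u) \<longlonglongrightarrow> f u"
    by (auto simp: measurable_on_def)
  \<comment> \<open>A trapezoid: 1 on \<open>{0..R}\<close> and 0 outside
    \<open>{-1..R+1}\<close>.\<close>
  define \<phi> where "\<phi> u = max 0 (min 1 (min (u + 1) (R + 1 - u)))" for u :: real
  define h where "h n u = \<phi> u * max (- R) (min R (g n u))" for n u
  have hc: "continuous_on UNIV (h n)" for n unfolding h_def \<phi>_def by (intro continuous_intros g)
  have [measurable]: "h n \<in> borel_measurable borel" for n using hc by (rule borel_measurable_continuous_onI)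
  have supp_h: "h n u = 0" if "u \<notin> {-1..R+1}" for n u using that by (auto simp: h_def \<phi>_def)
  have "(\<lambda>n. \<integral>\<^sup>+u. ennreal \<bar>f u - h n u\<bar> \<partial>lborel) \<longlonglongrightarrow> (\<integral>\<^sup>+u. 0 \<partial>(lborel :: real measure))"
  proof (rule nn_integral_dominated_convergence[where w = "\<lambda>u. ennreal (2 * R) * indicator {-1..R+1} u"])
    show "(\<integral>\<^sup>+u. ennreal (2 * R) * indicator {-1..R+1} u \<partial>lborel) < \<infinity>"
      using R by (subst nn_integral_cmult_indicator) (auto simp: ennreal_mult_less_top)
    show "AE u in lborel. ennreal \<bar>f u - h n u\<bar> \<le> ennreal (2 * R) * indicator {-1..R+1} u" for n
    proof (rule AE_I2)
      fix u
      show "ennreal \<bar>f u - h n u\<bar> \<le> ennreal (2 * R) * indicator {-1..R+1} u"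
      proof (cases "u \<in> {-1..R+1}")
        case True
        have "\<bar>h n u\<bar> \<le> 1 * R" unfolding h_def abs_mult using R by (intro mult_mono) (auto simp: \<phi>_def)
        then have "\<bar>f u - h n u\<bar> \<le> 2 * R" using bd[of u] by linarith
        then show ?thesis using True by (simp add: ennreal_leI)
      next
        case False
        then have "f u = 0" using R by (intro supp) auto
        then show ?thesis using supp_h[OF False] by simp
      qed
    qed
    have "K \<in> null_sets lebesgue" using K by (simp add: negligible_iff_null_sets)
    then have "AE u in lebesgue. u \<notin> K" by (rule AE_not_in)
    then have "AE u in lborel. u \<notin> K" by (simp add: AE_completion_iff)
    then show "AE u in lborel. (\<lambda>n. ennreal \<bar>f u - h n u\<bar>) \<longlonglongrightarrow> 0"
    proof eventually_elim
      case (elim u)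
      have "(\<lambda>n. \<bar>f u - h n u\<bar>) \<longlonglongrightarrow> \<bar>f u - \<phi> u * max (- R) (min R (f u))\<bar>"
        unfolding h_def by (intro tendsto_intros lim elim)
      also have "\<phi> u * max (- R) (min R (f u)) = f u"
        using supp[of u] bd[of u] R by (cases "u \<in> {0..R}") (auto simp: \<phi>_def)
      finally have "(\<lambda>n. \<bar>f u - h n u\<bar>) \<longlonglongrightarrow> 0" by simp
      from tendsto_ennrealI[OF this] show ?case by simp
    qed
  qed measurable
  then have "\<forall>\<^sub>F n in sequentially. (\<integral>\<^sup>+u. ennreal \<bar>f u - h n u\<bar> \<partial>lborel) < ennreal e"
    using e by (intro order_tendstoD(2)) auto
  then obtain n where "(\<integral>\<^sup>+u. ennreal \<bar>f u - h n u\<bar> \<partial>lborel) < ennreal e"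
    by (auto simp: eventually_sequentially)
  then show ?thesis using hc supp_h by blast
qed

text \<open>The usual three-term estimate: \<open>f\<close> is replaced by a continuous
  \<open>g\<close> at both arguments, each time at the cost of the \<open>L1\<close> distance, and
  uniform continuity of \<open>g\<close> handles the short distance that the kernel allows.\<close>

lemma cell_average_L1:
  fixes f :: "real \<Rightarrow> real"
  assumes f: "f \<in> borel_measurable borel" and R: "0 < R" and bd: "\<And>u. \<bar>f u\<bar> \<le> R"
    and supp: "\<And>u. u \<notin> {0..R} \<Longrightarrow> f u = 0"
  shows "(\<lambda>n. \<integral>\<^sup>+s. \<integral>\<^sup>+u. ennreal (cell_kernel n s u * \<bar>f u - f s\<bar>) \<partial>lborel \<partial>lborel) \<longlonglongrightarrow> 0"
proof (rule order_tendstoI)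
  fix e0 :: ennreal
  assume "0 < e0"
  then obtain e where e: "0 < e" "ennreal e \<le> e0"
    by (metis ennreal_cases ennreal_less_zero_iff linorder_le_cases order_refl top_greatest zero_less_one)
  note [measurable] = f
  \<comment> \<open>The middle term is supported on \<open>{-3..R+3}\<close>, an interval of length
    \<open>R + 6\<close>, so this \<open>\<eta>\<close> makes it cost at most \<open>e / 4\<close>;
    the two outer terms cost at most \<open>e / 4\<close> each.\<close>
  define \<eta> where "\<eta> = e / 4 / (R + 6)"
  have \<eta>: "0 < \<eta>" using e R by (simp add: \<eta>_def)
  obtain g where g: "continuous_on UNIV g" "\<And>u. u \<notin> {-1..R+1} \<Longrightarrow> g u = 0"
    "(\<integral>\<^sup>+u. ennreal \<bar>f u - g u\<bar> \<partial>lborel) < ennreal (e / 4)"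
    using continuous_L1_approx[OF f R bd supp, of "e / 4"] e by auto
  have [measurable]: "g \<in> borel_measurable borel" using g(1) by (rule borel_measurable_continuous_onI)
  have "uniformly_continuous_on {-4..R+4} g"
    by (intro compact_uniformly_continuous continuous_on_subset[OF g(1)]) auto
  then obtain d where d: "0 < d" "\<And>u s. u \<in> {-4..R+4} \<Longrightarrow> s \<in> {-4..R+4} \<Longrightarrow> dist u s < d \<Longrightarrow> dist (g u) (g s) < \<eta>"
    unfolding uniformly_continuous_on_def using \<eta> by metis
  obtain n0 :: nat where n0: "2 / d < real n0" using reals_Archimedean2 by blast
  have "(\<integral>\<^sup>+s. \<integral>\<^sup>+u. ennreal (cell_kernel n s u * \<bar>f u - f s\<bar>) \<partial>lborel \<partial>lborel) < e0" if n: "n \<ge> max 2 n0" for n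
  proof -
    let ?k = "cell_kernel n"
    have n': "0 < n" "2 / real n < d" "2 / real n \<le> 1"
    proof -
      have "2 / d < real n" using n0 n by (auto intro: less_le_trans)
      then show "2 / real n < d" using d(1) n by (simp add: field_simps)
    qed (use n in auto)
    have mid: "?k s u * \<bar>g u - g s\<bar> \<le> ?k s u * (\<eta> * indicator {-3..R+3} s)" for s u
    proof (cases "?k s u = 0")
      case False
      then have us: "\<bar>u - s\<bar> \<le> 2 / real n" using cell_kernel_dist n' by blast
      then have us1: "\<bar>u - s\<bar> \<le> 1" using n' by linarith
      have "\<bar>g u - g s\<bar> \<le> \<eta> * indicator {-3..R+3} s"
      proof (cases "s \<in> {-3..R+3}")
        case True
        then have "dist (g u) (g s) < \<eta>" using us us1 n'(2) by (intro d) (auto simp: dist_real_def)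
        then show ?thesis using True by (simp add: dist_real_def)
      next
        case False
        then have "g u = 0" "g s = 0" using us1 by (auto intro!: g(2))
        then show ?thesis using False by simp
      qed
      then show ?thesis by (intro mult_left_mono) auto
    qed simp
    have "?k s u * \<bar>f u - f s\<bar> \<le> ?k s u * \<bar>f u - g u\<bar> + ?k s u * (\<eta> * indicator {-3..R+3} s) + ?k s u * \<bar>f s - g s\<bar>" for s u
    proof -
      have "?k s u * \<bar>f u - f s\<bar> \<le> ?k s u * (\<bar>f u - g u\<bar> + \<bar>g u - g s\<bar> + \<bar>f s - g s\<bar>)"
        by (intro mult_left_mono) auto
      then show ?thesis using mid[of s u] by (simp add: distrib_left)
    qed
    then have "(\<integral>\<^sup>+s. \<integral>\<^sup>+u. ennreal (?k s u * \<bar>f u - f s\<bar>) \<partial>lborel \<partial>lborel)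
      \<le> (\<integral>\<^sup>+s. \<integral>\<^sup>+u. ennreal (?k s u) * ennreal \<bar>f u - g u\<bar> + ennreal (?k s u) * ennreal (\<eta> * indicator {-3..R+3} s) + ennreal (?k s u) * ennreal \<bar>f s - g s\<bar> \<partial>lborel \<partial>lborel)"
      using \<eta> by (intro nn_integral_mono) (simp add: ennreal_mult[symmetric] ennreal_plus[symmetric] ennreal_leI del: ennreal_plus)
    also have "\<dots> = (\<integral>\<^sup>+s. \<integral>\<^sup>+u. ennreal (?k s u) * ennreal \<bar>f u - g u\<bar> \<partial>lborel \<partial>lborel)
      + (\<integral>\<^sup>+s. ennreal (\<eta> * indicator {-3..R+3} s) \<partial>lborel) + (\<integral>\<^sup>+s. ennreal \<bar>f s - g s\<bar> \<partial>lborel)"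
      using cell_kernel_integral[OF n'(1)]
      by (simp add: nn_integral_add nn_integral_multc)
    also have "(\<integral>\<^sup>+s. \<integral>\<^sup>+u. ennreal (?k s u) * ennreal \<bar>f u - g u\<bar> \<partial>lborel \<partial>lborel)
       = (\<integral>\<^sup>+u. \<integral>\<^sup>+s. ennreal (?k s u) * ennreal \<bar>f u - g u\<bar> \<partial>lborel \<partial>lborel)"
      by (rule lborel_pair.Fubini'[symmetric]) measurable
    also have "\<dots> = (\<integral>\<^sup>+u. ennreal \<bar>f u - g u\<bar> \<partial>lborel)"
      using cell_kernel_integral[OF n'(1)] by (simp add: nn_integral_multc)
    also have "(\<integral>\<^sup>+s. ennreal (\<eta> * indicator {-3..R+3} s) \<partial>lborel) = (\<integral>\<^sup>+s. ennreal \<eta> * indicator {-3..R+3} s \<partial>lborel)"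
      by (intro nn_integral_cong) (simp add: indicator_def)
    also have "\<dots> = ennreal \<eta> * ennreal (R + 6)" using R by (subst nn_integral_cmult_indicator) (auto simp: add.commute)
    also have "\<dots> = ennreal (\<eta> * (R + 6))" using \<eta> R by (intro ennreal_mult[symmetric]) auto
    also have "\<eta> * (R + 6) = e / 4"
    proof -
      have "R + 6 \<noteq> 0" using R by simp
      then show ?thesis by (rule nonzero_eq_divide_eq[THEN iffD1, OF _ \<eta>_def])
    qed
    also have "(\<integral>\<^sup>+u. ennreal \<bar>f u - g u\<bar> \<partial>lborel) + ennreal (e / 4) + (\<integral>\<^sup>+u. ennreal \<bar>f u - g u\<bar> \<partial>lborel)
       \<le> ennreal (e / 4) + ennreal (e / 4) + ennreal (e / 4)"
      using g(3) by (intro add_mono) auto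
    also have "\<dots> = ennreal (3 * e / 4)" using e by (simp add: ennreal_plus[symmetric] del: ennreal_plus)
    also have "\<dots> < ennreal e" using e by (simp add: ennreal_lessI)
    also have "\<dots> \<le> e0" by fact
    finally show ?thesis .
  qed
  then show "\<forall>\<^sub>F n in sequentially. (\<integral>\<^sup>+s. \<integral>\<^sup>+u. ennreal (cell_kernel n s u * \<bar>f u - f s\<bar>) \<partial>lborel \<partial>lborel) < e0"
    unfolding eventually_sequentially by blast
qed simp

text \<open>The kernel is a probability density, and both bounds are instances of the triangle
  inequality for averages.\<close>

lemma kernel_average:
  fixes k f :: "real \<Rightarrow> real"
  assumes k: "k \<in> borel_measurable borel" "\<And>u. 0 \<le> k u" "(\<integral>\<^sup>+u. ennreal (k u) \<partial>lborel) = 1"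
    and f: "f \<in> borel_measurable borel" "\<And>u. \<bar>f u\<bar> \<le> R"
  shows "\<bar>\<integral>u. k u * f u \<partial>lborel\<bar> \<le> R"
    "ennreal \<bar>(\<integral>u. k u * f u \<partial>lborel) - c\<bar> \<le> (\<integral>\<^sup>+u. ennreal (k u * \<bar>f u - c\<bar>) \<partial>lborel)"
proof -
  note [measurable] = k(1) f(1)
  have ik: "integrable lborel k" using k by (intro integrableI_nonneg) auto
  have k1: "(\<integral>u. k u \<partial>lborel) = 1" using k by (subst integral_eq_nn_integral) auto
  have ikf: "integrable lborel (\<lambda>u. k u * f u)"
  proof (rule Bochner_Integration.integrable_bound)
    show "integrable lborel (\<lambda>u. R * k u)" using ik by simp
    show "AE u in lborel. norm (k u * f u) \<le> norm (R * k u)"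
    proof (rule AE_I2)
      fix u
      have "\<bar>k u\<bar> * \<bar>f u\<bar> \<le> \<bar>k u\<bar> * \<bar>R\<bar>" using f(2)[of u] by (intro mult_left_mono) auto
      then show "norm (k u * f u) \<le> norm (R * k u)" by (simp add: abs_mult mult.commute)
    qed
  qed measurable
  have "norm (\<integral>u. k u * f u \<partial>lborel) \<le> (\<integral>u. norm (k u * f u) \<partial>lborel)" by (rule integral_norm_bound)
  also have "\<dots> \<le> (\<integral>u. R * k u \<partial>lborel)"
  proof (rule integral_mono)
    show "norm (k u * f u) \<le> R * k u" for u
      using mult_left_mono[OF f(2)[of u] k(2)[of u]] k(2)[of u] by (simp add: abs_mult mult.commute)
  qed (use ik ikf in auto)
  finally show "\<bar>\<integral>u. k u * f u \<partial>lborel\<bar> \<le> R" using k1 ik by simp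
  have "(\<integral>u. k u * f u \<partial>lborel) - c = (\<integral>u. k u * f u - c * k u \<partial>lborel)" using ik ikf k1 by simp
  also have "\<dots> = (\<integral>u. k u * (f u - c) \<partial>lborel)"
    by (intro Bochner_Integration.integral_cong) (auto simp: algebra_simps)
  finally have eq: "(\<integral>u. k u * f u \<partial>lborel) - c = (\<integral>u. k u * (f u - c) \<partial>lborel)" .
  have "integrable lborel (\<lambda>u. k u * f u - c * k u)" using ik ikf by simp
  then have "integrable lborel (\<lambda>u. k u * (f u - c))" by (simp add: algebra_simps)
  from integral_norm_bound_ennreal[OF this]
  show "ennreal \<bar>(\<integral>u. k u * f u \<partial>lborel) - c\<bar> \<le> (\<integral>\<^sup>+u. ennreal (k u * \<bar>f u - c\<bar>) \<partial>lborel)"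
    unfolding eq using k(2) by (simp add: abs_mult)
qed

section \<open>Step functions built from cell averages\<close>

definition cell_average :: "nat \<Rightarrow> (real \<Rightarrow> real) \<Rightarrow> nat \<Rightarrow> real" where
  "cell_average n f i = (\<integral>u. (real n * indicator {real i / real n<..real (Suc i) / real n} u) * f u \<partial>lborel)"

definition cell_step :: "nat \<Rightarrow> nat \<Rightarrow> (real \<Rightarrow> real) \<Rightarrow> real \<Rightarrow> real" where
  "cell_step n m f s = (\<Sum>i<m. cell_average n f i * indicator {real (Suc i) / real n<..real (Suc (Suc i)) / real n} s)"

lemma cell_average_bound:
  assumes n: "0 < n" and f: "f \<in> borel_measurable borel" "\<And>u. \<bar>f u\<bar> \<le> R"
  shows "\<bar>cell_average n f i\<bar> \<le> R"
  unfolding cell_average_def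
proof (rule kernel_average(1)[OF _ _ _ f])
  show "(\<integral>\<^sup>+u. ennreal (real n * indicator {real i / real n<..real (Suc i) / real n} u) \<partial>lborel) = 1"
    using n by (intro nn_integral_scaled_cell) (auto simp: field_simps)
qed auto

text \<open>On the cell that contains \<open>s\<close> the step function takes the average over the
  cell before, which is the kernel average at \<open>s\<close>. With at least
  \<open>n * (R + 1)\<close> cells the sum reaches past the support of \<open>f\<close>, so nothing
  is lost at the end.\<close>

lemma cell_step_eq:
  assumes n: "0 < n" and m: "n * (R + 1) \<le> m" and s: "0 \<le> s"
    and supp: "\<And>u. u \<notin> {0..real R} \<Longrightarrow> f u = 0"
  shows "cell_step n m f s = (\<integral>u. cell_kernel n s u * f u \<partial>lborel)"
proof -
  \<comment> \<open>The point \<open>s\<close> lies in the cell that ends at \<open>j / n\<close>,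
    so the averaged cell has number \<open>j - 2\<close>, counted from 0; for \<open>j < 2\<close>
    the sum contains no such cell.\<close>
  define j where "j = \<lceil>real n * s\<rceil>"
  have ind: "indicator {real (Suc i) / real n<..real (Suc (Suc i)) / real n} s = (if j = int i + 2 then 1 else 0 :: real)" for i
  proof -
    have "s \<in> {real (Suc i) / real n<..real (Suc (Suc i)) / real n} \<longleftrightarrow> j = int i + 2"
      unfolding j_def ceiling_eq_iff using n by (auto simp: field_simps)
    then show ?thesis by (simp add: indicator_def)
  qed
  have sum: "cell_step n m f s = (\<Sum>i<m. if j = int i + 2 then cell_average n f i else 0)"
    unfolding cell_step_def ind by (intro sum.cong) auto
  have ker: "cell_kernel n s u = real n * indicator {(of_int j - 2) / real n<..(of_int j - 1) / real n} u" for u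
    unfolding j_def by (rule cell_kernel_eq1[OF n])
  consider "j < 2" | "2 \<le> j" "j - 2 < int m" | "int m \<le> j - 2" by linarith
  then show ?thesis
  proof cases
    case 1
    \<comment> \<open>The averaged cell ends at or before 0, where \<open>f\<close> vanishes except
      possibly at the single point 0; hence the identity holds only almost everywhere.\<close>
    have "AE u in lborel. cell_kernel n s u * f u = 0"
      using AE_lborel_singleton[of "0::real"]
    proof eventually_elim
      case (elim u)
      show ?case
      proof (cases "u \<le> (of_int j - 1) / real n")
        case True
        also have "(of_int j - 1) / real n \<le> 0" using 1 n by (simp add: divide_nonpos_pos)
        finally have "f u = 0" using elim by (intro supp) auto
        then show ?thesis by simp
      qed (simp add: ker)
    qed
    then have "(\<integral>u. cell_kernel n s u * f u \<partial>lborel) = 0" by (rule integral_eq_zero_AE)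
    then show ?thesis unfolding sum using 1 by (auto intro!: sum.neutral)
  next
    case 2
    define i where "i = nat (j - 2)"
    have ji: "j = int i + 2" "i < m" using 2 by (auto simp: i_def)
    have "cell_step n m f s = cell_average n f i" unfolding sum ji(1) using ji(2) by simp
    also have "\<dots> = (\<integral>u. cell_kernel n s u * f u \<partial>lborel)"
      unfolding cell_average_def ker by (simp add: ji(1) add.commute)
    finally show ?thesis .
  next
    case 3
    have "cell_kernel n s u * f u = 0" for u
    proof (cases "(of_int j - 2) / real n < u")
      case True
      have "real (n * (R + 1)) \<le> real m" using m by (rule of_nat_mono)
      then have "real n * (real R + 1) \<le> of_int j - 2" using 3 by (simp add: algebra_simps)
      then have "real R + 1 \<le> (of_int j - 2) / real n" using n by (simp add: field_simps)
      then have "f u = 0" using True by (intro supp) auto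
      then show ?thesis by simp
    qed (simp add: ker)
    then have "(\<integral>u. cell_kernel n s u * f u \<partial>lborel) = 0" by (intro integral_eq_zero_AE AE_I2)
    then show ?thesis unfolding sum using 3 by (auto intro!: sum.neutral)
  qed
qed

text \<open>Both functions are bounded by \<open>R\<close>, so the squared difference is at most
  \<open>2 * R\<close> times the absolute difference, and convergence in \<open>L1\<close>
  suffices.\<close>

lemma cell_step_L2:
  assumes f: "f \<in> borel_measurable borel" and bd: "\<And>u. \<bar>f u\<bar> \<le> real R"
    and supp: "\<And>u. u \<notin> {0..real R} \<Longrightarrow> f u = 0" and R: "0 < R"
  shows "(\<lambda>n. \<integral>\<^sup>+s\<in>{0..}. ennreal ((cell_step n (n * (R + 1)) f s - f s)\<^sup>2) \<partial>lborel) \<longlonglongrightarrow> 0"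
proof (rule tendsto_sandwich[of "\<lambda>_. 0"])
  let ?b = "\<lambda>n. ennreal (2 * real R) * (\<integral>\<^sup>+s. \<integral>\<^sup>+u. ennreal (cell_kernel n s u * \<bar>f u - f s\<bar>) \<partial>lborel \<partial>lborel)"
  note [measurable] = f
  show "\<forall>\<^sub>F n in sequentially. (\<integral>\<^sup>+s\<in>{0..}. ennreal ((cell_step n (n * (R + 1)) f s - f s)\<^sup>2) \<partial>lborel) \<le> ?b n"
    using eventually_gt_at_top[of 0]
  proof eventually_elim
    case (elim n)
    have "(\<integral>\<^sup>+s\<in>{0..}. ennreal ((cell_step n (n * (R + 1)) f s - f s)\<^sup>2) \<partial>lborel)
      \<le> (\<integral>\<^sup>+s. ennreal (2 * real R) * (\<integral>\<^sup>+u. ennreal (cell_kernel n s u * \<bar>f u - f s\<bar>) \<partial>lborel) \<partial>lborel)"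
    proof (rule nn_integral_mono)
      fix s
      let ?a = "\<integral>u. cell_kernel n s u * f u \<partial>lborel"
      note ka = kernel_average[OF cell_kernel_measurable1 cell_kernel_nonneg cell_kernel_integral(1)[OF elim] f bd]
      show "ennreal ((cell_step n (n * (R + 1)) f s - f s)\<^sup>2) * indicator {0..} s
        \<le> ennreal (2 * real R) * (\<integral>\<^sup>+u. ennreal (cell_kernel n s u * \<bar>f u - f s\<bar>) \<partial>lborel)"
      proof (cases "0 \<le> s")
        case True
        have "cell_step n (n * (R + 1)) f s = ?a" by (rule cell_step_eq[OF elim order_refl True supp])
        moreover have "(?a - f s)\<^sup>2 \<le> (2 * real R) * \<bar>?a - f s\<bar>"
        proof -
          have "\<bar>?a - f s\<bar> \<le> 2 * real R" using ka(1)[of s] bd[of s] by linarith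
          then have "\<bar>?a - f s\<bar> * \<bar>?a - f s\<bar> \<le> (2 * real R) * \<bar>?a - f s\<bar>" by (rule mult_right_mono) simp
          then show ?thesis by (simp add: power2_eq_square abs_mult_self_eq)
        qed
        ultimately have "ennreal ((cell_step n (n * (R + 1)) f s - f s)\<^sup>2) \<le> ennreal ((2 * real R) * \<bar>?a - f s\<bar>)"
          by (simp add: ennreal_leI)
        also have "\<dots> = ennreal (2 * real R) * ennreal \<bar>?a - f s\<bar>" by (rule ennreal_mult) auto
        also have "\<dots> \<le> ennreal (2 * real R) * (\<integral>\<^sup>+u. ennreal (cell_kernel n s u * \<bar>f u - f s\<bar>) \<partial>lborel)"
          by (intro mult_left_mono ka(2)) simp
        finally show ?thesis using True by simp
      qed simp
    qed
    also have "\<dots> = ?b n" by (rule nn_integral_cmult) measurable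
    finally show ?case .
  qed
  have "?b \<longlonglongrightarrow> ennreal (2 * real R) * 0"
    using R bd supp by (intro ennreal_tendsto_cmult cell_average_L1 f) auto
  then show "?b \<longlonglongrightarrow> 0" by simp
qed simp_all

section \<open>The Ito integral\<close>

text \<open>A crude substitute for the triangle inequality in \<open>L2\<close>, valid also for
  infinite norms; the factors 2 are absorbed by the rates of approximation.\<close>

lemma nn_integral_sq_add_le:
  fixes X Y :: "'b \<Rightarrow> real"
  assumes [measurable]: "X \<in> borel_measurable M" "Y \<in> borel_measurable M"
  shows "(\<integral>\<^sup>+z. ennreal ((X z + Y z)\<^sup>2) \<partial>M) \<le> 2 * (\<integral>\<^sup>+z. ennreal ((X z)\<^sup>2) \<partial>M) + 2 * (\<integral>\<^sup>+z. ennreal ((Y z)\<^sup>2) \<partial>M)"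
proof -
  have "(a + b)\<^sup>2 \<le> 2 * a\<^sup>2 + 2 * b\<^sup>2" for a b :: real
    using zero_le_power2[of "a - b"] by (simp add: power2_eq_square algebra_simps)
  then have "ennreal ((X z + Y z)\<^sup>2) \<le> 2 * ennreal ((X z)\<^sup>2) + 2 * ennreal ((Y z)\<^sup>2)" for z
  proof -
    assume "\<And>a b :: real. (a + b)\<^sup>2 \<le> 2 * a\<^sup>2 + 2 * b\<^sup>2"
    then have "ennreal ((X z + Y z)\<^sup>2) \<le> ennreal (2 * (X z)\<^sup>2 + 2 * (Y z)\<^sup>2)" by (intro ennreal_leI)
    also have "\<dots> = 2 * ennreal ((X z)\<^sup>2) + 2 * ennreal ((Y z)\<^sup>2)" by (simp add: ennreal_mult)
    finally show ?thesis .
  qed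
  then have "(\<integral>\<^sup>+z. ennreal ((X z + Y z)\<^sup>2) \<partial>M) \<le> (\<integral>\<^sup>+z. 2 * ennreal ((X z)\<^sup>2) + 2 * ennreal ((Y z)\<^sup>2) \<partial>M)"
    by (intro nn_integral_mono)
  also have "\<dots> = 2 * (\<integral>\<^sup>+z. ennreal ((X z)\<^sup>2) \<partial>M) + 2 * (\<integral>\<^sup>+z. ennreal ((Y z)\<^sup>2) \<partial>M)"
    by (subst nn_integral_add) (auto simp: nn_integral_cmult)
  finally show ?thesis .
qed

context filtered_bm begin

text \<open>Values at negative times are unconstrained, so they are cut off. The sample point comes
  first in order to match the order of integration in \<open>sqn\<close>.\<close>

definition joint_measurable :: "(real \<Rightarrow> 'a \<Rightarrow> real) \<Rightarrow> bool" where
  "joint_measurable \<alpha> \<longleftrightarrow> (\<lambda>(\<omega>, s). indicator {0..} s * \<alpha> s \<omega>) \<in> borel_measurable (N \<Otimes>\<^sub>M lborel)"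

definition sqn :: "(real \<Rightarrow> 'a \<Rightarrow> real) \<Rightarrow> ennreal" where
  "sqn \<alpha> = (\<integral>\<^sup>+\<omega>. (\<integral>\<^sup>+s\<in>{0..}. ennreal ((\<alpha> s \<omega>)\<^sup>2) \<partial>lborel) \<partial>N)"

lemma sqn_eq:
  assumes "joint_measurable \<alpha>"
  shows "sqn \<alpha> = (\<integral>\<^sup>+z. ennreal ((indicator {0..} (snd z) * \<alpha> (snd z) (fst z))\<^sup>2) \<partial>(N \<Otimes>\<^sub>M lborel))"
proof -
  have [measurable]: "(\<lambda>z. indicator {0..} (snd z) * \<alpha> (snd z) (fst z)) \<in> borel_measurable (N \<Otimes>\<^sub>M lborel)"
    using assms by (simp add: joint_measurable_def case_prod_beta')
  have "(\<integral>\<^sup>+z. ennreal ((indicator {0..} (snd z) * \<alpha> (snd z) (fst z))\<^sup>2) \<partial>(N \<Otimes>\<^sub>M lborel))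
    = (\<integral>\<^sup>+\<omega>. \<integral>\<^sup>+s. ennreal ((indicator {0..} (snd (\<omega>, s)) * \<alpha> (snd (\<omega>, s)) (fst (\<omega>, s)))\<^sup>2) \<partial>lborel \<partial>N)"
    by (rule lborel.nn_integral_fst[symmetric]) measurable
  also have "\<dots> = sqn \<alpha>" unfolding sqn_def
    by (intro nn_integral_cong) (simp add: indicator_def)
  finally show ?thesis by simp
qed

lemma joint_measurable_add:
  assumes "joint_measurable \<alpha>" "joint_measurable \<beta>" shows "joint_measurable (\<lambda>s \<omega>. \<alpha> s \<omega> + \<beta> s \<omega>)"
  using borel_measurable_add[OF assms[unfolded joint_measurable_def]]
  by (simp add: joint_measurable_def case_prod_beta' distrib_left)

lemma joint_measurable_diff:
  assumes "joint_measurable \<alpha>" "joint_measurable \<beta>" shows "joint_measurable (\<lambda>s \<omega>. \<alpha> s \<omega> - \<beta> s \<omega>)"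
  using borel_measurable_diff[OF assms[unfolded joint_measurable_def]]
  by (simp add: joint_measurable_def case_prod_beta' right_diff_distrib)

lemma sqn_add_le:
  assumes \<alpha>: "joint_measurable \<alpha>" and \<beta>: "joint_measurable \<beta>"
  shows "sqn (\<lambda>s \<omega>. \<alpha> s \<omega> + \<beta> s \<omega>) \<le> 2 * sqn \<alpha> + 2 * sqn \<beta>"
  unfolding sqn_eq[OF \<alpha>] sqn_eq[OF \<beta>] sqn_eq[OF joint_measurable_add[OF \<alpha> \<beta>]] distrib_left
  using \<alpha> \<beta> by (intro nn_integral_sq_add_le) (auto simp: joint_measurable_def case_prod_beta')

lemma sqn_commute: "sqn (\<lambda>s \<omega>. \<alpha> s \<omega> - \<beta> s \<omega>) = sqn (\<lambda>s \<omega>. \<beta> s \<omega> - \<alpha> s \<omega>)"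
  by (simp add: sqn_def power2_commute)

lemma sqn_triangle:
  assumes "joint_measurable \<alpha>" "joint_measurable \<beta>" "joint_measurable \<gamma>"
  shows "sqn (\<lambda>s \<omega>. \<alpha> s \<omega> - \<gamma> s \<omega>) \<le> 2 * sqn (\<lambda>s \<omega>. \<alpha> s \<omega> - \<beta> s \<omega>) + 2 * sqn (\<lambda>s \<omega>. \<beta> s \<omega> - \<gamma> s \<omega>)"
  using sqn_add_le[OF joint_measurable_diff[OF assms(1,2)] joint_measurable_diff[OF assms(2,3)]] by simp

lemma elem_joint_measurable:
  assumes d: "elem_data P a b \<xi>" shows "joint_measurable (elem_process P a b \<xi>)"
proof -
  have [measurable]: "\<xi> p \<in> borel_measurable N" if "p \<in> P" for p
    using d that F_measurable_N by (auto simp: elem_data_def weight_def)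
  have "(\<lambda>(\<omega>, s). indicator {0..} s * (\<Sum>p\<in>P. \<xi> p \<omega> * indicator {a p<..b p} s)) \<in> borel_measurable (N \<Otimes>\<^sub>M lborel)"
    by measurable
  then show ?thesis by (simp add: joint_measurable_def elem_process_def)
qed

lemma elem_integral_sq_le:
  assumes d: "elem_data P a b \<xi>" and t: "0 \<le> t"
  shows "(\<integral>\<^sup>+\<omega>. ennreal ((elem_integral P a b \<xi> t \<omega>)\<^sup>2) \<partial>N) \<le> sqn (elem_process P a b \<xi>)"
  unfolding elem_isometry[OF d t] sqn_def
  by (intro nn_integral_mono) (auto simp: indicator_def)

lemma elem_integral_diff_sq_le:
  assumes d: "elem_data P a b \<xi>" and e: "elem_data Q a' b' \<xi>'" and t: "0 \<le> t"
  shows "(\<integral>\<^sup>+\<omega>. ennreal ((elem_integral P a b \<xi> t \<omega> - elem_integral Q a' b' \<xi>' t \<omega>)\<^sup>2) \<partial>N)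
    \<le> sqn (\<lambda>s \<omega>. elem_process P a b \<xi> s \<omega> - elem_process Q a' b' \<xi>' s \<omega>)"
  using elem_integral_sq_le[OF elem_diff(1)[OF d e] t] unfolding elem_diff(3)[OF d e]
  by (simp add: elem_diff(2)[OF d e] sqn_def)

definition simple :: "nat \<Rightarrow> (nat \<Rightarrow> real) \<Rightarrow> (nat \<Rightarrow> 'a \<Rightarrow> real) \<Rightarrow> bool" where
  "simple n ts \<xi> \<longleftrightarrow> 0 \<le> ts 0 \<and> elem_data {..<n} ts (\<lambda>i. ts (Suc i)) \<xi>"

abbreviation "simple_proc n ts \<xi> \<equiv> elem_process {..<n} ts (\<lambda>i. ts (Suc i)) \<xi>"
abbreviation "simple_int n ts \<xi> \<equiv> elem_integral {..<n} ts (\<lambda>i. ts (Suc i)) \<xi>"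

text \<open>Progressive measurability lives on the interval \<open>{0..t}\<close> with its trace
  sigma-algebra. Composition with the clamp of time to \<open>{0..t}\<close> extends it to the whole
  line, and the indicator undoes the clamp.\<close>

lemma progressive_section:
  assumes \<alpha>: "progressively_measurable F \<alpha>" and t: "0 \<le> t"
  shows "(\<lambda>(\<omega>, s). indicator {0..t} s * \<alpha> s \<omega>) \<in> borel_measurable (F t \<Otimes>\<^sub>M lborel)"
proof -
  have m: "(\<lambda>(s, \<omega>). \<alpha> s \<omega>) \<in> borel_measurable (restrict_space borel {0..t} \<Otimes>\<^sub>M F t)"
    using \<alpha> t by (auto simp: progressively_measurable_def)
  have "(\<lambda>z. max 0 (min t (snd z))) \<in> measurable (F t \<Otimes>\<^sub>M lborel) (restrict_space borel {0..t})"
    using t by (intro measurable_restrict_space2) auto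
  then have "(\<lambda>z. (max 0 (min t (snd z)), fst z)) \<in> measurable (F t \<Otimes>\<^sub>M lborel) (restrict_space borel {0..t} \<Otimes>\<^sub>M F t)"
    by (intro measurable_Pair) auto
  from measurable_compose[OF this m]
  have [measurable]: "(\<lambda>z. \<alpha> (max 0 (min t (snd z))) (fst z)) \<in> borel_measurable (F t \<Otimes>\<^sub>M lborel)" by simp
  have "(\<lambda>z. indicator {0..t} (snd z) * \<alpha> (max 0 (min t (snd z))) (fst z)) \<in> borel_measurable (F t \<Otimes>\<^sub>M lborel)"
    by measurable
  also have "(\<lambda>z. indicator {0..t} (snd z) * \<alpha> (max 0 (min t (snd z))) (fst z)) = (\<lambda>(\<omega>, s). indicator {0..t} s * \<alpha> s \<omega>)"
    by (auto simp: indicator_def fun_eq_iff max_def min_def)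
  finally show ?thesis .
qed

lemma progressive_joint_measurable:
  assumes \<alpha>: "progressively_measurable F \<alpha>" shows "joint_measurable \<alpha>"
  unfolding joint_measurable_def
proof (rule borel_measurable_LIMSEQ_real)
  fix n :: nat
  have "sets (F (real n) \<Otimes>\<^sub>M lborel) \<subseteq> sets (N \<Otimes>\<^sub>M lborel)"
    using sets_F by (intro sets_pair_in_sets) auto
  then have "borel_measurable (F (real n) \<Otimes>\<^sub>M lborel) \<subseteq> borel_measurable (N \<Otimes>\<^sub>M lborel)"
    by (auto simp: measurable_def space_pair_measure space_F)
  then show "(\<lambda>(\<omega>, s). indicator {0..real n} s * \<alpha> s \<omega>) \<in> borel_measurable (N \<Otimes>\<^sub>M lborel)"
    using progressive_section[OF \<alpha>, of "real n"] by auto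
next
  fix z :: "'a \<times> real"
  obtain \<omega> s where z: "z = (\<omega>, s)" by force
  have "\<forall>\<^sub>F n in sequentially. s \<le> real n"
    using filterlim_real_sequentially by (simp add: filterlim_at_top)
  then have "\<forall>\<^sub>F n in sequentially. indicator {0..real n} s * \<alpha> s \<omega> = indicator {0..} s * \<alpha> s \<omega>"
    by eventually_elim (auto simp: indicator_def)
  then show "(\<lambda>n. case z of (\<omega>, s) \<Rightarrow> indicator {0..real n} s * \<alpha> s \<omega>) \<longlonglongrightarrow> (case z of (\<omega>, s) \<Rightarrow> indicator {0..} s * \<alpha> s \<omega>)"
    unfolding z by (auto intro: tendsto_eventually)
qed

text \<open>The weights are cell averages of \<open>\<beta>\<close>, known once the averaged cell
  has ended; the convergence along each path from \<open>cell_step_L2\<close> is integrated over the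
  sample space by dominated convergence.\<close>

lemma simple_dense_bounded:
  assumes \<beta>: "progressively_measurable F \<beta>" and R: "0 < R" and bd: "\<And>s \<omega>. \<bar>\<beta> s \<omega>\<bar> \<le> real R"
    and supp: "\<And>s \<omega>. s \<notin> {0..real R} \<Longrightarrow> \<beta> s \<omega> = 0" and e: "0 < e"
  shows "\<exists>n ts \<xi>. simple n ts \<xi> \<and> sqn (\<lambda>s \<omega>. simple_proc n ts \<xi> s \<omega> - \<beta> s \<omega>) < e"
proof -
  define m where "m n = n * (R + 1)" for n
  \<comment> \<open>The grid starts at \<open>1 / n\<close>: the weight with number \<open>i\<close>
    averages the cell that ends at \<open>ts n i\<close> and acts on the cell that begins
    there.\<close>
  define ts where "ts n i = real (Suc i) / real n" for n i
  define \<xi> where "\<xi> n i \<omega> = cell_average n (\<lambda>s. \<beta> s \<omega>) i" for n i \<omega>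
  note j\<beta> = progressive_joint_measurable[OF \<beta>]
  have ind: "indicator {0..} s * \<beta> s \<omega> = \<beta> s \<omega>" for s \<omega>
    using supp[of s \<omega>] by (auto simp: indicator_def)
  have b\<beta>: "(\<lambda>s. \<beta> s \<omega>) \<in> borel_measurable borel" if "\<omega> \<in> space N" for \<omega>
    using measurable_compose[OF measurable_Pair1'[OF that] j\<beta>[unfolded joint_measurable_def]] by (simp add: ind)
  have simple: "simple (m n) (ts n) (\<xi> n)" if n: "0 < n" for n
    unfolding simple_def elem_data_def weight_def
  proof (intro conjI ballI)
    fix i
    show "0 \<le> ts n 0" "0 \<le> ts n i" "ts n i \<le> ts n (Suc i)" using n by (auto simp: ts_def divide_right_mono)
    \<comment> \<open>The inserted indicator of \<open>{0..ts n i}\<close> does not change the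
      integral over the averaged cell, but it exhibits the integrand as measurable for the
      sigma-algebra of time \<open>ts n i\<close>.\<close>
    have "case_prod (\<lambda>\<omega> s. real n * indicator {real i / real n<..real (Suc i) / real n} s * (indicator {0..ts n i} s * \<beta> s \<omega>)) \<in> borel_measurable (F (ts n i) \<Otimes>\<^sub>M lborel)"
      using progressive_section[OF \<beta> \<open>0 \<le> ts n i\<close>] unfolding case_prod_beta' by measurable
    then have "(\<lambda>\<omega>. \<integral>s. real n * indicator {real i / real n<..real (Suc i) / real n} s * (indicator {0..ts n i} s * \<beta> s \<omega>) \<partial>lborel) \<in> borel_measurable (F (ts n i))"
      by (rule lborel.borel_measurable_lebesgue_integral)
    also have "(\<lambda>\<omega>. \<integral>s. real n * indicator {real i / real n<..real (Suc i) / real n} s * (indicator {0..ts n i} s * \<beta> s \<omega>) \<partial>lborel) = \<xi> n i"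
    proof (intro ext)
      fix \<omega>
      have "0 \<le> s" if "real i / real n < s" for s
        by (rule less_imp_le[OF le_less_trans[OF _ that]]) simp
      then show "(\<integral>s. real n * indicator {real i / real n<..real (Suc i) / real n} s * (indicator {0..ts n i} s * \<beta> s \<omega>) \<partial>lborel) = \<xi> n i \<omega>"
        unfolding \<xi>_def cell_average_def by (intro Bochner_Integration.integral_cong) (auto simp: ts_def indicator_def less_imp_le)
    qed
    finally show "\<xi> n i \<in> borel_measurable (F (ts n i))" .
    show "\<exists>C. \<forall>\<omega>\<in>space N. \<bar>\<xi> n i \<omega>\<bar> \<le> C"
      unfolding \<xi>_def using cell_average_bound[OF n b\<beta> bd] by blast
  qed simp
  have proc: "simple_proc (m n) (ts n) (\<xi> n) s \<omega> = cell_step n (n * (R + 1)) (\<lambda>s. \<beta> s \<omega>) s" for n s \<omega>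
    by (simp add: elem_process_def cell_step_def m_def \<xi>_def ts_def)
  have bstep: "\<bar>cell_step n (n * (R + 1)) (\<lambda>s. \<beta> s \<omega>) s\<bar> \<le> real R" if "0 < n" "0 \<le> s" "\<omega> \<in> space N" for n s \<omega>
  proof -
    have "cell_step n (n * (R + 1)) (\<lambda>s. \<beta> s \<omega>) s = (\<integral>u. cell_kernel n s u * \<beta> u \<omega> \<partial>lborel)"
      by (rule cell_step_eq[OF that(1) order_refl that(2) supp])
    then show ?thesis
      using kernel_average(1)[OF cell_kernel_measurable1 cell_kernel_nonneg cell_kernel_integral(1)[OF that(1)] b\<beta>[OF that(3)] bd]
      by simp
  qed
  let ?u = "\<lambda>n \<omega>. \<integral>\<^sup>+s\<in>{0..}. ennreal ((simple_proc (m (Suc n)) (ts (Suc n)) (\<xi> (Suc n)) s \<omega> - \<beta> s \<omega>)\<^sup>2) \<partial>lborel"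
  have "(\<lambda>n. \<integral>\<^sup>+\<omega>. ?u n \<omega> \<partial>N) \<longlonglongrightarrow> (\<integral>\<^sup>+\<omega>. 0 \<partial>N)"
  \<comment> \<open>Both processes are bounded by \<open>R\<close> and vanish after
    \<open>R + 3\<close>, since the kernel looks back by at most 2.\<close>
  proof (rule nn_integral_dominated_convergence[where w = "\<lambda>_. ennreal ((2 * real R)\<^sup>2 * (real R + 3))"])
    show "?u n \<in> borel_measurable N" for n
    proof -
      have "joint_measurable (\<lambda>s \<omega>. simple_proc (m (Suc n)) (ts (Suc n)) (\<xi> (Suc n)) s \<omega> - \<beta> s \<omega>)"
        using simple[of "Suc n"] by (intro joint_measurable_diff elem_joint_measurable j\<beta>) (simp add: simple_def)
      then have [measurable]: "(\<lambda>z. indicator {0..} (snd z) * (simple_proc (m (Suc n)) (ts (Suc n)) (\<xi> (Suc n)) (snd z) (fst z) - \<beta> (snd z) (fst z))) \<in> borel_measurable (N \<Otimes>\<^sub>M lborel)"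
        by (simp add: joint_measurable_def case_prod_beta')
      have "(\<lambda>\<omega>. \<integral>\<^sup>+s. (\<lambda>z. ennreal ((indicator {0..} (snd z) * (simple_proc (m (Suc n)) (ts (Suc n)) (\<xi> (Suc n)) (snd z) (fst z) - \<beta> (snd z) (fst z)))\<^sup>2)) (\<omega>, s) \<partial>lborel) \<in> borel_measurable N"
        by (rule lborel.borel_measurable_nn_integral_fst) measurable
      also have "(\<lambda>\<omega>. \<integral>\<^sup>+s. (\<lambda>z. ennreal ((indicator {0..} (snd z) * (simple_proc (m (Suc n)) (ts (Suc n)) (\<xi> (Suc n)) (snd z) (fst z) - \<beta> (snd z) (fst z)))\<^sup>2)) (\<omega>, s) \<partial>lborel) = ?u n"
        by (intro ext nn_integral_cong) (simp add: indicator_def)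
      finally show ?thesis .
    qed
    show "AE \<omega> in N. ?u n \<omega> \<le> ennreal ((2 * real R)\<^sup>2 * (real R + 3))" for n
    proof (rule AE_I2)
      fix \<omega> assume \<omega>: "\<omega> \<in> space N"
      have "?u n \<omega> \<le> (\<integral>\<^sup>+s. ennreal ((2 * real R)\<^sup>2) * indicator {0..real R + 3} s \<partial>lborel)"
      proof (rule nn_integral_mono)
        fix s
        let ?x = "cell_step (Suc n) (Suc n * (R + 1)) (\<lambda>s. \<beta> s \<omega>) s"
        show "ennreal ((simple_proc (m (Suc n)) (ts (Suc n)) (\<xi> (Suc n)) s \<omega> - \<beta> s \<omega>)\<^sup>2) * indicator {0..} s \<le> ennreal ((2 * real R)\<^sup>2) * indicator {0..real R + 3} s"
        proof (cases "s \<in> {0..real R + 3}")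
          case True
          then have "\<bar>?x - \<beta> s \<omega>\<bar> \<le> 2 * real R"
            using bstep[of "Suc n" s \<omega>] bd[of s \<omega>] \<omega> by auto
          then have "\<bar>?x - \<beta> s \<omega>\<bar> \<le> \<bar>2 * real R\<bar>" by simp
          then have "(?x - \<beta> s \<omega>)\<^sup>2 \<le> (2 * real R)\<^sup>2" by (simp only: abs_le_square_iff)
          then show ?thesis using True unfolding proc by (simp add: ennreal_leI)
        next
          case False
          show ?thesis
          proof (cases "0 \<le> s")
            case True
            with False have s: "real R + 3 < s" by simp
            have "?x = (\<integral>u. cell_kernel (Suc n) s u * \<beta> u \<omega> \<partial>lborel)"
              by (rule cell_step_eq[OF zero_less_Suc order_refl True supp])
            also have "\<dots> = 0"
            proof (intro integral_eq_zero_AE AE_I2)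
              fix u
              show "cell_kernel (Suc n) s u * \<beta> u \<omega> = 0"
              proof (cases "cell_kernel (Suc n) s u = 0")
                case False
                then have "\<bar>u - s\<bar> \<le> 2 / real (Suc n)" by (intro cell_kernel_dist) auto
                also have "\<dots> \<le> 2" by (simp add: divide_le_eq)
                finally have "u \<notin> {0..real R}" using s by auto
                then show ?thesis by (simp add: supp)
              qed simp
            qed
            finally show ?thesis using s unfolding proc by (simp add: supp)
          qed simp
        qed
      qed
      also have "\<dots> = ennreal ((2 * real R)\<^sup>2 * (real R + 3))"
        by (subst nn_integral_cmult_indicator) (auto simp: ennreal_mult)
      finally show "?u n \<omega> \<le> ennreal ((2 * real R)\<^sup>2 * (real R + 3))" .
    qed
    show "AE \<omega> in N. (\<lambda>n. ?u n \<omega>) \<longlonglongrightarrow> 0"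
      unfolding proc using LIMSEQ_Suc[OF cell_step_L2[OF b\<beta> bd supp R]] by (intro AE_I2) auto
  qed (auto simp: emeasure_space_1)
  then have "(\<lambda>n. sqn (\<lambda>s \<omega>. simple_proc (m (Suc n)) (ts (Suc n)) (\<xi> (Suc n)) s \<omega> - \<beta> s \<omega>)) \<longlonglongrightarrow> 0"
    by (simp add: sqn_def)
  from order_tendstoD(2)[OF this e] obtain n where "sqn (\<lambda>s \<omega>. simple_proc (m (Suc n)) (ts (Suc n)) (\<xi> (Suc n)) s \<omega> - \<beta> s \<omega>) < e"
    by (auto simp: eventually_sequentially)
  then show ?thesis using simple[of "Suc n"] by blast
qed

text \<open>Truncation in time and in value reduces the claim to
  \<open>simple_dense_bounded\<close>; the truncation error is dominated by \<open>\<alpha>\<close>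
  itself.\<close>

lemma simple_dense:
  assumes \<alpha>: "progressively_measurable F \<alpha>" "sqn \<alpha> < \<infinity>" and e: "0 < e"
  shows "\<exists>n ts \<xi>. simple n ts \<xi> \<and> sqn (\<lambda>s \<omega>. simple_proc n ts \<xi> s \<omega> - \<alpha> s \<omega>) < ennreal e"
proof -
  define \<beta> where "\<beta> R s \<omega> = indicator {0..real R} s * max (- real R) (min (real R) (\<alpha> s \<omega>))" for R :: nat and s \<omega>
  have prog: "progressively_measurable F (\<beta> R)" for R
    unfolding progressively_measurable_def
  proof (intro allI impI)
    fix t :: real assume "0 \<le> t"
    then have [measurable]: "(\<lambda>z. \<alpha> (fst z) (snd z)) \<in> borel_measurable (restrict_space borel {0..t} \<Otimes>\<^sub>M F t)"
      using \<alpha>(1) by (auto simp: progressively_measurable_def case_prod_beta')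
    have [measurable]: "(\<lambda>z. indicator {0..real R} (fst z) :: real) \<in> borel_measurable (restrict_space borel {0..t} \<Otimes>\<^sub>M F t)"
      by (rule measurable_compose[OF measurable_fst]) (auto intro: measurable_restrict_space1)
    show "(\<lambda>(s, \<omega>). \<beta> R s \<omega>) \<in> borel_measurable (restrict_space borel {0..t} \<Otimes>\<^sub>M F t)"
      unfolding \<beta>_def case_prod_beta' by measurable
  qed
  note j\<alpha> = progressive_joint_measurable[OF \<alpha>(1)] and j\<beta> = progressive_joint_measurable[OF prog]
  have \<alpha>m: "(\<lambda>z. indicator {0..} (snd z) * \<alpha> (snd z) (fst z)) \<in> borel_measurable (N \<Otimes>\<^sub>M lborel)"
    using j\<alpha> by (simp add: joint_measurable_def case_prod_beta')
  have bda: "\<bar>\<beta> R s \<omega> - \<alpha> s \<omega>\<bar> \<le> \<bar>\<alpha> s \<omega>\<bar>" for R s \<omega>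
    by (auto simp: \<beta>_def indicator_def max_def min_def)
  have "(\<lambda>R. \<integral>\<^sup>+z. ennreal ((indicator {0..} (snd z) * (\<beta> R (snd z) (fst z) - \<alpha> (snd z) (fst z)))\<^sup>2) \<partial>(N \<Otimes>\<^sub>M lborel)) \<longlonglongrightarrow> (\<integral>\<^sup>+z. 0 \<partial>(N \<Otimes>\<^sub>M (lborel :: real measure)))"
  proof (rule nn_integral_dominated_convergence[where w = "\<lambda>z. ennreal ((indicator {0..} (snd z) * \<alpha> (snd z) (fst z))\<^sup>2)"])
    show "(\<lambda>z. ennreal ((indicator {0..} (snd z) * (\<beta> R (snd z) (fst z) - \<alpha> (snd z) (fst z)))\<^sup>2)) \<in> borel_measurable (N \<Otimes>\<^sub>M lborel)" for R
      using joint_measurable_diff[OF j\<beta> j\<alpha>, of R] unfolding joint_measurable_def case_prod_beta' by measurable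
    show "(\<integral>\<^sup>+z. ennreal ((indicator {0..} (snd z) * \<alpha> (snd z) (fst z))\<^sup>2) \<partial>(N \<Otimes>\<^sub>M lborel)) < \<infinity>"
      using \<alpha>(2) unfolding sqn_eq[OF j\<alpha>] .
    show "AE z in N \<Otimes>\<^sub>M lborel. ennreal ((indicator {0..} (snd z) * (\<beta> R (snd z) (fst z) - \<alpha> (snd z) (fst z)))\<^sup>2) \<le> ennreal ((indicator {0..} (snd z) * \<alpha> (snd z) (fst z))\<^sup>2)" for R
      using bda by (intro AE_I2 ennreal_leI) (auto simp: indicator_def abs_le_square_iff[symmetric])
    show "AE z in N \<Otimes>\<^sub>M lborel. (\<lambda>R. ennreal ((indicator {0..} (snd z) * (\<beta> R (snd z) (fst z) - \<alpha> (snd z) (fst z)))\<^sup>2)) \<longlonglongrightarrow> 0"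
    proof (rule AE_I2)
      fix z :: "'a \<times> real"
      have "\<forall>\<^sub>F n in sequentially. max (snd z) \<bar>\<alpha> (snd z) (fst z)\<bar> \<le> real n"
        by (rule filterlim_real_sequentially[unfolded filterlim_at_top, rule_format])
      then have "\<forall>\<^sub>F R in sequentially. ennreal ((indicator {0..} (snd z) * (\<beta> R (snd z) (fst z) - \<alpha> (snd z) (fst z)))\<^sup>2) = 0"
        by eventually_elim (auto simp: \<beta>_def indicator_def max_def min_def abs_if split: if_splits)
      then show "(\<lambda>R. ennreal ((indicator {0..} (snd z) * (\<beta> R (snd z) (fst z) - \<alpha> (snd z) (fst z)))\<^sup>2)) \<longlonglongrightarrow> 0"
        by (rule tendsto_eventually)
    qed
  qed (use \<alpha>m in measurable)
  then have "(\<lambda>R. sqn (\<lambda>s \<omega>. \<beta> R s \<omega> - \<alpha> s \<omega>)) \<longlonglongrightarrow> 0"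
    by (simp add: sqn_eq[OF joint_measurable_diff[OF j\<beta> j\<alpha>]])
  \<comment> \<open>With the factor 2 of \<open>sqn_triangle\<close>, two errors of
    \<open>e / 4\<close> add up to \<open>e\<close>.\<close>
  then have "\<forall>\<^sub>F R in sequentially. sqn (\<lambda>s \<omega>. \<beta> R s \<omega> - \<alpha> s \<omega>) < ennreal (e / 4)"
    by (rule order_tendstoD(2)) (use e in simp)
  then have "\<forall>\<^sub>F R in sequentially. sqn (\<lambda>s \<omega>. \<beta> R s \<omega> - \<alpha> s \<omega>) < ennreal (e / 4) \<and> 0 < R"
    by (intro eventually_conj eventually_gt_at_top)
  then obtain R where R: "sqn (\<lambda>s \<omega>. \<beta> R s \<omega> - \<alpha> s \<omega>) < ennreal (e / 4)" "0 < R"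
    by (auto simp: eventually_sequentially)
  have "\<exists>n ts \<xi>. simple n ts \<xi> \<and> sqn (\<lambda>s \<omega>. simple_proc n ts \<xi> s \<omega> - \<beta> R s \<omega>) < ennreal (e / 4)"
    by (rule simple_dense_bounded[OF prog R(2)]) (use e in \<open>auto simp: \<beta>_def indicator_def\<close>)
  then obtain n ts \<xi> where s: "simple n ts \<xi>" "sqn (\<lambda>s \<omega>. simple_proc n ts \<xi> s \<omega> - \<beta> R s \<omega>) < ennreal (e / 4)" by blast
  have "sqn (\<lambda>s \<omega>. simple_proc n ts \<xi> s \<omega> - \<alpha> s \<omega>)
    \<le> 2 * sqn (\<lambda>s \<omega>. simple_proc n ts \<xi> s \<omega> - \<beta> R s \<omega>) + 2 * sqn (\<lambda>s \<omega>. \<beta> R s \<omega> - \<alpha> s \<omega>)"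
    using s(1) by (intro sqn_triangle elem_joint_measurable j\<alpha> j\<beta>) (simp add: simple_def)
  also have "\<dots> < 2 * ennreal (e / 4) + 2 * ennreal (e / 4)"
    using s(2) R(1) by (intro add_strict_mono ennreal_mult_strict_left_mono) auto
  also have "\<dots> = ennreal e"
    using e by (simp add: ennreal_mult[of 2, simplified, symmetric] ennreal_plus[symmetric] del: ennreal_plus)
  finally show ?thesis using s(1) by blast
qed

section \<open>Existence, martingale property and uniqueness of the Ito integral\<close>

definition is_ito :: "(real \<Rightarrow> 'a \<Rightarrow> real) \<Rightarrow> (real \<Rightarrow> 'a \<Rightarrow> real) \<Rightarrow> bool" where
  "is_ito \<alpha> I \<longleftrightarrow>
     (\<forall>t\<ge>0. I t \<in> borel_measurable (F t)) \<and>
     (\<forall>\<omega>\<in>space N. continuous_on {0..} (\<lambda>t. I t \<omega>)) \<and>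
     (\<exists>n ts \<xi>. (\<forall>k. simple (n k) (ts k) (\<xi> k)) \<and>
        (\<lambda>k. sqn (\<lambda>s \<omega>. simple_proc (n k) (ts k) (\<xi> k) s \<omega> - \<alpha> s \<omega>)) \<longlonglongrightarrow> 0 \<and>
        (\<forall>t\<ge>0. (\<lambda>k. \<integral>\<^sup>+\<omega>. ennreal ((simple_int (n k) (ts k) (\<xi> k) t \<omega> - I t \<omega>)\<^sup>2) \<partial>N) \<longlonglongrightarrow> 0))"

text \<open>Fast approximation makes consecutive simple integrals differ by at most
  \<open>(1/2) ^ k\<close> on growing time intervals for all large \<open>k\<close>, almost surely.
  The locally uniform limit is continuous. On the exceptional null set the version is put to 0,
  which keeps it adapted because null sets belong to the filtration.\<close>

theorem ito_exists:
  assumes \<alpha>: "progressively_measurable F \<alpha>" "sqn \<alpha> < \<infinity>"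
  shows "\<exists>I. is_ito \<alpha> I"
proof -
  \<comment> \<open>The maximal inequality at level \<open>(1/2) ^ k\<close> divides by
    \<open>(1/4) ^ k\<close>; the rate 1/8 leaves a summable bound for Borel-Cantelli.\<close>
  have "\<forall>k :: nat. \<exists>n ts \<xi>. simple n ts \<xi> \<and> sqn (\<lambda>s \<omega>. simple_proc n ts \<xi> s \<omega> - \<alpha> s \<omega>) < ennreal ((1/8) ^ k)"
    by (intro allI simple_dense[OF \<alpha>]) simp
  from choice[OF this] obtain n where "\<forall>k. \<exists>ts \<xi>. simple (n k) ts \<xi> \<and> sqn (\<lambda>s \<omega>. simple_proc (n k) ts \<xi> s \<omega> - \<alpha> s \<omega>) < ennreal ((1/8) ^ k)" ..
  from choice[OF this] obtain ts where "\<forall>k. \<exists>\<xi>. simple (n k) (ts k) \<xi> \<and> sqn (\<lambda>s \<omega>. simple_proc (n k) (ts k) \<xi> s \<omega> - \<alpha> s \<omega>) < ennreal ((1/8) ^ k)" ..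
  from choice[OF this] obtain \<xi> where s: "\<And>k. simple (n k) (ts k) (\<xi> k)"
    "\<And>k. sqn (\<lambda>s \<omega>. simple_proc (n k) (ts k) (\<xi> k) s \<omega> - \<alpha> s \<omega>) < ennreal ((1/8) ^ k)" by auto
  define S where "S k = simple_int (n k) (ts k) (\<xi> k)" for k
  note j\<alpha> = progressive_joint_measurable[OF \<alpha>(1)]
  have d: "elem_data {..<n k} (ts k) (\<lambda>i. ts k (Suc i)) (\<xi> k)" for k using s(1) by (simp add: simple_def)
  have Ssq: "sq_integrable N (S k t)" if "0 \<le> t" for k t unfolding S_def by (rule elem_integral_sq_integrable[OF d that])
  have diff: "(\<integral>\<omega>. (S k t \<omega> - S (k + j) t \<omega>)\<^sup>2 \<partial>N) \<le> 4 * (1/8) ^ k" if t: "0 \<le> t" for k j t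
  proof -
    have "ennreal (\<integral>\<omega>. (S k t \<omega> - S (k + j) t \<omega>)\<^sup>2 \<partial>N) = (\<integral>\<^sup>+\<omega>. ennreal ((S k t \<omega> - S (k + j) t \<omega>)\<^sup>2) \<partial>N)"
      by (rule sq_integrable_nn_eq[OF sq_integrable_diff[OF Ssq Ssq], symmetric]) (rule t)+
    also have "\<dots> \<le> sqn (\<lambda>s \<omega>. simple_proc (n k) (ts k) (\<xi> k) s \<omega> - simple_proc (n (k + j)) (ts (k + j)) (\<xi> (k + j)) s \<omega>)"
      unfolding S_def by (rule elem_integral_diff_sq_le[OF d d t])
    also have "\<dots> \<le> 2 * sqn (\<lambda>s \<omega>. simple_proc (n k) (ts k) (\<xi> k) s \<omega> - \<alpha> s \<omega>)
        + 2 * sqn (\<lambda>s \<omega>. \<alpha> s \<omega> - simple_proc (n (k + j)) (ts (k + j)) (\<xi> (k + j)) s \<omega>)"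
      by (intro sqn_triangle elem_joint_measurable[OF d] j\<alpha>)
    also have "\<dots> \<le> 2 * ennreal ((1/8) ^ k) + 2 * ennreal ((1/8) ^ (k + j))"
      unfolding sqn_commute[of \<alpha>] using s(2) by (intro add_mono mult_left_mono less_imp_le) auto
    also have "\<dots> \<le> 2 * ennreal ((1/8) ^ k) + 2 * ennreal ((1/8) ^ k)"
      by (intro add_mono mult_left_mono ennreal_leI power_decreasing) auto
    also have "\<dots> = ennreal (4 * (1/8) ^ k)" by (simp add: ennreal_mult[of 4, simplified] distrib_right[symmetric])
    finally show ?thesis by (subst (asm) ennreal_le_iff) auto
  qed
  define B where "B k = {\<omega> \<in> space N. \<exists>t\<in>{0..real (Suc k)}. (1/2) ^ k < \<bar>S k t \<omega> - S (Suc k) t \<omega>\<bar>}" for k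
  have B: "B k \<in> sets N" "prob (B k) \<le> 4 * (1/2) ^ k" for k
  proof -
    obtain C D where "l2_martingale (S k) C" "l2_martingale (S (Suc k)) D"
      unfolding S_def using elem_l2_martingale[OF d[of k]] elem_l2_martingale[OF d[of "Suc k"]] by blast
    note m = maximal_inequality[OF l2_martingale_diff[OF this], of "real (Suc k)" "(1/2) ^ k"]
    show "B k \<in> sets N" unfolding B_def by (rule m) auto
    have "prob (B k) \<le> (\<integral>\<omega>. (S k (real (Suc k)) \<omega> - S (Suc k) (real (Suc k)) \<omega>)\<^sup>2 \<partial>N) / ((1/2) ^ k)\<^sup>2"
      unfolding B_def by (rule m) auto
    also have "\<dots> \<le> 4 * (1/8) ^ k / ((1/2) ^ k)\<^sup>2"
      using diff[of "real (Suc k)" k 1] by (intro divide_right_mono) auto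
    also have "\<dots> = 4 * (1/2) ^ k"
    proof -
      have "(1/8 :: real) ^ k = (1/2) ^ k * ((1/2) ^ k)\<^sup>2"
        unfolding power2_eq_square power_mult_distrib[symmetric] by simp
      then show ?thesis by simp
    qed
    finally show "prob (B k) \<le> 4 * (1/2) ^ k" .
  qed
  have BC: "AE \<omega> in N. \<forall>\<^sub>F k in sequentially. \<omega> \<in> space N - B k"
  proof (rule borel_cantelli_AE1[OF B(1)])
    have "summable (\<lambda>k. 4 * (1/2 :: real) ^ k)" by (intro summable_mult summable_geometric) simp
    then show "summable (\<lambda>k. measure N (B k))"
      by (rule summable_comparison_test[rotated]) (use B(2) in auto)
  qed (simp add: emeasure_eq_measure)
  then obtain Z where Z: "{\<omega> \<in> space N. \<not> (\<forall>\<^sub>F k in sequentially. \<omega> \<in> space N - B k)} \<subseteq> Z" "Z \<in> null_sets N"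
    unfolding eventually_ae_filter by blast
  define I where "I t \<omega> = (if \<omega> \<in> Z then 0 else lim (\<lambda>k. S k t \<omega>))" for t \<omega>
  have unif: "uniform_limit {0..T} (\<lambda>k t. S k t \<omega>) (\<lambda>t. I t \<omega>) sequentially" if \<omega>: "\<omega> \<in> space N" "\<omega> \<notin> Z" and T: "0 \<le> T" for \<omega> T
  proof -
    have "\<forall>\<^sub>F k in sequentially. \<omega> \<in> space N - B k" using Z \<omega> by blast
    moreover have "\<forall>\<^sub>F k in sequentially. T \<le> real k"
      using filterlim_real_sequentially by (simp add: filterlim_at_top)
    ultimately have "\<forall>\<^sub>F k in sequentially. \<forall>t\<in>{0..T}. norm (S (Suc k) t \<omega> - S k t \<omega>) \<le> (1/2) ^ k"
    proof eventually_elim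
      case (elim k)
      show ?case
      proof
        fix t assume "t \<in> {0..T}"
        then have "t \<in> {0..real (Suc k)}" using elim by auto
        then have "\<bar>S k t \<omega> - S (Suc k) t \<omega>\<bar> \<le> (1/2) ^ k"
          using elim(1) by (force simp: B_def not_less)
        then show "norm (S (Suc k) t \<omega> - S k t \<omega>) \<le> (1/2) ^ k" by (simp add: abs_minus_commute)
      qed
    qed
    from Weierstrass_m_test_ev[OF this summable_geometric]
    have sums: "uniform_limit {0..T} (\<lambda>k t. \<Sum>i<k. S (Suc i) t \<omega> - S i t \<omega>) (\<lambda>t. \<Sum>i. S (Suc i) t \<omega> - S i t \<omega>) sequentially"
      by simp
    have tele: "(\<Sum>i<k. S (Suc i) t \<omega> - S i t \<omega>) + S 0 t \<omega> = S k t \<omega>" for k t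
      using sum_lessThan_telescope[of "\<lambda>i. S i t \<omega>" k] by simp
    from uniform_limit_add[OF sums uniform_limit_const[where c = "\<lambda>t. S 0 t \<omega>"]]
    have U: "uniform_limit {0..T} (\<lambda>k t. S k t \<omega>) (\<lambda>t. (\<Sum>i. S (Suc i) t \<omega> - S i t \<omega>) + S 0 t \<omega>) sequentially"
      by (simp only: tele)
    have "I t \<omega> = (\<Sum>i. S (Suc i) t \<omega> - S i t \<omega>) + S 0 t \<omega>" if "t \<in> {0..T}" for t
      using limI[OF tendsto_uniform_limitI[OF U that]] \<omega> by (simp add: I_def)
    then show ?thesis using U by (subst uniform_limit_cong'[where g = "\<lambda>k t. S k t \<omega>"]) auto
  qed
  have ptw: "(\<lambda>k. S k t \<omega>) \<longlonglongrightarrow> I t \<omega>" if "\<omega> \<in> space N" "\<omega> \<notin> Z" "0 \<le> t" for t \<omega>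
    by (rule tendsto_uniform_limitI[OF unif[OF that]]) (use that in auto)
  have adapted: "I t \<in> borel_measurable (F t)" if t: "0 \<le> t" for t
  proof -
    have [measurable]: "Z \<in> sets (F t)" using Z(2) F_null by auto
    have [measurable]: "S k t \<in> borel_measurable (F t)" for k unfolding S_def by (rule elem_integral_adapted[OF d t])
    show ?thesis unfolding I_def by measurable
  qed
  have cont: "continuous_on {0..} (\<lambda>t. I t \<omega>)" if \<omega>: "\<omega> \<in> space N" for \<omega>
  proof (cases "\<omega> \<in> Z")
    case False
    have "continuous_on {0..T} (\<lambda>t. I t \<omega>)" if "0 \<le> T" for T
    proof (rule uniform_limit_theorem[OF _ unif[OF \<omega> False that]])
      show "\<forall>\<^sub>F k in sequentially. continuous_on {0..T} (\<lambda>t. S k t \<omega>)"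
        unfolding S_def
        by (intro always_eventually allI continuous_on_subset[OF elem_integral_continuous[OF d \<omega>]]) auto
    qed simp
    note c = this
    \<comment> \<open>Continuity is local, so near each \<open>t\<close> the uniform limit on
      \<open>{0..t + 1}\<close> decides.\<close>
    show ?thesis unfolding continuous_on_eq_continuous_within
    proof
      fix t :: real assume t: "t \<in> {0..}"
      have "continuous_on {0..t + 1} (\<lambda>t. I t \<omega>)" using t by (intro c) auto
      then have "continuous (at t within {0..t + 1}) (\<lambda>t. I t \<omega>)"
        using t by (simp add: continuous_on_eq_continuous_within)
      moreover have "at t within {0..t + 1} = at t within {0..}"
        by (rule at_within_nhd[of t "{..<t + 1}"]) auto
      ultimately show "continuous (at t within {0..}) (\<lambda>t. I t \<omega>)" by simp
    qed
  qed (simp add: I_def)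
  have lim: "(\<lambda>k. \<integral>\<^sup>+\<omega>. ennreal ((S k t \<omega> - I t \<omega>)\<^sup>2) \<partial>N) \<longlonglongrightarrow> 0" if t: "0 \<le> t" for t
  proof -
    have AEl: "AE \<omega> in N. (\<lambda>k. S k t \<omega>) \<longlonglongrightarrow> I t \<omega>"
      using AE_not_in[OF Z(2)] AE_space by eventually_elim (use ptw t in auto)
    \<comment> \<open>The bound for \<open>S k - S (k + j)\<close> does not depend on
      \<open>j\<close> and survives the limit in \<open>j\<close>.\<close>
    have *: "(\<integral>\<^sup>+\<omega>. ennreal ((S k t \<omega> - I t \<omega>)\<^sup>2) \<partial>N) \<le> ennreal (4 * (1/8) ^ k)" for k
    proof -
      have lim': "AE \<omega> in N. (\<lambda>j. S k t \<omega> - S (k + j) t \<omega>) \<longlonglongrightarrow> S k t \<omega> - I t \<omega>"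
        using AEl
      proof eventually_elim
        case (elim \<omega>)
        from LIMSEQ_ignore_initial_segment[OF elim, of k] show ?case
          by (intro tendsto_intros) (simp add: add.commute)
      qed
      have m: "(\<lambda>\<omega>. S k t \<omega> - I t \<omega>) \<in> borel_measurable N"
        using Ssq[OF t, of k, THEN sq_integrableD(1)] F_measurable_N[OF adapted[OF t]] by simp
      note l = L2_bounded_tendsto_L1(1,2)[OF sq_integrable_diff[OF Ssq[OF t] Ssq[OF t]] m diff[OF t] lim']
      show ?thesis unfolding sq_integrable_nn_eq[OF l(1)] using l(2) by (rule ennreal_leI)
    qed
    have "(\<lambda>k. ennreal (4 * (1/8) ^ k)) \<longlonglongrightarrow> ennreal (4 * 0)"
      by (intro tendsto_ennrealI tendsto_mult tendsto_const LIMSEQ_power_zero) simp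
    then have "(\<lambda>k. ennreal (4 * (1/8) ^ k)) \<longlonglongrightarrow> 0" by simp
    then show ?thesis by (rule tendsto_sandwich[OF _ _ tendsto_const[of 0], rotated 2]) (use * in auto)
  qed
  have "(\<lambda>k. ennreal ((1/8) ^ k)) \<longlonglongrightarrow> ennreal 0"
    by (intro tendsto_ennrealI LIMSEQ_power_zero) simp
  then have "(\<lambda>k. ennreal ((1/8) ^ k)) \<longlonglongrightarrow> 0" by (simp only: ennreal_0)
  then have "(\<lambda>k. sqn (\<lambda>s \<omega>. simple_proc (n k) (ts k) (\<xi> k) s \<omega> - \<alpha> s \<omega>)) \<longlonglongrightarrow> 0"
    by (rule tendsto_sandwich[of "\<lambda>_. 0" _ sequentially "\<lambda>k. ennreal ((1/8) ^ k)", rotated 3])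
       (simp_all add: less_imp_le[OF s(2)])
  then have "is_ito \<alpha> I"
    unfolding is_ito_def using adapted cont s(1) lim[unfolded S_def] by blast
  then show ?thesis by blast
qed

text \<open>Square-integrability of the limit comes for free: a single finite distance to some
  \<open>X k\<close> forces it, and from then on Bochner integrals are available.\<close>

lemma nn_L2_tendsto:
  assumes X: "\<And>k. sq_integrable N (X k)" and Y: "Y \<in> borel_measurable N"
    and lim: "(\<lambda>k. \<integral>\<^sup>+\<omega>. ennreal ((X k \<omega> - Y \<omega>)\<^sup>2) \<partial>N) \<longlonglongrightarrow> 0"
  shows "sq_integrable N Y" "(\<lambda>k. \<integral>\<omega>. (X k \<omega> - Y \<omega>)\<^sup>2 \<partial>N) \<longlonglongrightarrow> 0"
proof -
  have "\<forall>\<^sub>F k in sequentially. (\<integral>\<^sup>+\<omega>. ennreal ((X k \<omega> - Y \<omega>)\<^sup>2) \<partial>N) < 1"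
    by (rule order_tendstoD(2)[OF lim]) simp
  then obtain k where k: "(\<integral>\<^sup>+\<omega>. ennreal ((X k \<omega> - Y \<omega>)\<^sup>2) \<partial>N) < 1" by (auto simp: eventually_sequentially)
  have "sq_integrable N (\<lambda>\<omega>. X k \<omega> - Y \<omega>)"
    unfolding sq_integrable_iff_nn using k X[of k, THEN sq_integrableD(1)] Y by (auto intro: less_trans)
  from sq_integrable_diff[OF X[of k] this] show sq: "sq_integrable N Y" by simp
  have "(\<lambda>k. ennreal (\<integral>\<omega>. (X k \<omega> - Y \<omega>)\<^sup>2 \<partial>N)) \<longlonglongrightarrow> 0"
    using lim by (simp add: sq_integrable_nn_eq[OF sq_integrable_diff[OF X sq]])
  then show "(\<lambda>k. \<integral>\<omega>. (X k \<omega> - Y \<omega>)\<^sup>2 \<partial>N) \<longlonglongrightarrow> 0"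
    by (subst (asm) ennreal_tendsto_0_iff) auto
qed

text \<open>Simple integrals are martingales that vanish at time 0, and the isometry bounds their
  second moments by \<open>sqn\<close> of the integrand; all of this survives the mean-square limit
  in \<open>is_ito\<close>.\<close>

lemma ito_martingale:
  assumes j: "joint_measurable \<alpha>" and fin: "sqn \<alpha> < \<infinity>" and I: "is_ito \<alpha> I"
  shows "\<exists>C. l2_martingale I C" "AE \<omega> in N. I 0 \<omega> = 0"
proof -
  from I obtain n ts \<xi> where s: "\<And>k. simple (n k) (ts k) (\<xi> k)"
    and s\<alpha>: "(\<lambda>k. sqn (\<lambda>s \<omega>. simple_proc (n k) (ts k) (\<xi> k) s \<omega> - \<alpha> s \<omega>)) \<longlonglongrightarrow> 0"
    and sI: "\<And>t. 0 \<le> t \<Longrightarrow> (\<lambda>k. \<integral>\<^sup>+\<omega>. ennreal ((simple_int (n k) (ts k) (\<xi> k) t \<omega> - I t \<omega>)\<^sup>2) \<partial>N) \<longlonglongrightarrow> 0"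
    and adapted: "\<And>t. 0 \<le> t \<Longrightarrow> I t \<in> borel_measurable (F t)"
    and cont: "\<And>\<omega>. \<omega> \<in> space N \<Longrightarrow> continuous_on {0..} (\<lambda>t. I t \<omega>)"
    unfolding is_ito_def by blast
  define S where "S k = simple_int (n k) (ts k) (\<xi> k)" for k
  have d: "elem_data {..<n k} (ts k) (\<lambda>i. ts k (Suc i)) (\<xi> k)" for k using s by (simp add: simple_def)
  have Ssq: "sq_integrable N (S k t)" if "0 \<le> t" for k t unfolding S_def by (rule elem_integral_sq_integrable[OF d that])
  have Isq: "sq_integrable N (I t)" and SI: "(\<lambda>k. \<integral>\<omega>. (S k t \<omega> - I t \<omega>)\<^sup>2 \<partial>N) \<longlonglongrightarrow> 0" if t: "0 \<le> t" for t
    using nn_L2_tendsto[OF Ssq[OF t] F_measurable_N[OF adapted[OF t]]] sI[OF t] by (simp_all add: S_def)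
  obtain c where c: "sqn \<alpha> = ennreal c" "0 \<le> c" using fin by (cases "sqn \<alpha>") auto
  \<comment> \<open>Once the simple process is within 1 of \<open>\<alpha>\<close> in
    \<open>sqn\<close>, the inequality \<open>sqn_add_le\<close> gives this bound.\<close>
  have bd: "(\<integral>\<omega>. (I t \<omega>)\<^sup>2 \<partial>N) \<le> 2 + 2 * c" if t: "0 \<le> t" for t
  proof (rule LIMSEQ_le_const2[OF L2_tendsto_sq[OF Ssq[OF t] Isq[OF t] SI[OF t]]])
    have "\<forall>\<^sub>F k in sequentially. sqn (\<lambda>s \<omega>. simple_proc (n k) (ts k) (\<xi> k) s \<omega> - \<alpha> s \<omega>) < 1"
      by (rule order_tendstoD(2)[OF s\<alpha>]) simp
    then obtain k0 where k0: "\<And>k. k \<ge> k0 \<Longrightarrow> sqn (\<lambda>s \<omega>. simple_proc (n k) (ts k) (\<xi> k) s \<omega> - \<alpha> s \<omega>) < 1"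
      by (auto simp: eventually_sequentially)
    have "(\<integral>\<omega>. (S k t \<omega>)\<^sup>2 \<partial>N) \<le> 2 + 2 * c" if k: "k \<ge> k0" for k
    proof -
      have "ennreal (\<integral>\<omega>. (S k t \<omega>)\<^sup>2 \<partial>N) = (\<integral>\<^sup>+\<omega>. ennreal ((S k t \<omega>)\<^sup>2) \<partial>N)"
        by (rule sq_integrable_nn_eq[OF Ssq[OF t], symmetric])
      also have "\<dots> \<le> sqn (simple_proc (n k) (ts k) (\<xi> k))"
        unfolding S_def by (rule elem_integral_sq_le[OF d t])
      also have "\<dots> = sqn (\<lambda>s \<omega>. (simple_proc (n k) (ts k) (\<xi> k) s \<omega> - \<alpha> s \<omega>) + \<alpha> s \<omega>)" by simp
      also have "\<dots> \<le> 2 * sqn (\<lambda>s \<omega>. simple_proc (n k) (ts k) (\<xi> k) s \<omega> - \<alpha> s \<omega>) + 2 * sqn \<alpha>"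
        by (intro sqn_add_le joint_measurable_diff elem_joint_measurable[OF d] j)
      also have "\<dots> \<le> 2 * 1 + 2 * ennreal c"
        unfolding c(1) by (intro add_mono mult_left_mono order_refl less_imp_le[OF k0[OF k]] zero_le)
      also have "\<dots> = ennreal (2 + 2 * c)" using c(2) by (simp add: ennreal_mult)
      finally show ?thesis using c(2) by (subst (asm) ennreal_le_iff) auto
    qed
    then show "\<exists>N'. \<forall>k\<ge>N'. (\<integral>\<omega>. (S k t \<omega>)\<^sup>2 \<partial>N) \<le> 2 + 2 * c" by blast
  qed
  have mart: "(\<integral>\<omega>. I t \<omega> * Z \<omega> \<partial>N) = (\<integral>\<omega>. I s \<omega> * Z \<omega> \<partial>N)"
    if st: "0 \<le> s" "s \<le> t" and Z: "Z \<in> borel_measurable (F s)" "sq_integrable N Z" for s t Z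
  proof (rule LIMSEQ_unique)
    have t: "0 \<le> t" using st by simp
    show "(\<lambda>k. \<integral>\<omega>. S k t \<omega> * Z \<omega> \<partial>N) \<longlonglongrightarrow> (\<integral>\<omega>. I t \<omega> * Z \<omega> \<partial>N)"
      by (intro L2_tendsto_mult Ssq Isq SI Z t)
    have "(\<integral>\<omega>. S k t \<omega> * Z \<omega> \<partial>N) = (\<integral>\<omega>. S k s \<omega> * Z \<omega> \<partial>N)" for k
      unfolding S_def by (rule elem_integral_martingale[OF d st Z])
    then show "(\<lambda>k. \<integral>\<omega>. S k t \<omega> * Z \<omega> \<partial>N) \<longlonglongrightarrow> (\<integral>\<omega>. I s \<omega> * Z \<omega> \<partial>N)"
      by (simp only:) (intro L2_tendsto_mult Ssq Isq SI Z st)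
  qed
  show "\<exists>C. l2_martingale I C"
    unfolding l2_martingale_def by (intro exI[of _ "2 + 2 * c"] conjI allI ballI impI adapted cont Isq bd mart)
  have "S k 0 \<omega> = 0" for k \<omega>
    unfolding S_def elem_integral_def
  proof (intro sum.neutral ballI)
    fix i assume "i \<in> {..<n k}"
    then have "0 \<le> ts k i" "ts k i \<le> ts k (Suc i)" using d[of k] by (simp_all add: elem_data_def)
    then have "0 \<le> ts k i" "0 \<le> ts k (Suc i)" by auto
    then show "\<xi> k i \<omega> * (W (min (ts k (Suc i)) 0) \<omega> - W (min (ts k i) 0) \<omega>) = 0" by (simp add: min_absorb2)
  qed
  then have "(\<lambda>k. \<integral>\<omega>. (0 - I 0 \<omega>)\<^sup>2 \<partial>N) \<longlonglongrightarrow> 0" using SI[of 0] by simp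
  then have "(\<integral>\<omega>. (I 0 \<omega>)\<^sup>2 \<partial>N) = 0" by (simp add: LIMSEQ_const_iff)
  then have "AE \<omega> in N. (I 0 \<omega>)\<^sup>2 = 0"
    using Isq[of 0, THEN sq_integrableD(2)] by (subst (asm) integral_nonneg_eq_0_iff_AE) auto
  then show "AE \<omega> in N. I 0 \<omega> = 0" by simp
qed

theorem ito_unique:
  assumes j: "joint_measurable \<alpha>" and I: "is_ito \<alpha> I" and t: "0 \<le> t"
    and d: "\<And>k. elem_data (P k) (a k) (b k) (\<eta> k)"
    and lim: "(\<lambda>k. sqn (\<lambda>s \<omega>. elem_process (P k) (a k) (b k) (\<eta> k) s \<omega> - \<alpha> s \<omega>)) \<longlonglongrightarrow> 0"
    and E: "E \<in> borel_measurable N"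
    and limE: "(\<lambda>k. \<integral>\<^sup>+\<omega>. ennreal ((elem_integral (P k) (a k) (b k) (\<eta> k) t \<omega> - E \<omega>)\<^sup>2) \<partial>N) \<longlonglongrightarrow> 0"
  shows "AE \<omega> in N. I t \<omega> = E \<omega>"
proof -
  from I obtain n ts \<xi> where s: "\<And>k. simple (n k) (ts k) (\<xi> k)"
    and s\<alpha>: "(\<lambda>k. sqn (\<lambda>s \<omega>. simple_proc (n k) (ts k) (\<xi> k) s \<omega> - \<alpha> s \<omega>)) \<longlonglongrightarrow> 0"
    and sI: "(\<lambda>k. \<integral>\<^sup>+\<omega>. ennreal ((simple_int (n k) (ts k) (\<xi> k) t \<omega> - I t \<omega>)\<^sup>2) \<partial>N) \<longlonglongrightarrow> 0"
    and adapted: "I t \<in> borel_measurable (F t)"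
    unfolding is_ito_def using t by blast
  have d': "elem_data {..<n k} (ts k) (\<lambda>i. ts k (Suc i)) (\<xi> k)" for k using s by (simp add: simple_def)
  define S where "S k = simple_int (n k) (ts k) (\<xi> k) t" for k
  define T where "T k = elem_integral (P k) (a k) (b k) (\<eta> k) t" for k
  have [measurable]: "S k \<in> borel_measurable N" "T k \<in> borel_measurable N" "I t \<in> borel_measurable N" for k
    using elem_integral_sq_integrable[OF d' t] elem_integral_sq_integrable[OF d t] F_measurable_N[OF adapted]
    by (auto simp: S_def T_def sq_integrable_def)
  note [measurable] = E
  let ?u = "\<lambda>k. sqn (\<lambda>s \<omega>. simple_proc (n k) (ts k) (\<xi> k) s \<omega> - \<alpha> s \<omega>)"
  let ?v = "\<lambda>k. sqn (\<lambda>s \<omega>. elem_process (P k) (a k) (b k) (\<eta> k) s \<omega> - \<alpha> s \<omega>)"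
  have "(\<integral>\<^sup>+\<omega>. ennreal ((I t \<omega> - E \<omega>)\<^sup>2) \<partial>N) \<le>
      2 * (\<integral>\<^sup>+\<omega>. ennreal ((S k \<omega> - I t \<omega>)\<^sup>2) \<partial>N) + 2 * (2 * (2 * ?u k + 2 * ?v k) + 2 * (\<integral>\<^sup>+\<omega>. ennreal ((T k \<omega> - E \<omega>)\<^sup>2) \<partial>N))" for k
  proof -
    have 1: "(\<integral>\<^sup>+\<omega>. ennreal ((I t \<omega> - E \<omega>)\<^sup>2) \<partial>N) \<le> 2 * (\<integral>\<^sup>+\<omega>. ennreal ((S k \<omega> - I t \<omega>)\<^sup>2) \<partial>N) + 2 * (\<integral>\<^sup>+\<omega>. ennreal ((S k \<omega> - E \<omega>)\<^sup>2) \<partial>N)"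
      using nn_integral_sq_add_le[of "\<lambda>\<omega>. I t \<omega> - S k \<omega>" N "\<lambda>\<omega>. S k \<omega> - E \<omega>"] by (simp add: power2_commute[of "I t _" "S k _"])
    have 2: "(\<integral>\<^sup>+\<omega>. ennreal ((S k \<omega> - E \<omega>)\<^sup>2) \<partial>N) \<le> 2 * (\<integral>\<^sup>+\<omega>. ennreal ((S k \<omega> - T k \<omega>)\<^sup>2) \<partial>N) + 2 * (\<integral>\<^sup>+\<omega>. ennreal ((T k \<omega> - E \<omega>)\<^sup>2) \<partial>N)"
      using nn_integral_sq_add_le[of "\<lambda>\<omega>. S k \<omega> - T k \<omega>" N "\<lambda>\<omega>. T k \<omega> - E \<omega>"] by simp
    have "(\<integral>\<^sup>+\<omega>. ennreal ((S k \<omega> - T k \<omega>)\<^sup>2) \<partial>N) \<le> sqn (\<lambda>s \<omega>. simple_proc (n k) (ts k) (\<xi> k) s \<omega> - elem_process (P k) (a k) (b k) (\<eta> k) s \<omega>)"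
      unfolding S_def T_def by (rule elem_integral_diff_sq_le[OF d' d t])
    also have "\<dots> \<le> 2 * ?u k + 2 * sqn (\<lambda>s \<omega>. \<alpha> s \<omega> - elem_process (P k) (a k) (b k) (\<eta> k) s \<omega>)"
      by (intro sqn_triangle elem_joint_measurable[OF d'] elem_joint_measurable[OF d] j)
    finally have 3: "(\<integral>\<^sup>+\<omega>. ennreal ((S k \<omega> - T k \<omega>)\<^sup>2) \<partial>N) \<le> 2 * ?u k + 2 * ?v k"
      unfolding sqn_commute[of \<alpha>] .
    show ?thesis
      by (rule order_trans[OF 1 add_left_mono[OF mult_left_mono[OF order_trans[OF 2 add_right_mono[OF mult_left_mono[OF 3]]]]]]) simp_all
  qed
  moreover have "(\<lambda>k. 2 * (\<integral>\<^sup>+\<omega>. ennreal ((S k \<omega> - I t \<omega>)\<^sup>2) \<partial>N) + 2 * (2 * (2 * ?u k + 2 * ?v k) + 2 * (\<integral>\<^sup>+\<omega>. ennreal ((T k \<omega> - E \<omega>)\<^sup>2) \<partial>N)))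
     \<longlonglongrightarrow> 2 * 0 + 2 * (2 * (2 * 0 + 2 * 0) + 2 * 0)"
    using sI limE s\<alpha> lim unfolding S_def[symmetric] T_def[symmetric]
    by (intro tendsto_add ennreal_tendsto_cmult) auto
  ultimately have "(\<integral>\<^sup>+\<omega>. ennreal ((I t \<omega> - E \<omega>)\<^sup>2) \<partial>N) \<le> 0"
    by (intro LIMSEQ_le_const[of _ 0]) auto
  then have "(\<integral>\<^sup>+\<omega>. ennreal ((I t \<omega> - E \<omega>)\<^sup>2) \<partial>N) = 0" by simp
  then have "AE \<omega> in N. ennreal ((I t \<omega> - E \<omega>)\<^sup>2) = 0"
    by (subst (asm) nn_integral_0_iff_AE) auto
  then show ?thesis by (simp add: ennreal_eq_0_iff)
qed

end

section \<open>The Markov property on path space\<close>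

definition path_space :: "(real \<Rightarrow> real) measure" where
  "path_space = PiM {0..} (\<lambda>_. borel)"

context filtered_bm begin

definition shifted :: "real \<Rightarrow> 'a \<Rightarrow> real \<Rightarrow> real" where
  "shifted h \<omega> = (\<lambda>s\<in>{0..}. W (h + s) \<omega> - W h \<omega>)"

lemma shifted_apply: "0 \<le> s \<Longrightarrow> shifted h \<omega> s = W (h + s) \<omega> - W h \<omega>"
  by (simp add: shifted_def)

lemma shifted_measurable: "0 \<le> h \<Longrightarrow> shifted h \<in> measurable N path_space"
  unfolding shifted_def[abs_def] path_space_def
  by (intro measurable_restrict borel_measurable_diff W_measurable) auto

lemma shifted_continuous:
  assumes "0 \<le> h" "\<omega> \<in> space N" shows "continuous_on {0..} (shifted h \<omega>)"
proof -
  have "continuous_on {0..} (\<lambda>s. W (h + s) \<omega> - W h \<omega>)"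
    using assms by (intro continuous_intros continuous_on_compose2[OF W_continuous]) auto
  then show ?thesis by (rule continuous_on_eq) (simp add: shifted_apply)
qed

text \<open>The heat semigroup at time \<open>v\<close>: the mean of \<open>u\<close> after an
  independent centred Gaussian of variance \<open>v\<close> has been added.\<close>

definition gauss_smooth :: "real \<Rightarrow> (real \<Rightarrow> ennreal) \<Rightarrow> real \<Rightarrow> ennreal" where
  "gauss_smooth v u a = (\<integral>\<^sup>+z. ennreal (normal_density 0 (sqrt v) z) * u (a + z) \<partial>lborel)"

lemma gauss_smooth_measurable [measurable]:
  assumes [measurable]: "u \<in> borel_measurable borel"
  shows "gauss_smooth v u \<in> borel_measurable borel"
  unfolding gauss_smooth_def[abs_def] by measurable

text \<open>The increment is independent of the pair of \<open>\<xi>\<close> and \<open>U\<close>,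
  so Fubini's theorem integrates it out first.\<close>

lemma smooth_increment:
  assumes r: "0 \<le> r" "r < t" and \<xi>: "\<xi> \<in> borel_measurable (F r)" and U: "U \<in> borel_measurable (F r)"
    and u: "u \<in> borel_measurable borel"
  shows "(\<integral>\<^sup>+\<omega>. \<xi> \<omega> * u (U \<omega> + (W t \<omega> - W r \<omega>)) \<partial>N) = (\<integral>\<^sup>+\<omega>. \<xi> \<omega> * gauss_smooth (t - r) u (U \<omega>) \<partial>N)"
proof -
  let ?X = "\<lambda>\<omega>. (\<xi> \<omega>, U \<omega>)" and ?D = "\<lambda>\<omega>. W t \<omega> - W r \<omega>"
  let ?S = "borel \<Otimes>\<^sub>M borel :: (ennreal \<times> real) measure"
  note [measurable] = u
  have [measurable]: "\<xi> \<in> borel_measurable N" "U \<in> borel_measurable N" "W t \<in> borel_measurable N" "W r \<in> borel_measurable N"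
    using \<xi> U r W_measurable by (auto intro: F_measurable_N)
  \<comment> \<open>A dummy first component gives the increment the value type of the pair, as
    \<open>indep_var\<close> requires.\<close>
  let ?Y = "\<lambda>\<omega>. (0 :: ennreal, ?D \<omega>)"
  have iv: "indep_var ?S ?X ?S (\<lambda>\<omega>. (\<lambda>z. (0, z)) (W t \<omega> - W r \<omega>))"
  proof (rule indep_var_increment[OF r])
    show "?X \<in> measurable (F r) ?S" using \<xi> U by (rule measurable_Pair)
    show "(\<lambda>z. (0, z)) \<in> measurable borel ?S" by (intro measurable_Pair) auto
  qed
  then have joint: "distr N ?S ?X \<Otimes>\<^sub>M distr N ?S ?Y = distr N (?S \<Otimes>\<^sub>M ?S) (\<lambda>\<omega>. (?X \<omega>, ?Y \<omega>))"
    unfolding indep_var_distribution_eq by simp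
  have D: "distr N borel ?D = density lborel (\<lambda>z. ennreal (normal_density 0 (sqrt (t - r)) z))"
    using distributed_distr_eq_density[OF W_increment[OF r]] by (simp cong: distr_cong)
  interpret D: prob_space "distr N ?S ?Y" by (rule prob_space_distr) measurable
  have "(\<integral>\<^sup>+\<omega>. \<xi> \<omega> * u (U \<omega> + ?D \<omega>) \<partial>N)
     = (\<integral>\<^sup>+z. fst (fst z) * u (snd (fst z) + snd (snd z)) \<partial>distr N (?S \<Otimes>\<^sub>M ?S) (\<lambda>\<omega>. (?X \<omega>, ?Y \<omega>)))"
    by (subst nn_integral_distr) auto
  also have "\<dots> = (\<integral>\<^sup>+x. \<integral>\<^sup>+z. fst x * u (snd x + snd z) \<partial>distr N ?S ?Y \<partial>distr N ?S ?X)"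
    unfolding joint[symmetric] by (subst D.nn_integral_fst[symmetric]) auto
  also have "\<dots> = (\<integral>\<^sup>+x. fst x * gauss_smooth (t - r) u (snd x) \<partial>distr N ?S ?X)"
  proof (rule nn_integral_cong)
    fix x :: "ennreal \<times> real"
    have "(\<integral>\<^sup>+z. fst x * u (snd x + snd z) \<partial>distr N ?S ?Y) = (\<integral>\<^sup>+\<omega>. fst x * u (snd x + ?D \<omega>) \<partial>N)"
      by (subst nn_integral_distr) auto
    also have "\<dots> = (\<integral>\<^sup>+z. fst x * u (snd x + z) \<partial>distr N borel ?D)"
      by (subst nn_integral_distr) auto
    also have "\<dots> = fst x * (\<integral>\<^sup>+z. u (snd x + z) \<partial>distr N borel ?D)"
      by (rule nn_integral_cmult) measurable
    also have "(\<integral>\<^sup>+z. u (snd x + z) \<partial>distr N borel ?D) = gauss_smooth (t - r) u (snd x)"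
      unfolding D gauss_smooth_def by (rule nn_integral_density) measurable
    finally show "(\<integral>\<^sup>+z. fst x * u (snd x + snd z) \<partial>distr N ?S ?Y) = fst x * gauss_smooth (t - r) u (snd x)" .
  qed
  also have "\<dots> = (\<integral>\<^sup>+\<omega>. \<xi> \<omega> * gauss_smooth (t - r) u (U \<omega>) \<partial>N)"
    by (subst nn_integral_distr) auto
  finally show ?thesis .
qed

text \<open>
  Peeling off the last time point turns the last test function into a factor of the one before, so
  the constant depends neither on \<open>h\<close> nor on \<open>\<xi>\<close>.
\<close>

lemma finite_dim_markov:
  assumes s0: "s 0 = (0::real)" and inc: "\<And>i. i < n \<Longrightarrow> s i < s (Suc i)"
    and u: "\<And>i. u i \<in> borel_measurable borel"
  shows "\<exists>c. \<forall>h\<ge>0. \<forall>\<xi>\<in>borel_measurable (F h).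
    (\<integral>\<^sup>+\<omega>. \<xi> \<omega> * (\<Prod>i\<le>n. u i (W (h + s i) \<omega> - W h \<omega>)) \<partial>N) = c * (\<integral>\<^sup>+\<omega>. \<xi> \<omega> \<partial>N)"
  using inc u
proof (induction n arbitrary: u)
  case 0
  have "(\<integral>\<^sup>+\<omega>. \<xi> \<omega> * (\<Prod>i\<le>0. u i (W (h + s i) \<omega> - W h \<omega>)) \<partial>N) = u 0 0 * (\<integral>\<^sup>+\<omega>. \<xi> \<omega> \<partial>N)"
    if "\<xi> \<in> borel_measurable (F h)" for h and \<xi> :: "'a \<Rightarrow> ennreal"
    using F_measurable_N[OF that] by (simp add: s0 nn_integral_multc mult.commute[of "u 0 0"])
  then show ?case by blast
next
  case (Suc n)
  define u' where "u' = u(n := (\<lambda>v. u n v * gauss_smooth (s (Suc n) - s n) (u (Suc n)) v))"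
  have mono: "0 \<le> s i \<and> s i \<le> s n" if "i \<le> n" for i
  proof -
    have *: "s i \<le> s j" if "i \<le> j" "j \<le> Suc n" for i j
      using that
    proof (induction j)
      case (Suc j)
      then show ?case using Suc.prems \<open>\<And>i. i < Suc n \<Longrightarrow> s i < s (Suc i)\<close>[of j] by (cases "i = Suc j") (auto intro: order_trans less_imp_le)
    qed simp
    show ?thesis using *[of 0 i] *[of i n] that s0 by simp
  qed
  have [measurable]: "u i \<in> borel_measurable borel" for i by (rule Suc.prems)
  have u'm: "u' i \<in> borel_measurable borel" for i unfolding u'_def by (cases "i = n") simp_all
  from Suc.IH[OF Suc.prems(1)[OF less_SucI] u'm]
  obtain c where c: "\<forall>h\<ge>0. \<forall>\<xi>\<in>borel_measurable (F h).
    (\<integral>\<^sup>+\<omega>. \<xi> \<omega> * (\<Prod>i\<le>n. u' i (W (h + s i) \<omega> - W h \<omega>)) \<partial>N) = c * (\<integral>\<^sup>+\<omega>. \<xi> \<omega> \<partial>N)" ..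
  have "(\<integral>\<^sup>+\<omega>. \<xi> \<omega> * (\<Prod>i\<le>Suc n. u i (W (h + s i) \<omega> - W h \<omega>)) \<partial>N) = c * (\<integral>\<^sup>+\<omega>. \<xi> \<omega> \<partial>N)"
    if h: "0 \<le> h" and \<xi>: "\<xi> \<in> borel_measurable (F h)" for h and \<xi> :: "'a \<Rightarrow> ennreal"
  proof -
    let ?r = "h + s n" and ?t = "h + s (Suc n)"
    have WF: "W (h + s i) \<in> borel_measurable (F ?r)" "W h \<in> borel_measurable (F ?r)" if "i \<le> n" for i
      using mono[OF that] mono[of n] h by (auto intro!: W_F)
    have \<xi>r: "\<xi> \<in> borel_measurable (F ?r)" using mono[of n] by (intro F_measurable_mono[OF _ \<xi>]) simp
    have uW: "(\<lambda>\<omega>. u i (W (h + s i) \<omega> - W h \<omega>)) \<in> borel_measurable (F ?r)" if "i \<le> n" for i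
      by (rule measurable_compose[OF borel_measurable_diff[OF WF(1)[OF that] WF(2)[OF that]] Suc.prems(2)])
    have m: "(\<lambda>\<omega>. \<xi> \<omega> * (\<Prod>i\<le>n. u i (W (h + s i) \<omega> - W h \<omega>))) \<in> borel_measurable (F ?r)"
      using uW by (intro borel_measurable_times_ennreal \<xi>r borel_measurable_prod_ennreal) auto
    have "(\<integral>\<^sup>+\<omega>. \<xi> \<omega> * (\<Prod>i\<le>Suc n. u i (W (h + s i) \<omega> - W h \<omega>)) \<partial>N)
      = (\<integral>\<^sup>+\<omega>. (\<xi> \<omega> * (\<Prod>i\<le>n. u i (W (h + s i) \<omega> - W h \<omega>))) * u (Suc n) ((W ?r \<omega> - W h \<omega>) + (W ?t \<omega> - W ?r \<omega>)) \<partial>N)"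
      by (intro nn_integral_cong) (simp add: mult.assoc)
    also have "\<dots> = (\<integral>\<^sup>+\<omega>. (\<xi> \<omega> * (\<Prod>i\<le>n. u i (W (h + s i) \<omega> - W h \<omega>))) * gauss_smooth (?t - ?r) (u (Suc n)) (W ?r \<omega> - W h \<omega>) \<partial>N)"
      using mono[of n] h Suc.prems(1)[of n] WF[of n] by (intro smooth_increment m) auto
    also have "\<dots> = (\<integral>\<^sup>+\<omega>. \<xi> \<omega> * (\<Prod>i\<le>n. u' i (W (h + s i) \<omega> - W h \<omega>)) \<partial>N)"
    proof (intro nn_integral_cong)
      fix \<omega>
      have "(\<Prod>i\<le>n. u' i (W (h + s i) \<omega> - W h \<omega>)) = (\<Prod>i\<in>{..<n}. u' i (W (h + s i) \<omega> - W h \<omega>)) * u' n (W ?r \<omega> - W h \<omega>)"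
        by (simp add: lessThan_Suc_atMost[symmetric])
      also have "(\<Prod>i\<in>{..<n}. u' i (W (h + s i) \<omega> - W h \<omega>)) = (\<Prod>i\<in>{..<n}. u i (W (h + s i) \<omega> - W h \<omega>))"
        by (intro prod.cong) (auto simp: u'_def)
      also have "\<dots> * u' n (W ?r \<omega> - W h \<omega>) = (\<Prod>i\<le>n. u i (W (h + s i) \<omega> - W h \<omega>)) * gauss_smooth (?t - ?r) (u (Suc n)) (W ?r \<omega> - W h \<omega>)"
        by (simp add: u'_def lessThan_Suc_atMost[symmetric] mult.assoc)
      finally show "\<xi> \<omega> * (\<Prod>i\<le>n. u i (W (h + s i) \<omega> - W h \<omega>)) * gauss_smooth (?t - ?r) (u (Suc n)) (W ?r \<omega> - W h \<omega>)
        = \<xi> \<omega> * (\<Prod>i\<le>n. u' i (W (h + s i) \<omega> - W h \<omega>))" by (simp add: mult.assoc)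
    qed
    also have "\<dots> = c * (\<integral>\<^sup>+\<omega>. \<xi> \<omega> \<partial>N)" using c h \<xi> by blast
    finally show ?thesis .
  qed
  then show ?case by blast
qed

text \<open>Sorting the times of \<open>J\<close> yields successive increments, to which
  \<open>finite_dim_markov\<close> applies; the constant obtained there serves all \<open>h\<close>
  and \<open>A\<close> at once.\<close>

lemma cylinder_markov:
  assumes J: "finite J" "J \<subseteq> {0..}" and B: "\<And>j. j \<in> J \<Longrightarrow> B j \<in> sets (borel :: real measure)"
  shows "\<exists>c. \<forall>h\<ge>0. \<forall>A\<in>sets (F h). emeasure N {\<omega> \<in> A. \<forall>j\<in>J. shifted h \<omega> j \<in> B j} = c * emeasure N A"
proof -
  \<comment> \<open>Time 0 is inserted because the peeling of time points ends there; if it is not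
    in \<open>J\<close>, its test function is the constant 1.\<close>
  define xs where "xs = sorted_list_of_set (insert 0 J)"
  define n where "n = length xs - 1"
  define u where "u i = (indicator (if xs ! i \<in> J then B (xs ! i) else UNIV) :: real \<Rightarrow> ennreal)" for i
  have set: "set xs = insert 0 J" unfolding xs_def using J(1) by (intro set_sorted_list_of_set) simp
  have srt: "sorted_wrt (<) xs" unfolding xs_def by (rule strict_sorted_list_of_set)
  have len: "length xs = Suc n" using set unfolding n_def by (cases xs) auto
  have s0: "xs ! 0 = 0"
  proof -
    have "0 \<in> set xs" using set by simp
    then obtain i where i: "i < length xs" "xs ! i = 0" by (auto simp: in_set_conv_nth)
    have "xs ! 0 \<in> set xs" using len by simp
    then have "0 \<le> xs ! 0" using set J(2) by auto
    then show ?thesis using i sorted_wrt_nth_less[OF srt, of 0 i] by (cases "i = 0") auto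
  qed
  have inc: "xs ! i < xs ! Suc i" if "i < n" for i
    using that len by (intro sorted_wrt_nth_less[OF srt]) auto
  have um: "u i \<in> borel_measurable borel" for i unfolding u_def using B by auto
  obtain c where c: "\<And>h \<xi>. 0 \<le> h \<Longrightarrow> \<xi> \<in> borel_measurable (F h) \<Longrightarrow>
    (\<integral>\<^sup>+\<omega>. \<xi> \<omega> * (\<Prod>i\<le>n. u i (W (h + xs ! i) \<omega> - W h \<omega>)) \<partial>N) = c * (\<integral>\<^sup>+\<omega>. \<xi> \<omega> \<partial>N)"
    using finite_dim_markov[of "\<lambda>i. xs ! i" n u, OF s0 inc um] by blast
  have "emeasure N {\<omega> \<in> A. \<forall>j\<in>J. shifted h \<omega> j \<in> B j} = c * emeasure N A" if h: "0 \<le> h" and A: "A \<in> sets (F h)" for h A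
  proof -
    have AN: "A \<in> sets N" using A sets_F by blast
    have ind: "(\<Prod>i\<le>n. u i (W (h + xs ! i) \<omega> - W h \<omega>)) = indicator {\<omega>. \<forall>j\<in>J. shifted h \<omega> j \<in> B j} \<omega>" for \<omega>
    proof (cases "\<forall>j\<in>J. shifted h \<omega> j \<in> B j")
      case True
      have "u i (W (h + xs ! i) \<omega> - W h \<omega>) = 1" for i
        using True J(2) by (auto simp: u_def indicator_def shifted_apply subset_iff)
      then show ?thesis using True by simp
    next
      case False
      then obtain j where j: "j \<in> J" "shifted h \<omega> j \<notin> B j" by auto
      then have "j \<in> set xs" using set by simp
      then obtain i where i: "i \<le> n" "xs ! i = j" using len by (auto simp: in_set_conv_nth less_Suc_eq_le)
      have "u i (W (h + xs ! i) \<omega> - W h \<omega>) = 0"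
        using j i J(2) by (auto simp: u_def indicator_def shifted_apply subset_iff)
      then have "(\<Prod>i\<le>n. u i (W (h + xs ! i) \<omega> - W h \<omega>)) = 0" using i(1) by (intro prod_zero) auto
      then show ?thesis using False by simp
    qed
    have "{\<omega> \<in> space N. \<forall>j\<in>J. shifted h \<omega> j \<in> B j} = space N \<inter> (\<Inter>j\<in>J. {\<omega> \<in> space N. W (h + j) \<omega> - W h \<omega> \<in> B j})"
      using J(2) by (auto simp: shifted_apply subset_iff)
    also have "\<dots> \<in> sets N"
    proof (cases "J = {}")
      case False
      have "{\<omega> \<in> space N. W (h + j) \<omega> - W h \<omega> \<in> B j} \<in> sets N" if "j \<in> J" for j
      proof -
        have "(\<lambda>\<omega>. W (h + j) \<omega> - W h \<omega>) \<in> borel_measurable N"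
          using that J(2) h by (intro borel_measurable_diff W_measurable) auto
        from measurable_sets[OF this B[OF that]] show ?thesis by (simp add: vimage_def Int_def conj_commute)
      qed
      then show ?thesis using False J(1) by (intro sets.Int sets.finite_INT) auto
    qed simp
    finally have E: "{\<omega> \<in> space N. \<forall>j\<in>J. shifted h \<omega> j \<in> B j} \<in> sets N" .
    have "{\<omega> \<in> A. \<forall>j\<in>J. shifted h \<omega> j \<in> B j} = A \<inter> {\<omega> \<in> space N. \<forall>j\<in>J. shifted h \<omega> j \<in> B j}"
      using sets.sets_into_space[OF AN] by auto
    then have "emeasure N {\<omega> \<in> A. \<forall>j\<in>J. shifted h \<omega> j \<in> B j} = (\<integral>\<^sup>+\<omega>. indicator (A \<inter> {\<omega> \<in> space N. \<forall>j\<in>J. shifted h \<omega> j \<in> B j}) \<omega> \<partial>N)"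
      using AN E by simp
    also have "\<dots> = (\<integral>\<^sup>+\<omega>. indicator A \<omega> * (\<Prod>i\<le>n. u i (W (h + xs ! i) \<omega> - W h \<omega>)) \<partial>N)"
      unfolding ind by (intro nn_integral_cong) (auto simp: indicator_def)
    also have "\<dots> = c * emeasure N A" using c[OF h, of "indicator A"] A AN by simp
    finally show ?thesis .
  qed
  then show ?thesis by blast
qed

text \<open>Two finite measures on path space agree on cylinders and hence everywhere. Since the
  constant of \<open>cylinder_markov\<close> depends on neither \<open>h\<close> nor
  \<open>A\<close>, the case of \<open>h = 0\<close> and the whole space identifies it as the
  probability of the cylinder.\<close>

theorem markov:
  assumes h: "0 \<le> h" and A: "A \<in> sets (F h)" and C: "C \<in> sets path_space"
  shows "emeasure N {\<omega> \<in> A. shifted h \<omega> \<in> C} = emeasure N A * emeasure N {\<omega> \<in> space N. shifted 0 \<omega> \<in> C}"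
proof -
  have AN: "A \<in> sets N" using A sets_F by blast
  let ?P = "distr (density N (indicator A)) path_space (shifted h)"
  let ?Q = "scale_measure (emeasure N A) (distr N path_space (shifted 0))"
  have mh: "shifted h \<in> measurable N path_space" and m0: "shifted 0 \<in> measurable N path_space"
    using shifted_measurable h by auto
  have P: "emeasure ?P C = emeasure N {\<omega> \<in> A. shifted h \<omega> \<in> C}" if "C \<in> sets path_space" for C
  proof -
    have S: "shifted h -` C \<inter> space N \<in> sets N" by (rule measurable_sets[OF mh that])
    have "emeasure ?P C = emeasure (density N (indicator A)) (shifted h -` C \<inter> space N)"
      using mh that by (subst emeasure_distr) auto
    also have "\<dots> = emeasure N (A \<inter> (shifted h -` C \<inter> space N))"
      by (rule emeasure_restricted[OF AN S])
    also have "A \<inter> (shifted h -` C \<inter> space N) = {\<omega> \<in> A. shifted h \<omega> \<in> C}"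
      using sets.sets_into_space[OF AN] by auto
    finally show ?thesis .
  qed
  have Q: "emeasure ?Q C = emeasure N A * emeasure N {\<omega> \<in> space N. shifted 0 \<omega> \<in> C}" if "C \<in> sets path_space" for C
    using m0 that by (simp add: emeasure_distr vimage_def Int_def conj_commute)
  have "?P = ?Q"
  proof (rule measure_eqI_PiM_infinite[where M = "\<lambda>_. borel" and I = "{0..}"])
    show "finite_measure ?P"
      using P[of "space path_space"] by (intro finite_measureI) (auto simp: emeasure_eq_measure)
    fix B :: "real \<Rightarrow> real set" and J :: "real set"
    assume J: "finite J" "J \<subseteq> {0..}" and B: "\<And>i. i \<in> J \<Longrightarrow> B i \<in> sets borel"
    let ?C = "prod_emb {0..} (\<lambda>_. borel) J (Pi\<^sub>E J B)"
    have C: "?C \<in> sets path_space" unfolding path_space_def using J B by (intro sets_PiM_I) auto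
    have mem: "shifted k \<omega> \<in> ?C \<longleftrightarrow> (\<forall>j\<in>J. shifted k \<omega> j \<in> B j)" for k \<omega>
      using J(2) by (auto simp: prod_emb_def shifted_def PiE_iff)
    obtain c where c: "\<And>h A. 0 \<le> h \<Longrightarrow> A \<in> sets (F h) \<Longrightarrow> emeasure N {\<omega> \<in> A. \<forall>j\<in>J. shifted h \<omega> j \<in> B j} = c * emeasure N A"
      using cylinder_markov[where B = B, OF J B] by blast
    have "space N \<in> sets (F 0)" using sets.top[of "F 0"] by (simp add: space_F)
    then have "emeasure N {\<omega> \<in> space N. \<forall>j\<in>J. shifted 0 \<omega> j \<in> B j} = c"
      using c[of 0 "space N"] by (simp add: emeasure_space_1)
    then show "emeasure ?P ?C = emeasure ?Q ?C"
      unfolding P[OF C] Q[OF C] mem using c[OF h A] by (simp add: mult.commute)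
  qed (simp_all add: path_space_def)
  then show ?thesis using P[OF C] Q[OF C] by simp
qed

end

text \<open>Continuous paths do not form a measurable set of the product sigma-algebra; its trace on
  them is the setting in which exit times are measurable functionals.\<close>

definition cpath_space :: "(real \<Rightarrow> real) measure" where
  "cpath_space = restrict_space path_space {p. continuous_on {0..} p}"

context filtered_bm begin

lemma shifted_measurable_c: "0 \<le> h \<Longrightarrow> shifted h \<in> measurable N cpath_space"
  unfolding cpath_space_def
  by (intro measurable_restrict_space2 shifted_measurable) (auto intro: shifted_continuous)

text \<open>The shifted paths of the motion are always continuous, so an event of the trace can be
  exchanged for an event of \<open>path_space\<close> without changing its preimage.\<close>

lemma markov_nn_integral:
  assumes h: "0 \<le> h" and A: "A \<in> sets (F h)" and g: "g \<in> borel_measurable cpath_space"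
  shows "(\<integral>\<^sup>+\<omega>. indicator A \<omega> * g (shifted h \<omega>) \<partial>N) = emeasure N A * (\<integral>\<^sup>+\<omega>. g (shifted 0 \<omega>) \<partial>N)"
proof -
  have AN: "A \<in> sets N" using A sets_F by blast
  let ?P = "distr (density N (indicator A)) cpath_space (shifted h)"
  let ?Q = "scale_measure (emeasure N A) (distr N cpath_space (shifted 0))"
  have mh: "shifted h \<in> measurable N cpath_space" and m0: "shifted 0 \<in> measurable N cpath_space"
    using shifted_measurable_c h by auto
  have "?P = ?Q"
  proof (rule measure_eqI)
    fix E assume "E \<in> sets ?P"
    then have E: "E \<in> sets cpath_space" by simp
    then obtain C where C: "C \<in> sets path_space" "E = {p. continuous_on {0..} p} \<inter> C"
      by (auto simp: cpath_space_def sets_restrict_space)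
    have S: "shifted h -` E \<inter> space N \<in> sets N" by (rule measurable_sets[OF mh E])
    have "emeasure ?P E = emeasure (density N (indicator A)) (shifted h -` E \<inter> space N)"
      using mh E by (subst emeasure_distr) auto
    also have "\<dots> = emeasure N (A \<inter> (shifted h -` E \<inter> space N))"
      by (rule emeasure_restricted[OF AN S])
    also have "A \<inter> (shifted h -` E \<inter> space N) = {\<omega> \<in> A. shifted h \<omega> \<in> C}"
      using sets.sets_into_space[OF AN] shifted_continuous[OF h] by (auto simp: C(2))
    also have "emeasure N \<dots> = emeasure N A * emeasure N {\<omega> \<in> space N. shifted 0 \<omega> \<in> C}"
      by (rule markov[OF h A C(1)])
    also have "{\<omega> \<in> space N. shifted 0 \<omega> \<in> C} = shifted 0 -` E \<inter> space N"
      using shifted_continuous[of 0] by (auto simp: C(2))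
    also have "emeasure N A * emeasure N (shifted 0 -` E \<inter> space N) = emeasure ?Q E"
      using m0 E by (simp add: emeasure_distr)
    finally show "emeasure ?P E = emeasure ?Q E" .
  qed simp
  have "(\<integral>\<^sup>+\<omega>. indicator A \<omega> * g (shifted h \<omega>) \<partial>N) = (\<integral>\<^sup>+p. g p \<partial>?P)"
    using mh g AN measurable_compose[OF mh g] by (simp add: nn_integral_distr nn_integral_density)
  also have "\<dots> = emeasure N A * (\<integral>\<^sup>+\<omega>. g (shifted 0 \<omega>) \<partial>N)"
    unfolding \<open>?P = ?Q\<close> using m0 g by (simp add: nn_integral_scale_measure nn_integral_distr)
  finally show ?thesis .
qed

lemma markov_integral:
  fixes g :: "(real \<Rightarrow> real) \<Rightarrow> real"
  assumes h: "0 \<le> h" and A: "A \<in> sets (F h)" and g: "g \<in> borel_measurable cpath_space"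
    and bd: "\<And>p. \<bar>g p\<bar> \<le> K"
  shows "(\<integral>\<omega>. indicator A \<omega> * g (shifted h \<omega>) \<partial>N) = prob A * (\<integral>\<omega>. g (shifted 0 \<omega>) \<partial>N)"
proof -
  have AN [measurable]: "A \<in> sets N" using A sets_F by blast
  have K: "0 \<le> K" using order_trans[OF abs_ge_zero bd] .
  have [measurable]: "(\<lambda>\<omega>. g (shifted h \<omega>)) \<in> borel_measurable N" "(\<lambda>\<omega>. g (shifted 0 \<omega>)) \<in> borel_measurable N"
    using measurable_compose[OF shifted_measurable_c g] h by auto
  \<comment> \<open>Adding \<open>K\<close> makes \<open>g\<close> nonnegative, so that
    \<open>markov_nn_integral\<close> applies; the constant is taken away again at the end.\<close>
  have pos: "0 \<le> g p + K" "g p + K \<le> 2 * K" for p using bd[of p] by auto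
  have ib: "integrable N X" if "X \<in> borel_measurable N" "\<And>\<omega>. \<bar>X \<omega>\<bar> \<le> 2 * K" for X :: "'a \<Rightarrow> real"
    using that by (intro integrable_const_bound[where B = "2 * K"]) auto
  have b1: "\<bar>g p + K\<bar> \<le> 2 * K" and b2: "\<bar>g p\<bar> \<le> 2 * K" for p using pos[of p] bd[of p] by linarith+
  have i: "integrable N (\<lambda>\<omega>. indicator A \<omega> * (g (shifted h \<omega>) + K))" "integrable N (\<lambda>\<omega>. g (shifted 0 \<omega>) + K)"
    "integrable N (\<lambda>\<omega>. indicator A \<omega> * g (shifted h \<omega>))" "integrable N (\<lambda>\<omega>. g (shifted 0 \<omega>))"
    "integrable N (\<lambda>\<omega>. indicator A \<omega> * K)"
    using b1 b2 K by (intro ib; simp add: indicator_def)+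
  have "ennreal (\<integral>\<omega>. indicator A \<omega> * (g (shifted h \<omega>) + K) \<partial>N) = (\<integral>\<^sup>+\<omega>. indicator A \<omega> * ennreal (g (shifted h \<omega>) + K) \<partial>N)"
    using pos by (subst nn_integral_eq_integral[OF i(1), symmetric]) (auto intro!: nn_integral_cong simp: indicator_def)
  also have "\<dots> = emeasure N A * (\<integral>\<^sup>+\<omega>. ennreal (g (shifted 0 \<omega>) + K) \<partial>N)"
    by (rule markov_nn_integral[OF h A, where g = "\<lambda>p. ennreal (g p + K)"]) (use g in simp)
  also have "\<dots> = ennreal (prob A * (\<integral>\<omega>. g (shifted 0 \<omega>) + K \<partial>N))"
    using pos by (subst nn_integral_eq_integral[OF i(2)]) (auto simp: emeasure_eq_measure ennreal_mult)
  finally have "(\<integral>\<omega>. indicator A \<omega> * (g (shifted h \<omega>) + K) \<partial>N) = prob A * (\<integral>\<omega>. g (shifted 0 \<omega>) + K \<partial>N)"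
    using pos by (subst (asm) ennreal_inj) (auto intro!: Bochner_Integration.integral_nonneg mult_nonneg_nonneg)
  moreover have "(\<integral>\<omega>. indicator A \<omega> * (g (shifted h \<omega>) + K) \<partial>N) = (\<integral>\<omega>. indicator A \<omega> * g (shifted h \<omega>) \<partial>N) + prob A * K"
    using i sets.sets_into_space[OF AN] by (simp add: distrib_left Int_absorb2)
  ultimately show ?thesis using i by (simp add: prob_space algebra_simps)
qed

section \<open>Weights as functionals of the path\<close>

text \<open>A Doob-Dynkin factorisation modulo null sets: \<open>F_generated\<close> provides it for
  indicators, and it passes to multiples, sums and increasing limits, where countably many
  exceptional sets are merged.\<close>

lemma factor_through_path:
  fixes \<xi> :: "'a \<Rightarrow> ennreal"
  assumes t: "0 \<le> t" and \<xi>: "\<xi> \<in> borel_measurable (F t)"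
  shows "\<exists>\<phi>\<in>borel_measurable (PiM {0..t} (\<lambda>_. borel)). AE \<omega> in N. \<xi> \<omega> = \<phi> (\<lambda>s\<in>{0..t}. W s \<omega> - W 0 \<omega>)"
  using \<xi>
proof (induction rule: borel_measurable_induct)
  case (cong f g)
  then obtain \<phi> where \<phi>: "\<phi> \<in> borel_measurable (PiM {0..t} (\<lambda>_. borel))" "AE \<omega> in N. g \<omega> = \<phi> (\<lambda>s\<in>{0..t}. W s \<omega> - W 0 \<omega>)"
    by blast
  from \<phi>(2) AE_space have "AE \<omega> in N. f \<omega> = \<phi> (\<lambda>s\<in>{0..t}. W s \<omega> - W 0 \<omega>)"
    by eventually_elim (use cong in \<open>auto simp: space_F\<close>)
  then show ?case using \<phi>(1) by blast
next
  case (set A)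
  from F_generated[OF t set] obtain C where C: "C \<in> sets (PiM {0..t} (\<lambda>_. borel))"
    "AE \<omega> in N. \<omega> \<in> A \<longleftrightarrow> (\<lambda>s\<in>{0..t}. W s \<omega> - W 0 \<omega>) \<in> C" by blast
  from C(2) have "AE \<omega> in N. indicator A \<omega> = (indicator C (\<lambda>s\<in>{0..t}. W s \<omega> - W 0 \<omega>) :: ennreal)"
    by eventually_elim (simp only: indicator_def)
  then show ?case by (rule bexI[OF _ borel_measurable_indicator[OF C(1)]])
next
  case (mult u c)
  then obtain \<phi> where \<phi>: "\<phi> \<in> borel_measurable (PiM {0..t} (\<lambda>_. borel))" "AE \<omega> in N. u \<omega> = \<phi> (\<lambda>s\<in>{0..t}. W s \<omega> - W 0 \<omega>)"
    by blast
  from \<phi>(2) have "AE \<omega> in N. c * u \<omega> = c * \<phi> (\<lambda>s\<in>{0..t}. W s \<omega> - W 0 \<omega>)" by eventually_elim simp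
  then show ?case by (rule bexI[where x = "\<lambda>p. c * \<phi> p"]) (use \<phi>(1) in simp)
next
  case (add u v)
  then obtain \<phi> \<psi> where \<phi>: "\<phi> \<in> borel_measurable (PiM {0..t} (\<lambda>_. borel))" "AE \<omega> in N. u \<omega> = \<phi> (\<lambda>s\<in>{0..t}. W s \<omega> - W 0 \<omega>)"
    and \<psi>: "\<psi> \<in> borel_measurable (PiM {0..t} (\<lambda>_. borel))" "AE \<omega> in N. v \<omega> = \<psi> (\<lambda>s\<in>{0..t}. W s \<omega> - W 0 \<omega>)"
    by blast
  from \<phi>(2) \<psi>(2) have "AE \<omega> in N. v \<omega> + u \<omega> = \<psi> (\<lambda>s\<in>{0..t}. W s \<omega> - W 0 \<omega>) + \<phi> (\<lambda>s\<in>{0..t}. W s \<omega> - W 0 \<omega>)"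
    by eventually_elim simp
  then show ?case by (rule bexI[where x = "\<lambda>p. \<psi> p + \<phi> p"]) (use \<phi>(1) \<psi>(1) in simp)
next
  case (seq U)
  then have "\<forall>i. \<exists>\<phi>. \<phi> \<in> borel_measurable (PiM {0..t} (\<lambda>_. borel)) \<and> (AE \<omega> in N. U i \<omega> = \<phi> (\<lambda>s\<in>{0..t}. W s \<omega> - W 0 \<omega>))"
    by blast
  from choice[OF this] obtain \<phi> where \<phi>: "\<And>i. \<phi> i \<in> borel_measurable (PiM {0..t} (\<lambda>_. borel))"
    "\<And>i. AE \<omega> in N. U i \<omega> = \<phi> i (\<lambda>s\<in>{0..t}. W s \<omega> - W 0 \<omega>)" by blast
  have "AE \<omega> in N. \<forall>i. U i \<omega> = \<phi> i (\<lambda>s\<in>{0..t}. W s \<omega> - W 0 \<omega>)"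
    unfolding AE_all_countable using \<phi>(2) by blast
  then have "AE \<omega> in N. (SUP i. U i) \<omega> = (SUP i. \<phi> i (\<lambda>s\<in>{0..t}. W s \<omega> - W 0 \<omega>))"
    by eventually_elim (simp add: image_comp)
  moreover have "(\<lambda>p. SUP i. \<phi> i p) \<in> borel_measurable (PiM {0..t} (\<lambda>_. borel))"
    using \<phi>(1) by (intro borel_measurable_SUP) auto
  ultimately show ?case by (rule bexI[where x = "\<lambda>p. SUP i. \<phi> i p"])
qed

text \<open>The functional reads the path only up to time \<open>t\<close>, which keeps its shifts adapted.\<close>

lemma weight_factor:
  assumes t: "0 \<le> t" and w: "weight t \<xi>"
  shows "\<exists>\<phi> C. \<phi> \<in> borel_measurable cpath_space \<and> (\<forall>p. \<bar>\<phi> p\<bar> \<le> C) \<and>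
    (AE \<omega> in N. \<xi> \<omega> = \<phi> (shifted 0 \<omega>)) \<and>
    (\<forall>h\<ge>0. (\<lambda>\<omega>. \<phi> (shifted h \<omega>)) \<in> borel_measurable (F (h + t)))"
proof -
  obtain C where C: "\<And>\<omega>. \<omega> \<in> space N \<Longrightarrow> \<bar>\<xi> \<omega>\<bar> \<le> C" and \<xi>m: "\<xi> \<in> borel_measurable (F t)"
    using w by (auto simp: weight_def)
  have C0: "0 \<le> C"
  proof -
    obtain \<omega> where "\<omega> \<in> space N" using not_empty by blast
    from C[OF this] show ?thesis by linarith
  qed
  \<comment> \<open>The factorisation is for values in \<open>ennreal\<close>, so
    \<open>\<xi>\<close> is first shifted to be nonnegative.\<close>
  have "(\<lambda>\<omega>. ennreal (\<xi> \<omega> + C)) \<in> borel_measurable (F t)" using \<xi>m by simp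
  from factor_through_path[OF t this] obtain \<psi> where
    \<psi>: "\<psi> \<in> borel_measurable (PiM {0..t} (\<lambda>_. borel))"
    "AE \<omega> in N. ennreal (\<xi> \<omega> + C) = \<psi> (\<lambda>s\<in>{0..t}. W s \<omega> - W 0 \<omega>)" by blast
  \<comment> \<open>The clamp makes the bound hold on every path and not only on almost every
    one.\<close>
  define \<phi> where "\<phi> p = max (- C) (min C (enn2real (\<psi> (restrict p {0..t})) - C))" for p
  have rs: "restrict (shifted h \<omega>) {0..t} = (\<lambda>s\<in>{0..t}. W (h + s) \<omega> - W h \<omega>)" for h \<omega>
    by (auto simp: shifted_def restrict_def fun_eq_iff)
  have "(\<lambda>p. restrict p {0..t}) \<in> measurable path_space (PiM {0..t} (\<lambda>_. borel))"
    unfolding path_space_def by (rule measurable_restrict_subset) auto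
  then have "(\<lambda>p. restrict p {0..t}) \<in> measurable cpath_space (PiM {0..t} (\<lambda>_. borel))"
    unfolding cpath_space_def by (rule measurable_restrict_space1)
  from measurable_compose[OF this \<psi>(1)] have "\<phi> \<in> borel_measurable cpath_space"
    unfolding \<phi>_def by measurable
  moreover have "\<bar>\<phi> p\<bar> \<le> C" for p
    using C0 enn2real_nonneg[of "\<psi> (restrict p {0..t})"] unfolding \<phi>_def by linarith
  moreover have "AE \<omega> in N. \<xi> \<omega> = \<phi> (shifted 0 \<omega>)"
    using \<psi>(2) AE_space
  proof eventually_elim
    case (elim \<omega>)
    have "\<psi> (restrict (shifted 0 \<omega>) {0..t}) = ennreal (\<xi> \<omega> + C)" using elim(1) by (simp add: rs)
    moreover have "- C \<le> \<xi> \<omega>" "\<xi> \<omega> \<le> C" using C[OF elim(2)] by linarith+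
    ultimately show ?case by (simp add: \<phi>_def min_absorb2 max_absorb2)
  qed
  moreover have "(\<lambda>\<omega>. \<phi> (shifted h \<omega>)) \<in> borel_measurable (F (h + t))" if h: "0 \<le> h" for h
  proof -
    have "(\<lambda>\<omega>. \<lambda>s\<in>{0..t}. W (h + s) \<omega> - W h \<omega>) \<in> measurable (F (h + t)) (PiM {0..t} (\<lambda>_. borel))"
      using h t by (intro measurable_restrict borel_measurable_diff W_F) auto
    from measurable_compose[OF this \<psi>(1)] show ?thesis unfolding \<phi>_def rs by measurable
  qed
  ultimately show ?thesis by blast
qed

end

section \<open>Simple controls and their payoffs as path functionals\<close>

definition path_int :: "nat \<Rightarrow> (nat \<Rightarrow> real) \<Rightarrow> (nat \<Rightarrow> (real \<Rightarrow> real) \<Rightarrow> real) \<Rightarrow> (real \<Rightarrow> real) \<Rightarrow> real \<Rightarrow> real" where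
  "path_int n ts \<phi> p t = (\<Sum>i<n. \<phi> i p * (p (min (ts (Suc i)) t) - p (min (ts i) t)))"

text \<open>The clamping only makes the functional bounded on paths for which the limit does not exist.\<close>

definition path_payoff :: "real \<Rightarrow> nat \<Rightarrow> (nat \<Rightarrow> real) \<Rightarrow> (nat \<Rightarrow> (real \<Rightarrow> real) \<Rightarrow> real) \<Rightarrow> (real \<Rightarrow> real) \<Rightarrow> real \<Rightarrow> (real \<Rightarrow> real) \<Rightarrow> real" where
  "path_payoff y n ts \<phi> G K p =
     max (- K) (min K (lim (\<lambda>k. G (p (exit_time (\<lambda>t. y - t + path_int n ts \<phi> p t) (real (Suc k)))))))"

lemma space_cpath: "p \<in> space cpath_space \<Longrightarrow> continuous_on {0..} p"
  by (auto simp: cpath_space_def space_restrict_space)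

lemma coordinate_measurable: "0 \<le> s \<Longrightarrow> (\<lambda>p. p s) \<in> borel_measurable cpath_space"
  unfolding cpath_space_def path_space_def
  by (intro measurable_restrict_space1 measurable_component_singleton) auto

lemma path_int_measurable:
  assumes \<phi>: "\<And>i. i < n \<Longrightarrow> \<phi> i \<in> borel_measurable cpath_space" and ts: "\<And>i. i \<le> n \<Longrightarrow> 0 \<le> ts i" and t: "0 \<le> t"
  shows "(\<lambda>p. path_int n ts \<phi> p t) \<in> borel_measurable cpath_space"
  unfolding path_int_def
  using t ts by (intro borel_measurable_sum borel_measurable_times borel_measurable_diff coordinate_measurable \<phi>) auto

lemma path_int_continuous:
  assumes p: "continuous_on {0..} p" and ts: "\<And>i. i \<le> n \<Longrightarrow> 0 \<le> ts i"
  shows "continuous_on {0..} (path_int n ts \<phi> p)"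
proof -
  have "continuous_on {0..} (\<lambda>t. p (min (ts i) t))" if "i \<le> n" for i
    using ts[OF that] by (intro continuous_on_compose2[OF p] continuous_intros) auto
  then show ?thesis unfolding path_int_def[abs_def] by (intro continuous_intros) auto
qed

lemma path_int_0: "(\<And>i. i \<le> n \<Longrightarrow> 0 \<le> ts i) \<Longrightarrow> path_int n ts \<phi> p 0 = 0"
  unfolding path_int_def by (intro sum.neutral) (auto simp: min_absorb2)

text \<open>For each finite cap a continuous path is sampled at a measurable exit time;
  \<open>lim\<close> over the caps stays measurable whether or not the sequence converges.\<close>

lemma path_payoff_measurable:
  assumes \<phi>: "\<And>i. i < n \<Longrightarrow> \<phi> i \<in> borel_measurable cpath_space" and ts: "\<And>i. i \<le> n \<Longrightarrow> 0 \<le> ts i"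
    and G: "continuous_on UNIV G"
  shows "path_payoff y n ts \<phi> G K \<in> borel_measurable cpath_space"
proof -
  have Gm: "G \<in> borel_measurable borel" using G by (rule borel_measurable_continuous_onI)
  have "(\<lambda>p. G (p (exit_time (\<lambda>t. y - t + path_int n ts \<phi> p t) (real (Suc k))))) \<in> borel_measurable cpath_space" for k
  proof (rule measurable_compose[OF sample_measurable[where X = "\<lambda>s p. p s" and T = "real (Suc k)"] Gm])
    show "(\<lambda>p. exit_time (\<lambda>t. y - t + path_int n ts \<phi> p t) (real (Suc k))) \<in> borel_measurable cpath_space"
    proof (rule exit_time_measurable)
      show "(\<lambda>p. y - s + path_int n ts \<phi> p s) \<in> borel_measurable cpath_space" if "0 \<le> s" for s
        using path_int_measurable[OF \<phi> ts that] by simp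
      show "continuous_on {0..} (\<lambda>t. y - t + path_int n ts \<phi> p t)" if "p \<in> space cpath_space" for p
        by (intro continuous_intros path_int_continuous ts space_cpath that)
    qed simp
  qed (use exit_time_bounds in \<open>auto intro: coordinate_measurable space_cpath\<close>)
  then have "(\<lambda>p. lim (\<lambda>k. G (p (exit_time (\<lambda>t. y - t + path_int n ts \<phi> p t) (real (Suc k)))))) \<in> borel_measurable cpath_space"
    by (rule borel_measurable_lim_metric)
  then show ?thesis unfolding path_payoff_def[abs_def] by simp
qed

lemma path_payoff_bound: "0 \<le> K \<Longrightarrow> \<bar>path_payoff y n ts \<phi> G K p\<bar> \<le> K"
  unfolding path_payoff_def by linarith

text \<open>Once the drifted path has come down to zero by time \<open>s\<close>, all exit times
  with a cap beyond \<open>s\<close> agree, so the limit is attained.\<close>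

lemma path_payoff_eq:
  assumes p: "continuous_on {0..} p" and ts: "\<And>i. i \<le> n \<Longrightarrow> 0 \<le> ts i" and y: "0 \<le> y"
    and s: "0 \<le> s" "y - s + path_int n ts \<phi> p s \<le> 0" and G: "\<And>z. \<bar>G z\<bar> \<le> K"
  shows "path_payoff y n ts \<phi> G K p = G (p (hit y (path_int n ts \<phi> p)))"
proof -
  obtain m :: nat where m: "s \<le> real m" using real_arch_simple by blast
  have "exit_time (\<lambda>t. y - t + path_int n ts \<phi> p t) (real (Suc k)) = hit y (path_int n ts \<phi> p)" if "m \<le> k" for k
    using y s m that
    by (intro hit_eq_exit_time[where s = s, symmetric] path_int_continuous p ts path_int_0) auto
  then have "\<forall>\<^sub>F k in sequentially. G (p (exit_time (\<lambda>t. y - t + path_int n ts \<phi> p t) (real (Suc k)))) = G (p (hit y (path_int n ts \<phi> p)))"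
    unfolding eventually_sequentially by metis
  then have "lim (\<lambda>k. G (p (exit_time (\<lambda>t. y - t + path_int n ts \<phi> p t) (real (Suc k))))) = G (p (hit y (path_int n ts \<phi> p)))"
    by (intro limI tendsto_eventually)
  then show ?thesis using G[of "p (hit y (path_int n ts \<phi> p))"] by (simp add: path_payoff_def abs_le_iff)
qed

context filtered_bm begin

lemma simple_times_nonneg: "simple n ts \<xi> \<Longrightarrow> i \<le> n \<Longrightarrow> 0 \<le> ts i"
proof (cases i)
  case (Suc k)
  assume "simple n ts \<xi>" "i \<le> n"
  then have "0 \<le> ts k" "ts k \<le> ts (Suc k)" using Suc by (simp_all add: simple_def elem_data_def)
  then show "0 \<le> ts i" using Suc by simp
qed (simp add: simple_def)

lemma simple_martingale:
  assumes s: "simple n ts \<xi>"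
  shows "\<exists>C. l2_martingale (simple_int n ts \<xi>) C" "AE \<omega> in N. simple_int n ts \<xi> 0 \<omega> = 0"
proof -
  show "\<exists>C. l2_martingale (simple_int n ts \<xi>) C"
    using s by (intro elem_l2_martingale) (simp add: simple_def)
  have "simple_int n ts \<xi> 0 \<omega> = 0" for \<omega>
    unfolding elem_integral_def
  proof (intro sum.neutral ballI)
    fix i assume "i \<in> {..<n}"
    then show "\<xi> i \<omega> * (W (min (ts (Suc i)) 0) \<omega> - W (min (ts i) 0) \<omega>) = 0"
      using simple_times_nonneg[OF s, of i] simple_times_nonneg[OF s, of "Suc i"] by (simp add: min_absorb2)
  qed
  then show "AE \<omega> in N. simple_int n ts \<xi> 0 \<omega> = 0" by simp
qed

text \<open>There are only finitely many weights, so one exceptional null set serves all of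
  them.\<close>

lemma simple_factor:
  assumes s: "simple n ts \<xi>"
  shows "\<exists>\<phi>. (\<forall>i<n. \<phi> i \<in> borel_measurable cpath_space) \<and>
    (AE \<omega> in N. \<forall>i<n. \<xi> i \<omega> = \<phi> i (shifted 0 \<omega>)) \<and>
    (\<forall>i<n. \<forall>h\<ge>0. weight (h + ts i) (\<lambda>\<omega>. \<phi> i (shifted h \<omega>)))"
proof -
  have "\<forall>i. \<exists>\<phi>. i < n \<longrightarrow> \<phi> \<in> borel_measurable cpath_space \<and> (AE \<omega> in N. \<xi> i \<omega> = \<phi> (shifted 0 \<omega>)) \<and>
    (\<forall>h\<ge>0. weight (h + ts i) (\<lambda>\<omega>. \<phi> (shifted h \<omega>)))"
  proof
    fix i
    show "\<exists>\<phi>. i < n \<longrightarrow> \<phi> \<in> borel_measurable cpath_space \<and> (AE \<omega> in N. \<xi> i \<omega> = \<phi> (shifted 0 \<omega>)) \<and>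
      (\<forall>h\<ge>0. weight (h + ts i) (\<lambda>\<omega>. \<phi> (shifted h \<omega>)))"
    proof (cases "i < n")
      case True
      then have "0 \<le> ts i" "weight (ts i) (\<xi> i)" using s by (auto simp: simple_def elem_data_def)
      from weight_factor[OF this] show ?thesis unfolding weight_def by blast
    qed simp
  qed
  from choice[OF this] obtain \<phi> where \<phi>: "\<forall>i. i < n \<longrightarrow> \<phi> i \<in> borel_measurable cpath_space \<and> (AE \<omega> in N. \<xi> i \<omega> = \<phi> i (shifted 0 \<omega>)) \<and>
    (\<forall>h\<ge>0. weight (h + ts i) (\<lambda>\<omega>. \<phi> i (shifted h \<omega>)))" ..
  have "AE \<omega> in N. \<forall>i\<in>{..<n}. \<xi> i \<omega> = \<phi> i (shifted 0 \<omega>)"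
    using \<phi> by (intro AE_finite_allI) auto
  then have "AE \<omega> in N. \<forall>i<n. \<xi> i \<omega> = \<phi> i (shifted 0 \<omega>)" by eventually_elim auto
  then show ?thesis using \<phi> by blast
qed

text \<open>Off a null set the weights equal their functionals along \<open>shifted 0\<close>. The
  simple integral and the path integral then coincide at all nonnegative times, and with them the
  hitting times.\<close>

lemma path_payoff_mean:
  assumes s: "simple n ts \<xi>" and y: "0 \<le> y" and G: "\<And>z. \<bar>G z\<bar> \<le> K" "continuous_on UNIV G"
    and \<phi>: "\<forall>i<n. \<phi> i \<in> borel_measurable cpath_space" "AE \<omega> in N. \<forall>i<n. \<xi> i \<omega> = \<phi> i (shifted 0 \<omega>)"
  shows "(\<integral>\<omega>. path_payoff y n ts \<phi> G K (shifted 0 \<omega>) \<partial>N)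
    = (\<integral>\<omega>. G (W (hit y (\<lambda>t. simple_int n ts \<xi> t \<omega>)) \<omega> - W 0 \<omega>) \<partial>N)"
proof (rule integral_cong_AE)
  obtain C where mart: "l2_martingale (simple_int n ts \<xi>) C" using simple_martingale(1)[OF s] by blast
  note z = simple_martingale(2)[OF s] and nn = simple_times_nonneg[OF s]
  show "(\<lambda>\<omega>. path_payoff y n ts \<phi> G K (shifted 0 \<omega>)) \<in> borel_measurable N"
    using \<phi>(1) nn by (intro measurable_compose[OF shifted_measurable_c path_payoff_measurable] G(2)) auto
  have Gm: "G \<in> borel_measurable borel" using G(2) by (rule borel_measurable_continuous_onI)
  show "(\<lambda>\<omega>. G (W (hit y (\<lambda>t. simple_int n ts \<xi> t \<omega>)) \<omega> - W 0 \<omega>)) \<in> borel_measurable N"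
    by (rule measurable_compose[OF _ Gm]) (intro borel_measurable_diff W_hit_measurable[OF mart z y] W_measurable, simp)
  show "AE \<omega> in N. path_payoff y n ts \<phi> G K (shifted 0 \<omega>) = G (W (hit y (\<lambda>t. simple_int n ts \<xi> t \<omega>)) \<omega> - W 0 \<omega>)"
    using \<phi>(2) hit_path[OF mart z y] AE_space
  proof eventually_elim
    case (elim \<omega>)
    have eq: "simple_int n ts \<xi> t \<omega> = path_int n ts \<phi> (shifted 0 \<omega>) t" if "0 \<le> t" for t
      unfolding elem_integral_def path_int_def
    proof (intro sum.cong refl)
      fix i assume "i \<in> {..<n}"
      then show "\<xi> i \<omega> * (W (min (ts (Suc i)) t) \<omega> - W (min (ts i) t) \<omega>)
        = \<phi> i (shifted 0 \<omega>) * (shifted 0 \<omega> (min (ts (Suc i)) t) - shifted 0 \<omega> (min (ts i) t))"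
        using elim(1) nn[of i] nn[of "Suc i"] that by (simp add: shifted_apply)
    qed
    have heq: "hit y (\<lambda>t. simple_int n ts \<xi> t \<omega>) = hit y (path_int n ts \<phi> (shifted 0 \<omega>))"
      unfolding hit_def by (intro arg_cong[where f = Inf]) (auto simp: eq)
    have "path_payoff y n ts \<phi> G K (shifted 0 \<omega>) = G (shifted 0 \<omega> (hit y (path_int n ts \<phi> (shifted 0 \<omega>))))"
      using elim(2) eq[of "hit y (\<lambda>t. simple_int n ts \<xi> t \<omega>)"]
      by (intro path_payoff_eq[where s = "hit y (\<lambda>t. simple_int n ts \<xi> t \<omega>)"] nn y G shifted_continuous elim(3)) auto
    also have "shifted 0 \<omega> (hit y (path_int n ts \<phi> (shifted 0 \<omega>))) = W (hit y (\<lambda>t. simple_int n ts \<xi> t \<omega>)) \<omega> - W 0 \<omega>"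
      using elim(2) by (simp add: heq[symmetric] shifted_apply)
    finally show ?case .
  qed
qed

text \<open>For bounded continuous \<open>G\<close>, the almost sure convergence of terminal values
  in \<open>hit_stability\<close> gives convergence of the means. A subsequence is enough, since a
  single good approximation is sought.\<close>

lemma simple_value_approx:
  fixes G :: "real \<Rightarrow> real"
  assumes j: "joint_measurable \<alpha>" and fin: "sqn \<alpha> < \<infinity>" and I: "is_ito \<alpha> I" and y: "0 \<le> y"
    and G: "\<And>z. \<bar>G z\<bar> \<le> K" "continuous_on UNIV G" and e: "0 < e"
  shows "\<exists>n ts \<xi>. simple n ts \<xi> \<and>
    \<bar>(\<integral>\<omega>. G (W (hit y (\<lambda>t. simple_int n ts \<xi> t \<omega>)) \<omega> - W 0 \<omega>) \<partial>N) - (\<integral>\<omega>. G (W (hit y (\<lambda>t. I t \<omega>)) \<omega> - W 0 \<omega>) \<partial>N)\<bar> < e"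
proof -
  from I obtain n ts \<xi> where s: "\<And>k :: nat. simple (n k) (ts k) (\<xi> k)"
    and sI: "\<And>t. 0 \<le> t \<Longrightarrow> (\<lambda>k. \<integral>\<^sup>+\<omega>. ennreal ((simple_int (n k) (ts k) (\<xi> k) t \<omega> - I t \<omega>)\<^sup>2) \<partial>N) \<longlonglongrightarrow> 0"
    and adapted: "\<And>t. 0 \<le> t \<Longrightarrow> I t \<in> borel_measurable (F t)"
    unfolding is_ito_def by blast
  define S where "S k = simple_int (n k) (ts k) (\<xi> k)" for k
  obtain C where C: "l2_martingale I C" using ito_martingale(1)[OF j fin I] by blast
  note I0 = ito_martingale(2)[OF j fin I]
  have "\<forall>k. \<exists>D. l2_martingale (S k) D" unfolding S_def using simple_martingale(1)[OF s] by blast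
  from choice[OF this] obtain D where D: "\<And>k. l2_martingale (S k) (D k)" by blast
  have S0: "AE \<omega> in N. S k 0 \<omega> = 0" for k unfolding S_def by (rule simple_martingale(2)[OF s])
  have "(\<lambda>k. \<integral>\<omega>. (S k t \<omega> - I t \<omega>)\<^sup>2 \<partial>N) \<longlonglongrightarrow> 0" if t: "0 \<le> t" for t
    by (rule nn_L2_tendsto(2)[OF l2_martingaleD(3)[OF D t] F_measurable_N[OF adapted[OF t]]])
       (use sI[OF t] in \<open>simp add: S_def\<close>)
  from hit_stability[OF C I0 y D S0 this] obtain r :: "nat \<Rightarrow> nat"
    where r: "AE \<omega> in N. (\<lambda>j. W (hit y (\<lambda>t. S (r j) t \<omega>)) \<omega>) \<longlonglongrightarrow> W (hit y (\<lambda>t. I t \<omega>)) \<omega>" by blast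
  have Gm: "G \<in> borel_measurable borel" using G(2) by (rule borel_measurable_continuous_onI)
  have "(\<lambda>j. \<integral>\<omega>. G (W (hit y (\<lambda>t. S (r j) t \<omega>)) \<omega> - W 0 \<omega>) \<partial>N) \<longlonglongrightarrow> (\<integral>\<omega>. G (W (hit y (\<lambda>t. I t \<omega>)) \<omega> - W 0 \<omega>) \<partial>N)"
  proof (rule integral_dominated_convergence[where w = "\<lambda>_. K"])
    show "(\<lambda>\<omega>. G (W (hit y (\<lambda>t. I t \<omega>)) \<omega> - W 0 \<omega>)) \<in> borel_measurable N"
      by (rule measurable_compose[OF _ Gm]) (intro borel_measurable_diff W_hit_measurable[OF C I0 y] W_measurable, simp)
    show "(\<lambda>\<omega>. G (W (hit y (\<lambda>t. S (r j) t \<omega>)) \<omega> - W 0 \<omega>)) \<in> borel_measurable N" for j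
      by (rule measurable_compose[OF _ Gm]) (intro borel_measurable_diff W_hit_measurable[OF D S0 y] W_measurable, simp)
    show "AE \<omega> in N. (\<lambda>j. G (W (hit y (\<lambda>t. S (r j) t \<omega>)) \<omega> - W 0 \<omega>)) \<longlonglongrightarrow> G (W (hit y (\<lambda>t. I t \<omega>)) \<omega> - W 0 \<omega>)"
      using r
    proof eventually_elim
      case (elim \<omega>)
      show ?case
        by (rule continuous_on_tendsto_compose[OF G(2)]) (intro tendsto_intros elim, auto)
    qed
  qed (use G in auto)
  from LIMSEQ_D[OF this e] obtain j0 where "\<bar>(\<integral>\<omega>. G (W (hit y (\<lambda>t. S (r j0) t \<omega>)) \<omega> - W 0 \<omega>) \<partial>N) - (\<integral>\<omega>. G (W (hit y (\<lambda>t. I t \<omega>)) \<omega> - W 0 \<omega>) \<partial>N)\<bar> < e"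
    by auto
  then show ?thesis using s[of "r j0"] unfolding S_def by blast
qed

end

section \<open>Mixing two controls\<close>

context filtered_bm begin

lemma elem_add:
  assumes "elem_data P a b \<xi>" "elem_data Q a' b' \<xi>'"
  shows "elem_data (P <+> Q) (case_sum a a') (case_sum b b') (case_sum \<xi> \<xi>')"
    "elem_process (P <+> Q) (case_sum a a') (case_sum b b') (case_sum \<xi> \<xi>') t \<omega>
       = elem_process P a b \<xi> t \<omega> + elem_process Q a' b' \<xi>' t \<omega>"
    "elem_integral (P <+> Q) (case_sum a a') (case_sum b b') (case_sum \<xi> \<xi>') t \<omega>
       = elem_integral P a b \<xi> t \<omega> + elem_integral Q a' b' \<xi>' t \<omega>"
proof -
  have fin: "finite P" "finite Q" using assms by (auto simp: elem_data_def)
  show "elem_data (P <+> Q) (case_sum a a') (case_sum b b') (case_sum \<xi> \<xi>')"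
    using assms unfolding elem_data_def by auto
  show "elem_process (P <+> Q) (case_sum a a') (case_sum b b') (case_sum \<xi> \<xi>') t \<omega>
       = elem_process P a b \<xi> t \<omega> + elem_process Q a' b' \<xi>' t \<omega>"
    unfolding elem_process_def sum.Plus[OF fin] o_def by (simp only: sum.case)
  show "elem_integral (P <+> Q) (case_sum a a') (case_sum b b') (case_sum \<xi> \<xi>') t \<omega>
       = elem_integral P a b \<xi> t \<omega> + elem_integral Q a' b' \<xi>' t \<omega>"
    unfolding elem_integral_def sum.Plus[OF fin] o_def by (simp only: sum.case)
qed

lemma progressively_measurable_add:
  assumes "progressively_measurable F \<alpha>" "progressively_measurable F \<beta>"
  shows "progressively_measurable F (\<lambda>s \<omega>. \<alpha> s \<omega> + \<beta> s \<omega>)"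
  using assms unfolding progressively_measurable_def case_prod_beta' by (auto intro: borel_measurable_add)

lemma elem_progressive:
  assumes d: "elem_data P a b \<xi>"
  shows "progressively_measurable F (elem_process P a b \<xi>)"
  unfolding progressively_measurable_def elem_process_def[abs_def] case_prod_beta'
proof (intro allI impI borel_measurable_sum)
  fix t :: real and p assume t: "0 \<le> t" and p: "p \<in> P"
  let ?M = "restrict_space borel {0..t} \<Otimes>\<^sub>M F t"
  show "(\<lambda>z. \<xi> p (snd z) * indicator {a p<..b p} (fst z)) \<in> borel_measurable ?M"
  proof (cases "a p \<le> t")
    case True
    moreover have "\<xi> p \<in> borel_measurable (F (a p))" using d p by (simp add: elem_data_def weight_def)
    ultimately have "\<xi> p \<in> borel_measurable (F t)" by (rule F_measurable_mono)
    then have "(\<lambda>z. \<xi> p (snd z)) \<in> borel_measurable ?M" by (rule measurable_compose[OF measurable_snd])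
    moreover have "(\<lambda>z. indicator {a p<..b p} (fst z) :: real) \<in> borel_measurable ?M"
      by (rule measurable_compose[OF measurable_fst]) (auto intro: measurable_restrict_space1)
    ultimately show ?thesis by (rule borel_measurable_times)
  next
    \<comment> \<open>An interval that begins after \<open>t\<close> contributes zero on
      \<open>{0..t}\<close>, so its unknown weight does no harm.\<close>
    case False
    have "(\<lambda>z. 0 :: real) \<in> borel_measurable ?M" by simp
    then show ?thesis
      by (rule measurable_cong[THEN iffD1, rotated])
         (use False in \<open>auto simp: space_pair_measure space_restrict_space indicator_def\<close>)
  qed
qed

text \<open>Up to time \<open>t\<close> the indicator depends on \<open>\<rho>\<close> only through
  \<open>min (\<rho> \<omega>) t\<close>, which is known at \<open>t\<close>.\<close>

lemma stopped_progressive: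
  assumes \<rho>: "bounded_stopping T \<rho>"
  shows "progressively_measurable F (\<lambda>s \<omega>. c * indicator {0<..\<rho> \<omega>} s)"
  unfolding progressively_measurable_def case_prod_beta'
proof (intro allI impI)
  fix t :: real assume t: "0 \<le> t"
  let ?M = "restrict_space borel {0..t} \<Otimes>\<^sub>M F t"
  have "(\<lambda>\<omega>. min (\<rho> \<omega>) t) \<in> borel_measurable (F t)"
  proof (rule borel_measurableI_le)
    fix u
    show "{\<omega> \<in> space (F t). min (\<rho> \<omega>) t \<le> u} \<in> sets (F t)"
    proof (cases "t \<le> u")
      case True
      then have "{\<omega> \<in> space (F t). min (\<rho> \<omega>) t \<le> u} = space (F t)" by auto
      then show ?thesis by simp
    next
      case False
      then have "{\<omega> \<in> space (F t). min (\<rho> \<omega>) t \<le> u} = {\<omega> \<in> space N. \<rho> \<omega> \<le> u}" by (auto simp: space_F)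
      then show ?thesis using bounded_stoppingD(4)[OF \<rho>, of u] F_mono[of u t] False by auto
    qed
  qed
  then have [measurable]: "(\<lambda>z. min (\<rho> (snd z)) t) \<in> borel_measurable ?M" by (rule measurable_compose[OF measurable_snd])
  have [measurable]: "(\<lambda>z. fst z) \<in> borel_measurable ?M"
    by (rule measurable_compose[OF measurable_fst]) (auto intro: measurable_restrict_space1)
  have "(\<lambda>z. c * (if 0 < fst z \<and> fst z \<le> min (\<rho> (snd z)) t then 1 else 0)) \<in> borel_measurable ?M"
    by measurable
  then show "(\<lambda>z. c * indicator {0<..\<rho> (snd z)} (fst z)) \<in> borel_measurable ?M"
    by (rule measurable_cong[THEN iffD1, rotated])
       (auto simp: space_pair_measure space_restrict_space indicator_def)
qed

text \<open>The two integrands differ only between the two times, and there by \<open>c\<close> in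
  absolute value.\<close>

lemma sqn_stopped_diff:
  assumes "\<And>\<omega>. \<omega> \<in> space N \<Longrightarrow> 0 \<le> \<rho> \<omega> \<and> 0 \<le> \<sigma> \<omega> \<and> \<bar>\<rho> \<omega> - \<sigma> \<omega>\<bar> \<le> d"
  shows "sqn (\<lambda>s \<omega>. c * indicator {0<..\<rho> \<omega>} s - c * indicator {0<..\<sigma> \<omega>} s) \<le> ennreal (c\<^sup>2 * d)"
proof -
  have "sqn (\<lambda>s \<omega>. c * indicator {0<..\<rho> \<omega>} s - c * indicator {0<..\<sigma> \<omega>} s) \<le> (\<integral>\<^sup>+\<omega>. ennreal (c\<^sup>2 * d) \<partial>N)"
    unfolding sqn_def
  proof (rule nn_integral_mono)
    fix \<omega> assume \<omega>: "\<omega> \<in> space N"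
    have "(\<integral>\<^sup>+s\<in>{0..}. ennreal ((c * indicator {0<..\<rho> \<omega>} s - c * indicator {0<..\<sigma> \<omega>} s)\<^sup>2) \<partial>lborel)
       = (\<integral>\<^sup>+s. ennreal (c\<^sup>2) * indicator {min (\<rho> \<omega>) (\<sigma> \<omega>)<..max (\<rho> \<omega>) (\<sigma> \<omega>)} s \<partial>lborel)"
      using assms[OF \<omega>] by (intro nn_integral_cong) (auto simp: indicator_def)
    also have "\<dots> = ennreal (c\<^sup>2) * ennreal (max (\<rho> \<omega>) (\<sigma> \<omega>) - min (\<rho> \<omega>) (\<sigma> \<omega>))"
      by (subst nn_integral_cmult_indicator) auto
    also have "\<dots> = ennreal (c\<^sup>2 * \<bar>\<rho> \<omega> - \<sigma> \<omega>\<bar>)"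
      by (subst ennreal_mult[symmetric]) (auto simp: max_def min_def)
    also have "\<dots> \<le> ennreal (c\<^sup>2 * d)"
      using assms[OF \<omega>] by (intro ennreal_leI mult_left_mono) auto
    finally show "(\<integral>\<^sup>+s\<in>{0..}. ennreal ((c * indicator {0<..\<rho> \<omega>} s - c * indicator {0<..\<sigma> \<omega>} s)\<^sup>2) \<partial>lborel) \<le> ennreal (c\<^sup>2 * d)" .
  qed
  then show ?thesis by (simp add: emeasure_space_1)
qed

text \<open>All intervals end by a common time, at which the isometry expresses the norm through a
  square-integrable variable.\<close>

lemma elem_sqn_finite:
  assumes d: "elem_data P a b \<xi>" shows "sqn (elem_process P a b \<xi>) < \<infinity>"
proof -
  define T where "T = (\<Sum>p\<in>P. b p)"
  have fin: "finite P" and ab: "\<And>p. p \<in> P \<Longrightarrow> 0 \<le> a p \<and> a p \<le> b p" using d by (auto simp: elem_data_def)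
  have bT: "b p \<le> T" if "p \<in> P" for p
    unfolding T_def using ab fin that by (intro member_le_sum) force+
  have T: "0 \<le> T" unfolding T_def using ab by (intro sum_nonneg) force
  have z: "elem_process P a b \<xi> s \<omega> = 0" if "T < s" for s \<omega>
    unfolding elem_process_def using bT that by (intro sum.neutral) (force simp: indicator_def)
  have "sqn (elem_process P a b \<xi>) = (\<integral>\<^sup>+\<omega>. (\<integral>\<^sup>+s\<in>{0..T}. ennreal ((elem_process P a b \<xi> s \<omega>)\<^sup>2) \<partial>lborel) \<partial>N)"
    unfolding sqn_def by (intro nn_integral_cong) (auto simp: indicator_def z not_le)
  also have "\<dots> = (\<integral>\<^sup>+\<omega>. ennreal ((elem_integral P a b \<xi> T \<omega>)\<^sup>2) \<partial>N)" by (rule elem_isometry[OF d T, symmetric])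
  also have "\<dots> < \<infinity>" using elem_integral_sq_integrable[OF d T] by (simp add: sq_integrable_iff_nn)
  finally show ?thesis .
qed

text \<open>The opening part of the mixed control is stopped at a time that need not lie on any
  grid, so it is not elementary as it stands. Rounding \<open>\<rho>\<close> up gives elementary
  approximations with explicit integrals, and uniqueness then identifies every version of the
  integral.\<close>

lemma stopped_plus_elem:
  fixes c :: real
  assumes \<rho>: "bounded_stopping T \<rho>" and d: "elem_data Q a b \<eta>"
  defines "\<alpha> \<equiv> \<lambda>s \<omega>. c * indicator {0<..\<rho> \<omega>} s + elem_process Q a b \<eta> s \<omega>"
  shows "progressively_measurable F \<alpha>" "sqn \<alpha> < \<infinity>"
    and "is_ito \<alpha> I \<Longrightarrow> 0 \<le> t \<Longrightarrow> AE \<omega> in N. I t \<omega> = c * (W (min (\<rho> \<omega>) t) \<omega> - W 0 \<omega>) + elem_integral Q a b \<eta> t \<omega>"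
proof -
  note r = bounded_stoppingD[OF \<rho>]
  show prog: "progressively_measurable F \<alpha>"
    unfolding \<alpha>_def by (intro progressively_measurable_add stopped_progressive[OF \<rho>] elem_progressive[OF d])
  note jW = progressive_joint_measurable[OF stopped_progressive[OF \<rho>, of c]]
  have "sqn (\<lambda>s \<omega>. c * indicator {0<..\<rho> \<omega>} s) \<le> ennreal (c\<^sup>2 * T)"
    using sqn_stopped_diff[of \<rho> "\<lambda>_. 0" T c] r(1-3) by simp
  then have W: "sqn (\<lambda>s \<omega>. c * indicator {0<..\<rho> \<omega>} s) < \<infinity>" by (rule le_less_trans) simp
  have "sqn \<alpha> \<le> 2 * sqn (\<lambda>s \<omega>. c * indicator {0<..\<rho> \<omega>} s) + 2 * sqn (elem_process Q a b \<eta>)"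
    unfolding \<alpha>_def by (intro sqn_add_le jW elem_joint_measurable[OF d])
  also have "\<dots> < \<infinity>" using W elem_sqn_finite[OF d] by (simp add: ennreal_mult_less_top)
  finally show "sqn \<alpha> < \<infinity>" .
  assume I: "is_ito \<alpha> I" and t: "0 \<le> t"
  define P where "P n = {..<Suc n} <+> Q" for n :: nat
  define A where "A n = case_sum (grid_point T (Suc n)) a" for n
  define B where "B n = case_sum (\<lambda>i. grid_point T (Suc n) (Suc i)) b" for n
  define X where "X n = case_sum (stop_weight c T (Suc n) \<rho>) \<eta>" for n
  define E where "E \<omega> = c * (W (min (\<rho> \<omega>) t) \<omega> - W 0 \<omega>) + elem_integral Q a b \<eta> t \<omega>" for \<omega>
  have e: "elem_data (P n) (A n) (B n) (X n)" for n
    unfolding P_def A_def B_def X_def by (rule elem_add(1)[OF stopped_elem(1)[OF \<rho> zero_less_Suc] d])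
  have ep: "elem_process (P n) (A n) (B n) (X n) s \<omega> = c * indicator {0<..grid_up T (Suc n) (\<rho> \<omega>)} s + elem_process Q a b \<eta> s \<omega>"
    if "\<omega> \<in> space N" for n s \<omega>
    unfolding P_def A_def B_def X_def elem_add(2)[OF stopped_elem(1)[OF \<rho> zero_less_Suc] d] stopped_elem(3)[OF \<rho> zero_less_Suc that] ..
  have ei: "elem_integral (P n) (A n) (B n) (X n) t \<omega> = c * (W (min (grid_up T (Suc n) (\<rho> \<omega>)) t) \<omega> - W 0 \<omega>) + elem_integral Q a b \<eta> t \<omega>"
    if "\<omega> \<in> space N" for n \<omega>
    unfolding P_def A_def B_def X_def elem_add(3)[OF stopped_elem(1)[OF \<rho> zero_less_Suc] d] stopped_elem(2)[OF \<rho> zero_less_Suc t that] ..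
  note g = grid_up_bounds[OF r(1) zero_less_Suc r(2) r(3)]
  have l1: "sqn (\<lambda>s \<omega>. elem_process (P n) (A n) (B n) (X n) s \<omega> - \<alpha> s \<omega>) \<le> ennreal (c\<^sup>2 * (T * inverse (real (Suc n))))" for n
  proof -
    have "sqn (\<lambda>s \<omega>. elem_process (P n) (A n) (B n) (X n) s \<omega> - \<alpha> s \<omega>)
      = sqn (\<lambda>s \<omega>. c * indicator {0<..grid_up T (Suc n) (\<rho> \<omega>)} s - c * indicator {0<..\<rho> \<omega>} s)"
      unfolding sqn_def by (intro nn_integral_cong) (simp add: ep \<alpha>_def)
    also have "\<dots> \<le> ennreal (c\<^sup>2 * (T * inverse (real (Suc n))))"
    proof (rule sqn_stopped_diff)
      fix \<omega> assume \<omega>: "\<omega> \<in> space N"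
      show "0 \<le> grid_up T (Suc n) (\<rho> \<omega>) \<and> 0 \<le> \<rho> \<omega> \<and> \<bar>grid_up T (Suc n) (\<rho> \<omega>) - \<rho> \<omega>\<bar> \<le> T * inverse (real (Suc n))"
        using g(2-4)[OF \<omega> \<omega>, of n] r(2)[OF \<omega>] unfolding divide_inverse by auto
    qed
    finally show ?thesis .
  qed
  have l2: "(\<integral>\<^sup>+\<omega>. ennreal ((elem_integral (P n) (A n) (B n) (X n) t \<omega> - E \<omega>)\<^sup>2) \<partial>N) \<le> ennreal (c\<^sup>2 * (T * inverse (real (Suc n))))"
    and Em: "E \<in> borel_measurable N" for n
  proof -
    define D where "D k \<omega> = elem_integral (P n) (A n) (B n) (X n) t \<omega> - elem_integral (P (k + n)) (A (k + n)) (B (k + n)) (X (k + n)) t \<omega>" for k \<omega>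
    have Dsq: "sq_integrable N (D k)" for k
      unfolding D_def[abs_def] by (intro sq_integrable_diff elem_integral_sq_integrable[OF e t])
    have bd: "(\<integral>\<omega>. (D k \<omega>)\<^sup>2 \<partial>N) \<le> c\<^sup>2 * (T * inverse (real (Suc n)))" for k
    proof -
      have "ennreal (\<integral>\<omega>. (D k \<omega>)\<^sup>2 \<partial>N) = (\<integral>\<^sup>+\<omega>. ennreal ((D k \<omega>)\<^sup>2) \<partial>N)"
        by (rule sq_integrable_nn_eq[OF Dsq, symmetric])
      also have "\<dots> \<le> sqn (\<lambda>s \<omega>. elem_process (P n) (A n) (B n) (X n) s \<omega> - elem_process (P (k + n)) (A (k + n)) (B (k + n)) (X (k + n)) s \<omega>)"
        unfolding D_def by (rule elem_integral_diff_sq_le[OF e e t])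
      also have "\<dots> = sqn (\<lambda>s \<omega>. c * indicator {0<..grid_up T (Suc n) (\<rho> \<omega>)} s - c * indicator {0<..grid_up T (Suc (k + n)) (\<rho> \<omega>)} s)"
        unfolding sqn_def by (intro nn_integral_cong) (simp add: ep)
      also have "\<dots> \<le> ennreal (c\<^sup>2 * (T * inverse (real (Suc n))))"
      proof (rule sqn_stopped_diff)
        fix \<omega> assume \<omega>: "\<omega> \<in> space N"
        have "T / real (Suc (k + n)) \<le> T / real (Suc n)" using r(1) by (intro divide_left_mono) auto
        then show "0 \<le> grid_up T (Suc n) (\<rho> \<omega>) \<and> 0 \<le> grid_up T (Suc (k + n)) (\<rho> \<omega>) \<and>
          \<bar>grid_up T (Suc n) (\<rho> \<omega>) - grid_up T (Suc (k + n)) (\<rho> \<omega>)\<bar> \<le> T * inverse (real (Suc n))"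
          using g(2-4)[OF \<omega> \<omega>, of n] g(2-4)[OF \<omega> \<omega>, of "k + n"] unfolding divide_inverse by linarith
      qed
      finally show ?thesis using r(1) by (subst (asm) ennreal_le_iff) auto
    qed
    have lim: "(\<lambda>k. elem_integral (P (k + n)) (A (k + n)) (B (k + n)) (X (k + n)) t \<omega>) \<longlonglongrightarrow> E \<omega>"
      if \<omega>: "\<omega> \<in> space N" for \<omega> n
    proof -
      have "(\<lambda>k. min (grid_up T (Suc k) (\<rho> \<omega>)) t) \<longlonglongrightarrow> min (\<rho> \<omega>) t"
        by (intro tendsto_min tendsto_const grid_up_tendsto r \<omega>)
      then have "(\<lambda>k. W (min (grid_up T (Suc k) (\<rho> \<omega>)) t) \<omega>) \<longlonglongrightarrow> W (min (\<rho> \<omega>) t) \<omega>"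
        by (rule continuous_on_tendsto_compose[OF W_continuous[OF \<omega>]]) (use r(2)[OF \<omega>] t g(4)[OF \<omega> \<omega>] in auto)
      then have "(\<lambda>k. elem_integral (P k) (A k) (B k) (X k) t \<omega>) \<longlonglongrightarrow> E \<omega>"
        unfolding ei[OF \<omega>] E_def by (intro tendsto_intros)
      then show ?thesis by (rule LIMSEQ_ignore_initial_segment)
    qed
    show Em: "E \<in> borel_measurable N"
      by (rule borel_measurable_LIMSEQ_real[OF lim[of _ 0] sq_integrableD(1)[OF elem_integral_sq_integrable[OF e t]]])
    have "AE \<omega> in N. (\<lambda>k. D k \<omega>) \<longlonglongrightarrow> elem_integral (P n) (A n) (B n) (X n) t \<omega> - E \<omega>"
      unfolding D_def by (intro AE_I2 tendsto_intros lim)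
    note l = L2_bounded_tendsto_L1(1,2)[OF Dsq _ bd this]
    have m: "(\<lambda>\<omega>. elem_integral (P n) (A n) (B n) (X n) t \<omega> - E \<omega>) \<in> borel_measurable N"
      by (rule borel_measurable_diff[OF sq_integrableD(1)[OF elem_integral_sq_integrable[OF e t]] Em])
    show "(\<integral>\<^sup>+\<omega>. ennreal ((elem_integral (P n) (A n) (B n) (X n) t \<omega> - E \<omega>)\<^sup>2) \<partial>N) \<le> ennreal (c\<^sup>2 * (T * inverse (real (Suc n))))"
      unfolding sq_integrable_nn_eq[OF l(1)[OF m]] using l(2)[OF m] by (rule ennreal_leI)
  qed
  have "(\<lambda>n. c\<^sup>2 * (T * inverse (real (Suc n)))) \<longlonglongrightarrow> c\<^sup>2 * (T * 0)"
    by (intro tendsto_intros LIMSEQ_inverse_real_of_nat)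
  from tendsto_ennrealI[OF this] have z: "(\<lambda>n. ennreal (c\<^sup>2 * (T * inverse (real (Suc n))))) \<longlonglongrightarrow> 0" by simp
  have "AE \<omega> in N. I t \<omega> = E \<omega>"
  proof (rule ito_unique[OF progressive_joint_measurable[OF prog] I t e _ Em])
    show "(\<lambda>k. sqn (\<lambda>s \<omega>. elem_process (P k) (A k) (B k) (X k) s \<omega> - \<alpha> s \<omega>)) \<longlonglongrightarrow> 0"
      by (rule tendsto_sandwich[OF _ _ tendsto_const z]) (use l1 in auto)
    show "(\<lambda>k. \<integral>\<^sup>+\<omega>. ennreal ((elem_integral (P k) (A k) (B k) (X k) t \<omega> - E \<omega>)\<^sup>2) \<partial>N) \<longlonglongrightarrow> 0"
      by (rule tendsto_sandwich[OF _ _ tendsto_const z]) (use l2 in auto)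
  qed
  then show "AE \<omega> in N. I t \<omega> = c * (W (min (\<rho> \<omega>) t) \<omega> - W 0 \<omega>) + elem_integral Q a b \<eta> t \<omega>"
    by (simp add: E_def)
qed

text \<open>\<open>ito_unique\<close> compares processes at one time only, while hitting times
  depend on the whole path. Equality on countably many grid times holds off a single null set, and
  continuity extends it to all times.\<close>

lemma continuous_indistinguishable:
  fixes X Y :: "real \<Rightarrow> 'a \<Rightarrow> real"
  assumes X: "\<And>\<omega>. \<omega> \<in> space N \<Longrightarrow> continuous_on {0..} (\<lambda>t. X t \<omega>)"
    and Y: "\<And>\<omega>. \<omega> \<in> space N \<Longrightarrow> continuous_on {0..} (\<lambda>t. Y t \<omega>)"
    and eq: "\<And>t. 0 \<le> t \<Longrightarrow> AE \<omega> in N. X t \<omega> = Y t \<omega>"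
  shows "AE \<omega> in N. \<forall>t\<ge>0. X t \<omega> = Y t \<omega>"
proof -
  have "AE \<omega> in N. \<forall>m n i :: nat. X (real i * real (Suc m) / real (Suc n)) \<omega> = Y (real i * real (Suc m) / real (Suc n)) \<omega>"
    unfolding AE_all_countable by (intro allI eq) simp
  then show ?thesis using AE_space
  proof eventually_elim
    case (elim \<omega>)
    show ?case
    proof (intro allI impI)
      fix t :: real assume t: "0 \<le> t"
      obtain m :: nat where m: "t \<le> real m" using real_arch_simple by blast
      then have tm: "t \<le> real (Suc m)" by simp
      have T: "0 < real (Suc m)" by simp
      have "(\<lambda>n. X (grid_up (real (Suc m)) (Suc n) t) \<omega>) \<longlonglongrightarrow> X t \<omega>"
        by (rule grid_up_path_tendsto[OF T t tm X[OF elim(2)]])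
      moreover have "(\<lambda>n. Y (grid_up (real (Suc m)) (Suc n) t) \<omega>) \<longlonglongrightarrow> Y t \<omega>"
        by (rule grid_up_path_tendsto[OF T t tm Y[OF elim(2)]])
      moreover have "X (grid_up (real (Suc m)) (Suc n) t) \<omega> = Y (grid_up (real (Suc m)) (Suc n) t) \<omega>" for n
        unfolding grid_up_def using elim(1) by blast
      ultimately show "X t \<omega> = Y t \<omega>" by (simp add: LIMSEQ_unique)
    qed
  qed
qed

text \<open>The Gaussian density never exceeds its peak \<open>1 / sqrt (2 * pi * h)\<close>, and
  the interval has length \<open>2 * d\<close>.\<close>

lemma small_increment_prob:
  assumes h: "0 < h" and d: "0 \<le> d"
  shows "{\<omega> \<in> space N. \<bar>W h \<omega> - W 0 \<omega>\<bar> \<le> d} \<in> sets N"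
    "prob {\<omega> \<in> space N. \<bar>W h \<omega> - W 0 \<omega>\<bar> \<le> d} \<le> 2 * d / sqrt (2 * pi * h)"
proof -
  have [measurable]: "W h \<in> borel_measurable N" "W 0 \<in> borel_measurable N" using W_measurable h by auto
  show S: "{\<omega> \<in> space N. \<bar>W h \<omega> - W 0 \<omega>\<bar> \<le> d} \<in> sets N" by measurable
  have dist: "distributed N lborel (\<lambda>\<omega>. W h \<omega> - W 0 \<omega>) (\<lambda>z. ennreal (normal_density 0 (sqrt h) z))"
    using W_increment[of 0 h] h by simp
  have le: "normal_density 0 (sqrt h) z \<le> 1 / sqrt (2 * pi * h)" for z
    using h by (simp add: normal_density_def divide_right_mono)
  have "emeasure N ((\<lambda>\<omega>. W h \<omega> - W 0 \<omega>) -` {-d..d} \<inter> space N) = (\<integral>\<^sup>+z. ennreal (normal_density 0 (sqrt h) z) * indicator {-d..d} z \<partial>lborel)"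
    by (rule distributed_emeasure[OF dist]) simp
  also have "\<dots> \<le> (\<integral>\<^sup>+z. ennreal (1 / sqrt (2 * pi * h)) * indicator {-d..d} z \<partial>lborel)"
    by (intro nn_integral_mono mult_right_mono ennreal_leI le) simp
  also have "\<dots> = ennreal (1 / sqrt (2 * pi * h)) * ennreal (2 * d)"
    using d by (subst nn_integral_cmult_indicator) auto
  also have "\<dots> = ennreal (2 * d / sqrt (2 * pi * h))"
    using d h by (subst ennreal_mult[symmetric]) auto
  also have "(\<lambda>\<omega>. W h \<omega> - W 0 \<omega>) -` {-d..d} \<inter> space N = {\<omega> \<in> space N. \<bar>W h \<omega> - W 0 \<omega>\<bar> \<le> d}" by auto
  finally show "prob {\<omega> \<in> space N. \<bar>W h \<omega> - W 0 \<omega>\<bar> \<le> d} \<le> 2 * d / sqrt (2 * pi * h)"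
    using d h by (simp add: emeasure_eq_measure)
qed

text \<open>Chebyshev's inequality; the variance of the increment is \<open>h\<close>.\<close>

lemma large_increment_prob:
  assumes h: "0 < h" and d: "0 < d"
  shows "{\<omega> \<in> space N. d < \<bar>W h \<omega> - W 0 \<omega>\<bar>} \<in> sets N"
    "prob {\<omega> \<in> space N. d < \<bar>W h \<omega> - W 0 \<omega>\<bar>} \<le> h / d\<^sup>2"
proof -
  have [measurable]: "W h \<in> borel_measurable N" "W 0 \<in> borel_measurable N" using W_measurable h by auto
  show S: "{\<omega> \<in> space N. d < \<bar>W h \<omega> - W 0 \<omega>\<bar>} \<in> sets N" by measurable
  have one: "(\<lambda>_. 1 :: real) \<in> borel_measurable (F 0)" "integrable N (\<lambda>_. 1 :: real)" by auto
  have v: "integrable N (\<lambda>\<omega>. (W h \<omega> - W 0 \<omega>)\<^sup>2)" "(\<integral>\<omega>. (W h \<omega> - W 0 \<omega>)\<^sup>2 \<partial>N) = h"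
    using increment_variance[OF order_refl less_imp_le[OF h] one] by (simp_all add: prob_space)
  have "d\<^sup>2 * prob {\<omega> \<in> space N. d < \<bar>W h \<omega> - W 0 \<omega>\<bar>} = (\<integral>\<omega>. d\<^sup>2 * indicator {\<omega> \<in> space N. d < \<bar>W h \<omega> - W 0 \<omega>\<bar>} \<omega> \<partial>N)"
    using S by (simp add: Int_absorb2)
  also have "\<dots> \<le> (\<integral>\<omega>. (W h \<omega> - W 0 \<omega>)\<^sup>2 \<partial>N)"
  proof (rule integral_mono[OF _ v(1)])
    show "integrable N (\<lambda>\<omega>. d\<^sup>2 * indicator {\<omega> \<in> space N. d < \<bar>W h \<omega> - W 0 \<omega>\<bar>} \<omega>)"
      using S by (simp add: emeasure_eq_measure)
    show "d\<^sup>2 * indicator {\<omega> \<in> space N. d < \<bar>W h \<omega> - W 0 \<omega>\<bar>} \<omega> \<le> (W h \<omega> - W 0 \<omega>)\<^sup>2" for \<omega>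
    proof (cases "d < \<bar>W h \<omega> - W 0 \<omega>\<bar>")
      case True
      then have "d\<^sup>2 \<le> \<bar>W h \<omega> - W 0 \<omega>\<bar>\<^sup>2" using d by (intro power_mono) auto
      then show ?thesis by (simp add: indicator_def)
    qed (simp add: indicator_def)
  qed
  finally show "prob {\<omega> \<in> space N. d < \<bar>W h \<omega> - W 0 \<omega>\<bar>} \<le> h / d\<^sup>2"
    using d v(2) by (simp add: field_simps)
qed

text \<open>\<open>W - W 0\<close> is not bounded in \<open>L2\<close> over all times, so optional
  stopping is applied to the elementary integral of 1 over \<open>{0<..h}\<close>, which agrees with
  it until \<open>h\<close>.\<close>

lemma stopped_mean_zero:
  assumes \<rho>: "bounded_stopping h \<rho>"
  shows "sq_integrable N (\<lambda>\<omega>. W (\<rho> \<omega>) \<omega> - W 0 \<omega>)" "(\<integral>\<omega>. W (\<rho> \<omega>) \<omega> - W 0 \<omega> \<partial>N) = 0"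
proof -
  note r = bounded_stoppingD[OF \<rho>]
  let ?I = "elem_integral {()} (\<lambda>_. 0) (\<lambda>_. h) (\<lambda>_ _. 1)"
  have d: "elem_data {()} (\<lambda>_. 0) (\<lambda>_. h) (\<lambda>_ _. 1)" using r(1) by (auto simp: elem_data_def weight_def)
  obtain C where C: "l2_martingale ?I C" using elem_l2_martingale[OF d] by blast
  have "sq_integrable N (\<lambda>\<omega>. ?I (\<rho> \<omega>) \<omega>)" by (rule optional_stopping(1)[OF C \<rho>])
  moreover have "(\<integral>\<omega>. ?I (\<rho> \<omega>) \<omega> \<partial>N) = (\<integral>\<omega>. ?I 0 \<omega> \<partial>N)" by (rule optional_stopping(2)[OF C \<rho>])
  moreover have "?I (\<rho> \<omega>) \<omega> = W (\<rho> \<omega>) \<omega> - W 0 \<omega>" if "\<omega> \<in> space N" for \<omega>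
    using r(2,3)[OF that] by (simp add: elem_integral_def min_absorb1 min_absorb2)
  moreover have "?I 0 \<omega> = 0" for \<omega> using r(1) by (simp add: elem_integral_def min_absorb2)
  ultimately show "sq_integrable N (\<lambda>\<omega>. W (\<rho> \<omega>) \<omega> - W 0 \<omega>)" "(\<integral>\<omega>. W (\<rho> \<omega>) \<omega> - W 0 \<omega> \<partial>N) = 0"
    unfolding sq_integrable_def
    by (simp_all cong: measurable_cong Bochner_Integration.integrable_cong Bochner_Integration.integral_cong)
qed

end

text \<open>With no zero before \<open>h\<close>, the first zero is \<open>h\<close> plus the first
  zero of the path seen from \<open>h\<close>. A zero at \<open>h\<close> itself is allowed, as
  happens when the continuation starts from level 0.\<close>

lemma hit_shift:
  assumes h: "0 \<le> h" and \<tau>: "0 \<le> hit y v" "y - hit y v + v (hit y v) = 0" "\<And>s. 0 \<le> s \<Longrightarrow> s < hit y v \<Longrightarrow> 0 < y - s + v s"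
    and pos: "\<And>t. 0 \<le> t \<Longrightarrow> t < h \<Longrightarrow> 0 < y - t + v t"
    and shift: "\<And>s. 0 \<le> s \<Longrightarrow> y - (h + s) + v (h + s) = y' - s + w s"
  shows "hit y v = h + hit y' w" "0 \<le> hit y' w" "y' - hit y' w + w (hit y' w) = 0"
proof -
  have le: "h \<le> hit y v"
  proof (rule ccontr)
    assume "\<not> h \<le> hit y v"
    then show False using pos[of "hit y v"] \<tau> by simp
  qed
  have "hit y' w = hit y v - h"
    unfolding hit_def[of y' w]
  proof (rule cInf_eq_minimum)
    show "hit y v - h \<in> {t. 0 \<le> t \<and> y' - t + w t = 0}"
      using shift[of "hit y v - h"] le \<tau> by simp
    show "hit y v - h \<le> t" if "t \<in> {t. 0 \<le> t \<and> y' - t + w t = 0}" for t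
    proof (rule ccontr)
      assume "\<not> hit y v - h \<le> t"
      then have "0 < y - (h + t) + v (h + t)" using that h by (intro \<tau>(3)) auto
      then show False using shift[of t] that by simp
    qed
  qed
  then show "hit y v = h + hit y' w" "0 \<le> hit y' w" "y' - hit y' w + w (hit y' w) = 0"
    using le shift[of "hit y v - h"] \<tau> by auto
qed

context filtered_bm begin

text \<open>A simple control is delayed by feeding its weights the motion restarted at
  \<open>h\<close>. Since \<open>A\<close> belongs to \<open>F h\<close>, switching the control on
  only there keeps the weights known in time.\<close>

lemma shifted_elem:
  assumes s: "simple n ts \<xi>" and h: "0 \<le> h" and A: "A \<in> sets (F h)"
    and \<phi>: "\<forall>i<n. \<forall>h\<ge>0. weight (h + ts i) (\<lambda>\<omega>. \<phi> i (shifted h \<omega>))"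
  defines "E \<equiv> elem_integral {..<n} (\<lambda>i. h + ts i) (\<lambda>i. h + ts (Suc i)) (\<lambda>i \<omega>. indicator A \<omega> * \<phi> i (shifted h \<omega>))"
  shows "elem_data {..<n} (\<lambda>i. h + ts i) (\<lambda>i. h + ts (Suc i)) (\<lambda>i \<omega>. indicator A \<omega> * \<phi> i (shifted h \<omega>))"
    and "t \<le> h \<Longrightarrow> E t \<omega> = 0"
    and "0 \<le> r \<Longrightarrow> E (h + r) \<omega> = indicator A \<omega> * path_int n ts \<phi> (shifted h \<omega>) r"
proof -
  note nn = simple_times_nonneg[OF s]
  show "elem_data {..<n} (\<lambda>i. h + ts i) (\<lambda>i. h + ts (Suc i)) (\<lambda>i \<omega>. indicator A \<omega> * \<phi> i (shifted h \<omega>))"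
    unfolding elem_data_def
  proof (intro conjI ballI)
    fix i assume i: "i \<in> {..<n}"
    then show "0 \<le> h + ts i" using nn[of i] h by simp
    show "h + ts i \<le> h + ts (Suc i)" using s i by (simp add: simple_def elem_data_def)
    have "weight (h + ts i) (indicator A)"
      using nn[of i] i by (intro weight_mono[OF weight_indicator[OF A]]) auto
    then show "weight (h + ts i) (\<lambda>\<omega>. indicator A \<omega> * \<phi> i (shifted h \<omega>))"
      using \<phi> h i by (intro weight_mult) auto
  qed simp
  show "E t \<omega> = 0" if "t \<le> h"
    unfolding E_def elem_integral_def
  proof (intro sum.neutral ballI)
    fix i assume "i \<in> {..<n}"
    then have "min (h + ts (Suc i)) t = t" "min (h + ts i) t = t"
      using nn[of i] nn[of "Suc i"] that by auto
    then show "indicator A \<omega> * \<phi> i (shifted h \<omega>) * (W (min (h + ts (Suc i)) t) \<omega> - W (min (h + ts i) t) \<omega>) = 0" by simp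
  qed
  show "E (h + r) \<omega> = indicator A \<omega> * path_int n ts \<phi> (shifted h \<omega>) r" if "0 \<le> r"
    unfolding E_def elem_integral_def path_int_def sum_distrib_left
  proof (intro sum.cong refl)
    fix i assume i: "i \<in> {..<n}"
    have "min (h + ts j) (h + r) = h + min (ts j) r" for j by (simp add: min_def)
    then show "indicator A \<omega> * \<phi> i (shifted h \<omega>) * (W (min (h + ts (Suc i)) (h + r)) \<omega> - W (min (h + ts i) (h + r)) \<omega>)
      = indicator A \<omega> * (\<phi> i (shifted h \<omega>) * (shifted h \<omega> (min (ts (Suc i)) r) - shifted h \<omega> (min (ts i) r)))"
      using nn[of i] nn[of "Suc i"] i that by (simp add: shifted_apply)
  qed
qed

text \<open>The loss \<open>e\<close> is divided into five parts: small displacements during the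
  waiting time, large displacements, the shift of the exit probabilities by \<open>h / L\<close>,
  and the event that the strip is not left in time, with one part to spare. All versions of the
  integral are covered, because the value function works with an unspecified one.\<close>

theorem mixing:
  fixes G :: "real \<Rightarrow> real"
  assumes y: "0 \<le> y2" "y2 < y1" and l: "0 < l" "l < 1"
    and s1: "simple n1 ts1 \<xi>1" and s2: "simple n2 ts2 \<xi>2"
    and G: "\<And>z. \<bar>G z\<bar> \<le> K" "uniformly_continuous_on UNIV G" and e: "0 < e"
  defines "y0 \<equiv> l * y1 + (1 - l) * y2"
    and "v1 \<equiv> \<integral>\<omega>. G (W (hit y1 (\<lambda>t. simple_int n1 ts1 \<xi>1 t \<omega>)) \<omega> - W 0 \<omega>) \<partial>N"
    and "v2 \<equiv> \<integral>\<omega>. G (W (hit y2 (\<lambda>t. simple_int n2 ts2 \<xi>2 t \<omega>)) \<omega> - W 0 \<omega>) \<partial>N"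
  shows "\<exists>\<alpha>. progressively_measurable F \<alpha> \<and> sqn \<alpha> < \<infinity> \<and>
    (\<forall>I. is_ito \<alpha> I \<longrightarrow> l * v1 + (1 - l) * v2 - e \<le> (\<integral>\<omega>. G (W (hit y0 (\<lambda>t. I t \<omega>)) \<omega> - W 0 \<omega>) \<partial>N))"
proof -
  define L where "L = y1 - y2"
  have L: "0 < L" using y by (simp add: L_def)
  have K: "0 \<le> K" using order_trans[OF abs_ge_zero G(1)] .
  have y1: "0 \<le> y1" using y by simp
  have Gc: "continuous_on UNIV G" using G(2) by (rule uniformly_continuous_imp_continuous)
  have Gm: "G \<in> borel_measurable borel" using Gc by (rule borel_measurable_continuous_onI)
  have y0: "y0 - y2 = l * L" by (simp add: y0_def L_def algebra_simps)
  have y0nn: "0 \<le> y0" using y l y1 by (simp add: y0_def)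
  from G(2) e obtain d where d: "0 < d" "\<And>a b. \<bar>a - b\<bar> < d \<Longrightarrow> \<bar>G a - G b\<bar> < e / 5"
    unfolding uniformly_continuous_on_def dist_real_def by (metis UNIV_I divide_pos_pos zero_less_numeral)
  define \<delta> where "\<delta> = d / 2"
  have \<delta>: "0 < \<delta>" "\<And>a b. \<bar>a\<bar> \<le> \<delta> \<Longrightarrow> \<bar>G (b + a) - G b\<bar> \<le> e / 5"
    using d(1) d(2)[of "_ + _" _] by (force simp: \<delta>_def intro!: less_imp_le)+
  \<comment> \<open>The three bounds serve in turn: the start \<open>y0\<close> lies above
    \<open>y2 + h\<close>; a displacement beyond \<open>\<delta>\<close> during time
    \<open>h\<close> is improbable by Chebyshev's inequality; the shift \<open>h / L\<close> of the
    exit probabilities is small.\<close>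
  define h where "h = min (l * L / 2) (min (e * \<delta>\<^sup>2 / (10 * (K + 1))) (e * L / (10 * (K + 1))))"
  have h: "0 < h" "h < l * L" "2 * K * (h / \<delta>\<^sup>2) \<le> e / 5" "2 * K * (h / L) \<le> e / 5"
  proof -
    show "0 < h" using l L e \<delta>(1) K by (simp add: h_def)
    have "0 < l * L" using l L by simp
    moreover have "h \<le> l * L / 2" unfolding h_def by (rule min.cobounded1)
    ultimately show "h < l * L" by linarith
    have "h / \<delta>\<^sup>2 \<le> e / (10 * (K + 1))"
    proof -
      have "h \<le> e * \<delta>\<^sup>2 / (10 * (K + 1))" unfolding h_def by (rule min.coboundedI2, rule min.cobounded1)
      then show ?thesis using \<delta>(1) by (simp add: pos_divide_le_eq)
    qed
    then have "2 * K * (h / \<delta>\<^sup>2) \<le> 2 * K * (e / (10 * (K + 1)))" using K by (intro mult_left_mono) auto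
    also have "\<dots> \<le> e / 5" using K e by (simp add: divide_simps)
    finally show "2 * K * (h / \<delta>\<^sup>2) \<le> e / 5" .
    have "h / L \<le> e / (10 * (K + 1))"
    proof -
      have "h \<le> e * L / (10 * (K + 1))" unfolding h_def by (rule min.coboundedI2, rule min.cobounded2)
      then show ?thesis using L by (simp add: pos_divide_le_eq)
    qed
    then have "2 * K * (h / L) \<le> 2 * K * (e / (10 * (K + 1)))" using K by (intro mult_left_mono) auto
    also have "\<dots> \<le> e / 5" using K e by (simp add: divide_simps)
    finally show "2 * K * (h / L) \<le> e / 5" .
  qed
  define R where "R = sqrt (2 * pi * h)"
  have R: "0 < R" using h(1) by (simp add: R_def)
  \<comment> \<open>With this slope the bound \<open>q\<close> below, for the probability of staying
    in the strip until \<open>h\<close>, equals \<open>e / (15 * (K + 1))\<close>.\<close>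
  define c where "c = 30 * (K + 1) * L / (e * R)"
  have c: "0 < c" using K L e R by (simp add: c_def)
  define q where "q = 2 * (L / c) / R"
  \<comment> \<open>The factor 3 counts one loss on \<open>A3\<close> itself and one in each of the
    probabilities of \<open>A1\<close> and \<open>A2\<close>.\<close>
  have q: "3 * K * q \<le> e / 5"
  proof -
    have "q = 2 * e / (30 * (K + 1))" using K L e R by (simp add: q_def c_def)
    then have "q * (30 * (K + 1)) = 2 * e" using K by simp
    then have "30 * (K * q) + 30 * q = 2 * e" by (simp add: algebra_simps)
    moreover have "0 \<le> q" using L c R by (simp add: q_def)
    moreover have "3 * K * q = 3 * (K * q)" by simp
    ultimately show ?thesis by linarith
  qed
  \<comment> \<open>Positive exactly while the martingale started at \<open>y0\<close> is inside the
    open strip between \<open>y2 + h\<close> and \<open>y1 + h\<close>.\<close>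
  define V where "V t \<omega> = min (y0 + c * (W t \<omega> - W 0 \<omega>) - (y2 + h)) ((y1 + h) - (y0 + c * (W t \<omega> - W 0 \<omega>)))" for t \<omega>
  define \<rho> where "\<rho> \<omega> = exit_time (\<lambda>t. V t \<omega>) h" for \<omega>
  have y01: "y2 + h < y0" "y0 < y1 + h"
  proof -
    show "y2 + h < y0" using y0 h(2) by simp
    have "l * L \<le> 1 * L" using l L by (intro mult_right_mono) auto
    then show "y0 < y1 + h" using y0 h(1) by (simp add: L_def)
  qed
  have V0: "0 \<le> V 0 \<omega>" for \<omega> using y01 by (simp add: V_def)
  have Vc: "continuous_on {0..} (\<lambda>t. V t \<omega>)" if "\<omega> \<in> space N" for \<omega>
    unfolding V_def by (intro continuous_intros W_continuous that)
  have VF: "V t \<in> borel_measurable (F t)" if "0 \<le> t" for t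
    unfolding V_def[abs_def] using W_F[of t t] W_F[of 0 t] that by simp
  have \<rho>: "bounded_stopping h \<rho>"
    unfolding \<rho>_def[abs_def] by (rule exit_time_stopping[OF VF Vc h(1)])
  note r = bounded_stoppingD[OF \<rho>]
  have \<rho>F: "\<rho> \<in> borel_measurable (F h)"
  proof (rule borel_measurableI_le)
    fix t
    show "{\<omega> \<in> space (F h). \<rho> \<omega> \<le> t} \<in> sets (F h)"
    proof (cases "t \<le> h")
      case True
      then show ?thesis using r(4)[of t] F_mono[OF True] by (auto simp: space_F)
    next
      case False
      then have "{\<omega> \<in> space (F h). \<rho> \<omega> \<le> t} = space (F h)" using r(3) by (force simp: space_F)
      then show ?thesis by simp
    qed
  qed
  have W\<rho>F: "(\<lambda>\<omega>. W (\<rho> \<omega>) \<omega>) \<in> borel_measurable (F h)"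
  proof -
    \<comment> \<open>Freezing the motion at \<open>h\<close> makes all sampled values known at
      \<open>h\<close> and leaves the sample at \<open>\<rho>\<close> unchanged.\<close>
    have "(\<lambda>\<omega>. W (min (\<rho> \<omega>) h) \<omega>) \<in> borel_measurable (F h)"
      using h(1) r(2,3)
      by (intro sample_measurable[where X = "\<lambda>s. W (min s h)" and T = h and \<rho> = \<rho> and M = "F h"] \<rho>F W_F
            continuous_on_compose2[OF W_continuous] continuous_intros) (auto simp: space_F)
    then show ?thesis by (rule measurable_cong[THEN iffD1, rotated]) (use r(3) in \<open>auto simp: space_F min_absorb1\<close>)
  qed
  define Mh where "Mh \<omega> = y0 + c * (W (\<rho> \<omega>) \<omega> - W 0 \<omega>)" for \<omega>
  have MhF: "Mh \<in> borel_measurable (F h)"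
    unfolding Mh_def[abs_def] using W\<rho>F W_F[of 0 h] h(1) by simp
  define A1 where "A1 = {\<omega> \<in> space N. Mh \<omega> = y1 + h}"
  define A2 where "A2 = {\<omega> \<in> space N. Mh \<omega> = y2 + h}"
  \<comment> \<open>The paths that are still inside the strip at time \<open>h\<close>.\<close>
  define A3 where "A3 = space N - A1 - A2"
  have A: "A1 \<in> sets (F h)" "A2 \<in> sets (F h)"
  proof -
    have "{\<omega> \<in> space (F h). Mh \<omega> = a} \<in> sets (F h)" for a using MhF by measurable
    then show "A1 \<in> sets (F h)" "A2 \<in> sets (F h)" by (simp_all add: A1_def A2_def space_F)
  qed
  then have AN: "A1 \<in> sets N" "A2 \<in> sets N" "A3 \<in> sets N" using sets_F unfolding A3_def by auto
  have dj: "A1 \<inter> A2 = {}" using y by (auto simp: A1_def A2_def)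
  have Vnn: "0 \<le> V s \<omega>" if \<omega>: "\<omega> \<in> space N" and s: "0 \<le> s" "s \<le> \<rho> \<omega>" for s \<omega>
  proof (cases "s < \<rho> \<omega>")
    case True
    then show ?thesis using exit_time_positive[of s "\<lambda>t. V t \<omega>" h] s h(1) by (simp add: \<rho>_def less_imp_le)
  next
    case False
    then have s\<rho>: "s = \<rho> \<omega>" using s by simp
    show ?thesis
    proof (cases "\<forall>s\<in>{0..h}. 0 < V s \<omega>")
      case True
      then show ?thesis using r(2,3)[OF \<omega>] unfolding s\<rho> by (simp add: less_imp_le)
    next
      case False
      then obtain u where "u \<in> {0..h}" "V u \<omega> \<le> 0" by (auto simp: not_less)
      then have "V (\<rho> \<omega>) \<omega> = 0" unfolding \<rho>_def by (intro exit_time_zero[OF Vc[OF \<omega>] _ _ V0])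
      then show ?thesis by (simp add: s\<rho>)
    qed
  qed
  have tri: "\<rho> \<omega> = h \<and> 0 < V h \<omega>" if "\<omega> \<in> A3" for \<omega>
  proof -
    have \<omega>: "\<omega> \<in> space N" using that by (simp add: A3_def)
    show ?thesis
    proof (cases "\<forall>s\<in>{0..h}. 0 < V s \<omega>")
      case True
      then show ?thesis using h(1) by (simp add: \<rho>_def exit_time_def)
    next
      case False
      then obtain u where "u \<in> {0..h}" "V u \<omega> \<le> 0" by (auto simp: not_less)
      then have "V (\<rho> \<omega>) \<omega> = 0" unfolding \<rho>_def by (intro exit_time_zero[OF Vc[OF \<omega>] _ _ V0])
      then have "Mh \<omega> = y1 + h \<or> Mh \<omega> = y2 + h" by (auto simp: V_def Mh_def min_def split: if_splits)
      then show ?thesis using that \<omega> by (auto simp: A3_def A1_def A2_def)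
    qed
  qed
  have Mb: "y2 + h \<le> Mh \<omega>" "Mh \<omega> \<le> y1 + h" if "\<omega> \<in> space N" for \<omega>
    using Vnn[OF that r(2)[OF that] order_refl] by (auto simp: V_def Mh_def)
  have p3: "prob A3 \<le> q"
  proof -
    note sm = small_increment_prob[OF h(1), of "L / c"]
    have "A3 \<subseteq> {\<omega> \<in> space N. \<bar>W h \<omega> - W 0 \<omega>\<bar> \<le> L / c}"
    proof
      fix \<omega> assume A3: "\<omega> \<in> A3"
      \<comment> \<open>The start and the value at \<open>h\<close> lie in the same strip of width
        \<open>L\<close>.\<close>
      have "\<bar>c * (W h \<omega> - W 0 \<omega>)\<bar> \<le> L" using tri[OF A3] y01 by (auto simp: V_def L_def abs_le_iff)
      then have "\<bar>W h \<omega> - W 0 \<omega>\<bar> * c \<le> L" using c by (simp only: abs_mult abs_of_pos mult.commute)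
      then have "\<bar>W h \<omega> - W 0 \<omega>\<bar> \<le> L / c" using c by (simp only: pos_le_divide_eq)
      then show "\<omega> \<in> {\<omega> \<in> space N. \<bar>W h \<omega> - W 0 \<omega>\<bar> \<le> L / c}" using A3 by (simp add: A3_def)
    qed
    then have "prob A3 \<le> prob {\<omega> \<in> space N. \<bar>W h \<omega> - W 0 \<omega>\<bar> \<le> L / c}"
      using sm(1) L c by (intro finite_measure_mono) auto
    also have "\<dots> \<le> q" using sm(2) L c by (simp add: q_def R_def)
    finally show ?thesis .
  qed
  have int_ind: "integrable N (\<lambda>\<omega>. a * indicator B \<omega> :: real)" "(\<integral>\<omega>. a * indicator B \<omega> \<partial>N) = a * prob B" if "B \<in> sets N" for a B
    using that sets.sets_into_space[OF that] by (simp_all add: emeasure_eq_measure Int_absorb2)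
  have part: "prob A1 + prob A2 + prob A3 = 1"
  proof -
    have "prob (A1 \<union> A2) = prob A1 + prob A2" using AN dj by (intro finite_measure_Union) auto
    moreover have "prob (space N - (A1 \<union> A2)) = 1 - prob (A1 \<union> A2)" using AN by (intro prob_compl) auto
    moreover have "A3 = space N - (A1 \<union> A2)" by (auto simp: A3_def)
    ultimately show ?thesis by simp
  qed
  \<comment> \<open>The variable \<open>Mh \<omega> - (y2 + h)\<close> has mean
    \<open>l * L - h\<close>; it is \<open>L\<close> on \<open>A1\<close>, 0 on \<open>A2\<close>,
    and between 0 and \<open>L\<close> on \<open>A3\<close>.\<close>
  have p1: "L * prob A1 \<le> l * L - h" "l * L - h \<le> L * prob A1 + L * prob A3"
  proof -
    note m0 = stopped_mean_zero[OF \<rho>]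
    have iM: "integrable N Mh" "(\<integral>\<omega>. Mh \<omega> \<partial>N) = y0"
      using m0 sq_integrable_integrable[OF m0(1)] by (simp_all add: Mh_def[abs_def] prob_space)
    then have iM': "integrable N (\<lambda>\<omega>. Mh \<omega> - (y2 + h))" "(\<integral>\<omega>. Mh \<omega> - (y2 + h) \<partial>N) = l * L - h"
      using y0 by (simp_all add: prob_space)
    have "(\<integral>\<omega>. L * indicator A1 \<omega> \<partial>N) \<le> (\<integral>\<omega>. Mh \<omega> - (y2 + h) \<partial>N)"
      using Mb by (intro integral_mono int_ind AN iM') (auto simp: A1_def L_def indicator_def)
    then show "L * prob A1 \<le> l * L - h" by (simp only: iM'(2) int_ind(2)[OF AN(1)])
    have "(\<integral>\<omega>. Mh \<omega> - (y2 + h) \<partial>N) \<le> (\<integral>\<omega>. L * indicator A1 \<omega> + L * indicator A3 \<omega> \<partial>N)"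
    proof (rule integral_mono[OF iM'(1)])
      show "integrable N (\<lambda>\<omega>. L * indicator A1 \<omega> + L * indicator A3 \<omega>)"
        by (rule Bochner_Integration.integrable_add[OF int_ind(1)[OF AN(1)] int_ind(1)[OF AN(3)]])
      show "Mh \<omega> - (y2 + h) \<le> L * indicator A1 \<omega> + L * indicator A3 \<omega>" if "\<omega> \<in> space N" for \<omega>
        using Mb[OF that] that y L by (cases "\<omega> \<in> A1"; cases "\<omega> \<in> A2") (auto simp: A1_def A2_def A3_def L_def)
    qed
    also have "\<dots> = L * prob A1 + L * prob A3"
      by (simp only: Bochner_Integration.integral_add[OF int_ind(1)[OF AN(1)] int_ind(1)[OF AN(3)]] int_ind(2)[OF AN(1)] int_ind(2)[OF AN(3)])
    finally show "l * L - h \<le> L * prob A1 + L * prob A3" by (simp only: iM'(2))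
  qed
  have pl: "\<bar>prob A1 - l\<bar> \<le> h / L + q" "\<bar>prob A2 - (1 - l)\<bar> \<le> h / L + q"
  proof -
    have "prob A1 \<le> l - h / L" using p1(1) L by (simp add: field_simps)
    moreover have "l - h / L \<le> prob A1 + prob A3" using p1(2) L by (simp add: field_simps)
    moreover have "0 \<le> h / L" using h L by simp
    moreover have "0 \<le> prob A3" by simp
    ultimately show "\<bar>prob A1 - l\<bar> \<le> h / L + q" "\<bar>prob A2 - (1 - l)\<bar> \<le> h / L + q"
      using p3 part by linarith+
  qed
  obtain \<phi>1 where \<phi>1: "\<forall>i<n1. \<phi>1 i \<in> borel_measurable cpath_space" "AE \<omega> in N. \<forall>i<n1. \<xi>1 i \<omega> = \<phi>1 i (shifted 0 \<omega>)"
    "\<forall>i<n1. \<forall>h\<ge>0. weight (h + ts1 i) (\<lambda>\<omega>. \<phi>1 i (shifted h \<omega>))" using simple_factor[OF s1] by blast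
  obtain \<phi>2 where \<phi>2: "\<forall>i<n2. \<phi>2 i \<in> borel_measurable cpath_space" "AE \<omega> in N. \<forall>i<n2. \<xi>2 i \<omega> = \<phi>2 i (shifted 0 \<omega>)"
    "\<forall>i<n2. \<forall>h\<ge>0. weight (h + ts2 i) (\<lambda>\<omega>. \<phi>2 i (shifted h \<omega>))" using simple_factor[OF s2] by blast
  note nn1 = simple_times_nonneg[OF s1] and nn2 = simple_times_nonneg[OF s2]
  define \<Psi>1 where "\<Psi>1 = path_payoff y1 n1 ts1 \<phi>1 G K"
  define \<Psi>2 where "\<Psi>2 = path_payoff y2 n2 ts2 \<phi>2 G K"
  have \<Psi>m: "\<Psi>1 \<in> borel_measurable cpath_space" "\<Psi>2 \<in> borel_measurable cpath_space"
    unfolding \<Psi>1_def \<Psi>2_def using \<phi>1(1) \<phi>2(1) nn1 nn2 by (intro path_payoff_measurable Gc; auto)+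
  have \<Psi>b: "\<bar>\<Psi>1 p\<bar> \<le> K" "\<bar>\<Psi>2 p\<bar> \<le> K" for p
    unfolding \<Psi>1_def \<Psi>2_def by (intro path_payoff_bound K)+
  have v\<Psi>: "v1 = (\<integral>\<omega>. \<Psi>1 (shifted 0 \<omega>) \<partial>N)" "v2 = (\<integral>\<omega>. \<Psi>2 (shifted 0 \<omega>) \<partial>N)"
    unfolding \<Psi>1_def \<Psi>2_def v1_def v2_def
    by (rule path_payoff_mean[OF s1 y1 G(1) Gc \<phi>1(1,2), symmetric], rule path_payoff_mean[OF s2 y(1) G(1) Gc \<phi>2(1,2), symmetric])
  have val: "(\<integral>\<omega>. indicator A1 \<omega> * \<Psi>1 (shifted h \<omega>) \<partial>N) = prob A1 * v1"
    "(\<integral>\<omega>. indicator A2 \<omega> * \<Psi>2 (shifted h \<omega>) \<partial>N) = prob A2 * v2"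
    unfolding v\<Psi>
    by (rule markov_integral[OF less_imp_le[OF h(1)] A(1) \<Psi>m(1) \<Psi>b(1)], rule markov_integral[OF less_imp_le[OF h(1)] A(2) \<Psi>m(2) \<Psi>b(2)])
  have vb: "\<bar>v1\<bar> \<le> K" "\<bar>v2\<bar> \<le> K"
  proof -
    have *: "\<bar>\<integral>\<omega>. g (shifted 0 \<omega>) \<partial>N\<bar> \<le> K" if g: "\<And>p. \<bar>g p\<bar> \<le> K" for g :: "(real \<Rightarrow> real) \<Rightarrow> real"
    proof (cases "integrable N (\<lambda>\<omega>. g (shifted 0 \<omega>))")
      case True
      have "\<bar>\<integral>\<omega>. g (shifted 0 \<omega>) \<partial>N\<bar> \<le> (\<integral>\<omega>. \<bar>g (shifted 0 \<omega>)\<bar> \<partial>N)"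
        using integral_norm_bound[of N "\<lambda>\<omega>. g (shifted 0 \<omega>)"] by simp
      also have "\<dots> \<le> (\<integral>\<omega>. K \<partial>N)" using True g by (intro integral_mono) auto
      finally show ?thesis by (simp add: prob_space)
    qed (use K in \<open>simp add: not_integrable_integral_eq\<close>)
    show "\<bar>v1\<bar> \<le> K" "\<bar>v2\<bar> \<le> K"
      unfolding v\<Psi> by (rule *, rule \<Psi>b)+
  qed
  let ?E1 = "elem_integral {..<n1} (\<lambda>i. h + ts1 i) (\<lambda>i. h + ts1 (Suc i)) (\<lambda>i \<omega>. indicator A1 \<omega> * \<phi>1 i (shifted h \<omega>))"
  let ?E2 = "elem_integral {..<n2} (\<lambda>i. h + ts2 i) (\<lambda>i. h + ts2 (Suc i)) (\<lambda>i \<omega>. indicator A2 \<omega> * \<phi>2 i (shifted h \<omega>))"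
  note e1 = shifted_elem[OF s1 less_imp_le[OF h(1)] A(1) \<phi>1(3)] and e2 = shifted_elem[OF s2 less_imp_le[OF h(1)] A(2) \<phi>2(3)]
  note eQ = elem_add[OF e1(1) e2(1)]
  define EQ where "EQ = elem_integral ({..<n1} <+> {..<n2}) (case_sum (\<lambda>i. h + ts1 i) (\<lambda>i. h + ts2 i))
     (case_sum (\<lambda>i. h + ts1 (Suc i)) (\<lambda>i. h + ts2 (Suc i)))
     (case_sum (\<lambda>i \<omega>. indicator A1 \<omega> * \<phi>1 i (shifted h \<omega>)) (\<lambda>i \<omega>. indicator A2 \<omega> * \<phi>2 i (shifted h \<omega>)))"
  have EQ: "EQ t \<omega> = ?E1 t \<omega> + ?E2 t \<omega>" for t \<omega> unfolding EQ_def by (rule eQ(3))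
  \<comment> \<open>The steep integrand runs up to \<open>\<rho>\<close>, nothing follows until
    \<open>h\<close>, and then the delayed control selected by the exit point takes over; on
    \<open>A3\<close> there is no continuation.\<close>
  define \<alpha> where "\<alpha> s \<omega> = c * indicator {0<..\<rho> \<omega>} s + elem_process ({..<n1} <+> {..<n2}) (case_sum (\<lambda>i. h + ts1 i) (\<lambda>i. h + ts2 i))
     (case_sum (\<lambda>i. h + ts1 (Suc i)) (\<lambda>i. h + ts2 (Suc i)))
     (case_sum (\<lambda>i \<omega>. indicator A1 \<omega> * \<phi>1 i (shifted h \<omega>)) (\<lambda>i \<omega>. indicator A2 \<omega> * \<phi>2 i (shifted h \<omega>))) s \<omega>" for s \<omega>
  note sp = stopped_plus_elem[OF \<rho> eQ(1), of c, folded \<alpha>_def[abs_def] EQ_def]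
  have "l * v1 + (1 - l) * v2 - e \<le> (\<integral>\<omega>. G (W (hit y0 (\<lambda>t. I t \<omega>)) \<omega> - W 0 \<omega>) \<partial>N)" if I: "is_ito \<alpha> I" for I
  proof -
    define E where "E t \<omega> = c * (W (min (\<rho> \<omega>) t) \<omega> - W 0 \<omega>) + EQ t \<omega>" for t \<omega>
    obtain C where C: "l2_martingale I C"
      using ito_martingale(1)[OF progressive_joint_measurable[OF sp(1)] sp(2) I] by blast
    note I0 = ito_martingale(2)[OF progressive_joint_measurable[OF sp(1)] sp(2) I]
    have IE: "AE \<omega> in N. \<forall>t\<ge>0. I t \<omega> = E t \<omega>"
    proof (rule continuous_indistinguishable)
      show "continuous_on {0..} (\<lambda>t. E t \<omega>)" if "\<omega> \<in> space N" for \<omega>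
        unfolding E_def EQ_def using r(2)[OF that]
        by (intro continuous_intros elem_integral_continuous[OF eQ(1) that] continuous_on_compose2[OF W_continuous[OF that]]) auto
      show "AE \<omega> in N. I t \<omega> = E t \<omega>" if "0 \<le> t" for t
        unfolding E_def by (rule sp(3)[OF I that])
    qed (rule l2_martingaleD(2)[OF C])
    \<comment> \<open>Waiting until \<open>h\<close> displaces the terminal value by
      \<open>W h - W 0\<close>. Outside \<open>D\<close> uniform continuity absorbs this; on
      \<open>D\<close> only the bound \<open>K\<close> is available.\<close>
    define D where "D = {\<omega> \<in> space N. \<delta> < \<bar>W h \<omega> - W 0 \<omega>\<bar>}"
    have D: "D \<in> sets N" "prob D \<le> h / \<delta>\<^sup>2" unfolding D_def using large_increment_prob[OF h(1) \<delta>(1)] by auto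
    let ?Z = "\<lambda>\<omega>. G (W (hit y0 (\<lambda>t. I t \<omega>)) \<omega> - W 0 \<omega>)"
    have Zm: "?Z \<in> borel_measurable N"
      by (rule measurable_compose[OF _ Gm]) (intro borel_measurable_diff W_hit_measurable[OF C I0 y0nn] W_measurable, simp)
    let ?B = "\<lambda>\<omega>. indicator A1 \<omega> * \<Psi>1 (shifted h \<omega>) + indicator A2 \<omega> * \<Psi>2 (shifted h \<omega>) - (e / 5 + (2 * K) * indicator D \<omega> + K * indicator A3 \<omega>)"
    have key: "AE \<omega> in N. ?B \<omega> \<le> ?Z \<omega>"
      using IE hit_path[OF C I0 y0nn] AE_space
    proof eventually_elim
      case (elim \<omega>)
      note \<omega> = elim(3)
      let ?\<tau> = "hit y0 (\<lambda>t. I t \<omega>)"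
      \<comment> \<open>Until \<open>h\<close> the drifted process is the stopped martingale minus
        \<open>t\<close>. It is at least \<open>y2 + h - t\<close>, which is positive.\<close>
      have before: "0 < y0 - t + I t \<omega>" if t: "0 \<le> t" "t < h" for t
      proof -
        have "EQ t \<omega> = 0" unfolding EQ using e1(2)[of t \<omega>] e2(2)[of t \<omega>] t by simp
        then have "I t \<omega> = c * (W (min (\<rho> \<omega>) t) \<omega> - W 0 \<omega>)" using elim(1) t by (simp add: E_def)
        moreover have "0 \<le> V (min (\<rho> \<omega>) t) \<omega>" using r(2)[OF \<omega>] t by (intro Vnn[OF \<omega>]) auto
        ultimately show ?thesis using t y by (simp add: V_def)
      qed
      have at: "I (h + s) \<omega> = (Mh \<omega> - y0) + indicator A1 \<omega> * path_int n1 ts1 \<phi>1 (shifted h \<omega>) s + indicator A2 \<omega> * path_int n2 ts2 \<phi>2 (shifted h \<omega>) s"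
        if s: "0 \<le> s" for s
      proof -
        have "min (\<rho> \<omega>) (h + s) = \<rho> \<omega>" using r(3)[OF \<omega>] s by simp
        then show ?thesis using elim(1) s h(1) e1(3)[OF s] e2(3)[OF s] by (simp add: E_def EQ Mh_def)
      qed
      have swap: "G (shifted h \<omega> \<sigma>) - e / 5 - 2 * K * indicator D \<omega> \<le> ?Z \<omega>" if \<sigma>: "?\<tau> = h + \<sigma>" "0 \<le> \<sigma>" for \<sigma>
      proof -
        have eq: "W ?\<tau> \<omega> - W 0 \<omega> = shifted h \<omega> \<sigma> + (W h \<omega> - W 0 \<omega>)" using \<sigma> by (simp add: shifted_apply)
        show ?thesis
        proof (cases "\<omega> \<in> D")
          case True
          then show ?thesis using G(1)[of "shifted h \<omega> \<sigma>"] G(1)[of "W ?\<tau> \<omega> - W 0 \<omega>"] e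
            by (simp add: abs_le_iff)
        next
          case False
          then have "\<bar>G (shifted h \<omega> \<sigma> + (W h \<omega> - W 0 \<omega>)) - G (shifted h \<omega> \<sigma>)\<bar> \<le> e / 5"
            using \<omega> by (intro \<delta>(2)) (simp add: D_def)
          then have "G (shifted h \<omega> \<sigma>) - e / 5 \<le> G (shifted h \<omega> \<sigma> + (W h \<omega> - W 0 \<omega>))"
            by linarith
          then show ?thesis unfolding eq using False by simp
        qed
      qed
      consider "\<omega> \<in> A1" | "\<omega> \<in> A2" | "\<omega> \<in> A3" using \<omega> by (auto simp: A3_def)
      then show ?case
      proof cases
        case 1
        then have n: "\<omega> \<notin> A2" "\<omega> \<notin> A3" using dj by (auto simp: A3_def)
        have M: "Mh \<omega> = y1 + h" using 1 by (simp add: A1_def)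
        have sh: "y0 - (h + s) + I (h + s) \<omega> = y1 - s + path_int n1 ts1 \<phi>1 (shifted h \<omega>) s" if "0 \<le> s" for s
          using at[OF that] 1 n by (simp add: M)
        note hs = hit_shift[where v = "\<lambda>t. I t \<omega>" and w = "path_int n1 ts1 \<phi>1 (shifted h \<omega>)" and y = y0 and y' = y1 and h = h, OF _ _ _ _ before sh]
        have hs: "?\<tau> = h + hit y1 (path_int n1 ts1 \<phi>1 (shifted h \<omega>))" "0 \<le> hit y1 (path_int n1 ts1 \<phi>1 (shifted h \<omega>))"
          "y1 - hit y1 (path_int n1 ts1 \<phi>1 (shifted h \<omega>)) + path_int n1 ts1 \<phi>1 (shifted h \<omega>) (hit y1 (path_int n1 ts1 \<phi>1 (shifted h \<omega>))) = 0"
          using elim(2) h(1) by (intro hs; simp)+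
        have "\<Psi>1 (shifted h \<omega>) = G (shifted h \<omega> (hit y1 (path_int n1 ts1 \<phi>1 (shifted h \<omega>))))"
          unfolding \<Psi>1_def using hs h(1) by (intro path_payoff_eq[OF shifted_continuous nn1 y1 hs(2) _ G(1)]) (auto simp: \<omega>)
        then show ?thesis using swap[OF hs(1,2)] 1 n by simp
      next
        case 2
        then have n: "\<omega> \<notin> A1" "\<omega> \<notin> A3" using dj by (auto simp: A3_def)
        have M: "Mh \<omega> = y2 + h" using 2 by (simp add: A2_def)
        have sh: "y0 - (h + s) + I (h + s) \<omega> = y2 - s + path_int n2 ts2 \<phi>2 (shifted h \<omega>) s" if "0 \<le> s" for s
          using at[OF that] 2 n by (simp add: M)
        note hs = hit_shift[where v = "\<lambda>t. I t \<omega>" and w = "path_int n2 ts2 \<phi>2 (shifted h \<omega>)" and y = y0 and y' = y2 and h = h, OF _ _ _ _ before sh]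
        have hs: "?\<tau> = h + hit y2 (path_int n2 ts2 \<phi>2 (shifted h \<omega>))" "0 \<le> hit y2 (path_int n2 ts2 \<phi>2 (shifted h \<omega>))"
          "y2 - hit y2 (path_int n2 ts2 \<phi>2 (shifted h \<omega>)) + path_int n2 ts2 \<phi>2 (shifted h \<omega>) (hit y2 (path_int n2 ts2 \<phi>2 (shifted h \<omega>))) = 0"
          using elim(2) h(1) by (intro hs; simp)+
        have "\<Psi>2 (shifted h \<omega>) = G (shifted h \<omega> (hit y2 (path_int n2 ts2 \<phi>2 (shifted h \<omega>))))"
          unfolding \<Psi>2_def using hs h(1) by (intro path_payoff_eq[OF shifted_continuous nn2 y(1) hs(2) _ G(1)]) (auto simp: \<omega>)
        then show ?thesis using swap[OF hs(1,2)] 2 n by simp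
      next
        case 3
        then have n: "\<omega> \<notin> A1" "\<omega> \<notin> A2" by (auto simp: A3_def)
        have "0 \<le> 2 * K * indicator D \<omega>" using K by simp
        moreover have "- K \<le> ?Z \<omega>" using G(1)[of "W ?\<tau> \<omega> - W 0 \<omega>"] by linarith
        ultimately have "- (e / 5 + (2 * K) * indicator D \<omega> + K) \<le> ?Z \<omega>" using e by linarith
        then show ?thesis using 3 n by simp
      qed
    qed
    have ib: "integrable N X" if "X \<in> borel_measurable N" "\<And>\<omega>. \<bar>X \<omega>\<bar> \<le> K" for X :: "'a \<Rightarrow> real"
      using that by (intro integrable_const_bound[where B = K]) auto
    have \<Psi>N: "(\<lambda>\<omega>. \<Psi>1 (shifted h \<omega>)) \<in> borel_measurable N" "(\<lambda>\<omega>. \<Psi>2 (shifted h \<omega>)) \<in> borel_measurable N"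
      using h(1) by (intro measurable_compose[OF shifted_measurable_c] \<Psi>m; simp)+
    have i\<Psi>: "integrable N (\<lambda>\<omega>. indicator A1 \<omega> * \<Psi>1 (shifted h \<omega>))" "integrable N (\<lambda>\<omega>. indicator A2 \<omega> * \<Psi>2 (shifted h \<omega>))"
      using \<Psi>N \<Psi>b AN K by (intro ib borel_measurable_times borel_measurable_indicator; simp add: indicator_def)+
    have lin: "integrable N (\<lambda>\<omega>. f1 \<omega> + f2 \<omega> - (a + f3 \<omega> + f4 \<omega>))"
      "(\<integral>\<omega>. f1 \<omega> + f2 \<omega> - (a + f3 \<omega> + f4 \<omega>) \<partial>N) = (\<integral>\<omega>. f1 \<omega> \<partial>N) + (\<integral>\<omega>. f2 \<omega> \<partial>N) - (a + (\<integral>\<omega>. f3 \<omega> \<partial>N) + (\<integral>\<omega>. f4 \<omega> \<partial>N))"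
      if "integrable N f1" "integrable N f2" "integrable N f3" "integrable N f4" for f1 f2 f3 f4 :: "'a \<Rightarrow> real" and a
      using that by (simp_all add: prob_space)
    note linB = lin[OF i\<Psi> int_ind(1)[OF D(1), of "2 * K"] int_ind(1)[OF AN(3), of K]]
    have "prob A1 * v1 + prob A2 * v2 - (e / 5 + 2 * K * prob D + K * prob A3) = (\<integral>\<omega>. ?B \<omega> \<partial>N)"
      by (simp only: linB(2) val int_ind(2)[OF D(1)] int_ind(2)[OF AN(3)])
    also have "\<dots> \<le> (\<integral>\<omega>. ?Z \<omega> \<partial>N)"
    proof (rule integral_mono_AE[OF _ _ key])
      show "integrable N ?B" by (rule linB(1))
      show "integrable N ?Z" by (rule ib[OF Zm G(1)])
    qed
    finally have fin: "prob A1 * v1 + prob A2 * v2 - (e / 5 + 2 * K * prob D + K * prob A3) \<le> (\<integral>\<omega>. ?Z \<omega> \<partial>N)" .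
    have b: "p * v \<ge> m * v - K * t" if "\<bar>p - m\<bar> \<le> t" "\<bar>v\<bar> \<le> K" for p m v t :: real
    proof -
      have "\<bar>(p - m) * v\<bar> \<le> t * K" unfolding abs_mult using that by (intro mult_mono) auto
      then show ?thesis unfolding left_diff_distrib mult.commute[of t] by linarith
    qed
    have "2 * K * prob D \<le> e / 5"
      using mult_left_mono[OF D(2), of "2 * K"] K h(3) by linarith
    moreover have "K * prob A3 \<le> K * q" using p3 K by (rule mult_left_mono)
    moreover note b[OF pl(1) vb(1)] b[OF pl(2) vb(2)]
    moreover have "K * (h / L + q) = K * (h / L) + K * q" by (rule distrib_left)
    ultimately show ?thesis using fin h(4) q e by (simp add: mult.assoc)
  qed
  then show ?thesis using sp(1,2) by blast
qed

end

section \<open>Brownian motion with its augmented filtration\<close>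

text \<open>The sets with such a representation form a sigma-algebra, because equality up to null
  sets respects complements and countable unions.\<close>

lemma AE_sigma_sets_vimage:
  assumes "A \<in> sigma_sets (space N) G"
    and gen: "\<And>A. A \<in> G \<Longrightarrow> \<exists>C\<in>sets S. AE \<omega> in N. \<omega> \<in> A \<longleftrightarrow> h \<omega> \<in> C"
    and h: "h \<in> space N \<rightarrow> space S"
  shows "\<exists>C\<in>sets S. AE \<omega> in N. \<omega> \<in> A \<longleftrightarrow> h \<omega> \<in> C"
  using assms(1)
proof induction
  case (Basic a)
  then show ?case by (rule gen)
next
  case Empty
  show ?case by (rule bexI[of _ "{}"]) auto
next
  case (Compl a)
  then obtain C where C: "C \<in> sets S" "AE \<omega> in N. \<omega> \<in> a \<longleftrightarrow> h \<omega> \<in> C" by auto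
  have "AE \<omega> in N. \<omega> \<in> space N - a \<longleftrightarrow> h \<omega> \<in> space S - C"
    using C(2) AE_space by eventually_elim (use h in auto)
  then show ?case using C(1) by (intro bexI[of _ "space S - C"]) auto
next
  case (Union a)
  then have "\<forall>i. \<exists>C. C \<in> sets S \<and> (AE \<omega> in N. \<omega> \<in> a i \<longleftrightarrow> h \<omega> \<in> C)" by auto
  from choice[OF this] obtain C where C: "\<And>i. C i \<in> sets S" "\<And>i. AE \<omega> in N. \<omega> \<in> a i \<longleftrightarrow> h \<omega> \<in> C i" by auto
  have "AE \<omega> in N. \<forall>i. \<omega> \<in> a i \<longleftrightarrow> h \<omega> \<in> C i" using C(2) by (simp add: AE_all_countable)
  then have "AE \<omega> in N. \<omega> \<in> (\<Union>i. a i) \<longleftrightarrow> h \<omega> \<in> (\<Union>i. C i)" by eventually_elim auto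
  then show ?case using C(1) by (intro bexI[of _ "\<Union>i. C i"]) auto
qed

lemma sets_natural_filtration:
  "sets (natural_filtration M W t) = sigma_sets (space M) (\<Union>s\<in>{0..t}. {W s -` B \<inter> space M | B. B \<in> sets borel})"
  unfolding natural_filtration_def by (rule sets_measure_of) auto

lemma space_natural_filtration: "space (natural_filtration M W t) = space M"
  unfolding natural_filtration_def by (rule space_measure_of) auto

lemma sets_augmented_filtration:
  "sets (augmented_filtration M W t) = sigma_sets (space M) (sets (natural_filtration M W t) \<union> null_sets (completion M))"
  unfolding augmented_filtration_def
proof (rule sets_measure_of)
  have "sets (natural_filtration M W t) \<subseteq> Pow (space M)"
    using sets.space_closed[of "natural_filtration M W t"] by (simp add: space_natural_filtration)
  moreover have "null_sets (completion M) \<subseteq> Pow (space M)"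
    using null_setsD2[THEN sets.sets_into_space, of _ "completion M"] by auto
  ultimately show "sets (natural_filtration M W t) \<union> null_sets (completion M) \<subseteq> Pow (space M)" by simp
qed

text \<open>The null sets added by the augmentation are represented by the empty set, so only the
  natural filtration has to be examined.\<close>

lemma augmented_filtration_AE:
  assumes "A \<in> sets (augmented_filtration M W t)"
    and gen: "\<And>A. A \<in> sets (natural_filtration M W t) \<Longrightarrow> \<exists>C\<in>sets S. AE \<omega> in completion M. \<omega> \<in> A \<longleftrightarrow> h \<omega> \<in> C"
    and h: "h \<in> space M \<rightarrow> space S"
  shows "\<exists>C\<in>sets S. AE \<omega> in completion M. \<omega> \<in> A \<longleftrightarrow> h \<omega> \<in> C"
proof (rule AE_sigma_sets_vimage)
  show "A \<in> sigma_sets (space (completion M)) (sets (natural_filtration M W t) \<union> null_sets (completion M))"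
    using assms(1) by (simp only: sets_augmented_filtration space_completion)
  show "h \<in> space (completion M) \<rightarrow> space S" using h by simp
  fix A assume "A \<in> sets (natural_filtration M W t) \<union> null_sets (completion M)"
  then show "\<exists>C\<in>sets S. AE \<omega> in completion M. \<omega> \<in> A \<longleftrightarrow> h \<omega> \<in> C"
  proof
    assume "A \<in> null_sets (completion M)"
    then have "AE \<omega> in completion M. \<omega> \<notin> A" by (rule AE_not_in)
    then show ?thesis by (intro bexI[of _ "{}"]) auto
  qed (rule gen)
qed

lemma natural_filtration_le:
  assumes "brownian_motion M W x"
  shows "sets (natural_filtration M W t) \<subseteq> sets M"
  unfolding sets_natural_filtration
proof (rule sets.sigma_sets_subset, safe)
  fix s B assume "s \<in> {0..t}" "B \<in> sets (borel :: real measure)"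
  then show "W s -` B \<inter> space M \<in> sets M"
    using assms by (intro measurable_sets[of "W s" M borel]) (auto simp: brownian_motion_def)
qed

text \<open>Each augmented event differs from a natural one by a null set, so independence of the
  increments carries over; their laws and the starting value are not affected by completion.\<close>

lemma brownian_motion_filtered_bm:
  assumes bm: "brownian_motion M W x"
  shows "filtered_bm (completion M) (augmented_filtration M W) W x"
proof -
  have pM: "prob_space M" and Wm: "\<And>t. 0 \<le> t \<Longrightarrow> W t \<in> borel_measurable M"
    and Wc: "\<And>\<omega>. \<omega> \<in> space M \<Longrightarrow> continuous_on {0..} (\<lambda>t. W t \<omega>)" and W0: "AE \<omega> in M. W 0 \<omega> = x"
    and Wd: "\<And>s t. 0 \<le> s \<Longrightarrow> s < t \<Longrightarrow> distributed M lborel (\<lambda>\<omega>. W t \<omega> - W s \<omega>) (\<lambda>z. ennreal (normal_density 0 (sqrt (t - s)) z))"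
    and Wi: "\<And>s t. 0 \<le> s \<Longrightarrow> s < t \<Longrightarrow> prob_space.indep_set M (sets (natural_filtration M W s))
          {(\<lambda>\<omega>. W t \<omega> - W s \<omega>) -` B \<inter> space M | B. B \<in> sets borel}"
    using bm unfolding brownian_motion_def by auto
  interpret M: prob_space M by (rule pM)
  interpret C: prob_space "completion M" by (rule M.prob_space_completion)
  let ?F = "augmented_filtration M W"
  interpret f: filtration "space M" ?F by (rule filtration_augmented_filtration)
  have nat_aug: "sets (natural_filtration M W t) \<subseteq> sets (?F t)" for t
    unfolding sets_augmented_filtration by auto
  have sets_aug: "sets (?F t) \<subseteq> sets (completion M)" for t
  proof -
    have "sigma_sets (space (completion M)) (sets (natural_filtration M W t) \<union> null_sets (completion M)) \<subseteq> sets (completion M)"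
      using natural_filtration_le[OF bm, of t] by (intro sets.sigma_sets_subset) auto
    then show ?thesis by (simp only: sets_augmented_filtration space_completion)
  qed
  have inc: "(\<lambda>\<omega>. W t \<omega> - W s \<omega>) \<in> borel_measurable M" if "0 \<le> s" "0 \<le> t" for s t
    using Wm that by simp
  show ?thesis
  proof unfold_locales
    show "space (?F t) = space (completion M)" for t by (simp add: f.space_F)
    show "sets (?F t) \<subseteq> sets (completion M)" for t by (rule sets_aug)
    show "sets (?F s) \<subseteq> sets (?F t)" if "s \<le> t" for s t by (rule f.sets_F_mono[OF that])
    show "null_sets (completion M) \<subseteq> sets (?F t)" for t unfolding sets_augmented_filtration by auto
    show "W t \<in> borel_measurable (?F t)" if t: "0 \<le> t" for t
    proof (rule measurableI)
      fix B :: "real set" assume "B \<in> sets borel"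
      then have "W t -` B \<inter> space M \<in> sets (natural_filtration M W t)"
        unfolding sets_natural_filtration using t by (intro sigma_sets.Basic UN_I[of t]) auto
      then show "W t -` B \<inter> space (?F t) \<in> sets (?F t)" using nat_aug by (auto simp: f.space_F)
    qed simp
    show "continuous_on {0..} (\<lambda>t. W t \<omega>)" if "\<omega> \<in> space (completion M)" for \<omega> using Wc that by simp
    show "AE \<omega> in completion M. W 0 \<omega> = x" using W0 by (rule AE_completion)
    show "distributed (completion M) lborel (\<lambda>\<omega>. W t \<omega> - W s \<omega>) (\<lambda>z. ennreal (normal_density 0 (sqrt (t - s)) z))"
      if "0 \<le> s" "s < t" for s t
    proof -
      have "(\<lambda>\<omega>. W t \<omega> - W s \<omega>) \<in> measurable M lborel" using Wd[OF that] by (simp add: distributed_def)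
      from distr_completion[OF this] measurable_completion[OF this] show ?thesis
        using Wd[OF that] by (simp add: distributed_def)
    qed
    show "C.indep_set (sets (?F s)) {(\<lambda>\<omega>. W t \<omega> - W s \<omega>) -` B \<inter> space (completion M) | B. B \<in> sets borel}"
      if st: "0 \<le> s" "s < t" for s t
    proof (rule C.indep_setI)
      have bM: "b \<in> sets M" if "b \<in> {(\<lambda>\<omega>. W t \<omega> - W s \<omega>) -` B \<inter> space (completion M) | B. B \<in> sets borel}" for b
        using that measurable_sets[OF inc[of s t]] st by auto
      then show "{(\<lambda>\<omega>. W t \<omega> - W s \<omega>) -` B \<inter> space (completion M) | B. B \<in> sets borel} \<subseteq> C.events"
        by (blast intro: sets_completionI_sets)
      fix a b assume a: "a \<in> sets (?F s)" and b: "b \<in> {(\<lambda>\<omega>. W t \<omega> - W s \<omega>) -` B \<inter> space (completion M) | B. B \<in> sets borel}"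
      \<comment> \<open>With the identity as map and the natural filtration as target,
        \<open>augmented_filtration_AE\<close> replaces \<open>a\<close> by a natural event.\<close>
      have "\<exists>A\<in>sets (natural_filtration M W s). AE \<omega> in completion M. \<omega> \<in> a \<longleftrightarrow> id \<omega> \<in> A"
        using a by (rule augmented_filtration_AE) (auto simp: space_natural_filtration)
      then obtain A where A: "A \<in> sets (natural_filtration M W s)" "AE \<omega> in completion M. \<omega> \<in> a \<longleftrightarrow> \<omega> \<in> A" by auto
      have AM: "A \<in> sets M" using A(1) natural_filtration_le[OF bm] by blast
      have aC: "a \<in> sets (completion M)" using a sets_aug by blast
      have bC: "b \<in> sets M" by (rule bM[OF b])
      have "C.prob (a \<inter> b) = C.prob (A \<inter> b)"
      proof (rule measure_eq_AE)
        show "AE \<omega> in completion M. \<omega> \<in> a \<inter> b \<longleftrightarrow> \<omega> \<in> A \<inter> b" using A(2) by eventually_elim auto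
      qed (intro sets.Int sets_completionI_sets aC bC AM)+
      also have "\<dots> = M.prob A * M.prob b"
        using M.indep_setD[OF Wi[OF st] A(1), of b] b AM bC by simp
      also have "M.prob A = C.prob a"
      proof -
        have "C.prob a = C.prob A" by (intro measure_eq_AE A(2) aC sets_completionI_sets AM)
        then show ?thesis using AM by simp
      qed
      also have "M.prob b = C.prob b" using bC by simp
      finally show "C.prob (a \<inter> b) = C.prob a * C.prob b" .
    qed (rule sets_aug)
    show "\<exists>C\<in>sets (PiM {0..t} (\<lambda>_. borel)). AE \<omega> in completion M. \<omega> \<in> A \<longleftrightarrow> (\<lambda>s\<in>{0..t}. W s \<omega> - W 0 \<omega>) \<in> C"
      if t: "0 \<le> t" and A: "A \<in> sets (?F t)" for t A
    proof (rule augmented_filtration_AE[OF A])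
      show h: "(\<lambda>\<omega>. \<lambda>s\<in>{0..t}. W s \<omega> - W 0 \<omega>) \<in> space M \<rightarrow> space (PiM {0..t} (\<lambda>_. borel :: real measure))"
        by (auto simp: space_PiM)
      fix A assume "A \<in> sets (natural_filtration M W t)"
      then have "A \<in> sigma_sets (space (completion M)) (\<Union>s\<in>{0..t}. {W s -` B \<inter> space M | B. B \<in> sets borel})"
        by (simp only: sets_natural_filtration space_completion)
      then show "\<exists>C\<in>sets (PiM {0..t} (\<lambda>_. borel)). AE \<omega> in completion M. \<omega> \<in> A \<longleftrightarrow> (\<lambda>s\<in>{0..t}. W s \<omega> - W 0 \<omega>) \<in> C"
      proof (rule AE_sigma_sets_vimage)
        show "(\<lambda>\<omega>. \<lambda>s\<in>{0..t}. W s \<omega> - W 0 \<omega>) \<in> space (completion M) \<rightarrow> space (PiM {0..t} (\<lambda>_. borel :: real measure))"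
          using h by simp
        fix A assume "A \<in> (\<Union>s\<in>{0..t}. {W s -` B \<inter> space M | B. B \<in> sets borel})"
        then obtain s B where s: "s \<in> {0..t}" and B: "B \<in> sets borel" and A: "A = W s -` B \<inter> space M" by auto
        \<comment> \<open>Almost surely \<open>W s\<close> is \<open>x\<close> plus its increment
          from \<open>W 0\<close>; the deterministic start turns events of \<open>W\<close> into
          events of increments.\<close>
        let ?C = "(\<lambda>p. x + p s) -` B \<inter> space (PiM {0..t} (\<lambda>_. borel :: real measure))"
        have "?C \<in> sets (PiM {0..t} (\<lambda>_. borel :: real measure))"
          using s by (intro measurable_sets[OF _ B] borel_measurable_add borel_measurable_const measurable_component_singleton)
        moreover have "AE \<omega> in completion M. \<omega> \<in> A \<longleftrightarrow> (\<lambda>s\<in>{0..t}. W s \<omega> - W 0 \<omega>) \<in> ?C"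
          using AE_completion[OF W0] AE_space by eventually_elim (use s A in \<open>auto simp: space_PiM\<close>)
        ultimately show "\<exists>C\<in>sets (PiM {0..t} (\<lambda>_. borel)). AE \<omega> in completion M. \<omega> \<in> A \<longleftrightarrow> (\<lambda>s\<in>{0..t}. W s \<omega> - W 0 \<omega>) \<in> C"
          by blast
      qed
    qed
  qed
qed

section \<open>Concavity of the value function\<close>

text \<open>Only \<open>\<bar>z\<bar> > R\<close> matters. There both values are at most
  \<open>2 * K * \<bar>z\<bar>\<close> in absolute value, and \<open>\<bar>z\<bar>\<close> is at
  most \<open>z^2 / R\<close>, so a second moment controls the error.\<close>

lemma clamp_growth:
  fixes g :: "real \<Rightarrow> real"
  assumes g: "\<And>z. \<bar>g z\<bar> \<le> K * (1 + \<bar>z\<bar>)" and R: "1 \<le> R"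
  shows "\<bar>g z - g (max (-R) (min R z))\<bar> \<le> 4 * K * z\<^sup>2 / R"
proof -
  have K: "0 \<le> K" using order_trans[OF abs_ge_zero g[of 0]] by simp
  show ?thesis
  proof (cases "\<bar>z\<bar> \<le> R")
    case True
    then have "max (-R) (min R z) = z" by auto
    then show ?thesis using K R by simp
  next
    case False
    then have z: "R \<le> \<bar>z\<bar>" by simp
    have "\<bar>max (-R) (min R z)\<bar> = R" using False R by auto
    then have "\<bar>g (max (-R) (min R z))\<bar> \<le> K * (1 + R)" using g[of "max (-R) (min R z)"] by simp
    also have "\<dots> \<le> K * (2 * \<bar>z\<bar>)" using z R K by (intro mult_left_mono) auto
    finally have 1: "\<bar>g (max (-R) (min R z))\<bar> \<le> K * (2 * \<bar>z\<bar>)" .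
    have "\<bar>g z\<bar> \<le> K * (1 + \<bar>z\<bar>)" by (rule g)
    also have "\<dots> \<le> K * (2 * \<bar>z\<bar>)" using z R K by (intro mult_left_mono) auto
    finally have 2: "\<bar>g z\<bar> \<le> K * (2 * \<bar>z\<bar>)" .
    have "\<bar>g z - g (max (-R) (min R z))\<bar> \<le> 4 * K * \<bar>z\<bar>"
      using 1 2 by (intro order_trans[OF abs_triangle_ineq4]) linarith
    then have "\<bar>g z - g (max (-R) (min R z))\<bar> * R \<le> (4 * K * \<bar>z\<bar>) * \<bar>z\<bar>"
      using z R K by (intro mult_mono; simp)
    then show ?thesis using R by (simp add: pos_le_divide_eq power2_eq_square mult.assoc)
  qed
qed

text \<open>The clamp is 1-Lipschitz with compact range, and on that range a continuous function is
  uniformly continuous.\<close>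

lemma clamp_uniformly_continuous:
  fixes g :: "real \<Rightarrow> real"
  assumes g: "continuous_on UNIV g" and R: "0 \<le> R"
  shows "uniformly_continuous_on UNIV (\<lambda>z. g (max (-R) (min R z)))"
proof (rule uniformly_continuous_on_compose[where f = g])
  have "\<bar>max (-R) (min R a) - max (-R) (min R b)\<bar> \<le> \<bar>a - b\<bar>" for a b by linarith
  then show "uniformly_continuous_on UNIV (\<lambda>z. max (-R) (min R z))"
    unfolding uniformly_continuous_on_def dist_real_def by (meson le_less_trans)
  have "range (\<lambda>z. max (-R) (min R z)) = {-R..R}"
  proof safe
    fix z assume "z \<in> {-R..R}"
    then have "z = max (-R) (min R z)" by auto
    then show "z \<in> range (\<lambda>z. max (-R) (min R z))" by (rule range_eqI)
  qed (use R in auto)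
  then show "uniformly_continuous_on (range (\<lambda>z. max (-R) (min R z))) g"
    by (simp only:) (intro compact_uniformly_continuous continuous_on_subset[OF g], auto)
qed

context filtered_bm begin

text \<open>Both corrections come from \<open>wald_hit\<close>: the second moment of the
  displacement turns the quadratic term into exactly \<open>\<beta> * y\<close> and bounds the mean
  of the error in \<open>clamp_growth\<close>.\<close>

lemma payoff_truncation:
  fixes f :: "real \<Rightarrow> real" and \<beta> :: real
  defines "g \<equiv> \<lambda>z. f (x + z) + \<beta> * z\<^sup>2"
  assumes I: "l2_martingale I C" "AE \<omega> in N. I 0 \<omega> = 0" and y: "0 \<le> y"
    and f: "continuous_on UNIV f" and K: "\<And>z. \<bar>g z\<bar> \<le> K * (1 + \<bar>z\<bar>)" and R: "1 \<le> R"
  shows "\<bar>(\<integral>\<omega>. f (W (hit y (\<lambda>t. I t \<omega>)) \<omega>) \<partial>N) + \<beta> * y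
      - (\<integral>\<omega>. g (max (-R) (min R (W (hit y (\<lambda>t. I t \<omega>)) \<omega> - W 0 \<omega>))) \<partial>N)\<bar> \<le> 4 * K * y / R"
proof -
  define X where "X \<omega> = W (hit y (\<lambda>t. I t \<omega>)) \<omega> - W 0 \<omega>" for \<omega>
  let ?c = "\<lambda>z. max (-R) (min R z)"
  have K0: "0 \<le> K" using order_trans[OF abs_ge_zero K[of 0]] by simp
  have X: "sq_integrable N X" "(\<integral>\<omega>. (X \<omega>)\<^sup>2 \<partial>N) = y"
    using wald_hit[OF I y] by (simp_all add: X_def[abs_def])
  note Xm = sq_integrableD(1)[OF X(1)] and X2 = sq_integrableD(2)[OF X(1)]
  have gc: "continuous_on UNIV g"
    unfolding g_def by (intro continuous_intros continuous_on_compose2[OF f]) auto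
  then have gm: "g \<in> borel_measurable borel" by (rule borel_measurable_continuous_onI)
  have gX: "integrable N (\<lambda>\<omega>. g (X \<omega>))"
  proof (rule Bochner_Integration.integrable_bound)
    show "integrable N (\<lambda>\<omega>. K * (2 + (X \<omega>)\<^sup>2))" using X2 by simp
    show "(\<lambda>\<omega>. g (X \<omega>)) \<in> borel_measurable N" by (rule measurable_compose[OF Xm gm])
    have "\<bar>z\<bar> \<le> 1 + z\<^sup>2" for z :: real
      using sum_squares_bound[of "\<bar>z\<bar>" 1] by (simp add: abs_mult)
    then have "\<bar>g z\<bar> \<le> K * (2 + z\<^sup>2)" for z
      using K[of z] mult_left_mono[OF _ K0, of "1 + \<bar>z\<bar>" "2 + z\<^sup>2"] by (smt (verit))
    then show "AE \<omega> in N. norm (g (X \<omega>)) \<le> norm (K * (2 + (X \<omega>)\<^sup>2))" using K0 by simp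
  qed
  have cX: "integrable N (\<lambda>\<omega>. g (?c (X \<omega>)))"
  proof (rule integrable_const_bound)
    have "\<bar>?c z\<bar> \<le> R" for z using R by linarith
    then have "\<bar>g (?c z)\<bar> \<le> K * (1 + R)" for z
      by (intro order_trans[OF K] mult_left_mono K0) simp
    then show "AE \<omega> in N. norm (g (?c (X \<omega>))) \<le> K * (1 + R)" by simp
    show "(\<lambda>\<omega>. g (?c (X \<omega>))) \<in> borel_measurable N"
      by (rule measurable_compose[OF _ gm]) (intro borel_measurable_max borel_measurable_min borel_measurable_const Xm)
  qed
  have "(\<integral>\<omega>. f (W (hit y (\<lambda>t. I t \<omega>)) \<omega>) \<partial>N) = (\<integral>\<omega>. g (X \<omega>) - \<beta> * (X \<omega>)\<^sup>2 \<partial>N)"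
  proof (rule integral_cong_AE)
    show "(\<lambda>\<omega>. f (W (hit y (\<lambda>t. I t \<omega>)) \<omega>)) \<in> borel_measurable N"
      by (rule measurable_compose[OF W_hit_measurable[OF I y] borel_measurable_continuous_onI[OF f]])
    show "(\<lambda>\<omega>. g (X \<omega>) - \<beta> * (X \<omega>)\<^sup>2) \<in> borel_measurable N"
      using gX X2 by (intro borel_measurable_diff borel_measurable_times) auto
    show "AE \<omega> in N. f (W (hit y (\<lambda>t. I t \<omega>)) \<omega>) = g (X \<omega>) - \<beta> * (X \<omega>)\<^sup>2"
      using W_start by eventually_elim (simp add: g_def X_def)
  qed
  also have "\<dots> = (\<integral>\<omega>. g (X \<omega>) \<partial>N) - \<beta> * y" using gX X2 by (simp add: X(2))
  finally have "(\<integral>\<omega>. f (W (hit y (\<lambda>t. I t \<omega>)) \<omega>) \<partial>N) + \<beta> * y - (\<integral>\<omega>. g (?c (X \<omega>)) \<partial>N)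
      = (\<integral>\<omega>. g (X \<omega>) - g (?c (X \<omega>)) \<partial>N)" using gX cX by simp
  also have "\<bar>\<dots>\<bar> \<le> (\<integral>\<omega>. \<bar>g (X \<omega>) - g (?c (X \<omega>))\<bar> \<partial>N)" by (rule integral_abs_bound)
  also have "\<dots> \<le> (\<integral>\<omega>. 4 * K / R * (X \<omega>)\<^sup>2 \<partial>N)"
    using clamp_growth[OF K R] gX cX X2 by (intro integral_mono integrable_abs) auto
  also have "\<dots> = 4 * K * y / R" by (simp add: X(2))
  finally show ?thesis by (simp add: X_def)
qed

text \<open>The terms \<open>\<beta> * y\<close> cancel exactly, because \<open>y0\<close> is the
  same convex combination as the values. Each of the given controls costs \<open>e / 6\<close> for
  clamping and \<open>e / 6\<close> for the passage to a simple control; the mixing and the clamping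
  at \<open>y0\<close> cost another \<open>e / 6\<close> each.\<close>

theorem value_mixing:
  fixes f :: "real \<Rightarrow> real"
  assumes y: "0 \<le> y2" "y2 < y1" and l: "0 < l" "l < 1" and e: "0 < e"
    and f: "continuous_on UNIV f" and \<beta>: "0 \<le> \<beta>" and \<gamma>: "0 \<le> \<gamma>" "\<And>z. \<bar>f z + \<beta> * z\<^sup>2\<bar> \<le> \<gamma> * (1 + \<bar>z\<bar>)"
    and \<alpha>1: "progressively_measurable F \<alpha>1" "sqn \<alpha>1 < \<infinity>" "is_ito \<alpha>1 I1"
    and \<alpha>2: "progressively_measurable F \<alpha>2" "sqn \<alpha>2 < \<infinity>" "is_ito \<alpha>2 I2"
  defines "J \<equiv> \<lambda>y I. \<integral>\<omega>. f (W (hit y (\<lambda>t. I t \<omega>)) \<omega>) \<partial>N"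
  shows "\<exists>\<alpha>. progressively_measurable F \<alpha> \<and> sqn \<alpha> < \<infinity> \<and>
    (\<forall>I. is_ito \<alpha> I \<longrightarrow> l * J y1 I1 + (1 - l) * J y2 I2 - e \<le> J (l * y1 + (1 - l) * y2) I)"
proof -
  define y0 where "y0 = l * y1 + (1 - l) * y2"
  have y1: "0 \<le> y1" using y by simp
  have y0: "0 \<le> y0" using y1 y l by (simp add: y0_def)
  define g where "g z = f (x + z) + \<beta> * z\<^sup>2" for z
  \<comment> \<open>Expanding \<open>\<beta> * (x + z)^2\<close> leaves a constant and the cross
    term \<open>2 * \<beta> * x * z\<close>; this \<open>K\<close> dominates them together with the
    growth bound of \<open>f\<close> recentred at \<open>x\<close>.\<close>
  define K where "K = \<gamma> * (1 + \<bar>x\<bar>) + \<gamma> + \<beta> * x\<^sup>2 + 2 * \<beta> * \<bar>x\<bar>"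
  have K0: "0 \<le> K" using \<beta> \<gamma>(1) by (simp add: K_def)
  have gK: "\<bar>g z\<bar> \<le> K * (1 + \<bar>z\<bar>)" for z
  proof -
    have "g z = (f (x + z) + \<beta> * (x + z)\<^sup>2) - (\<beta> * x\<^sup>2 + 2 * \<beta> * (x * z))"
      by (simp add: g_def power2_eq_square algebra_simps)
    then have "\<bar>g z\<bar> \<le> \<bar>f (x + z) + \<beta> * (x + z)\<^sup>2\<bar> + \<bar>\<beta> * x\<^sup>2 + 2 * \<beta> * (x * z)\<bar>"
      by (simp only: abs_triangle_ineq4)
    also have "\<bar>\<beta> * x\<^sup>2 + 2 * \<beta> * (x * z)\<bar> \<le> \<beta> * x\<^sup>2 + 2 * \<beta> * (\<bar>x\<bar> * \<bar>z\<bar>)"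
      using \<beta> by (intro order_trans[OF abs_triangle_ineq]) (simp add: abs_mult)
    also have "\<bar>f (x + z) + \<beta> * (x + z)\<^sup>2\<bar> \<le> \<gamma> * (1 + \<bar>x + z\<bar>)" by (rule \<gamma>(2))
    also have "\<dots> \<le> \<gamma> * (1 + (\<bar>x\<bar> + \<bar>z\<bar>))" using \<gamma>(1) by (intro mult_left_mono) auto
    finally have "\<bar>g z\<bar> \<le> \<gamma> * (1 + (\<bar>x\<bar> + \<bar>z\<bar>)) + (\<beta> * x\<^sup>2 + 2 * \<beta> * (\<bar>x\<bar> * \<bar>z\<bar>))" by simp
    moreover have "0 \<le> \<gamma> + \<gamma> * (\<bar>x\<bar> * \<bar>z\<bar>) + \<beta> * x\<^sup>2 * \<bar>z\<bar> + 2 * (\<beta> * \<bar>x\<bar>)" using \<beta> \<gamma>(1) by simp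
    moreover have "0 \<le> \<gamma> * \<bar>z\<bar>" using \<gamma>(1) by simp
    ultimately show ?thesis by (simp add: K_def algebra_simps)
  qed
  have gc: "continuous_on UNIV g"
    unfolding g_def by (intro continuous_intros continuous_on_compose2[OF f]) auto
  \<comment> \<open>Chosen so that \<open>4 * K * y / R\<close> is at most \<open>e / 6\<close> for
    every \<open>y\<close> up to \<open>y1\<close>, hence for all three initial values.\<close>
  define R where "R = max 1 (24 * K * y1 / e)"
  have R: "1 \<le> R" by (simp add: R_def)
  define G where "G z = g (max (-R) (min R z))" for z
  have GK: "\<bar>G z\<bar> \<le> K * (1 + R)" for z
  proof -
    have "\<bar>max (-R) (min R z)\<bar> \<le> R" using R by linarith
    then show ?thesis unfolding G_def by (intro order_trans[OF gK] mult_left_mono K0) simp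
  qed
  have Gu: "uniformly_continuous_on UNIV G"
    unfolding G_def using R by (intro clamp_uniformly_continuous gc) simp
  have Gc: "continuous_on UNIV G" using Gu by (rule uniformly_continuous_imp_continuous)
  have small: "4 * K * y / R \<le> e / 6" if "0 \<le> y" "y \<le> y1" for y
  proof -
    have "24 * K * y1 / e \<le> R" by (simp add: R_def)
    then have "24 * K * y1 \<le> R * e" using e by (simp add: pos_divide_le_eq)
    moreover have "24 * K * y \<le> 24 * K * y1" using that K0 by (intro mult_left_mono) auto
    ultimately show ?thesis using R by (simp add: field_simps)
  qed
  have trunc: "\<bar>J y I + \<beta> * y - (\<integral>\<omega>. G (W (hit y (\<lambda>t. I t \<omega>)) \<omega> - W 0 \<omega>) \<partial>N)\<bar> \<le> e / 6"
    if \<alpha>: "progressively_measurable F \<alpha>" "sqn \<alpha> < \<infinity>" "is_ito \<alpha> I" and y: "0 \<le> y" "y \<le> y1" for \<alpha> I y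
  proof -
    note m = ito_martingale[OF progressive_joint_measurable[OF \<alpha>(1)] \<alpha>(2,3)]
    from m(1) obtain C where C: "l2_martingale I C" ..
    show ?thesis
      unfolding J_def G_def g_def
      by (rule order_trans[OF payoff_truncation[OF C m(2) y(1) f gK[unfolded g_def] R] small[OF y]])
  qed
  have e6: "0 < e / 6" using e by simp
  obtain n1 ts1 \<xi>1 where s1: "simple n1 ts1 \<xi>1"
    "\<bar>(\<integral>\<omega>. G (W (hit y1 (\<lambda>t. simple_int n1 ts1 \<xi>1 t \<omega>)) \<omega> - W 0 \<omega>) \<partial>N)
      - (\<integral>\<omega>. G (W (hit y1 (\<lambda>t. I1 t \<omega>)) \<omega> - W 0 \<omega>) \<partial>N)\<bar> < e / 6"
    using simple_value_approx[OF progressive_joint_measurable[OF \<alpha>1(1)] \<alpha>1(2,3) y1 GK Gc e6] by blast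
  obtain n2 ts2 \<xi>2 where s2: "simple n2 ts2 \<xi>2"
    "\<bar>(\<integral>\<omega>. G (W (hit y2 (\<lambda>t. simple_int n2 ts2 \<xi>2 t \<omega>)) \<omega> - W 0 \<omega>) \<partial>N)
      - (\<integral>\<omega>. G (W (hit y2 (\<lambda>t. I2 t \<omega>)) \<omega> - W 0 \<omega>) \<partial>N)\<bar> < e / 6"
    using simple_value_approx[OF progressive_joint_measurable[OF \<alpha>2(1)] \<alpha>2(2,3) y(1) GK Gc e6] by blast
  define v1 where "v1 = (\<integral>\<omega>. G (W (hit y1 (\<lambda>t. simple_int n1 ts1 \<xi>1 t \<omega>)) \<omega> - W 0 \<omega>) \<partial>N)"
  define v2 where "v2 = (\<integral>\<omega>. G (W (hit y2 (\<lambda>t. simple_int n2 ts2 \<xi>2 t \<omega>)) \<omega> - W 0 \<omega>) \<partial>N)"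
  obtain \<alpha> where \<alpha>: "progressively_measurable F \<alpha>" "sqn \<alpha> < \<infinity>"
    and mix: "\<And>I. is_ito \<alpha> I \<Longrightarrow> l * v1 + (1 - l) * v2 - e / 6 \<le> (\<integral>\<omega>. G (W (hit y0 (\<lambda>t. I t \<omega>)) \<omega> - W 0 \<omega>) \<partial>N)"
    using mixing[OF y l s1(1) s2(1) GK Gu e6] unfolding v1_def v2_def y0_def by blast
  have "l * J y1 I1 + (1 - l) * J y2 I2 - e \<le> J y0 I" if I: "is_ito \<alpha> I" for I
  proof -
    have "y0 = y1 - (1 - l) * (y1 - y2)" by (simp add: y0_def algebra_simps)
    then have y01: "y0 \<le> y1" using y l by simp
    have "J y1 I1 + \<beta> * y1 - e / 3 \<le> v1"
      using trunc[OF \<alpha>1 y1 order_refl] s1(2) unfolding v1_def by linarith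
    then have "l * (J y1 I1 + \<beta> * y1 - e / 3) \<le> l * v1" using l by (intro mult_left_mono) auto
    moreover have "J y2 I2 + \<beta> * y2 - e / 3 \<le> v2"
      using trunc[OF \<alpha>2 y(1) less_imp_le[OF y(2)]] s2(2) unfolding v2_def by linarith
    then have "(1 - l) * (J y2 I2 + \<beta> * y2 - e / 3) \<le> (1 - l) * v2" using l by (intro mult_left_mono) auto
    moreover have "l * (J y1 I1 + \<beta> * y1 - e / 3) + (1 - l) * (J y2 I2 + \<beta> * y2 - e / 3)
        = l * J y1 I1 + (1 - l) * J y2 I2 + \<beta> * y0 - e / 3"
      by (simp add: y0_def field_simps)
    moreover note mix[OF I] trunc[OF \<alpha> I y0 y01]
    ultimately show ?thesis using e by linarith
  qed
  then show ?thesis using \<alpha> unfolding y0_def by blast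
qed

end

section \<open>Transfer from the locale to the given definitions\<close>

context
  fixes M :: "'a measure" and W :: "real \<Rightarrow> 'a \<Rightarrow> real" and x :: real
  assumes bm: "brownian_motion M W x"
begin

interpretation filtered_bm "completion M" "augmented_filtration M W" W x
  by (rule brownian_motion_filtered_bm[OF bm])

text \<open>Nonnegativity of all partition points, which elementary data demand, follows from that
  of the first one by monotonicity.\<close>

lemma simple_data_eq: "simple_data M W = simple"
proof (intro ext iffI)
  fix n ts \<xi>
  assume d: "simple_data M W n ts \<xi>"
  have "0 \<le> ts i" if "i \<le> n" for i
    using that by (induction i) (use d in \<open>auto simp: simple_data_def intro: order_trans\<close>)
  then show "simple n ts \<xi>" using d by (auto simp: simple_data_def simple_def elem_data_def weight_def)
qed (auto simp: simple_data_def simple_def elem_data_def weight_def)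

lemma sq_norm_process_eq: "sq_norm_process M = sqn"
  by (simp add: fun_eq_iff sq_norm_process_def sqn_def)

lemma is_ito_integral_eq: "is_ito_integral M W = is_ito"
proof -
  have "simple_process = simple_proc" for n :: nat
    by (simp add: fun_eq_iff simple_process_def elem_process_def)
  moreover have "simple_integral W = simple_int"
    by (simp add: fun_eq_iff simple_integral_def elem_integral_def)
  ultimately show ?thesis
    by (simp add: fun_eq_iff is_ito_integral_def is_ito_def simple_data_eq sq_norm_process_eq)
qed

lemma controls_eq: "controls M W = {\<alpha>. progressively_measurable (augmented_filtration M W) \<alpha> \<and> sqn \<alpha> < \<infinity>}"
  by (simp add: controls_def sq_norm_process_eq)

text \<open>\<open>ito_integral\<close> is a Hilbert choice, and the existence theorem gives the
  choice its defining property.\<close>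

lemma ito_integral_is_ito: "\<alpha> \<in> controls M W \<Longrightarrow> is_ito \<alpha> (ito_integral M W \<alpha>)"
  unfolding ito_integral_def is_ito_integral_eq controls_eq
  by (rule someI_ex[of "is_ito \<alpha>"], rule ito_exists) auto

lemma controls_mixing:
  fixes f :: "real \<Rightarrow> real"
  assumes y: "0 \<le> y2" "y2 < y1" and l: "0 < l" "l < 1" and e: "0 < e"
    and f: "continuous_on UNIV f" and \<beta>: "0 \<le> \<beta>" and \<gamma>: "0 \<le> \<gamma>" "\<And>z. \<bar>f z + \<beta> * z\<^sup>2\<bar> \<le> \<gamma> * (1 + \<bar>z\<bar>)"
    and \<alpha>: "\<alpha>1 \<in> controls M W" "\<alpha>2 \<in> controls M W"
  defines "J \<equiv> \<lambda>y \<alpha>. \<integral>\<omega>. f (W (hitting_time M W \<alpha> y \<omega>) \<omega>) \<partial>completion M"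
  shows "\<exists>\<alpha>\<in>controls M W. l * J y1 \<alpha>1 + (1 - l) * J y2 \<alpha>2 - e \<le> J (l * y1 + (1 - l) * y2) \<alpha>"
proof -
  have h: "hitting_time M W \<alpha> y \<omega> = hit y (\<lambda>t. ito_integral M W \<alpha> t \<omega>)" for \<alpha> y \<omega>
    by (simp add: hitting_time_def hit_def)
  show ?thesis
    using value_mixing[OF y l e f \<beta> \<gamma> _ _ ito_integral_is_ito[OF \<alpha>(1)] _ _ ito_integral_is_ito[OF \<alpha>(2)]]
      \<alpha> ito_integral_is_ito
    unfolding J_def h controls_eq by blast
qed

lemma zero_control: "(\<lambda>_ _. 0) \<in> controls M W"
  by (simp add: controls_eq progressively_measurable_def sqn_def)

end

text \<open>The maximum with 0 covers the non-integrable case, where the integral is 0 by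
  convention.\<close>

lemma (in prob_space) integral_le_max:
  fixes X :: "'a \<Rightarrow> real"
  assumes "\<And>\<omega>. X \<omega> \<le> B"
  shows "(\<integral>\<omega>. X \<omega> \<partial>M) \<le> max 0 B"
proof (cases "integrable M X")
  case True
  then have "(\<integral>\<omega>. X \<omega> \<partial>M) \<le> B" using assms by (intro integral_le_const) auto
  then show ?thesis by simp
qed (simp add: not_integrable_integral_eq)

theorem proposition1:
  fixes P :: "real \<Rightarrow> 'a measure" and W :: "real \<Rightarrow> 'a \<Rightarrow> real"
    and f :: "real \<Rightarrow> real" and \<beta> \<gamma> :: real
  assumes "\<And>x. sets (P x) = sets (P 0)"
    and "\<And>x. brownian_motion (P x) W x"
    and "continuous_on UNIV f"
    and "bdd_above (range f)"
    and "\<beta> \<ge> 0" and "\<gamma> \<ge> 0"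
    and "\<And>x. \<bar>f x + \<beta> * x\<^sup>2\<bar> \<le> \<gamma> * (1 + \<bar>x\<bar>)"
  shows "\<forall>x. concave_on {0..} (\<lambda>y. value_function P W f x y)"
proof
  fix x
  note bm = assms(2)[of x]
  interpret C: prob_space "completion (P x)"
    using bm by (intro prob_space.prob_space_completion) (simp add: brownian_motion_def)
  define J where "J y \<alpha> = (\<integral>\<omega>. f (W (hitting_time (P x) W \<alpha> y \<omega>) \<omega>) \<partial>completion (P x))" for y \<alpha>
  define V where "V y = value_function P W f x y" for y
  have V: "V y = (SUP \<alpha>\<in>controls (P x) W. J y \<alpha>)" for y
    by (simp add: V_def value_function_def J_def)
  obtain B where B: "\<And>z. f z \<le> B" using assms(4) by (auto simp: bdd_above_def)
  \<comment> \<open>A supremum of reals has its order properties only for a nonempty set that is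
    bounded above; the bound on \<open>f\<close> and the zero control provide the two.\<close>
  have bdd: "bdd_above (J y ` controls (P x) W)" for y
    unfolding J_def by (intro bdd_aboveI2[where M = "max 0 B"] C.integral_le_max B)
  have ne: "controls (P x) W \<noteq> {}" using zero_control[OF bm] by auto
  have mix: "l * V y1 + (1 - l) * V y2 \<le> V (l * y1 + (1 - l) * y2)"
    if y: "0 \<le> y2" "y2 < y1" and l: "0 < l" "l < 1" for l y1 y2
  proof (rule field_le_epsilon)
    fix e :: real assume "0 < e"
    then have e: "0 < e / 2" by simp
    \<comment> \<open>Half of the margin goes to the choice of nearly optimal controls, half to the
      loss in the mixing.\<close>
    have "\<exists>\<alpha>\<in>controls (P x) W. V y - e / 2 < J y \<alpha>" for y
      using e less_cSUP_iff[OF ne bdd, of "V y - e / 2" y] by (simp add: V)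
    then obtain \<alpha>1 \<alpha>2 where \<alpha>: "\<alpha>1 \<in> controls (P x) W" "\<alpha>2 \<in> controls (P x) W"
      "V y1 - e / 2 < J y1 \<alpha>1" "V y2 - e / 2 < J y2 \<alpha>2" by meson
    obtain \<alpha> where c: "\<alpha> \<in> controls (P x) W"
      "l * J y1 \<alpha>1 + (1 - l) * J y2 \<alpha>2 - e / 2 \<le> J (l * y1 + (1 - l) * y2) \<alpha>"
      using controls_mixing[OF bm y l e assms(3,5,6,7) \<alpha>(1,2)] unfolding J_def by blast
    note c(2)
    also have "J (l * y1 + (1 - l) * y2) \<alpha> \<le> V (l * y1 + (1 - l) * y2)"
      unfolding V by (rule cSUP_upper[OF c(1) bdd])
    finally have "l * J y1 \<alpha>1 + (1 - l) * J y2 \<alpha>2 - e / 2 \<le> V (l * y1 + (1 - l) * y2)" .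
    moreover have "l * (V y1 - e / 2) \<le> l * J y1 \<alpha>1" "(1 - l) * (V y2 - e / 2) \<le> (1 - l) * J y2 \<alpha>2"
      using l \<alpha> by (auto intro!: mult_left_mono)
    moreover have "l * (V y1 - e / 2) + (1 - l) * (V y2 - e / 2) = l * V y1 + (1 - l) * V y2 - e / 2"
      by (simp add: field_simps)
    ultimately show "l * V y1 + (1 - l) * V y2 \<le> V (l * y1 + (1 - l) * y2) + e" by linarith
  qed
  have "concave_on {0..} V"
    unfolding concave_on_def
  proof (rule convex_onI)
    fix t y z :: real
    assume t: "0 < t" "t < 1" and y: "y \<in> {0..}" "z \<in> {0..}"
    \<comment> \<open>The mixing takes two distinct initial values with the larger one first, which
      determines whether its weight is \<open>t\<close> or \<open>1 - t\<close>.\<close>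
    consider "y = z" | "y < z" | "z < y" by linarith
    then have "(1 - t) * V y + t * V z \<le> V ((1 - t) * y + t * z)"
    proof cases
      case 1
      then show ?thesis by (simp add: algebra_simps)
    next
      case 2
      then show ?thesis using mix[of y z t] t y by (simp add: add.commute)
    next
      case 3
      then show ?thesis using mix[of z y "1 - t"] t y by simp
    qed
    then show "- V ((1 - t) *\<^sub>R y + t *\<^sub>R z) \<le> (1 - t) * - V y + t * - V z" by simp
  qed simp
  then show "concave_on {0..} (\<lambda>y. value_function P W f x y)" by (simp add: V_def[abs_def])
qed

end
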